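(* Let $G$ be a connected graph that is $2$-cell embedded in a surface $\mathbb{M}\in\{\mathbb{S}_p,\mathbb{N}_q\}$, and let $\chi=\chi(\mathbb{M})$. Suppose that $V_s(G)\neq\emptyset$ for some integer $s\geq 4$ and that \[ -14\chi < (s-4)\,\beta_0(\langle V_s,G\rangle) + 2(s-5)|G| + 4|V_{\leq 2}| + 2\sum_{j=3}^{s-1}(5-j)|V_j| . \] Then $b(G)\leq B'(G)\leq 2s-2$.
   Context: Graphs are finite, without loops or multiple edges. $\mathbb{S}_h$ ($h\ge0$) is the orientable surface of genus $h$ (sphere with $h$ handles), $\mathbb{N}_q$ ($q\ge1$) the non-orientable surface of genus $q$ (sphere with $q$ crosscaps); $\chi(\mathbb{S}_h)=2-2h$, $\chi(\mathbb{N}_q)=2-q$. An embedding is $2$-cell if every face is homeomorphic to an open disc. $|G|=|V(G)|$, $\|G\|=|E(G)|$, $d_G(x)$ is the degree, $N_G(x)$ the neighbourhood, $d_G(x,y)$ the distance. $V_r=V_r(G)=\{x: d_G(x)=r\}$, $V_{\leq r}=V_{\le r}(G)=\{x: d_G(x)\le r\}$. $\langle A,G\rangle$ is the subgraph induced by $A$, and $\beta_0(H)$ is the independence number of $H$. The domination number $\gamma(G)$ is the minimum size of a dominating set; the bondage number $b(G)$ is the smallest number of edges whose removal from $G$ yields a graph with larger domination number. Define $b_1(G)=\min\{d_G(x)+d_G(y)-1 : x,y\in V(G),\ 1\le d_G(x,y)\le 2\}$, $b_3(G)=\min_{xy\in E(G)}\max\{d_G(x)+d_G(y)-1-|N_G(x)\cap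 N_G(y)|,\ d_G(x)+d_G(y)-3\}$, and $B'(G)=\min\{b_1(G),b_3(G)\}$. *)

theory Defs
  imports "HOL-Analysis.Analysis"
begin

definition simple_graph :: "'a set \<Rightarrow> 'a set set \<Rightarrow> bool" where
  "simple_graph V E \<longleftrightarrow> finite V \<and> (\<forall>e\<in>E. e \<subseteq> V \<and> card e = 2)"

definition adjacency :: "'a set set \<Rightarrow> 'a rel" where
  "adjacency E = {(x, y). {x, y} \<in> E}"

definition connected_graph :: "'a set \<Rightarrow> 'a set set \<Rightarrow> bool" where
  "connected_graph V E \<longleftrightarrow> V \<noteq> {} \<and> (\<forall>x\<in>V. \<forall>y\<in>V. (x, y) \<in> (adjacency E)\<^sup>*)"

definition neighbourhood :: "'a set set \<Rightarrow> 'a \<Rightarrow> 'a set" where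
  "neighbourhood E x = {y. {x, y} \<in> E}"

definition vertex_degree :: "'a set set \<Rightarrow> 'a \<Rightarrow> nat" where
  "vertex_degree E x = card (neighbourhood E x)"

text \<open>The relation power \<open>adjacency E ^^ n\<close> consists of the pairs joined by a walk of
  length \<open>n\<close>; the infimum over the empty set is \<open>\<infinity>\<close>.\<close>

definition graph_dist :: "'a set set \<Rightarrow> 'a \<Rightarrow> 'a \<Rightarrow> enat" where
  "graph_dist E x y = (INF n\<in>{n. (x, y) \<in> adjacency E ^^ n}. enat n)"

definition verts_of_degree :: "'a set \<Rightarrow> 'a set set \<Rightarrow> nat \<Rightarrow> 'a set" where
  "verts_of_degree V E r = {x\<in>V. vertex_degree E x = r}"

definition verts_of_degree_le :: "'a set \<Rightarrow> 'a set set \<Rightarrow> nat \<Rightarrow> 'a set" where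
  "verts_of_degree_le V E r = {x\<in>V. vertex_degree E x \<le> r}"

definition induced_edges :: "'a set \<Rightarrow> 'a set set \<Rightarrow> 'a set set" where
  "induced_edges A E = {e\<in>E. e \<subseteq> A}"

definition independent_set :: "'a set \<Rightarrow> 'a set set \<Rightarrow> 'a set \<Rightarrow> bool" where
  "independent_set V E I \<longleftrightarrow> I \<subseteq> V \<and> (\<forall>x\<in>I. \<forall>y\<in>I. {x, y} \<notin> E)"

definition independence_number :: "'a set \<Rightarrow> 'a set set \<Rightarrow> nat" where
  "independence_number V E = Max (card ` {I. independent_set V E I})"

definition dominating_set :: "'a set \<Rightarrow> 'a set set \<Rightarrow> 'a set \<Rightarrow> bool" where
  "dominating_set V E D \<longleftrightarrow> D \<subseteq> V \<and> (\<forall>x\<in>V - D. \<exists>y\<in>D. {x, y} \<in> E)"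

definition domination_number :: "'a set \<Rightarrow> 'a set set \<Rightarrow> nat" where
  "domination_number V E = Min (card ` {D. dominating_set V E D})"

definition bondage_number :: "'a set \<Rightarrow> 'a set set \<Rightarrow> nat" where
  "bondage_number V E =
     (LEAST k. \<exists>F\<subseteq>E. card F = k \<and> domination_number V (E - F) > domination_number V E)"

definition b1 :: "'a set \<Rightarrow> 'a set set \<Rightarrow> int" where
  "b1 V E = Min {int (vertex_degree E x) + int (vertex_degree E y) - 1 | x y.
     x \<in> V \<and> y \<in> V \<and> 1 \<le> graph_dist E x y \<and> graph_dist E x y \<le> 2}"

definition b3 :: "'a set set \<Rightarrow> int" where
  "b3 E = Min {max
     (int (vertex_degree E x) + int (vertex_degree E y) - 1
        - int (card (neighbourhood E x \<inter> neighbourhood E y)))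
     (int (vertex_degree E x) + int (vertex_degree E y) - 3) | x y. {x, y} \<in> E}"

definition B' :: "'a set \<Rightarrow> 'a set set \<Rightarrow> int" where
  "B' V E = min (b1 V E) (b3 E)"

text \<open>All discs on the unit sphere are spherical caps, i.e. intersections of the sphere with
  balls of a common radius \<open>r\<close> centred at points of the sphere.\<close>

definition disjoint_caps :: "nat \<Rightarrow> (nat \<Rightarrow> real ^ 3) \<Rightarrow> real \<Rightarrow> bool" where
  "disjoint_caps n c r \<longleftrightarrow> 0 < r \<and> r < 2 \<and> (\<forall>i<n. c i \<in> sphere 0 1) \<and>
     (\<forall>i<n. \<forall>j<n. i \<noteq> j \<longrightarrow> sphere 0 1 \<inter> cball (c i) r \<inter> cball (c j) r = {})"

definition holed_sphere :: "nat \<Rightarrow> (nat \<Rightarrow> real ^ 3) \<Rightarrow> real \<Rightarrow> (real ^ 3) set" where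
  "holed_sphere n c r = sphere 0 1 - (\<Union>i<n. ball (c i) r)"

definition cap_rim :: "real ^ 3 \<Rightarrow> real \<Rightarrow> (real ^ 3) set" where
  "cap_rim a r = sphere 0 1 \<inter> sphere a r"

text \<open>For unit vectors \<open>a \<noteq> b\<close>, the reflection of the sphere that exchanges \<open>a\<close> and \<open>b\<close>.\<close>

definition mirror :: "real ^ 3 \<Rightarrow> real ^ 3 \<Rightarrow> real ^ 3 \<Rightarrow> real ^ 3" where
  "mirror a b x = x - (2 * (x \<bullet> (a - b)) / ((a - b) \<bullet> (a - b))) *\<^sub>R (a - b)"

text \<open>The rim of the cap around \<open>a\<close> is a circle with centre \<open>(1 - r\<^sup>2 / 2) *\<^sub>R a\<close>;
  this is the antipodal map of that circle.\<close>

definition rim_antipode :: "real ^ 3 \<Rightarrow> real \<Rightarrow> real ^ 3 \<Rightarrow> real ^ 3" where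
  "rim_antipode a r x = (2 - r\<^sup>2) *\<^sub>R a - x"

text \<open>A handle: remove the open caps around \<open>c (2 * i)\<close> and \<open>c (2 * i + 1)\<close> and identify their
  rims. As the reflection reverses the orientation of the sphere, it reverses the orientations
  that the two rims inherit as boundary components, so the result stays orientable.  A crosscap: remove one open
  cap and identify antipodal points of its rim.  The quotient space is unique up to homeomorphism,
  so \<open>M\<close> ranges over all spaces homeomorphic to the surface.\<close>

definition handle_glued :: "nat \<Rightarrow> (nat \<Rightarrow> real ^ 3) \<Rightarrow> real \<Rightarrow> real ^ 3 \<Rightarrow> real ^ 3 \<Rightarrow> bool" where
  "handle_glued h c r x y \<longleftrightarrow>
     (\<exists>i<h. x \<in> cap_rim (c (2 * i)) r \<and> y = mirror (c (2 * i)) (c (2 * i + 1)) x)"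

definition crosscap_glued :: "nat \<Rightarrow> (nat \<Rightarrow> real ^ 3) \<Rightarrow> real \<Rightarrow> real ^ 3 \<Rightarrow> real ^ 3 \<Rightarrow> bool" where
  "crosscap_glued q c r x y \<longleftrightarrow> (\<exists>i<q. x \<in> cap_rim (c i) r \<and> y = rim_antipode (c i) r x)"

definition sphere_with_handles :: "nat \<Rightarrow> 'b topology \<Rightarrow> bool" where
  "sphere_with_handles h M \<longleftrightarrow>
     (\<exists>c r f. disjoint_caps (2 * h) c r \<and>
        quotient_map (top_of_set (holed_sphere (2 * h) c r)) M f \<and>
        (\<forall>x\<in>holed_sphere (2 * h) c r. \<forall>y\<in>holed_sphere (2 * h) c r.
           f x = f y \<longleftrightarrow> x = y \<or> handle_glued h c r x y \<or> handle_glued h c r y x))"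

definition sphere_with_crosscaps :: "nat \<Rightarrow> 'b topology \<Rightarrow> bool" where
  "sphere_with_crosscaps q M \<longleftrightarrow>
     (\<exists>c r f. disjoint_caps q c r \<and>
        quotient_map (top_of_set (holed_sphere q c r)) M f \<and>
        (\<forall>x\<in>holed_sphere q c r. \<forall>y\<in>holed_sphere q c r.
           f x = f y \<longleftrightarrow> x = y \<or> crosscap_glued q c r x y))"

text \<open>A vertex \<open>x\<close> is drawn as the point \<open>p x\<close>, an edge \<open>e\<close> as the arc \<open>g e ` {0..1}\<close>.\<close>

definition graph_embedding ::
  "'b topology \<Rightarrow> 'a set \<Rightarrow> 'a set set \<Rightarrow> ('a \<Rightarrow> 'b) \<Rightarrow> ('a set \<Rightarrow> real \<Rightarrow> 'b) \<Rightarrow> bool" where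
  "graph_embedding M V E p g \<longleftrightarrow>
     p ` V \<subseteq> topspace M \<and> inj_on p V \<and>
     (\<forall>e\<in>E. embedding_map (top_of_set {0..1}) M (g e) \<and> {g e 0, g e 1} = p ` e \<and>
        g e ` {0<..<1} \<inter> p ` V = {}) \<and>
     (\<forall>e\<in>E. \<forall>e'\<in>E. e \<noteq> e' \<longrightarrow> g e ` {0<..<1} \<inter> g e' ` {0<..<1} = {})"

definition embedded_graph ::
  "'a set \<Rightarrow> 'a set set \<Rightarrow> ('a \<Rightarrow> 'b) \<Rightarrow> ('a set \<Rightarrow> real \<Rightarrow> 'b) \<Rightarrow> 'b set" where
  "embedded_graph V E p g = p ` V \<union> (\<Union>e\<in>E. g e ` {0..1})"

definition embedding_faces ::
  "'b topology \<Rightarrow> 'a set \<Rightarrow> 'a set set \<Rightarrow> ('a \<Rightarrow> 'b) \<Rightarrow> ('a set \<Rightarrow> real \<Rightarrow> 'b) \<Rightarrow> 'b set set" where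
  "embedding_faces M V E p g =
     connected_components_of (subtopology M (topspace M - embedded_graph V E p g))"

definition two_cell_embedding ::
  "'b topology \<Rightarrow> 'a set \<Rightarrow> 'a set set \<Rightarrow> ('a \<Rightarrow> 'b) \<Rightarrow> ('a set \<Rightarrow> real \<Rightarrow> 'b) \<Rightarrow> bool" where
  "two_cell_embedding M V E p g \<longleftrightarrow> graph_embedding M V E p g \<and>
     (\<forall>F\<in>embedding_faces M V E p g.
        subtopology M F homeomorphic_space top_of_set (ball (0 :: real ^ 2) 1))"

end

theory Submission
  imports Defs
begin

text \<open>A two-colouring of the complement of the drawing changes colour across an even number of the
  edges at each vertex.  Conversely, an edge set \<open>C\<close> with even degrees has local two-colourings that
  change exactly across \<open>C\<close>; they differ by a double covering of the surface, and \<open>C\<close>, \<open>C'\<close> with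
  isomorphic coverings differ by the boundary of a union of faces.  A sphere with \<open>h\<close> handles or
  \<open>q\<close> crosscaps has at most \<open>2 ^ (2 * h)\<close>, respectively \<open>2 ^ q\<close>, double coverings, and there are at
  least \<open>2 ^ (card E - card V + 1)\<close> sets \<open>C\<close>; this is the one half of Euler's formula that is needed.

  If \<open>B' \<ge> 2 * s - 1\<close>, then vertices of degree less than \<open>s\<close> are at distance at least three from each
  other, and an edge with degree sum \<open>2 * s\<close> (\<open>2 * s + 1\<close>) lies on no (at most one) triangular face.
  Giving the excess of the long faces to the corners, and then moving charge to a maximum
  independent set of \<open>V\<^sub>s\<close>, contradicts Euler's inequality.  Only for \<open>s = 4\<close> can a vertex end with
  negative charge: one of degree 5 all of whose faces are triangles; these are handled by counting.\<close>

section \<open>Local separation by arcs in the plane\<close>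

text \<open>Faces are given as bare connected components, without facial walks or a cyclic order of
  the edges at a vertex. Counting sets replaces rank computations over the two-element field, and a
  face is known through the edges that have it on one side or on both. The one-sided edges have even
  degree at every vertex; this parity alone forces faces of length 3 and 4 to have the expected
  boundary.

  Leaves apart, 84 (|E| - |V| - |\<Phi>|) is the sum of 14 (d(v) - 6) over the vertices and of 28
  (len F - 3) over the faces, so triangles are neutral. A quadrilateral gives 7 per side, a longer
  face can give 11, since 5 * 11 = 55 is below 56. A vertex of the independent set takes 2 on each
  of its 2 s edge sides, which meets its target exactly: 14 (s - 6) + 4 s = 12 (s - 5) + 6 (s - 4).
  For s = 4 some estimates hold with equality and a vertex can end at -2; counting then leaves only
  Euler characteristic 2, where connectedness of the graph decides.\<close>

text \<open>Janiszewski's theorem with second set \<open>K2 \<union> - ball p \<epsilon>\<close>: it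
  meets \<open>K\<close> exactly in the connected set \<open>K2\<close>, it does not separate points
  of the small ball, and the complement of the union is \<open>ball p \<epsilon> - K\<close>. A
  global connection off \<open>K\<close> is thereby confined to the ball.\<close>

lemma Janiszewski_local:
  fixes p z z' :: complex
  assumes K: "compact K" and K2: "closed K2" "connected K2" "K2 \<subseteq> K"
    and near: "K - K2 \<subseteq> ball p \<epsilon>" and far: "ball p \<delta> \<inter> K2 = {}" and "\<delta> \<le> \<epsilon>"
    and z: "z \<in> ball p \<delta>" "z' \<in> ball p \<delta>" and cc: "connected_component (- K) z z'"
  shows "connected_component (ball p \<epsilon> - K) z z'"
proof -
  let ?T = "K2 \<union> - ball p \<epsilon>"
  have KT: "K \<inter> ?T = K2"
    using K2 near by auto
  have "ball p \<delta> \<subseteq> - ?T"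
    using far \<open>\<delta> \<le> \<epsilon>\<close> by auto
  then have "connected_component (- ?T) z z'"
    using z unfolding connected_component_def by blast
  then have "connected_component (- (K \<union> ?T)) z z'"
    using Janiszewski[of K ?T z z'] K K2 KT cc by (simp add: closed_Un closed_Compl)
  moreover have "- (K \<union> ?T) = ball p \<epsilon> - K"
    using K2 by auto
  ultimately show ?thesis by simp
qed

text \<open>An arc does not separate the plane, so some path avoids a middle piece of
  \<open>\<gamma>\<close> and joins its ends. The part of this path between its last visit to the
  initial piece and its next visit to the final piece yields \<open>\<delta>\<close>; with the piece
  of \<open>\<gamma>\<close> from \<open>u\<close> to \<open>w\<close> it will form a Jordan curve
  through \<open>\<gamma> t0\<close>.\<close>

lemma arc_close_up:
  fixes \<gamma> :: "real \<Rightarrow> complex"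
  assumes "arc \<gamma>" "0 < t0" "t0 < 1"
  obtains u w \<delta> where "0 \<le> u" "u < t0" "t0 < w" "w \<le> 1" "arc \<delta>"
    "pathstart \<delta> = \<gamma> w" "pathfinish \<delta> = \<gamma> u"
    "path_image \<delta> \<inter> path_image \<gamma> \<subseteq> {\<gamma> u, \<gamma> w}"
proof -
  have inj: "inj_on \<gamma> {0..1}" and cont: "continuous_on {0..1} \<gamma>"
    using assms(1) by (auto simp: arc_def path_def)
  have inj_eq: "\<gamma> a = \<gamma> b \<longleftrightarrow> a = b" if "a \<in> {0..1}" "b \<in> {0..1}" for a b
    using inj_on_eq_iff[OF inj that] .
  define t1 where "t1 = t0 / 2"
  define t2 where "t2 = (1 + t0) / 2"
  have t: "0 < t1" "t1 < t0" "t0 < t2" "t2 < 1"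
    using assms by (auto simp: t1_def t2_def)
  define A where "A = path_image (subpath t1 t2 \<gamma>)"
  have A: "A = \<gamma> ` {t1..t2}"
    unfolding A_def path_image_subpath using t by auto
  have "arc (subpath t1 t2 \<gamma>)"
    using assms t by (intro arc_subpath_arc) auto
  then have "path_connected (- A)"
    unfolding A_def by (intro path_connected_arc_complement) auto
  moreover have "\<gamma> 0 \<in> - A" "\<gamma> 1 \<in> - A"
    using t unfolding A by (auto simp: inj_eq)
  ultimately obtain d where d: "path d" "path_image d \<subseteq> - A" "pathstart d = \<gamma> 0" "pathfinish d = \<gamma> 1"
    unfolding path_connected_def by blast
  have dcont: "continuous_on {0..1} d"
    using d by (simp add: path_def)
  have dA: "d s \<notin> A" if "s \<in> {0..1}" for s
    using d that unfolding path_image_def by blast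
  define S1 where "S1 = {s \<in> {0..1}. d s \<in> \<gamma> ` {0..t1}}"
  have cl1: "closed (\<gamma> ` {0..t1})" and cl2: "closed (\<gamma> ` {t2..1})"
    using t by (auto intro!: compact_imp_closed compact_continuous_image continuous_on_subset[OF cont])
  have "closed S1"
  proof -
    have "closed ({0..1} \<inter> d -` (\<gamma> ` {0..t1}))"
      by (rule continuous_closed_preimage[OF dcont _ cl1]) simp
    also have "{0..1} \<inter> d -` (\<gamma> ` {0..t1}) = S1" unfolding S1_def by blast
    finally show ?thesis .
  qed
  have "compact S1"
    using \<open>closed S1\<close> bounded_subset[OF bounded_closed_interval[of 0 1], of S1]
    unfolding compact_eq_bounded_closed by (auto simp: S1_def subset_iff)
  moreover have "0 \<in> S1"
    using d t by (auto simp: S1_def pathstart_def)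
  ultimately obtain s1 where s1: "s1 \<in> S1" "\<And>s. s \<in> S1 \<Longrightarrow> s \<le> s1"
    using compact_attains_sup[of S1] by blast
  define S2 where "S2 = {s \<in> {s1..1}. d s \<in> \<gamma> ` {t2..1}}"
  have s1r: "0 \<le> s1" "s1 \<le> 1" "d s1 \<in> \<gamma> ` {0..t1}"
    using s1 by (auto simp: S1_def)
  have "closed S2"
  proof -
    have "continuous_on {s1..1} d"
      using dcont s1r by (auto intro: continuous_on_subset)
    then have "closed ({s1..1} \<inter> d -` (\<gamma> ` {t2..1}))"
      by (rule continuous_closed_preimage[OF _ _ cl2]) simp
    also have "{s1..1} \<inter> d -` (\<gamma> ` {t2..1}) = S2" unfolding S2_def by blast
    finally show ?thesis .
  qed
  then have "compact S2"
    using bounded_subset[OF bounded_closed_interval[of s1 1], of S2]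
    unfolding compact_eq_bounded_closed by (auto simp: S2_def subset_iff)
  moreover have "1 \<in> S2"
    using d t s1r by (auto simp: S2_def pathfinish_def)
  ultimately obtain s2 where s2: "s2 \<in> S2" "\<And>s. s \<in> S2 \<Longrightarrow> s2 \<le> s"
    using compact_attains_inf[of S2] by blast
  have s2r: "s1 \<le> s2" "s2 \<le> 1" "d s2 \<in> \<gamma> ` {t2..1}"
    using s2 by (auto simp: S2_def)
  obtain u where u: "u \<in> {0..t1}" "d s1 = \<gamma> u" using s1r by auto
  obtain w where w: "w \<in> {t2..1}" "d s2 = \<gamma> w" using s2r by auto
  have "u \<noteq> w" using u w t by auto
  then have ne: "\<gamma> u \<noteq> \<gamma> w"
    using inj u w t by (auto dest: inj_onD)
  have off: "d s \<notin> path_image \<gamma>" if "s1 < s" "s < s2" for s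
  proof
    assume "d s \<in> path_image \<gamma>"
    then obtain v where v: "v \<in> {0..1}" "d s = \<gamma> v" unfolding path_image_def by auto
    have sr: "s \<in> {0..1}" using that s1r s2r by auto
    consider "v \<le> t1" | "t1 \<le> v \<and> v \<le> t2" | "t2 \<le> v" by linarith
    then show False
    proof cases
      case 1
      then have "s \<in> S1" using v sr by (auto simp: S1_def)
      then show False using s1 that by force
    next
      case 2
      then show False using dA[OF sr] v by (auto simp: A)
    next
      case 3
      then have "s \<in> S2" using v sr that by (auto simp: S2_def)
      then show False using s2 that by force
    qed
  qed
  have psub: "path (subpath s2 s1 d)"
    using d s1r s2r by (intro path_subpath) auto
  have "pathstart (subpath s2 s1 d) \<noteq> pathfinish (subpath s2 s1 d)"
    using ne u w by simp
  then obtain q where q: "arc q" "path_image q \<subseteq> path_image (subpath s2 s1 d)"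
     "pathstart q = \<gamma> w" "pathfinish q = \<gamma> u"
    using path_contains_arc[OF psub, of "\<gamma> w" "\<gamma> u"] u w by auto
  have "path_image q \<inter> path_image \<gamma> \<subseteq> {\<gamma> u, \<gamma> w}"
  proof
    fix x assume x: "x \<in> path_image q \<inter> path_image \<gamma>"
    then obtain s where s: "s \<in> {s1..s2}" "x = d s"
      using q(2) s2r(1) unfolding path_image_subpath by (auto split: if_splits)
    then have "s = s1 \<or> s = s2" using off[of s] x by force
    then show "x \<in> {\<gamma> u, \<gamma> w}" using s u w by auto
  qed
  then show ?thesis
    using that[of u w q] q u w t by auto
qed

text \<open>Near \<open>\<gamma> t0\<close> the arc coincides with the Jordan curve built from
  \<open>arc_close_up\<close>, and \<open>\<kappa>\<close> is membership in its inside. The Jordan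
  curve theorem gives local constancy off the arc and both values near each arc point; joining
  points of one side within a small ball is \<open>Janiszewski_local\<close>.\<close>

lemma arc_two_sides:
  fixes \<gamma> :: "real \<Rightarrow> complex"
  assumes "arc \<gamma>" "0 < t0" "t0 < 1"
  obtains \<kappa> :: "complex \<Rightarrow> bool" and r :: real where "r > 0"
    "\<And>z. z \<in> ball (\<gamma> t0) r - path_image \<gamma> \<Longrightarrow> \<exists>d>0. \<forall>z'\<in>ball z d. \<kappa> z' = \<kappa> z"
    "\<And>q d b. q \<in> path_image \<gamma> \<inter> ball (\<gamma> t0) r \<Longrightarrow> d > 0 \<Longrightarrow> \<exists>z\<in>ball q d - path_image \<gamma>. \<kappa> z = b"
    "\<And>q \<epsilon>. q \<in> path_image \<gamma> \<inter> ball (\<gamma> t0) r \<Longrightarrow> \<epsilon> > 0 \<Longrightarrow>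
       \<exists>\<delta>>0. \<forall>z\<in>ball q \<delta> - path_image \<gamma>. \<forall>z'\<in>ball q \<delta> - path_image \<gamma>. \<kappa> z = \<kappa> z' \<longrightarrow>
         connected_component (ball q \<epsilon> - path_image \<gamma>) z z'"
proof -
  have inj: "inj_on \<gamma> {0..1}" and cont: "continuous_on {0..1} \<gamma>"
    using assms(1) by (auto simp: arc_def path_def)
  have inj_eq: "\<gamma> a = \<gamma> b \<longleftrightarrow> a = b" if "a \<in> {0..1}" "b \<in> {0..1}" for a b
    using inj_on_eq_iff[OF inj that] .
  obtain u w \<delta> where uw: "0 \<le> u" "u < t0" "t0 < w" "w \<le> 1" and \<delta>: "arc \<delta>"
    "pathstart \<delta> = \<gamma> w" "pathfinish \<delta> = \<gamma> u"
    "path_image \<delta> \<inter> path_image \<gamma> \<subseteq> {\<gamma> u, \<gamma> w}"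
    by (rule arc_close_up[OF assms])
  define c where "c = subpath u w \<gamma> +++ \<delta>"
  have im: "path_image (subpath u w \<gamma>) = \<gamma> ` {u..w}"
    unfolding path_image_subpath using uw by auto
  have sub: "\<gamma> ` {u..w} \<subseteq> path_image \<gamma>"
    using uw by (auto simp: path_image_def)
  have simp_c: "simple_path c"
    unfolding c_def
  proof (rule simple_path_join_loop)
    show "arc (subpath u w \<gamma>)" using assms uw by (intro arc_subpath_arc) auto
    show "path_image (subpath u w \<gamma>) \<inter> path_image \<delta> \<subseteq> {pathstart (subpath u w \<gamma>), pathstart \<delta>}"
      using \<delta> sub im by auto
  qed (use \<delta> in auto)
  have loop: "pathfinish c = pathstart c"
    using \<delta> by (simp add: c_def)
  define J where "J = path_image c"
  have J: "J = \<gamma> ` {u..w} \<union> path_image \<delta>"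
    unfolding J_def c_def using \<delta> by (subst path_image_join) (auto simp: im)
  have "compact J" unfolding J_def using simp_c by (simp add: compact_simple_path_image)
  define I where "I = inside J"
  define U where "U = outside J"
  have jor: "open I" "connected I" "open U" "connected U" "I \<inter> U = {}" "I \<union> U = - J"
     "frontier I = J" "frontier U = J"
    using Jordan_inside_outside[OF simp_c loop] unfolding I_def U_def J_def by auto
  have cl: "closed (\<gamma> ` {a..b})" "compact (\<gamma> ` {a..b})" if "0 \<le> a" "b \<le> 1" for a b
    using that by (auto intro!: compact_imp_closed compact_continuous_image continuous_on_subset[OF cont])
  have clrest: "closed (\<gamma> ` {0..u} \<union> \<gamma> ` {w..1} \<union> path_image \<delta>)"
    using cl uw \<delta> by (intro closed_Un) (auto simp: closed_arc_image)
  have int_not_\<delta>: "\<gamma> t \<notin> path_image \<delta>" if "u < t" "t < w" for t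
  proof
    assume "\<gamma> t \<in> path_image \<delta>"
    moreover have "\<gamma> t \<in> path_image \<gamma>" using that uw by (auto simp: path_image_def)
    ultimately have "\<gamma> t = \<gamma> u \<or> \<gamma> t = \<gamma> w" using \<delta> by auto
    then show False using that uw by (auto simp: inj_eq)
  qed
  have "\<gamma> t0 \<notin> \<gamma> ` {0..u} \<union> \<gamma> ` {w..1} \<union> path_image \<delta>"
    using int_not_\<delta>[of t0] uw assms by (auto simp: inj_eq)
  then obtain r where r: "r > 0" "ball (\<gamma> t0) r \<inter> (\<gamma> ` {0..u} \<union> \<gamma> ` {w..1} \<union> path_image \<delta>) = {}"
    using clrest by (metis open_Compl ComplI openE disjoint_eq_subset_Compl)
  have eqJ: "J \<inter> ball (\<gamma> t0) r = path_image \<gamma> \<inter> ball (\<gamma> t0) r"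
  proof -
    have "path_image \<gamma> = \<gamma> ` {0..u} \<union> \<gamma> ` {u..w} \<union> \<gamma> ` {w..1}"
      unfolding path_image_def image_Un[symmetric] using uw by (auto intro!: arg_cong[of _ _ "image \<gamma>"])
    then show ?thesis using r(2) unfolding J by blast
  qed
  let ?\<kappa> = "\<lambda>z. z \<in> I"
  have lc: "\<exists>d>0. \<forall>z'\<in>ball z d. ?\<kappa> z' = ?\<kappa> z" if "z \<in> ball (\<gamma> t0) r - path_image \<gamma>" for z
  proof -
    have "z \<in> I \<or> z \<in> U" using that eqJ jor by blast
    then show ?thesis
    proof
      assume "z \<in> I"
      then obtain d where "d > 0" "ball z d \<subseteq> I" using jor(1) openE by blast
      then show ?thesis using \<open>z \<in> I\<close> by (intro exI[of _ d]) auto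
    next
      assume "z \<in> U"
      then obtain d where "d > 0" "ball z d \<subseteq> U" using jor(3) openE by blast
      then show ?thesis using \<open>z \<in> U\<close> jor(5) by (intro exI[of _ d]) auto
    qed
  qed
  have both: "\<exists>z\<in>ball q d - path_image \<gamma>. ?\<kappa> z = b"
    if "q \<in> path_image \<gamma> \<inter> ball (\<gamma> t0) r" "d > 0" for q d b
  proof -
    have "q \<in> J" "q \<in> ball (\<gamma> t0) r" using that(1) eqJ by blast+
    then obtain e where e: "e > 0" "ball q e \<subseteq> ball (\<gamma> t0) r"
      by (metis open_ball openE)
    have "q \<in> closure I" "q \<in> closure U"
      using \<open>q \<in> J\<close> jor(7,8) by (auto simp: frontier_def)
    moreover have de: "0 < min d e" using that e by simp
    ultimately obtain z1 z2 where z: "z1 \<in> I" "dist z1 q < min d e" "z2 \<in> U" "dist z2 q < min d e"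
      unfolding closure_approachable by blast
    have "z1 \<notin> J" "z2 \<notin> J" using z jor by auto
    then have "z1 \<in> ball q d - path_image \<gamma>" "z2 \<in> ball q d - path_image \<gamma>"
      using z(2,4) e eqJ by (auto simp: dist_commute)
    then show ?thesis using z(1,3) jor(5) by (cases b) blast+
  qed
  have conn: "\<exists>\<delta>'>0. \<forall>z\<in>ball q \<delta>' - path_image \<gamma>. \<forall>z'\<in>ball q \<delta>' - path_image \<gamma>. ?\<kappa> z = ?\<kappa> z' \<longrightarrow>
         connected_component (ball q \<epsilon> - path_image \<gamma>) z z'"
    if q: "q \<in> path_image \<gamma> \<inter> ball (\<gamma> t0) r" and "\<epsilon> > 0" for q \<epsilon>
  proof -
    obtain e where e: "e > 0" "ball q e \<subseteq> ball (\<gamma> t0) r"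
      using q by (metis open_ball openE IntD2)
    define \<epsilon>' where "\<epsilon>' = min \<epsilon> e"
    have \<epsilon>': "\<epsilon>' > 0" "\<epsilon>' \<le> \<epsilon>" "ball q \<epsilon>' \<subseteq> ball (\<gamma> t0) r"
      using e \<open>\<epsilon> > 0\<close> by (auto simp: \<epsilon>'_def)
    obtain t where t: "t \<in> {0..1}" "q = \<gamma> t" using q by (auto simp: path_image_def)
    have "t \<notin> {0..u}" "t \<notin> {w..1}" using r(2) q t by blast+
    then have tr: "u < t" "t < w" using t by auto
    have "continuous (at t within {0..1}) \<gamma>" using cont t(1) by (simp add: continuous_on_eq_continuous_within)
    then obtain \<eta>0 where \<eta>0: "\<eta>0 > 0" "\<And>t'. t' \<in> {0..1} \<Longrightarrow> dist t' t < \<eta>0 \<Longrightarrow> dist (\<gamma> t') (\<gamma> t) < \<epsilon>'"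
      using \<epsilon>'(1) unfolding continuous_within_eps_delta by blast
    define \<eta> where "\<eta> = min (\<eta>0/2) (min ((t-u)/2) ((w-t)/2))"
    have \<eta>: "\<eta> > 0" "\<eta> < \<eta>0" "u < t - \<eta>" "t + \<eta> < w"
      using \<eta>0 tr by (auto simp: \<eta>_def min_def field_simps)
    \<comment> \<open>The Jordan curve without a short open piece around \<open>q\<close>. The two
      remaining pieces of \<open>\<gamma>\<close> hang together through \<open>\<delta>\<close>, so
      this set is connected, as \<open>Janiszewski_local\<close> requires.\<close>
    define K2 where "K2 = \<gamma> ` {u..t-\<eta>} \<union> \<gamma> ` {t+\<eta>..w} \<union> path_image \<delta>"
    have "closed K2" unfolding K2_def
      using cl uw \<delta> tr \<eta> by (intro closed_Un) (auto simp: closed_arc_image)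
    have c1: "connected (\<gamma> ` {u..t-\<eta>})" "connected (\<gamma> ` {t+\<eta>..w})" "connected (path_image \<delta>)"
      using uw tr \<eta> \<delta> by (auto intro!: connected_continuous_image continuous_on_subset[OF cont] connected_arc_image)
    have m1: "\<gamma> u \<in> \<gamma> ` {u..t-\<eta>}" "\<gamma> u \<in> path_image \<delta>" "\<gamma> w \<in> \<gamma> ` {t+\<eta>..w}" "\<gamma> w \<in> path_image \<delta>"
      using \<eta> \<delta> pathfinish_in_path_image[of \<delta>] pathstart_in_path_image[of \<delta>] by auto
    have "connected (\<gamma> ` {u..t-\<eta>} \<union> path_image \<delta>)"
      using c1 m1 by (intro connected_Un) auto
    then have "connected (\<gamma> ` {u..t-\<eta>} \<union> path_image \<delta> \<union> \<gamma> ` {t+\<eta>..w})"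
      using c1 m1 by (intro connected_Un) auto
    then have "connected K2" unfolding K2_def by (simp add: Un_ac)
    have "K2 \<subseteq> J" unfolding K2_def J using \<eta> by auto
    have near: "J - K2 \<subseteq> ball q \<epsilon>'"
    proof
      fix x assume x: "x \<in> J - K2"
      then obtain t' where t': "t' \<in> {u..w}" "x = \<gamma> t'" unfolding J K2_def by auto
      then have "t - \<eta> < t'" "t' < t + \<eta>" using x unfolding K2_def by force+
      then have "dist t' t < \<eta>0" using \<eta> by (auto simp: dist_real_def)
      then have "dist (\<gamma> t') (\<gamma> t) < \<epsilon>'" using \<eta>0 t' uw by auto
      then show "x \<in> ball q \<epsilon>'" using t t' by (simp add: dist_commute)
    qed
    have "q \<notin> K2"
      using int_not_\<delta>[OF tr] t tr uw \<eta> unfolding K2_def by (auto simp: inj_eq)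
    then obtain d where d: "d > 0" "ball q d \<inter> K2 = {}"
      using \<open>closed K2\<close> by (metis open_Compl ComplI openE disjoint_eq_subset_Compl)
    define d' where "d' = min d \<epsilon>'"
    have d': "d' > 0" "ball q d' \<inter> K2 = {}" "d' \<le> \<epsilon>'"
      using d \<epsilon>' by (auto simp: d'_def)
    have "connected_component (ball q \<epsilon> - path_image \<gamma>) z z'"
      if z: "z \<in> ball q d' - path_image \<gamma>" "z' \<in> ball q d' - path_image \<gamma>" "?\<kappa> z = ?\<kappa> z'" for z z'
    proof -
      have sm: "ball q d' \<subseteq> ball (\<gamma> t0) r" using d' \<epsilon>' by auto
      then have "z \<notin> J" "z' \<notin> J" using z eqJ by blast+
      then have "z \<in> I \<and> z' \<in> I \<or> z \<in> U \<and> z' \<in> U" using z(3) jor by blast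
      moreover have "I \<subseteq> - J" "U \<subseteq> - J" using jor by auto
      ultimately have "connected_component (- J) z z'"
        using jor unfolding connected_component_def by blast
      then have "connected_component (ball q \<epsilon>' - J) z z'"
        using Janiszewski_local[OF \<open>compact J\<close> \<open>closed K2\<close> \<open>connected K2\<close> \<open>K2 \<subseteq> J\<close> near d'(2,3)] z by auto
      moreover have "ball q \<epsilon>' - J \<subseteq> ball q \<epsilon> - path_image \<gamma>"
        using \<epsilon>' eqJ by auto
      ultimately show ?thesis by (rule connected_component_of_subset)
    qed
    then show ?thesis using d'(1) by blast
  qed
  show ?thesis using that[of r ?\<kappa>] r(1) lc both conn by blast
qed

text \<open>The same localisation at an end of the arc: the part away from the end is connected and
  the whole arc does not separate the plane. This will forbid a colour change across a single edge
  at a vertex.\<close>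

lemma arc_endpoint_nonseparating:
  fixes \<gamma> :: "real \<Rightarrow> complex"
  assumes "arc \<gamma>" "\<epsilon> > 0"
  shows "\<exists>\<delta>>0. \<forall>z\<in>ball (\<gamma> 0) \<delta> - path_image \<gamma>. \<forall>z'\<in>ball (\<gamma> 0) \<delta> - path_image \<gamma>.
         connected_component (ball (\<gamma> 0) \<epsilon> - path_image \<gamma>) z z'"
proof -
  have inj: "inj_on \<gamma> {0..1}" and cont: "continuous_on {0..1} \<gamma>"
    using assms(1) by (auto simp: arc_def path_def)
  have inj_eq: "\<gamma> a = \<gamma> b \<longleftrightarrow> a = b" if "a \<in> {0..1}" "b \<in> {0..1}" for a b
    using inj_on_eq_iff[OF inj that] .
  have "continuous (at 0 within {0..1}) \<gamma>" using cont by (simp add: continuous_on_eq_continuous_within)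
  then obtain \<eta>0 where \<eta>0: "\<eta>0 > 0" "\<And>t'. t' \<in> {0..1} \<Longrightarrow> dist t' 0 < \<eta>0 \<Longrightarrow> dist (\<gamma> t') (\<gamma> 0) < \<epsilon>"
    using assms(2) unfolding continuous_within_eps_delta by blast
  define \<eta> where "\<eta> = min (\<eta>0/2) (1/2)"
  have \<eta>: "\<eta> > 0" "\<eta> < \<eta>0" "\<eta> < 1" using \<eta>0 by (auto simp: \<eta>_def)
  define K2 where "K2 = \<gamma> ` {\<eta>..1}"
  have K2: "closed K2" "connected K2" "K2 \<subseteq> path_image \<gamma>"
    unfolding K2_def path_image_def using \<eta>
    by (auto intro!: compact_imp_closed compact_continuous_image connected_continuous_image continuous_on_subset[OF cont])
  have near: "path_image \<gamma> - K2 \<subseteq> ball (\<gamma> 0) \<epsilon>"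
  proof
    fix x assume x: "x \<in> path_image \<gamma> - K2"
    then obtain t' where t': "t' \<in> {0..1}" "x = \<gamma> t'" unfolding path_image_def by auto
    then have "t' < \<eta>" using x unfolding K2_def by force
    then show "x \<in> ball (\<gamma> 0) \<epsilon>" using \<eta>0(2)[of t'] t' \<eta> by (auto simp: dist_commute)
  qed
  have "\<gamma> 0 \<notin> K2" using \<eta> unfolding K2_def by (auto simp: inj_eq)
  then obtain d where d: "d > 0" "ball (\<gamma> 0) d \<inter> K2 = {}"
    using \<open>closed K2\<close> by (metis open_Compl ComplI openE disjoint_eq_subset_Compl)
  define d' where "d' = min d \<epsilon>"
  have d': "d' > 0" "ball (\<gamma> 0) d' \<inter> K2 = {}" "d' \<le> \<epsilon>"
    using d assms by (auto simp: d'_def)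
  have con: "connected (- path_image \<gamma>)"
    using assms by (intro connected_arc_complement) auto
  have "connected_component (ball (\<gamma> 0) \<epsilon> - path_image \<gamma>) z z'"
    if "z \<in> ball (\<gamma> 0) d' - path_image \<gamma>" "z' \<in> ball (\<gamma> 0) d' - path_image \<gamma>" for z z'
  proof (rule Janiszewski_local[OF _ K2 near d'(2,3)])
    show "compact (path_image \<gamma>)" using assms by (simp add: compact_arc_image)
    show "connected_component (- path_image \<gamma>) z z'"
      using con that unfolding connected_component_def by blast
  qed (use that in auto)
  then show ?thesis using d'(1) by blast
qed

section \<open>Arcs on a surface\<close>

text \<open>Charts start in \<open>complex\<close>, the type in which the planar separation results
  are stated, so that these transfer directly.\<close>

locale surface =
  fixes M :: "'b topology"
  assumes Hausdorff: "Hausdorff_space M"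
    and chart: "x \<in> topspace M \<Longrightarrow> \<exists>D U \<phi>. open (D :: complex set) \<and> openin M U \<and> x \<in> U \<and>
      homeomorphic_map (top_of_set D) (subtopology M U) \<phi>"
begin

definition disc_chart :: "'b \<Rightarrow> 'b set \<Rightarrow> complex \<Rightarrow> real \<Rightarrow> (complex \<Rightarrow> 'b) \<Rightarrow> ('b \<Rightarrow> complex) \<Rightarrow> bool" where
  "disc_chart x U z \<epsilon> \<phi> \<psi> \<longleftrightarrow> openin M U \<and> x \<in> U \<and> \<epsilon> > 0 \<and> \<phi> z = x \<and> \<psi> x = z \<and>
     homeomorphic_maps (top_of_set (ball z \<epsilon>)) (subtopology M U) \<phi> \<psi>"

lemma disc_chart_exists:
  assumes "openin M W" "x \<in> W"
  obtains U z \<epsilon> \<phi> \<psi> where "disc_chart x U z \<epsilon> \<phi> \<psi>" "U \<subseteq> W"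
proof -
  have "x \<in> topspace M" using assms openin_subset by blast
  then obtain D U0 \<phi> where D: "open (D :: complex set)" "openin M U0" "x \<in> U0"
     "homeomorphic_map (top_of_set D) (subtopology M U0) \<phi>"
    using chart by blast
  then obtain \<psi> where h: "homeomorphic_maps (top_of_set D) (subtopology M U0) \<phi> \<psi>"
    unfolding homeomorphic_map_maps by blast
  have U0: "U0 \<subseteq> topspace M" using D openin_subset by blast
  have \<phi>: "continuous_map (top_of_set D) (subtopology M U0) \<phi>"
    and \<psi>: "continuous_map (subtopology M U0) (top_of_set D) \<psi>"
    and i1: "\<And>d. d \<in> D \<Longrightarrow> \<psi> (\<phi> d) = d" and i2: "\<And>y. y \<in> U0 \<Longrightarrow> \<phi> (\<psi> y) = y"
    using h U0 unfolding homeomorphic_maps_def by auto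
  define z where "z = \<psi> x"
  have zD: "z \<in> D" using \<psi> D(3) U0 unfolding z_def continuous_map_def by auto
  have "openin (top_of_set D) {d \<in> topspace (top_of_set D). \<phi> d \<in> U0 \<inter> W}"
    by (rule openin_continuous_map_preimage[OF \<phi>]) (use assms(1) in \<open>auto simp: openin_subtopology\<close>)
  then have "open {d \<in> D. \<phi> d \<in> U0 \<inter> W}"
    using D(1) openin_open_eq by auto
  moreover have "z \<in> {d \<in> D. \<phi> d \<in> U0 \<inter> W}" using zD D(3) i2 assms by (simp add: z_def)
  ultimately obtain \<epsilon> where \<epsilon>: "\<epsilon> > 0" "ball z \<epsilon> \<subseteq> {d \<in> D. \<phi> d \<in> U0 \<inter> W}"
    using openE by blast
  define U where "U = \<phi> ` ball z \<epsilon>"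
  have bD: "ball z \<epsilon> \<subseteq> D" using \<epsilon> by auto
  have U: "U \<subseteq> U0" "U \<subseteq> W" using \<epsilon> by (auto simp: U_def)
  have Ueq: "U = {y \<in> topspace (subtopology M U0). \<psi> y \<in> ball z \<epsilon>}"
    using U i1 i2 bD U0 unfolding U_def by force
  have "openin (subtopology M U0) U"
    unfolding Ueq using D(1) bD
    by (intro openin_continuous_map_preimage[OF \<psi>]) (auto simp: openin_open_eq)
  then have "openin M U" using D(2) openin_trans_full by blast
  moreover have "homeomorphic_maps (top_of_set (ball z \<epsilon>)) (subtopology M U) \<phi> \<psi>"
  proof -
    have "homeomorphic_maps (subtopology (top_of_set D) (ball z \<epsilon>)) (subtopology (subtopology M U0) U) \<phi> \<psi>"
      by (rule homeomorphic_maps_subtopologies[OF h]) (use bD U U0 in \<open>auto simp: U_def Int_absorb1\<close>)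
    then show ?thesis using bD U by (simp add: subtopology_subtopology Int_absorb1)
  qed
  moreover have "x \<in> U"
    using i2[OF D(3)] \<epsilon>(1) unfolding U_def z_def by (metis centre_in_ball image_eqI)
  ultimately have "disc_chart x U z \<epsilon> \<phi> \<psi>"
    unfolding disc_chart_def using \<epsilon>(1) i2[OF D(3)] z_def by auto
  then show ?thesis using that U by blast
qed

context
  fixes x U z \<epsilon> \<phi> \<psi>
  assumes dc: "disc_chart x U z \<epsilon> \<phi> \<psi>"
begin

lemma dc_open: "openin M U" and dc_x: "x \<in> U" "\<phi> z = x" "\<psi> x = z" and dc_pos: "\<epsilon> > 0"
  and dc_sub: "U \<subseteq> topspace M"
  using dc openin_subset unfolding disc_chart_def by auto

lemma dc_cont:
  shows "continuous_map (top_of_set (ball z \<epsilon>)) M \<phi>"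
    and "continuous_map (subtopology M U) (top_of_set (ball z \<epsilon>)) \<psi>"
  using dc unfolding disc_chart_def homeomorphic_maps_def
  by (auto simp: continuous_map_in_subtopology)

lemma dc_inv:
  shows "d \<in> ball z \<epsilon> \<Longrightarrow> \<psi> (\<phi> d) = d" "d \<in> ball z \<epsilon> \<Longrightarrow> \<phi> d \<in> U"
    "y \<in> U \<Longrightarrow> \<phi> (\<psi> y) = y" "y \<in> U \<Longrightarrow> \<psi> y \<in> ball z \<epsilon>"
  using dc dc_sub unfolding disc_chart_def homeomorphic_maps_def continuous_map_def by auto

lemma dc_open_image:
  assumes "open S" "S \<subseteq> ball z \<epsilon>"
  shows "openin M (\<phi> ` S)"
proof -
  have "\<phi> ` S = {y \<in> topspace (subtopology M U). \<psi> y \<in> S}"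
  proof (intro equalityI subsetI)
    fix y assume "y \<in> \<phi> ` S"
    then show "y \<in> {y \<in> topspace (subtopology M U). \<psi> y \<in> S}"
      using assms(2) dc_inv(1,2) dc_sub by (auto simp: subset_iff)
  next
    fix y assume y: "y \<in> {y \<in> topspace (subtopology M U). \<psi> y \<in> S}"
    then have "\<phi> (\<psi> y) = y" using dc_inv(3) by auto
    then show "y \<in> \<phi> ` S" using y by (metis (mono_tags, lifting) image_eqI mem_Collect_eq)
  qed
  moreover have "openin (subtopology M U) {y \<in> topspace (subtopology M U). \<psi> y \<in> S}"
    using assms by (intro openin_continuous_map_preimage[OF dc_cont(2)]) (auto simp: openin_open_eq)
  ultimately show ?thesis using dc_open openin_trans_full by metis
qed

lemma dc_small_ball:
  assumes "openin M N" "y \<in> N" "y \<in> U"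
  obtains d where "d > 0" "ball (\<psi> y) d \<subseteq> ball z \<epsilon>" "\<phi> ` ball (\<psi> y) d \<subseteq> N"
proof -
  have "openin (top_of_set (ball z \<epsilon>)) {d \<in> topspace (top_of_set (ball z \<epsilon>)). \<phi> d \<in> N}"
    by (rule openin_continuous_map_preimage[OF dc_cont(1) assms(1)])
  then have "open {d \<in> ball z \<epsilon>. \<phi> d \<in> N}" by (simp add: openin_open_eq)
  moreover have "\<psi> y \<in> {d \<in> ball z \<epsilon>. \<phi> d \<in> N}" using assms dc_inv by simp
  ultimately obtain d where "d > 0" "ball (\<psi> y) d \<subseteq> {d \<in> ball z \<epsilon>. \<phi> d \<in> N}"
    using openE by blast
  then show ?thesis using that[of d] by blast
qed

lemma dc_connected_image:
  assumes "connected K" "K \<subseteq> ball z \<epsilon>"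
  shows "connectedin M (\<phi> ` K)"
proof (rule connectedin_continuous_map_image[OF dc_cont(1)])
  show "connectedin (top_of_set (ball z \<epsilon>)) K"
    using assms by (simp add: connectedin_subtopology)
qed

lemma dc_ball:
  assumes "y \<in> U" "d > 0" "ball (\<psi> y) d \<subseteq> ball z \<epsilon>"
  shows "openin M (\<phi> ` ball (\<psi> y) d)" "y \<in> \<phi> ` ball (\<psi> y) d"
proof -
  show "openin M (\<phi> ` ball (\<psi> y) d)" using dc_open_image[of "ball (\<psi> y) d"] assms by simp
  have "\<phi> (\<psi> y) = y" "\<psi> y \<in> ball (\<psi> y) d" using assms dc_inv(3)[of y] by auto
  then show "y \<in> \<phi> ` ball (\<psi> y) d" by (metis image_eqI)
qed

end

definition arc_in :: "(real \<Rightarrow> 'b) \<Rightarrow> bool" where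
  "arc_in a \<longleftrightarrow> continuous_map (top_of_set {0..1}) M a \<and> inj_on a {0..1}"

lemma arc_in_topspace: "arc_in a \<Longrightarrow> t \<in> {0..1} \<Longrightarrow> a t \<in> topspace M"
  unfolding arc_in_def continuous_map_def by auto

lemma arc_in_segment:
  assumes "arc_in a" "0 \<le> u" "w \<le> 1"
  shows "closedin M (a ` {u..w})" "connectedin M (a ` {u..w})"
proof -
  have sub: "{u..w} \<subseteq> {0..1}" using assms by auto
  have "compactin (top_of_set {0..1}) {u..w}"
    using sub by (auto simp: compactin_subtopology)
  then show "closedin M (a ` {u..w})"
    using assms Hausdorff unfolding arc_in_def by (meson compactin_imp_closedin image_compactin)
  have "connectedin (top_of_set {0..1}) {u..w}"
    using sub by (auto simp: connectedin_subtopology)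
  then show "connectedin M (a ` {u..w})"
    using assms unfolding arc_in_def by (meson connectedin_continuous_map_image)
qed

lemma arc_in_near:
  assumes a: "arc_in a" and t: "t \<in> {0..1}" and N: "openin M N" "a t \<in> N"
  obtains \<eta> where "\<eta> > 0" "\<And>t'. t' \<in> {0..1} \<Longrightarrow> \<bar>t' - t\<bar> < \<eta> \<Longrightarrow> a t' \<in> N"
proof -
  have "openin (top_of_set {0..1}) {t \<in> topspace (top_of_set {0..1}). a t \<in> N}"
    using a N unfolding arc_in_def by (blast intro: openin_continuous_map_preimage)
  then obtain T where T: "open T" "{t \<in> {0..1}. a t \<in> N} = {0..1} \<inter> T"
    by (auto simp: openin_open)
  then have "t \<in> T" using t N by auto
  then obtain \<eta> where "\<eta> > 0" "ball t \<eta> \<subseteq> T" using T openE by blast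
  then have "a t' \<in> N" if "t' \<in> {0..1}" "\<bar>t' - t\<bar> < \<eta>" for t'
  proof -
    have "t' \<in> ball t \<eta>" using that by (simp add: dist_real_def abs_minus_commute)
    then have "t' \<in> {0..1} \<inter> T" using that \<open>ball t \<eta> \<subseteq> T\<close> by auto
    then have "t' \<in> {t \<in> {0..1}. a t \<in> N}" using T(2) by metis
    then show ?thesis by simp
  qed
  then show ?thesis using that \<open>\<eta> > 0\<close> by blast
qed

lemma arc_in_chart:
  assumes a: "arc_in a" and dc: "disc_chart x U z \<epsilon> \<phi> \<psi>" and uw: "0 \<le> u" "u < w" "w \<le> 1"
    and sub: "a ` {u..w} \<subseteq> U"
  shows "arc (\<lambda>t. \<psi> (a (u + (w - u) * t)))"
    and "path_image (\<lambda>t. \<psi> (a (u + (w - u) * t))) = \<psi> ` a ` {u..w}"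
proof -
  let ?l = "\<lambda>t. u + (w - u) * t"
  have l: "?l ` {0..1} = {u..w}"
  proof -
    have "?l ` {0..1} = (\<lambda>t. (w - u) * t + u) ` {0..1}" by (simp add: add.commute)
    then show ?thesis using uw image_affinity_atLeastAtMost[of "w - u" u 0 1] by auto
  qed
  have lin: "?l t \<in> {u..w}" if "t \<in> {0..1}" for t using l that by blast
  have "continuous_map (top_of_set {0..1}) (top_of_set {0..1}) ?l"
  proof -
    have "continuous_on {0..1} ?l" by (intro continuous_intros)
    moreover have "?l ` {0..1} \<subseteq> {0..1}" unfolding l using uw by auto
    ultimately show ?thesis by (simp add: image_subset_iff_funcset)
  qed
  then have "continuous_map (top_of_set {0..1}) M (a \<circ> ?l)"
    using a unfolding arc_in_def by (blast intro: continuous_map_compose)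
  then have "continuous_map (top_of_set {0..1}) (subtopology M U) (a \<circ> ?l)"
    using sub lin by (auto simp: continuous_map_in_subtopology)
  then have "continuous_map (top_of_set {0..1}) (top_of_set (ball z \<epsilon>)) (\<psi> \<circ> (a \<circ> ?l))"
    using dc_cont(2)[OF dc] continuous_map_compose by blast
  then have "continuous_on {0..1} (\<lambda>t. \<psi> (a (?l t)))"
    by (simp add: continuous_map_in_subtopology o_def)
  moreover have "inj_on (\<lambda>t. \<psi> (a (?l t))) {0..1}"
  proof (rule inj_onI)
    fix s t assume st: "s \<in> {0..1}" "t \<in> {0..1}" and eq: "\<psi> (a (?l s)) = \<psi> (a (?l t))"
    have "a (?l s) \<in> U" "a (?l t) \<in> U" using lin st sub by blast+
    then have "a (?l s) = a (?l t)" using eq dc_inv(3)[OF dc] by metis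
    moreover have "?l s \<in> {0..1}" "?l t \<in> {0..1}" using lin[OF st(1)] lin[OF st(2)] uw by auto
    ultimately have "?l s = ?l t" using a unfolding arc_in_def by (meson inj_onD)
    then show "s = t" using uw by simp
  qed
  ultimately show "arc (\<lambda>t. \<psi> (a (?l t)))" by (simp add: arc_def path_def)
  show "path_image (\<lambda>t. \<psi> (a (?l t))) = \<psi> ` a ` {u..w}"
    unfolding path_image_def l[symmetric] image_image ..
qed

text \<open>A short subarc around \<open>a t0\<close> lies in one chart, where the planar lemma
  applies. The rest \<open>R\<close> of the arc may re-enter the chart, but it is closed and misses
  \<open>a t0\<close>; with \<open>R\<close> removed, \<open>A\<close> and the planar arc agree on
  \<open>N0\<close>.\<close>

lemma arc_in_two_sides:
  assumes a: "arc_in a" and t0: "0 < t0" "t0 < 1" and W0: "openin M W0" "a t0 \<in> W0"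
  defines "A \<equiv> a ` {0..1}"
  obtains N0 \<kappa> where "openin M N0" "a t0 \<in> N0" "N0 \<subseteq> W0"
    "\<And>y. y \<in> N0 - A \<Longrightarrow> \<exists>N. openin M N \<and> y \<in> N \<and> (\<forall>z\<in>N. \<kappa> z = (\<kappa> y :: bool))"
    "\<And>y N b. y \<in> A \<inter> N0 \<Longrightarrow> openin M N \<Longrightarrow> y \<in> N \<Longrightarrow> \<exists>z\<in>N - A. \<kappa> z = b"
    "\<And>y W. y \<in> A \<inter> N0 \<Longrightarrow> openin M W \<Longrightarrow> y \<in> W \<Longrightarrow>
       \<exists>N. openin M N \<and> y \<in> N \<and> (\<forall>z\<in>N - A. \<forall>z'\<in>N - A. \<kappa> z = \<kappa> z' \<longrightarrow>
          (\<exists>K. connectedin M K \<and> K \<subseteq> W - A \<and> z \<in> K \<and> z' \<in> K))"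
proof -
  have at0: "a t0 \<in> topspace M" using a t0 arc_in_topspace by auto
  obtain U z \<epsilon> \<phi> \<psi> where dc: "disc_chart (a t0) U z \<epsilon> \<phi> \<psi>" and UW0: "U \<subseteq> W0"
    by (rule disc_chart_exists[OF W0])
  note inv = dc_inv[OF dc]
  obtain \<eta>0 where \<eta>0: "\<eta>0 > 0" "\<And>t'. t' \<in> {0..1} \<Longrightarrow> \<bar>t' - t0\<bar> < \<eta>0 \<Longrightarrow> a t' \<in> U"
    using arc_in_near[OF a, of t0 U] t0 dc_open[OF dc] dc_x[OF dc] by auto
  define \<eta> where "\<eta> = min (\<eta>0/2) (min (t0/2) ((1-t0)/2))"
  have \<eta>: "\<eta> > 0" "\<eta> < \<eta>0" "0 < t0 - \<eta>" "t0 + \<eta> < 1"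
    using \<eta>0 t0 by (auto simp: \<eta>_def min_def field_simps)
  define u where "u = t0 - \<eta>"
  define w where "w = t0 + \<eta>"
  have uw: "0 \<le> u" "u < w" "w \<le> 1" "u < t0" "t0 < w" using \<eta> by (auto simp: u_def w_def)
  have sub: "a ` {u..w} \<subseteq> U" using \<eta>0 \<eta> by (auto simp: u_def w_def)
  define \<gamma> where "\<gamma> = (\<lambda>t. \<psi> (a (u + (w - u) * t)))"
  have arc: "arc \<gamma>" and im: "path_image \<gamma> = \<psi> ` a ` {u..w}"
    using arc_in_chart[OF a dc uw(1-3) sub] by (auto simp: \<gamma>_def)
  have \<gamma>h: "\<gamma> (1/2) = z"
    using \<eta>(1) dc_x[OF dc] by (simp add: \<gamma>_def u_def w_def field_simps)
  obtain \<kappa>' r where r: "r > 0"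
    and k1: "\<And>y. y \<in> ball z r - path_image \<gamma> \<Longrightarrow> \<exists>d>0. \<forall>y'\<in>ball y d. \<kappa>' y' = (\<kappa>' y::bool)"
    and k2: "\<And>q d b. q \<in> path_image \<gamma> \<inter> ball z r \<Longrightarrow> d > 0 \<Longrightarrow> \<exists>y\<in>ball q d - path_image \<gamma>. \<kappa>' y = b"
    and k3: "\<And>q e. q \<in> path_image \<gamma> \<inter> ball z r \<Longrightarrow> e > 0 \<Longrightarrow>
       \<exists>d>0. \<forall>y\<in>ball q d - path_image \<gamma>. \<forall>y'\<in>ball q d - path_image \<gamma>. \<kappa>' y = \<kappa>' y' \<longrightarrow>
         connected_component (ball q e - path_image \<gamma>) y y'"
  proof (rule arc_two_sides[OF arc, of "1/2", unfolded \<gamma>h])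
    show "0 < (1/2::real)" "1/2 < (1::real)" by auto
  qed (rule that)
  define R where "R = a ` {0..u} \<union> a ` {w..1}"
  have clR: "closedin M R" unfolding R_def
    using arc_in_segment(1)[OF a] uw by (intro closedin_Un) auto
  have injD: "a s = a t \<longleftrightarrow> s = t" if "s \<in> {0..1}" "t \<in> {0..1}" for s t
    using a that unfolding arc_in_def by (meson inj_on_eq_iff)
  have "a t0 \<notin> R" using uw t0 unfolding R_def by (auto simp: injD)
  have AR: "A = a ` {u..w} \<union> R"
    unfolding A_def R_def image_Un[symmetric] using uw by (auto intro!: arg_cong[of _ _ "image a"])
  define N0 where "N0 = \<phi> ` (ball z (min r \<epsilon>)) - R"
  have N0U: "N0 \<subseteq> U" using inv unfolding N0_def by auto
  have oN0: "openin M N0"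
    unfolding N0_def using dc_open_image[OF dc, of "ball z (min r \<epsilon>)"] clR
    by (intro openin_diff) (simp_all add: subset_ball)
  have N0in: "a t0 \<in> N0"
  proof -
    have "z \<in> ball z (min r \<epsilon>)" using r dc_pos[OF dc] by simp
    then have "\<phi> z \<in> \<phi> ` ball z (min r \<epsilon>)" by (rule imageI)
    then show ?thesis using \<open>a t0 \<notin> R\<close> dc_x(2)[OF dc] unfolding N0_def by simp
  qed
  have \<psi>N0: "\<psi> y \<in> ball z r" if "y \<in> N0" for y
    using that inv(1) unfolding N0_def by auto
  have AN0: "y \<in> A \<longleftrightarrow> \<psi> y \<in> path_image \<gamma>" if y: "y \<in> N0" for y
  proof -
    have "y \<in> A \<longleftrightarrow> y \<in> a ` {u..w}" using y AR by (auto simp: N0_def)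
    also have "\<dots> \<longleftrightarrow> \<psi> y \<in> path_image \<gamma>"
    proof
      show "y \<in> a ` {u..w} \<Longrightarrow> \<psi> y \<in> path_image \<gamma>" unfolding im by (rule imageI)
      assume "\<psi> y \<in> path_image \<gamma>"
      then obtain y' where y': "y' \<in> a ` {u..w}" "\<psi> y = \<psi> y'" unfolding im by blast
      then have "y' \<in> U" "y \<in> U" using sub y N0U by blast+
      then have "y = y'" using inv(3)[of y] inv(3)[of y'] y'(2) by metis
      then show "y \<in> a ` {u..w}" using y' by simp
    qed
    finally show ?thesis .
  qed
  define \<kappa> where "\<kappa> = \<kappa>' \<circ> \<psi>"
  have c1: "\<exists>N. openin M N \<and> y \<in> N \<and> (\<forall>z\<in>N. \<kappa> z = \<kappa> y)" if y: "y \<in> N0 - A" for y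
  proof -
    obtain d where d: "d > 0" "\<forall>y'\<in>ball (\<psi> y) d. \<kappa>' y' = \<kappa>' (\<psi> y)"
      using k1[of "\<psi> y"] y \<psi>N0 AN0 by auto
    have yU: "y \<in> U" using y N0U by auto
    obtain d' where d': "d' > 0" "ball (\<psi> y) d' \<subseteq> ball z \<epsilon>"
      using dc_small_ball[OF dc dc_open[OF dc] yU yU] by metis
    define m where "m = min d d'"
    have m: "m > 0" "ball (\<psi> y) m \<subseteq> ball z \<epsilon>" using d d' by (auto simp: m_def)
    have "\<forall>x\<in>\<phi> ` ball (\<psi> y) m. \<kappa> x = \<kappa> y"
    proof
      fix x assume "x \<in> \<phi> ` ball (\<psi> y) m"
      then obtain q where q: "q \<in> ball (\<psi> y) m" "x = \<phi> q" by blast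
      then have "\<psi> x = q" using inv(1) m(2) by blast
      moreover have "q \<in> ball (\<psi> y) d" using q(1) by (simp add: m_def)
      ultimately show "\<kappa> x = \<kappa> y" using d(2) by (simp add: \<kappa>_def)
    qed
    then show ?thesis using dc_ball[OF dc yU m] by blast
  qed
  have c2: "\<exists>x\<in>N - A. \<kappa> x = b" if y: "y \<in> A \<inter> N0" and N: "openin M N" "y \<in> N" for y N b
  proof -
    have yU: "y \<in> U" using y N0U by auto
    obtain d where d: "d > 0" "ball (\<psi> y) d \<subseteq> ball z \<epsilon>" "\<phi> ` ball (\<psi> y) d \<subseteq> N \<inter> N0"
      using dc_small_ball[OF dc, of "N \<inter> N0" y] yU y N oN0 by (metis IntD2 IntI openin_Int)
    have "\<psi> y \<in> path_image \<gamma> \<inter> ball z r" using y AN0 \<psi>N0 by auto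
    then obtain q where q: "q \<in> ball (\<psi> y) d - path_image \<gamma>" "\<kappa>' q = b"
      using k2 d(1) by blast
    have qe: "\<psi> (\<phi> q) = q" using q d inv(1) by blast
    have "\<phi> q \<in> N \<inter> N0" using q d by blast
    moreover have "\<phi> q \<notin> A" using AN0[of "\<phi> q"] calculation qe q by auto
    ultimately show ?thesis using qe q by (intro bexI[of _ "\<phi> q"]) (auto simp: \<kappa>_def)
  qed
  have c3: "\<exists>N. openin M N \<and> y \<in> N \<and> (\<forall>x\<in>N - A. \<forall>x'\<in>N - A. \<kappa> x = \<kappa> x' \<longrightarrow>
          (\<exists>K. connectedin M K \<and> K \<subseteq> W - A \<and> x \<in> K \<and> x' \<in> K))"
     if y: "y \<in> A \<inter> N0" and W: "openin M W" "y \<in> W" for y W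
  proof -
    have yU: "y \<in> U" using y N0U by auto
    obtain d where d: "d > 0" "ball (\<psi> y) d \<subseteq> ball z \<epsilon>" "\<phi> ` ball (\<psi> y) d \<subseteq> W \<inter> N0"
      using dc_small_ball[OF dc, of "W \<inter> N0" y] yU y W oN0 by (metis IntD2 IntI openin_Int)
    have "\<psi> y \<in> path_image \<gamma> \<inter> ball z r" using y AN0 \<psi>N0 by auto
    then obtain d' where d': "d' > 0" and cc: "\<forall>q\<in>ball (\<psi> y) d' - path_image \<gamma>. \<forall>q'\<in>ball (\<psi> y) d' - path_image \<gamma>.
       \<kappa>' q = \<kappa>' q' \<longrightarrow> connected_component (ball (\<psi> y) d - path_image \<gamma>) q q'"
      using k3 d(1) by blast
    define m where "m = min d d'"
    have m: "m > 0" "ball (\<psi> y) m \<subseteq> ball z \<epsilon>" using d d' by (auto simp: m_def)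
    have mem: "\<phi> q \<in> N0" "\<psi> (\<phi> q) = q" if "q \<in> ball (\<psi> y) d" for q
      using that d inv(1) by blast+
    have "\<exists>K. connectedin M K \<and> K \<subseteq> W - A \<and> x \<in> K \<and> x' \<in> K"
      if "x \<in> \<phi> ` ball (\<psi> y) m - A" "x' \<in> \<phi> ` ball (\<psi> y) m - A" and k: "\<kappa> x = \<kappa> x'" for x x'
    proof -
      obtain q q' where q: "q \<in> ball (\<psi> y) m" "x = \<phi> q" "q' \<in> ball (\<psi> y) m" "x' = \<phi> q'"
        using \<open>x \<in> \<phi> ` ball (\<psi> y) m - A\<close> \<open>x' \<in> \<phi> ` ball (\<psi> y) m - A\<close> by blast
      then have qd: "q \<in> ball (\<psi> y) d" "q' \<in> ball (\<psi> y) d" by (auto simp: m_def)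
      have "q \<notin> path_image \<gamma>" "q' \<notin> path_image \<gamma>"
        using AN0[of x] AN0[of x'] mem[OF qd(1)] mem[OF qd(2)] q that by auto
      moreover have "\<kappa>' q = \<kappa>' q'" using k q mem(2) qd by (auto simp: \<kappa>_def)
      ultimately have "connected_component (ball (\<psi> y) d - path_image \<gamma>) q q'"
        using cc q by (auto simp: m_def)
      then obtain L where L: "connected L" "L \<subseteq> ball (\<psi> y) d - path_image \<gamma>" "q \<in> L" "q' \<in> L"
        unfolding connected_component_def by blast
      have "connectedin M (\<phi> ` L)" using L d by (intro dc_connected_image[OF dc]) auto
      moreover have "\<phi> ` L \<subseteq> W - A"
      proof -
        have "\<phi> l \<in> W \<and> \<phi> l \<notin> A" if "l \<in> L" for l
        proof -
          have "l \<in> ball (\<psi> y) d" "l \<notin> path_image \<gamma>" using that L by auto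
          then show ?thesis using AN0[of "\<phi> l"] mem[of l] d(3) by auto
        qed
        then show ?thesis by auto
      qed
      ultimately show ?thesis using L q by blast
    qed
    then show ?thesis using dc_ball[OF dc yU m] by blast
  qed
  show ?thesis
    by (rule that[OF oN0 N0in subset_trans[OF N0U UW0] c1 c2 c3])
qed

lemma arc_in_endpoint:
  assumes a: "arc_in a" and W: "openin M W" "a 0 \<in> W"
  defines "A \<equiv> a ` {0..1}"
  shows "\<exists>N. openin M N \<and> a 0 \<in> N \<and> (\<forall>z\<in>N - A. \<forall>z'\<in>N - A.
          \<exists>K. connectedin M K \<and> K \<subseteq> W - A \<and> z \<in> K \<and> z' \<in> K)"
proof -
  obtain U z \<epsilon> \<phi> \<psi> where dc: "disc_chart (a 0) U z \<epsilon> \<phi> \<psi>" and UW: "U \<subseteq> W"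
    by (rule disc_chart_exists[OF W])
  note inv = dc_inv[OF dc]
  obtain \<eta>0 where \<eta>0: "\<eta>0 > 0" "\<And>t'. t' \<in> {0..1} \<Longrightarrow> \<bar>t' - 0\<bar> < \<eta>0 \<Longrightarrow> a t' \<in> U"
    using arc_in_near[OF a, of 0 U] dc_open[OF dc] dc_x[OF dc] by auto
  define w where "w = min (\<eta>0/2) (1/2)"
  have w: "0 < w" "w < \<eta>0" "w < 1" using \<eta>0 by (auto simp: w_def)
  have sub: "a ` {0..w} \<subseteq> U" using \<eta>0 w by auto
  define \<gamma> where "\<gamma> = (\<lambda>t. \<psi> (a (0 + (w - 0) * t)))"
  have arc: "arc \<gamma>" and im: "path_image \<gamma> = \<psi> ` a ` {0..w}"
    using arc_in_chart[OF a dc, of 0 w] w sub by (auto simp: \<gamma>_def)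
  have \<gamma>0: "\<gamma> 0 = z" using dc_x[OF dc] by (simp add: \<gamma>_def)
  define R where "R = a ` {w..1}"
  have clR: "closedin M R" unfolding R_def using arc_in_segment(1)[OF a] w by auto
  have injD: "a s = a t \<longleftrightarrow> s = t" if "s \<in> {0..1}" "t \<in> {0..1}" for s t
    using a that unfolding arc_in_def by (meson inj_on_eq_iff)
  have "a 0 \<notin> R" using w unfolding R_def by (auto simp: injD)
  have AR: "A = a ` {0..w} \<union> R"
    unfolding A_def R_def image_Un[symmetric] using w by (auto intro!: arg_cong[of _ _ "image a"])
  have oN0: "openin M (U - R)" using dc_open[OF dc] clR by blast
  have AN0: "y \<in> A \<longleftrightarrow> \<psi> y \<in> path_image \<gamma>" if y: "y \<in> U - R" for y
  proof -
    have "y \<in> A \<longleftrightarrow> y \<in> a ` {0..w}" using y AR by auto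
    also have "\<dots> \<longleftrightarrow> \<psi> y \<in> path_image \<gamma>"
    proof
      show "y \<in> a ` {0..w} \<Longrightarrow> \<psi> y \<in> path_image \<gamma>" unfolding im by (rule imageI)
      assume "\<psi> y \<in> path_image \<gamma>"
      then obtain y' where y': "y' \<in> a ` {0..w}" "\<psi> y = \<psi> y'" unfolding im by blast
      then have "y' \<in> U" using sub by blast
      then have "y = y'" using inv(3)[of y] inv(3)[of y'] y y'(2) by (metis DiffD1)
      then show "y \<in> a ` {0..w}" using y' by simp
    qed
    finally show ?thesis .
  qed
  obtain d where d: "d > 0" "ball (\<psi> (a 0)) d \<subseteq> ball z \<epsilon>" "\<phi> ` ball (\<psi> (a 0)) d \<subseteq> U - R"
    using dc_small_ball[OF dc oN0, of "a 0"] dc_x[OF dc] \<open>a 0 \<notin> R\<close> by blast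
  have z: "\<psi> (a 0) = z" using dc_x[OF dc] by simp
  obtain d' where d': "d' > 0" and cc: "\<forall>q\<in>ball z d' - path_image \<gamma>. \<forall>q'\<in>ball z d' - path_image \<gamma>.
       connected_component (ball z d - path_image \<gamma>) q q'"
    using arc_endpoint_nonseparating[OF arc d(1)] unfolding \<gamma>0 by blast
  define m where "m = min d d'"
  have m: "m > 0" "ball (\<psi> (a 0)) m \<subseteq> ball z \<epsilon>" using d d' by (auto simp: m_def)
  have mem: "\<phi> q \<in> U - R" "\<psi> (\<phi> q) = q" if "q \<in> ball z d" for q
    using that d inv(1) unfolding z by blast+
  have "\<exists>K. connectedin M K \<and> K \<subseteq> W - A \<and> x \<in> K \<and> x' \<in> K"
    if xx: "x \<in> \<phi> ` ball z m - A" "x' \<in> \<phi> ` ball z m - A" for x x'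
  proof -
    obtain q q' where q: "q \<in> ball z m" "x = \<phi> q" "q' \<in> ball z m" "x' = \<phi> q'"
      using xx by blast
    then have qd: "q \<in> ball z d" "q' \<in> ball z d" by (auto simp: m_def)
    have "q \<notin> path_image \<gamma>" "q' \<notin> path_image \<gamma>"
      using AN0[of x] AN0[of x'] mem[OF qd(1)] mem[OF qd(2)] q that by auto
    then have "connected_component (ball z d - path_image \<gamma>) q q'"
      using cc q by (auto simp: m_def)
    then obtain L where L: "connected L" "L \<subseteq> ball z d - path_image \<gamma>" "q \<in> L" "q' \<in> L"
      unfolding connected_component_def by blast
    have "connectedin M (\<phi> ` L)" using L d z by (intro dc_connected_image[OF dc]) auto
    moreover have "\<phi> ` L \<subseteq> W - A"
    proof -
      have "\<phi> l \<in> W \<and> \<phi> l \<notin> A" if "l \<in> L" for l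
      proof -
        have "l \<in> ball z d" "l \<notin> path_image \<gamma>" using that L by auto
        then show ?thesis using AN0[of "\<phi> l"] mem[of l] UW by auto
      qed
      then show ?thesis by auto
    qed
    ultimately show ?thesis using L q by blast
  qed
  moreover have "openin M (\<phi> ` ball z m)" "a 0 \<in> \<phi> ` ball z m"
    using dc_ball[OF dc dc_x(1)[OF dc] m] z by auto
  ultimately show ?thesis by blast
qed

text \<open>A disc stays connected without its centre. Around a vertex this allows a colouring to be
  followed all the way round when it changes across no edge.\<close>

lemma punctured_connected_nbhd:
  assumes "openin M W" "x \<in> W"
  obtains N where "openin M N" "x \<in> N" "N \<subseteq> W" "connectedin M N" "connectedin M (N - {x})"
proof -
  obtain U z \<epsilon> \<phi> \<psi> where dc: "disc_chart x U z \<epsilon> \<phi> \<psi>" and UW: "U \<subseteq> W"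
    by (rule disc_chart_exists[OF assms])
  note inv = dc_inv[OF dc]
  have eq: "\<phi> ` ball z \<epsilon> = U" using inv by force
  have "connected (ball z \<epsilon> - {z})"
    by (rule connected_punctured_ball) simp
  then have "connectedin M (\<phi> ` (ball z \<epsilon> - {z}))"
    using dc_connected_image[OF dc] by auto
  moreover have "\<phi> ` (ball z \<epsilon> - {z}) = U - {x}"
  proof -
    have "inj_on \<phi> (ball z \<epsilon>)" using inv(1) by (rule inj_on_inverseI)
    then have "\<phi> ` (ball z \<epsilon> - {z}) = \<phi> ` ball z \<epsilon> - \<phi> ` {z}"
      using dc_pos[OF dc] by (intro inj_on_image_set_diff) auto
    then show ?thesis using eq dc_x(2)[OF dc] by simp
  qed
  moreover have "connectedin M U"
    using dc_connected_image[OF dc, of "ball z \<epsilon>"] eq by simp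
  ultimately show ?thesis using that[of U] dc_open[OF dc] dc_x[OF dc] UW by auto
qed

end

section \<open>Two-colourings of the complement of an embedded graph\<close>

lemma connectedin_locally_constant:
  assumes S: "connectedin X S"
    and loc: "\<And>y. y \<in> S \<Longrightarrow> \<exists>N. openin X N \<and> y \<in> N \<and> (\<forall>y'\<in>N \<inter> S. Q y' = (Q y :: bool))"
    and y: "y \<in> S" "y' \<in> S"
  shows "Q y = Q y'"
proof (rule ccontr)
  assume ne: "Q y \<noteq> Q y'"
  let ?N = "\<lambda>b. \<Union>{N. openin X N \<and> (\<forall>z\<in>N \<inter> S. Q z = b)}"
  have op: "openin X (?N b)" for b by (rule openin_Union) blast
  have cov: "z \<in> ?N (Q z)" if "z \<in> S" for z
    using loc[OF that] by blast
  have "S \<subseteq> ?N True \<union> ?N False"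
  proof
    fix z assume "z \<in> S"
    then show "z \<in> ?N True \<union> ?N False" using cov[of z] by (cases "Q z") auto
  qed
  moreover have "?N True \<inter> ?N False \<inter> S = {}" by blast
  moreover have "?N True \<inter> S \<noteq> {}" "?N False \<inter> S \<noteq> {}"
  proof -
    have "\<exists>z\<in>S. Q z = b" for b using y ne by (cases "Q y = b") auto
    have "?N b \<inter> S \<noteq> {}" for b
    proof -
      obtain z where "z \<in> S" "Q z = b" using \<open>\<And>b. \<exists>z\<in>S. Q z = b\<close> by blast
      then show ?thesis using cov[of z] by blast
    qed
    then show "?N True \<inter> S \<noteq> {}" "?N False \<inter> S \<noteq> {}" by blast+
  qed
  ultimately have "\<exists>E1 E2. openin X E1 \<and> openin X E2 \<and> S \<subseteq> E1 \<union> E2 \<and> E1 \<inter> E2 \<inter> S = {} \<and> E1 \<inter> S \<noteq> {} \<and> E2 \<inter> S \<noteq> {}"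
    by (intro exI[of _ "?N True"] exI[of _ "?N False"] conjI op)
  then show False using S unfolding connectedin by (elim conjE notE)
qed

locale surface_graph = surface M for M :: "'b topology" +
  fixes V :: "'a set" and E :: "'a set set" and p :: "'a \<Rightarrow> 'b" and g :: "'a set \<Rightarrow> real \<Rightarrow> 'b"
  assumes simple: "simple_graph V E" and emb: "graph_embedding M V E p g"
    and no_isolated: "v \<in> V \<Longrightarrow> \<exists>e\<in>E. v \<in> e"
begin

definition \<Gamma> :: "'b set" where "\<Gamma> = embedded_graph V E p g"

lemma finite_V: "finite V" and finite_E: "finite E" and edge_sub: "e \<in> E \<Longrightarrow> e \<subseteq> V"
  and edge_card: "e \<in> E \<Longrightarrow> card e = 2"
proof -
  show V: "finite V" and *: "e \<in> E \<Longrightarrow> e \<subseteq> V" "e \<in> E \<Longrightarrow> card e = 2" for e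
    using simple by (auto simp: simple_graph_def)
  have "E \<subseteq> Pow V" using *(1) by blast
  then show "finite E" using V finite_subset by blast
qed

lemma arc_g: "e \<in> E \<Longrightarrow> arc_in (g e)"
proof -
  assume "e \<in> E"
  then have "embedding_map (top_of_set {0..1}) M (g e)" using emb by (auto simp: graph_embedding_def)
  then show ?thesis unfolding arc_in_def
    by (metis embedding_map_def homeomorphic_imp_continuous_map homeomorphic_imp_injective_map
        continuous_map_in_subtopology topspace_euclidean_subtopology)
qed

lemma g_ends: "e \<in> E \<Longrightarrow> {g e 0, g e 1} = p ` e"
  and g_int_V: "e \<in> E \<Longrightarrow> 0 < t \<Longrightarrow> t < 1 \<Longrightarrow> g e t \<notin> p ` V"
  and p_top: "v \<in> V \<Longrightarrow> p v \<in> topspace M" and p_inj: "inj_on p V"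
  using emb unfolding graph_embedding_def by (blast, force, blast, blast)

lemma g_int_disj:
  assumes "e \<in> E" "e' \<in> E" "e \<noteq> e'" "0 < t" "t < 1" "s \<in> {0..1}"
  shows "g e t \<noteq> g e' s"
proof (cases "0 < s \<and> s < 1")
  case True
  have "g e ` {0<..<1} \<inter> g e' ` {0<..<1} = {}"
    using emb assms unfolding graph_embedding_def by blast
  then show ?thesis using True assms by (metis IntI empty_iff greaterThanLessThan_iff image_eqI)
next
  case False
  then have "s = 0 \<or> s = 1" using assms by auto
  then have "g e' s \<in> p ` V" using g_ends[OF assms(2)] edge_sub[OF assms(2)] by blast
  then show ?thesis using g_int_V[OF assms(1,4,5)] by metis
qed

lemma g_inj: "e \<in> E \<Longrightarrow> s \<in> {0..1} \<Longrightarrow> t \<in> {0..1} \<Longrightarrow> g e s = g e t \<longleftrightarrow> s = t"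
  using arc_g unfolding arc_in_def by (meson inj_on_eq_iff)

lemma \<Gamma>_cases:
  assumes "y \<in> \<Gamma>"
  obtains (vertex) v where "v \<in> V" "y = p v" | (edge) e t where "e \<in> E" "0 < t" "t < 1" "y = g e t"
proof -
  consider "y \<in> p ` V" | e t where "e \<in> E" "t \<in> {0..1}" "y = g e t"
    using assms unfolding \<Gamma>_def embedded_graph_def by blast
  then show ?thesis
  proof cases
    case 1 then show ?thesis using vertex by blast
  next
    case 2
    show ?thesis
    proof (cases "0 < t \<and> t < 1")
      case True then show ?thesis using 2 edge by blast
    next
      case False
      then have "t = 0 \<or> t = 1" using 2 by auto
      then have "y \<in> p ` V" using g_ends[OF 2(1)] edge_sub[OF 2(1)] 2(3) by blast
      then show ?thesis using vertex by blast
    qed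
  qed
qed

lemma g_in_\<Gamma>: "e \<in> E \<Longrightarrow> t \<in> {0..1} \<Longrightarrow> g e t \<in> \<Gamma>" and p_in_\<Gamma>: "v \<in> V \<Longrightarrow> p v \<in> \<Gamma>"
  unfolding \<Gamma>_def embedded_graph_def by blast+

lemma closed_edge: "e \<in> E \<Longrightarrow> closedin M (g e ` {0..1})"
  using arc_in_segment(1)[OF arc_g] by simp

lemma closed_points: "X \<subseteq> V \<Longrightarrow> closedin M (p ` X)"
proof -
  assume X: "X \<subseteq> V"
  then have "finite (p ` X)" using finite_V finite_subset by blast
  moreover have "p ` X \<subseteq> topspace M" using p_top X by blast
  ultimately show ?thesis
    using Hausdorff Hausdorff_imp_t1_space t1_space_closedin_finite by blast
qed

lemma closed_edges: "F \<subseteq> E \<Longrightarrow> closedin M (\<Union>e\<in>F. g e ` {0..1})"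
  using closed_edge finite_E by (intro closedin_Union) (auto intro: finite_subset)

lemma closed_\<Gamma>: "closedin M \<Gamma>"
  unfolding \<Gamma>_def embedded_graph_def using closed_points[of V] closed_edges[of E] by (intro closedin_Un) auto

lemma edge_nbhd:
  assumes e: "e \<in> E" "0 < t" "t < 1"
  obtains W where "openin M W" "g e t \<in> W" "W \<inter> \<Gamma> \<subseteq> g e ` {0<..<1}"
proof -
  let ?R = "p ` V \<union> (\<Union>e'\<in>E - {e}. g e' ` {0..1})"
  have "closedin M ?R" using closed_points[of V] closed_edges[of "E - {e}"] by (intro closedin_Un) auto
  moreover have "g e t \<notin> ?R"
    using g_int_V[OF e] g_int_disj[OF e(1) _ _ e(2,3)] by blast
  moreover have "(topspace M - ?R) \<inter> \<Gamma> \<subseteq> g e ` {0<..<1}"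
  proof
    fix y assume y: "y \<in> (topspace M - ?R) \<inter> \<Gamma>"
    then have "y \<in> \<Gamma>" by blast
    then show "y \<in> g e ` {0<..<1}"
    proof (cases rule: \<Gamma>_cases)
      case (edge e' t')
      have "e' = e"
      proof (rule ccontr)
        assume "e' \<noteq> e"
        moreover have "t' \<in> {0..1}" using edge by simp
        ultimately have "y \<in> ?R" using edge by blast
        then show False using y by blast
      qed
      then show ?thesis using edge by auto
    qed (use y in auto)
  qed
  moreover have "g e t \<in> topspace M" using arc_in_topspace[OF arc_g[OF e(1)]] e by auto
  ultimately show ?thesis using that[of "topspace M - ?R"] by blast
qed

lemma vertex_nbhd:
  assumes v: "v \<in> V"
  obtains W where "openin M W" "p v \<in> W" "\<And>v'. v' \<in> V \<Longrightarrow> p v' \<in> W \<Longrightarrow> v' = v"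
    "\<And>e t. e \<in> E \<Longrightarrow> t \<in> {0..1} \<Longrightarrow> g e t \<in> W \<Longrightarrow> v \<in> e"
proof -
  let ?R = "p ` (V - {v}) \<union> (\<Union>e\<in>{e\<in>E. v \<notin> e}. g e ` {0..1})"
  have "closedin M ?R" using closed_points[of "V - {v}"] closed_edges[of "{e\<in>E. v \<notin> e}"]
    by (intro closedin_Un) auto
  moreover have "p v \<notin> ?R"
  proof
    assume "p v \<in> ?R"
    moreover have "p v \<notin> p ` (V - {v})" using p_inj v by (auto dest: inj_onD)
    ultimately obtain e t where e: "e \<in> E" "v \<notin> e" "t \<in> {0..1}" "p v = g e t" by blast
    have "t = 0 \<or> t = 1" using g_int_V[OF e(1), of t] e v by force
    then have "p v \<in> p ` e" using g_ends[OF e(1)] e(4) by blast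
    then show False using e(1,2) edge_sub[OF e(1)] p_inj v by (auto dest: inj_onD)
  qed
  ultimately show ?thesis using that[of "topspace M - ?R"] p_top[OF v] by blast
qed

text \<open>Colourings are total functions, but their values on \<open>\<Gamma>\<close> are irrelevant.\<close>

definition lc :: "'b set \<Rightarrow> ('b \<Rightarrow> bool) \<Rightarrow> bool" where
  "lc W c \<longleftrightarrow> openin M W \<and> (\<forall>z\<in>W - \<Gamma>. \<exists>N. openin M N \<and> z \<in> N \<and> (\<forall>z'\<in>N - \<Gamma>. c z' = c z))"

definition flip :: "('b \<Rightarrow> bool) \<Rightarrow> 'b \<Rightarrow> bool" where
  "flip c y \<longleftrightarrow> (\<forall>N. openin M N \<and> y \<in> N \<longrightarrow> (\<exists>z\<in>N - \<Gamma>. \<exists>z'\<in>N - \<Gamma>. c z \<noteq> c z'))"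

lemma lc_open: "lc W c \<Longrightarrow> openin M W"
  unfolding lc_def by blast

lemma lcD: "lc W c \<Longrightarrow> z \<in> W \<Longrightarrow> z \<notin> \<Gamma> \<Longrightarrow> \<exists>N. openin M N \<and> z \<in> N \<and> (\<forall>z'\<in>N - \<Gamma>. c z' = c z)"
  unfolding lc_def by blast

lemma lcI:
  assumes "openin M W" "\<And>z. z \<in> W \<Longrightarrow> z \<notin> \<Gamma> \<Longrightarrow> \<exists>N. openin M N \<and> z \<in> N \<and> (\<forall>z'\<in>N - \<Gamma>. c z' = c z)"
  shows "lc W c"
  using assms unfolding lc_def by blast

lemma lc_subset: "lc W c \<Longrightarrow> openin M W' \<Longrightarrow> W' \<subseteq> W \<Longrightarrow> lc W' c"
  unfolding lc_def by blast

lemma lc_xor: "lc W c \<Longrightarrow> lc W' c' \<Longrightarrow> lc (W \<inter> W') (\<lambda>z. c z \<noteq> c' z)"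
proof (rule lcI)
  assume c: "lc W c" "lc W' c'"
  then show "openin M (W \<inter> W')" using lc_open by blast
  fix z assume "z \<in> W \<inter> W'" "z \<notin> \<Gamma>"
  then obtain N N' where "openin M N" "z \<in> N" "\<forall>z'\<in>N - \<Gamma>. c z' = c z"
    "openin M N'" "z \<in> N'" "\<forall>z'\<in>N' - \<Gamma>. c' z' = c' z"
    using lcD[OF c(1)] lcD[OF c(2)] by (metis IntD1 IntD2)
  then show "\<exists>N. openin M N \<and> z \<in> N \<and> (\<forall>z'\<in>N - \<Gamma>. (c z' \<noteq> c' z') = (c z \<noteq> c' z))"
    by (intro exI[of _ "N \<inter> N'"]) auto
qed

lemma lc_const: "openin M W \<Longrightarrow> lc W (\<lambda>_. b)"
  unfolding lc_def by blast

lemma not_flip_const: "y \<in> topspace M \<Longrightarrow> \<not> flip (\<lambda>_. b) y"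
  unfolding flip_def by blast

lemma not_flip_iff: "\<not> flip c y \<longleftrightarrow> (\<exists>N b. openin M N \<and> y \<in> N \<and> (\<forall>z\<in>N - \<Gamma>. c z = b))"
  unfolding flip_def by metis

lemma lc_connected:
  assumes "lc W c" "connectedin M K" "K \<subseteq> W - \<Gamma>" "z \<in> K" "z' \<in> K"
  shows "c z = c z'"
proof (rule connectedin_locally_constant[OF assms(2) _ assms(4,5)])
  fix y assume "y \<in> K"
  then have "y \<in> W - \<Gamma>" using assms(3) by blast
  then obtain N where "openin M N" "y \<in> N" "\<forall>z'\<in>N - \<Gamma>. c z' = c y"
    using assms(1) unfolding lc_def by blast
  then show "\<exists>N. openin M N \<and> y \<in> N \<and> (\<forall>y'\<in>N \<inter> K. c y' = c y)"
    using assms(3) by blast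
qed

text \<open>Two-sidedness of the drawing near an edge point, with \<open>\<kappa>\<close> as a
  reference colouring of the two sides: every other locally constant colouring becomes a function of
  \<open>\<kappa>\<close> there (\<open>sides_form\<close>).\<close>

definition sides :: "'b set \<Rightarrow> ('b \<Rightarrow> bool) \<Rightarrow> bool" where
  "sides N0 \<kappa> \<longleftrightarrow> lc N0 \<kappa> \<and>
    (\<forall>y\<in>N0 \<inter> \<Gamma>. \<forall>N b. openin M N \<longrightarrow> y \<in> N \<longrightarrow> (\<exists>z\<in>N - \<Gamma>. \<kappa> z = b)) \<and>
    (\<forall>y\<in>N0 \<inter> \<Gamma>. \<forall>W. openin M W \<longrightarrow> y \<in> W \<longrightarrow> (\<exists>N. openin M N \<and> y \<in> N \<and>
       (\<forall>z\<in>N - \<Gamma>. \<forall>z'\<in>N - \<Gamma>. \<kappa> z = \<kappa> z' \<longrightarrow>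
          (\<exists>K. connectedin M K \<and> K \<subseteq> W - \<Gamma> \<and> z \<in> K \<and> z' \<in> K))))"

lemma sides_lc: "sides N0 \<kappa> \<Longrightarrow> lc N0 \<kappa>"
  unfolding sides_def by (elim conjE)

lemma sides_dense: "sides N0 \<kappa> \<Longrightarrow> y \<in> N0 \<inter> \<Gamma> \<Longrightarrow> openin M N \<Longrightarrow> y \<in> N \<Longrightarrow> \<exists>z\<in>N - \<Gamma>. \<kappa> z = b"
  unfolding sides_def by (elim conjE) simp

lemma sides_connect:
  assumes "sides N0 \<kappa>" "y \<in> N0 \<inter> \<Gamma>" "openin M W" "y \<in> W"
  shows "\<exists>N. openin M N \<and> y \<in> N \<and> (\<forall>z\<in>N - \<Gamma>. \<forall>z'\<in>N - \<Gamma>. \<kappa> z = \<kappa> z' \<longrightarrow>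
          (\<exists>K. connectedin M K \<and> K \<subseteq> W - \<Gamma> \<and> z \<in> K \<and> z' \<in> K))"
  using assms unfolding sides_def by (elim conjE) simp

lemma edge_sides:
  assumes e: "e \<in> E" "0 < t" "t < 1"
  obtains N0 \<kappa> where "sides N0 \<kappa>" "g e t \<in> N0" "N0 \<inter> \<Gamma> \<subseteq> g e ` {0<..<1}"
proof -
  obtain W0 where W0: "openin M W0" "g e t \<in> W0" "W0 \<inter> \<Gamma> \<subseteq> g e ` {0<..<1}"
    by (rule edge_nbhd[OF e])
  let ?A = "g e ` {0..1}"
  obtain N0 \<kappa> where N0: "openin M N0" "g e t \<in> N0" "N0 \<subseteq> W0"
    and k1: "\<And>y. y \<in> N0 - ?A \<Longrightarrow> \<exists>N. openin M N \<and> y \<in> N \<and> (\<forall>z\<in>N. \<kappa> z = (\<kappa> y :: bool))"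
    and k2: "\<And>y N b. y \<in> ?A \<inter> N0 \<Longrightarrow> openin M N \<Longrightarrow> y \<in> N \<Longrightarrow> \<exists>z\<in>N - ?A. \<kappa> z = b"
    and k3: "\<And>y W. y \<in> ?A \<inter> N0 \<Longrightarrow> openin M W \<Longrightarrow> y \<in> W \<Longrightarrow>
       \<exists>N. openin M N \<and> y \<in> N \<and> (\<forall>z\<in>N - ?A. \<forall>z'\<in>N - ?A. \<kappa> z = \<kappa> z' \<longrightarrow>
          (\<exists>K. connectedin M K \<and> K \<subseteq> W - ?A \<and> z \<in> K \<and> z' \<in> K))"
    by (rule arc_in_two_sides[OF arc_g[OF e(1)] e(2,3) W0(1,2)]) blast
  have A\<Gamma>: "?A \<subseteq> \<Gamma>" using g_in_\<Gamma>[OF e(1)] by blast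
  have \<Gamma>A: "y \<in> ?A" if "y \<in> N0" "y \<in> \<Gamma>" for y
  proof -
    have "y \<in> g e ` {0<..<1}" using that N0 W0 by blast
    then show ?thesis by auto
  qed
  have "lc N0 \<kappa>"
  proof (rule lcI[OF N0(1)])
    fix z assume "z \<in> N0" "z \<notin> \<Gamma>"
    then obtain N where "openin M N" "z \<in> N" "\<forall>z'\<in>N. \<kappa> z' = \<kappa> z" using k1[of z] A\<Gamma> by blast
    then show "\<exists>N. openin M N \<and> z \<in> N \<and> (\<forall>z'\<in>N - \<Gamma>. \<kappa> z' = \<kappa> z)" by blast
  qed
  moreover have "\<exists>z\<in>N - \<Gamma>. \<kappa> z = b" if "y \<in> N0 \<inter> \<Gamma>" "openin M N" "y \<in> N" for y N b
  proof -
    have "y \<in> ?A \<inter> N0" "openin M (N \<inter> N0)" "y \<in> N \<inter> N0" using that \<Gamma>A N0 by blast+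
    then obtain z where "z \<in> N \<inter> N0 - ?A" "\<kappa> z = b" using k2[of y "N \<inter> N0" b] by blast
    then show ?thesis using \<Gamma>A by blast
  qed
  moreover have "\<exists>N. openin M N \<and> y \<in> N \<and> (\<forall>z\<in>N - \<Gamma>. \<forall>z'\<in>N - \<Gamma>. \<kappa> z = \<kappa> z' \<longrightarrow>
          (\<exists>K. connectedin M K \<and> K \<subseteq> W - \<Gamma> \<and> z \<in> K \<and> z' \<in> K))"
    if "y \<in> N0 \<inter> \<Gamma>" "openin M W" "y \<in> W" for y W
  proof -
    have "y \<in> ?A \<inter> N0" using that \<Gamma>A by blast
    moreover have "openin M (W \<inter> N0)" "y \<in> W \<inter> N0" using that N0 by auto
    ultimately obtain N where N: "openin M N" "y \<in> N"
       "\<forall>z\<in>N - ?A. \<forall>z'\<in>N - ?A. \<kappa> z = \<kappa> z' \<longrightarrow> (\<exists>K. connectedin M K \<and> K \<subseteq> W \<inter> N0 - ?A \<and> z \<in> K \<and> z' \<in> K)"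
      using k3[of y "W \<inter> N0"] by blast
    have "W \<inter> N0 - ?A \<subseteq> W - \<Gamma>" using \<Gamma>A by blast
    then have "\<forall>z\<in>N - \<Gamma>. \<forall>z'\<in>N - \<Gamma>. \<kappa> z = \<kappa> z' \<longrightarrow> (\<exists>K. connectedin M K \<and> K \<subseteq> W - \<Gamma> \<and> z \<in> K \<and> z' \<in> K)"
    proof (intro ballI impI)
      fix z z' assume z: "z \<in> N - \<Gamma>" "z' \<in> N - \<Gamma>" "\<kappa> z = \<kappa> z'"
      then have "z \<in> N - ?A" "z' \<in> N - ?A" using A\<Gamma> by blast+
      then have "\<exists>K. connectedin M K \<and> K \<subseteq> W \<inter> N0 - ?A \<and> z \<in> K \<and> z' \<in> K" using N(3) z(3) by blast
      then show "\<exists>K. connectedin M K \<and> K \<subseteq> W - \<Gamma> \<and> z \<in> K \<and> z' \<in> K"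
        using \<open>W \<inter> N0 - ?A \<subseteq> W - \<Gamma>\<close> by (meson subset_trans)
    qed
    then show ?thesis using N(1,2) by blast
  qed
  ultimately have "sides N0 \<kappa>" unfolding sides_def by (intro conjI ballI allI impI)
  then show ?thesis using that N0 W0 by blast
qed

text \<open>Points of one side near \<open>y\<close> are joined off \<open>\<Gamma>\<close> inside
  \<open>W\<close>, so \<open>c\<close> takes one value per side. The last claim holds at all points
  of \<open>\<Gamma>\<close> in \<open>N\<close>, which makes flipping locally constant along an
  edge.\<close>

lemma sides_form:
  assumes s: "sides N0 \<kappa>" and y: "y \<in> N0 \<inter> \<Gamma>" and c: "lc W c" "y \<in> W"
  obtains N a b where "openin M N" "y \<in> N" "N \<subseteq> W \<inter> N0" "\<And>z. z \<in> N - \<Gamma> \<Longrightarrow> c z = (if \<kappa> z then a else b)"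
    "\<And>y'. y' \<in> N \<inter> \<Gamma> \<Longrightarrow> flip c y' \<longleftrightarrow> a \<noteq> b"
proof -
  have oN0: "openin M N0" and oW: "openin M W" using sides_lc[OF s] c lc_open by blast+
  have dense: "\<exists>z\<in>N - \<Gamma>. \<kappa> z = b" if "y' \<in> N0 \<inter> \<Gamma>" "openin M N" "y' \<in> N" for N b y'
    using sides_dense[OF s that] .
  obtain N1 where N1: "openin M N1" "y \<in> N1"
      "\<forall>z\<in>N1 - \<Gamma>. \<forall>z'\<in>N1 - \<Gamma>. \<kappa> z = \<kappa> z' \<longrightarrow> (\<exists>K. connectedin M K \<and> K \<subseteq> W - \<Gamma> \<and> z \<in> K \<and> z' \<in> K)"
    using sides_connect[OF s y oW c(2)] by blast
  define N where "N = N1 \<inter> W \<inter> N0"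
  have N: "openin M N" "y \<in> N" "N \<subseteq> W \<inter> N0" using N1 oW oN0 y c by (auto simp: N_def)
  have same: "c z = c z'" if "z \<in> N - \<Gamma>" "z' \<in> N - \<Gamma>" "\<kappa> z = \<kappa> z'" for z z'
  proof -
    have "z \<in> N1 - \<Gamma>" "z' \<in> N1 - \<Gamma>" using that unfolding N_def by blast+
    then obtain K where "connectedin M K" "K \<subseteq> W - \<Gamma>" "z \<in> K" "z' \<in> K"
      using N1(3) \<open>\<kappa> z = \<kappa> z'\<close> by blast
    then show ?thesis using lc_connected[OF c(1)] by blast
  qed
  obtain zt where zt: "zt \<in> N - \<Gamma>" "\<kappa> zt" using dense[of y N True] y N by blast
  obtain zf where zf: "zf \<in> N - \<Gamma>" "\<not> \<kappa> zf" using dense[of y N False] y N by blast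
  have form: "c z = (if \<kappa> z then c zt else c zf)" if "z \<in> N - \<Gamma>" for z
    using same[OF that zt(1)] same[OF that zf(1)] zt zf by auto
  have "flip c y' \<longleftrightarrow> c zt \<noteq> c zf" if y': "y' \<in> N \<inter> \<Gamma>" for y'
  proof
    assume "flip c y'"
    then obtain z z' where "z \<in> N - \<Gamma>" "z' \<in> N - \<Gamma>" "c z \<noteq> c z'"
      using N y' unfolding flip_def by blast
    then show "c zt \<noteq> c zf" using form by (auto split: if_splits)
  next
    assume ne: "c zt \<noteq> c zf"
    show "flip c y'" unfolding flip_def
    proof (intro allI impI)
      fix N' assume N': "openin M N' \<and> y' \<in> N'"
      then have "openin M (N' \<inter> N)" "y' \<in> N' \<inter> N" "y' \<in> N0 \<inter> \<Gamma>" using N y' by auto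
      then obtain z z' where "z \<in> N' \<inter> N - \<Gamma>" "\<kappa> z" "z' \<in> N' \<inter> N - \<Gamma>" "\<not> \<kappa> z'"
        using dense[of y' "N' \<inter> N" True] dense[of y' "N' \<inter> N" False] by blast
      then show "\<exists>z\<in>N' - \<Gamma>. \<exists>z'\<in>N' - \<Gamma>. c z \<noteq> c z'"
        using form[of z] form[of z'] ne by auto
    qed
  qed
  then show ?thesis using that[OF N form] by blast
qed

lemma sides_flip: "sides N0 \<kappa> \<Longrightarrow> y \<in> N0 \<inter> \<Gamma> \<Longrightarrow> flip \<kappa> y"
proof -
  assume s: "sides N0 \<kappa>" and y: "y \<in> N0 \<inter> \<Gamma>"
  show ?thesis unfolding flip_def
  proof (intro allI impI)
    fix N assume N: "openin M N \<and> y \<in> N"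
    have "\<exists>z\<in>N - \<Gamma>. \<kappa> z = b" for b using sides_dense[OF s y] N by blast
    from this[of True] this[of False] show "\<exists>z\<in>N - \<Gamma>. \<exists>z'\<in>N - \<Gamma>. \<kappa> z \<noteq> \<kappa> z'" by blast
  qed
qed

text \<open>Relative to the reference colouring both colourings are pairs of values, one per side,
  and such pairs add modulo 2. At a vertex there is no such rule: two colourings that change there
  may have a sum that changes there too.\<close>

lemma flip_xor_edge:
  assumes e: "e \<in> E" "0 < t" "t < 1" and c: "lc W c" "g e t \<in> W" and c': "lc W' c'" "g e t \<in> W'"
  shows "flip (\<lambda>z. c z \<noteq> c' z) (g e t) \<longleftrightarrow> (flip c (g e t) \<noteq> flip c' (g e t))"
proof -
  let ?y = "g e t"
  obtain N0 \<kappa> where s: "sides N0 \<kappa>" "?y \<in> N0" "N0 \<inter> \<Gamma> \<subseteq> g e ` {0<..<1}"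
    by (rule edge_sides[OF e])
  have y\<Gamma>: "?y \<in> \<Gamma>" using g_in_\<Gamma> e by auto
  then have y: "?y \<in> N0 \<inter> \<Gamma>" using s by blast
  obtain N a b where N: "openin M N" "?y \<in> N" "N \<subseteq> W \<inter> N0" "\<And>z. z \<in> N - \<Gamma> \<Longrightarrow> c z = (if \<kappa> z then a else b)"
    "\<And>y'. y' \<in> N \<inter> \<Gamma> \<Longrightarrow> flip c y' \<longleftrightarrow> a \<noteq> b"
    by (rule sides_form[OF s(1) y c]) blast
  obtain N' a' b' where N': "openin M N'" "?y \<in> N'" "N' \<subseteq> W' \<inter> N0" "\<And>z. z \<in> N' - \<Gamma> \<Longrightarrow> c' z = (if \<kappa> z then a' else b')"
    "\<And>y'. y' \<in> N' \<inter> \<Gamma> \<Longrightarrow> flip c' y' \<longleftrightarrow> a' \<noteq> b'"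
    by (rule sides_form[OF s(1) y c']) blast
  have yy: "?y \<in> W \<inter> W'" using c c' by blast
  obtain N'' a'' b'' where N'': "openin M N''" "?y \<in> N''" "N'' \<subseteq> (W \<inter> W') \<inter> N0"
      "\<And>z. z \<in> N'' - \<Gamma> \<Longrightarrow> (c z \<noteq> c' z) = (if \<kappa> z then a'' else b'')"
    "\<And>y'. y' \<in> N'' \<inter> \<Gamma> \<Longrightarrow> flip (\<lambda>z. c z \<noteq> c' z) y' \<longleftrightarrow> a'' \<noteq> b''"
    by (rule sides_form[OF s(1) y lc_xor[OF c(1) c'(1)] yy]) blast
  have o: "openin M (N \<inter> N' \<inter> N'')" "?y \<in> N \<inter> N' \<inter> N''" using N N' N'' by auto
  have "\<exists>z\<in>N \<inter> N' \<inter> N'' - \<Gamma>. \<kappa> z = b" for b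
    by (rule sides_dense[OF s(1) y o])
  then obtain zt zf where "zt \<in> N \<inter> N' \<inter> N'' - \<Gamma>" "\<kappa> zt" "zf \<in> N \<inter> N' \<inter> N'' - \<Gamma>" "\<not> \<kappa> zf" by metis
  then have "a'' = (a \<noteq> a')" "b'' = (b \<noteq> b')"
    using N(4)[of zt] N'(4)[of zt] N''(4)[of zt] N(4)[of zf] N'(4)[of zf] N''(4)[of zf] by auto
  then show ?thesis using N(5)[of ?y] N'(5)[of ?y] N''(5)[of ?y] N(2) N'(2) N''(2) y\<Gamma> by auto
qed

lemma edge_points_near_vertex:
  assumes e: "e \<in> E" "v \<in> e" and N: "openin M N" "p v \<in> N"
  obtains t where "0 < t" "t < 1" "g e t \<in> N"
proof -
  have "p v \<in> {g e 0, g e 1}" using g_ends e by blast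
  then consider "g e 0 = p v" | "g e 1 = p v" by auto
  then show ?thesis
  proof cases
    case 1
    obtain \<eta> where \<eta>: "\<eta> > 0" "\<And>t'. t' \<in> {0..1} \<Longrightarrow> \<bar>t' - 0\<bar> < \<eta> \<Longrightarrow> g e t' \<in> N"
      using arc_in_near[OF arc_g[OF e(1)], of 0 N] 1 N by auto
    then have "g e (min (\<eta>/2) (1/2)) \<in> N" by (intro \<eta>(2)) auto
    then show ?thesis using that[of "min (\<eta>/2) (1/2)"] \<eta>(1) by auto
  next
    case 2
    obtain \<eta> where \<eta>: "\<eta> > 0" "\<And>t'. t' \<in> {0..1} \<Longrightarrow> \<bar>t' - 1\<bar> < \<eta> \<Longrightarrow> g e t' \<in> N"
      using arc_in_near[OF arc_g[OF e(1)], of 1 N] 2 N by auto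
    then have "g e (1 - min (\<eta>/2) (1/2)) \<in> N" by (intro \<eta>(2)) auto
    then show ?thesis using that[of "1 - min (\<eta>/2) (1/2)"] \<eta>(1) by auto
  qed
qed

text \<open>An interior edge point has points of both sides nearby, and a vertex is a limit of such
  edge points by \<open>no_isolated\<close>.\<close>

lemma complement_dense:
  assumes "openin M N" "y \<in> N"
  shows "N - \<Gamma> \<noteq> {}"
proof (cases "y \<in> \<Gamma>")
  case True
  have edge: "N - \<Gamma> \<noteq> {}" if e: "e \<in> E" "0 < t" "t < 1" "g e t \<in> N" for e t
  proof -
    obtain N0 \<kappa> where s: "sides N0 \<kappa>" "g e t \<in> N0" by (rule edge_sides[OF e(1-3)])
    then have "flip \<kappa> (g e t)" using sides_flip g_in_\<Gamma> e by auto
    then show ?thesis using assms(1) e unfolding flip_def by blast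
  qed
  from True show ?thesis
  proof (cases rule: \<Gamma>_cases)
    case (vertex v)
    then obtain e where "e \<in> E" "v \<in> e" using no_isolated by blast
    then show ?thesis using edge_points_near_vertex[of e v N] edge assms vertex by metis
  next
    case (edge e t)
    then show ?thesis using \<open>\<And>t e. e \<in> E \<Longrightarrow> 0 < t \<Longrightarrow> t < 1 \<Longrightarrow> g e t \<in> N \<Longrightarrow> N - \<Gamma> \<noteq> {}\<close> assms by blast
  qed
qed (use assms in blast)

text \<open>Flipping is locally constant along the open edge by \<open>sides_form\<close>, and the
  open edge is connected. Hence the midpoint \<open>g e (1/2)\<close> can represent the whole edge
  later on.\<close>

lemma flip_edge_const:
  assumes e: "e \<in> E" and t: "0 < t" "t < 1" "0 < t'" "t' < 1"
    and c: "lc W c" "g e ` {0<..<1} \<subseteq> W"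
  shows "flip c (g e t) \<longleftrightarrow> flip c (g e t')"
proof (rule connectedin_locally_constant[of M "g e ` {0<..<1}"])
  show "connectedin M (g e ` {0<..<1})"
    using arc_g[OF e] unfolding arc_in_def
    by (elim conjE, intro connectedin_continuous_map_image) (auto simp: connectedin_subtopology)
  fix y assume y: "y \<in> g e ` {0<..<1}"
  then obtain s where s: "0 < s" "s < 1" "y = g e s" by auto
  obtain N0 \<kappa> where k: "sides N0 \<kappa>" "g e s \<in> N0" by (rule edge_sides[OF e s(1,2)])
  have y0: "y \<in> N0 \<inter> \<Gamma>" using k s g_in_\<Gamma>[OF e] by auto
  have yW: "y \<in> W" using y c by blast
  obtain N a b where N: "openin M N" "y \<in> N" "N \<subseteq> W \<inter> N0" "\<And>z. z \<in> N - \<Gamma> \<Longrightarrow> c z = (if \<kappa> z then a else b)"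
     "\<And>y'. y' \<in> N \<inter> \<Gamma> \<Longrightarrow> flip c y' \<longleftrightarrow> a \<noteq> b"
    by (rule sides_form[OF k(1) y0 c(1) yW]) blast
  have "\<forall>y'\<in>N \<inter> g e ` {0<..<1}. flip c y' = flip c y"
    using N(2,5) g_in_\<Gamma>[OF e] y0 by auto
  then show "\<exists>N. openin M N \<and> y \<in> N \<and> (\<forall>y'\<in>N \<inter> g e ` {0<..<1}. flip c y' = flip c y)"
    using N by blast
qed (use t in auto)

text \<open>Continuation of a colouring over the points of \<open>\<Gamma>\<close> where it does not
  change. Where it changes, the value defaults to False.\<close>

definition extend :: "('b \<Rightarrow> bool) \<Rightarrow> 'b \<Rightarrow> bool" where
  "extend c y \<longleftrightarrow> (\<exists>N. openin M N \<and> y \<in> N \<and> (\<forall>z\<in>N - \<Gamma>. c z))"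

lemma extend_eq:
  assumes "openin M N" "y \<in> N" "\<And>z. z \<in> N - \<Gamma> \<Longrightarrow> c z = b"
  shows "extend c y = b"
proof (cases b)
  case True then show ?thesis using assms unfolding extend_def by blast
next
  case False
  have "\<not> (\<forall>z\<in>N' - \<Gamma>. c z)" if "openin M N'" "y \<in> N'" for N'
  proof -
    have "openin M (N \<inter> N')" "y \<in> N \<inter> N'" using that assms by auto
    then obtain z where "z \<in> N \<inter> N' - \<Gamma>" using complement_dense by blast
    then show ?thesis using assms(3)[of z] False by blast
  qed
  then show ?thesis using False unfolding extend_def by blast
qed

lemma extend_lc:
  assumes "lc W c" "z \<in> W - \<Gamma>"
  shows "extend c z = c z"
proof -
  obtain N where "openin M N" "z \<in> N" "\<forall>z'\<in>N - \<Gamma>. c z' = c z" using assms unfolding lc_def by blast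
  then show ?thesis using extend_eq[of N z c "c z"] by blast
qed

lemma extend_nbhd:
  assumes "lc W c" "y \<in> W" "y \<in> \<Gamma> \<Longrightarrow> \<not> flip c y"
  obtains N where "openin M N" "y \<in> N" "N \<subseteq> W" "\<And>z. z \<in> N - \<Gamma> \<Longrightarrow> c z = extend c y"
     "\<And>y'. y' \<in> N \<Longrightarrow> extend c y' = extend c y"
proof -
  have oW: "openin M W" using assms unfolding lc_def by blast
  have "\<exists>N b. openin M N \<and> y \<in> N \<and> (\<forall>z\<in>N - \<Gamma>. c z = b)"
  proof (cases "y \<in> \<Gamma>")
    case True then show ?thesis using assms(3) not_flip_iff by blast
  next
    case False then show ?thesis using assms(1,2) unfolding lc_def by blast
  qed
  then obtain N b where N: "openin M N" "y \<in> N" "\<And>z. z \<in> N - \<Gamma> \<Longrightarrow> c z = b" by blast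
  have "extend c y' = b" if "y' \<in> N" for y' using extend_eq[OF N(1) that N(3)] .
  then show ?thesis using that[of "N \<inter> W"] N oW assms(2) by auto
qed

text \<open>The set \<open>S\<close> may cross \<open>\<Gamma>\<close>, but only where the colouring
  does not change; there the continuation \<open>extend c\<close> is locally constant.
  \<open>K\<close> collects the points that have to be avoided.\<close>

lemma no_flip_connected:
  assumes c: "lc W c" and nf: "\<And>y. y \<in> W \<inter> \<Gamma> - K \<Longrightarrow> \<not> flip c y"
    and S: "connectedin M S" "S \<subseteq> W - K" and z: "z \<in> S - \<Gamma>" "z' \<in> S - \<Gamma>"
  shows "c z = c z'"
proof -
  have "extend c z = extend c z'"
  proof (rule connectedin_locally_constant[OF S(1)])
    fix y assume y: "y \<in> S"
    then have "y \<in> W" "y \<in> \<Gamma> \<Longrightarrow> \<not> flip c y" using S nf by blast+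
    then have "\<exists>N. openin M N \<and> y \<in> N \<and> (\<forall>y'\<in>N. extend c y' = extend c y)"
      by (rule extend_nbhd[OF c]) blast+
    then show "\<exists>N. openin M N \<and> y \<in> N \<and> (\<forall>y'\<in>N \<inter> S. extend c y' = extend c y)" by blast
  qed (use z in auto)
  moreover have "z \<in> W - \<Gamma>" "z' \<in> W - \<Gamma>" using z S by blast+
  ultimately show ?thesis using extend_lc[OF c] by metis
qed

text \<open>A punctured disc around the vertex is connected and meets \<open>\<Gamma>\<close> only
  in edge points, none of which flips.\<close>

lemma vertex_no_flip:
  assumes v: "v \<in> V" and c: "lc W c" "p v \<in> W"
    and nf: "\<And>e t. e \<in> E \<Longrightarrow> 0 < t \<Longrightarrow> t < 1 \<Longrightarrow> g e t \<in> W \<Longrightarrow> \<not> flip c (g e t)"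
  shows "\<not> flip c (p v)"
proof -
  obtain W1 where W1: "openin M W1" "p v \<in> W1" "\<And>v'. v' \<in> V \<Longrightarrow> p v' \<in> W1 \<Longrightarrow> v' = v"
    using vertex_nbhd[OF v] by metis
  have "openin M W" using c unfolding lc_def by blast
  then have "openin M (W \<inter> W1)" "p v \<in> W \<inter> W1" using W1 c by auto
  then obtain N where N: "openin M N" "p v \<in> N" "N \<subseteq> W \<inter> W1" "connectedin M (N - {p v})"
    using punctured_connected_nbhd by metis
  have lcN: "lc N c" using lc_subset[OF c(1) N(1)] N(3) by blast
  have "c z = c z'" if "z \<in> N - \<Gamma>" "z' \<in> N - \<Gamma>" for z z'
  proof (rule no_flip_connected[OF lcN _ N(4), of "{p v}"])
    fix y assume y: "y \<in> N \<inter> \<Gamma> - {p v}"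
    then have "y \<in> \<Gamma>" by blast
    then show "\<not> flip c y"
    proof (cases rule: \<Gamma>_cases)
      case (vertex v') then show ?thesis using W1(3) N(3) y by blast
    next
      case (edge e t) then show ?thesis using nf N(3) y by blast
    qed
  qed (use that p_in_\<Gamma>[OF v] in auto)
  then show ?thesis unfolding flip_def using N by blast
qed

definition og :: "'a \<Rightarrow> 'a set \<Rightarrow> real \<Rightarrow> 'b" where
  "og v e t = (if g e 0 = p v then g e t else g e (1 - t))"

lemma og:
  assumes e: "e \<in> E" "v \<in> e"
  shows "og v e 0 = p v" "arc_in (og v e)" "og v e ` {0..1} = g e ` {0..1}"
    "0 < t \<Longrightarrow> t < 1 \<Longrightarrow> \<exists>s. 0 < s \<and> s < 1 \<and> og v e t = g e s"
    "\<exists>v'\<in>e. v' \<noteq> v \<and> og v e 1 = p v'"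
proof -
  have ends: "{g e 0, g e 1} = p ` e" using g_ends e by blast
  have ne: "g e 0 \<noteq> g e 1" using g_inj[OF e(1), of 0 1] by simp
  have "p v \<in> {g e 0, g e 1}" using ends e by blast
  then show o0: "og v e 0 = p v" unfolding og_def by auto
  have "continuous_map (top_of_set {0..1}) (top_of_set {0..1}) (\<lambda>t::real. 1 - t)"
    by (simp add: continuous_intros image_subset_iff_funcset)
  then have "continuous_map (top_of_set {0..1}) M (g e \<circ> (\<lambda>t. 1 - t))"
    using arc_g[OF e(1)] continuous_map_compose unfolding arc_in_def by blast
  moreover have "inj_on (g e \<circ> (\<lambda>t. 1 - t)) {0..1}"
    using g_inj[OF e(1)] by (auto simp: inj_on_def)
  ultimately have rev: "arc_in (\<lambda>t. g e (1 - t))" unfolding arc_in_def by (simp add: o_def)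
  show "arc_in (og v e)"
  proof (cases "g e 0 = p v")
    case True
    then have "og v e = g e" by (auto simp: og_def)
    then show ?thesis using arc_g e by simp
  next
    case False
    then have "og v e = (\<lambda>t. g e (1 - t))" by (auto simp: og_def)
    then show ?thesis using rev by simp
  qed
  have "(\<lambda>t. 1 - t) ` {0..1} = {0..1::real}"
    using image_affinity_atLeastAtMost[of "-1" 1 0 "1::real"] by simp
  then have "(\<lambda>t. g e (1 - t)) ` {0..1} = g e ` {0..1}"
    by (metis image_image)
  then show "og v e ` {0..1} = g e ` {0..1}"
    unfolding og_def by (cases "g e 0 = p v") simp_all
  show "0 < t \<Longrightarrow> t < 1 \<Longrightarrow> \<exists>s. 0 < s \<and> s < 1 \<and> og v e t = g e s"
    unfolding og_def by (cases "g e 0 = p v") (auto intro: exI[of _ t] exI[of _ "1 - t"])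
  have "og v e 1 \<in> p ` e" using ends unfolding og_def by auto
  moreover have "og v e 1 \<noteq> p v" using ne o0 unfolding og_def by (auto split: if_splits)
  ultimately show "\<exists>v'\<in>e. v' \<noteq> v \<and> og v e 1 = p v'" by auto
qed

text \<open>Two edges at \<open>v\<close> form one arc with \<open>p v\<close> in its interior. A
  colouring of the two sides of this arc changes across exactly these edges, since all other edges
  near \<open>p v\<close> run off the arc.\<close>

lemma vertex_pair_colouring:
  assumes v: "v \<in> V" and e: "e1 \<in> E" "e2 \<in> E" "e1 \<noteq> e2" "v \<in> e1" "v \<in> e2"
  obtains W \<kappa> where "lc W \<kappa>" "p v \<in> W"
    "\<And>e t. e \<in> E \<Longrightarrow> 0 < t \<Longrightarrow> t < 1 \<Longrightarrow> g e t \<in> W \<Longrightarrow> flip \<kappa> (g e t) \<longleftrightarrow> e \<in> {e1, e2}"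
proof -
  define a where "a = (\<lambda>t. if t \<le> 1/2 then og v e1 (1 - 2 * t) else og v e2 (2 * t - 1))"
  note o1 = og[OF e(1,4)] and o2 = og[OF e(2,5)]
  have c1: "continuous_map (top_of_set {0..1/2}) M (\<lambda>t. og v e1 (1 - 2 * t))"
  proof -
    have "continuous_map (top_of_set {0..1/2}) (top_of_set {0..1}) (\<lambda>t::real. 1 - 2 * t)"
      by (auto simp: continuous_intros image_subset_iff_funcset)
    then have "continuous_map (top_of_set {0..1/2}) M (og v e1 \<circ> (\<lambda>t. 1 - 2 * t))"
      using o1(2) continuous_map_compose unfolding arc_in_def by blast
    then show ?thesis by (simp add: o_def)
  qed
  have c2: "continuous_map (top_of_set {1/2..1}) M (\<lambda>t. og v e2 (2 * t - 1))"
  proof -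
    have "continuous_map (top_of_set {1/2..1}) (top_of_set {0..1}) (\<lambda>t::real. 2 * t - 1)"
      by (auto simp: continuous_intros image_subset_iff_funcset)
    then have "continuous_map (top_of_set {1/2..1}) M (og v e2 \<circ> (\<lambda>t. 2 * t - 1))"
      using o2(2) continuous_map_compose unfolding arc_in_def by blast
    then show ?thesis by (simp add: o_def)
  qed
  have "continuous_map (top_of_set {0..1}) M a"
    unfolding a_def
  proof (rule continuous_map_cases_le)
    show "continuous_map (subtopology (top_of_set {0..1}) {x \<in> topspace (top_of_set {0..1}). x \<le> 1/2}) M (\<lambda>t. og v e1 (1 - 2 * t))"
    proof -
      have "{0..1} \<inter> {x \<in> {0..1}. x \<le> 1/2} = {0..1/2::real}" by auto
      then show ?thesis using c1 by (simp add: subtopology_subtopology)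
    qed
    show "continuous_map (subtopology (top_of_set {0..1}) {x \<in> topspace (top_of_set {0..1}). 1/2 \<le> x}) M (\<lambda>t. og v e2 (2 * t - 1))"
    proof -
      have "{0..1} \<inter> {x \<in> {0..1}. 1/2 \<le> x} = {1/2..1::real}" by auto
      then show ?thesis using c2 by (simp add: subtopology_subtopology)
    qed
    show "og v e1 (1 - 2 * x) = og v e2 (2 * x - 1)" if "x \<in> topspace (top_of_set {0..1})" "x = 1/2" for x :: real
      unfolding that(2) using o1(1) o2(1) by simp
  qed (auto simp: continuous_intros)
  moreover have "inj_on a {0..1}"
  proof -
    have key: "s = 0 \<and> s' = 0" if "s \<in> {0..1}" "s' \<in> {0..1}" "og v e1 s = og v e2 s'" for s s'
    proof -
      have nV: "og v e t \<notin> p ` V" if "e \<in> E" "v \<in> e" "0 < t" "t < 1" for e t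
        using og(4)[OF that(1,2), OF that(3,4)] g_int_V[OF that(1)] by metis
      have inV: "og v e t \<in> p ` V" if "e \<in> E" "v \<in> e" "t = 0 \<or> t = 1" for e t
        using og(1,5)[OF that(1,2)] that edge_sub v by (metis image_eqI subsetD)
      have "\<not> (0 < s \<and> s < 1)"
      proof
        assume s: "0 < s \<and> s < 1"
        then have "0 < s' \<and> s' < 1"
          using that nV[OF e(1,4)] inV[OF e(2,5), of s'] by (metis atLeastAtMost_iff less_eq_real_def)
        then obtain r' where "0 < r'" "r' < 1" "og v e2 s' = g e2 r'" using o2(4) by blast
        moreover obtain r where "0 < r" "r < 1" "og v e1 s = g e1 r" using s o1(4) by blast
        ultimately show False using g_int_disj[OF e(1,2,3), of r r'] that(3) by simp
      qed
      then have s: "s = 0 \<or> s = 1" using that by auto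
      moreover have s': "s' = 0 \<or> s' = 1"
        using inV[OF e(1,4) s] nV[OF e(2,5), of s'] that by (metis atLeastAtMost_iff less_eq_real_def)
      moreover obtain v1 v2 where v12: "v1 \<in> e1" "v1 \<noteq> v" "og v e1 1 = p v1" "v2 \<in> e2" "v2 \<noteq> v" "og v e2 1 = p v2"
        using o1(5) o2(5) by blast
      \<comment> \<open>There are no multiple edges, so the two far ends differ and the concatenated
        arc is injective there as well.\<close>
      moreover have "v1 \<noteq> v2"
      proof
        assume "v1 = v2"
        moreover have "finite e1" "finite e2" using edge_card e by (metis card.infinite zero_neq_numeral)+
        ultimately have "e1 = {v, v1}" "e2 = {v, v1}"
          using card_seteq[of e1 "{v, v1}"] card_seteq[of e2 "{v, v1}"] edge_card e v12 by auto
        then show False using e by simp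
      qed
      moreover have "v1 \<in> V" "v2 \<in> V" using v12 edge_sub e by blast+
      ultimately show ?thesis using that(3) o1(1) o2(1) v inj_onD[OF p_inj] by metis
    qed
    have i1: "og v e1 s = og v e1 s' \<longleftrightarrow> s = s'" if "s \<in> {0..1}" "s' \<in> {0..1}" for s s'
      using o1(2) that unfolding arc_in_def by (meson inj_on_eq_iff)
    have i2: "og v e2 s = og v e2 s' \<longleftrightarrow> s = s'" if "s \<in> {0..1}" "s' \<in> {0..1}" for s s'
      using o2(2) that unfolding arc_in_def by (meson inj_on_eq_iff)
    show ?thesis
    proof (rule inj_onI)
      fix s t :: real assume st: "s \<in> {0..1}" "t \<in> {0..1}" "a s = a t"
      consider "s \<le> 1/2 \<and> t \<le> 1/2" | "s > 1/2 \<and> t > 1/2" | "s \<le> 1/2 \<and> t > 1/2" | "s > 1/2 \<and> t \<le> 1/2"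
        by linarith
      then show "s = t"
      proof cases
        case 1 then show ?thesis using st i1[of "1 - 2 * s" "1 - 2 * t"] by (auto simp: a_def)
      next
        case 2 then show ?thesis using st i2[of "2 * s - 1" "2 * t - 1"] by (auto simp: a_def)
      next
        case 3 then show ?thesis using st key[of "1 - 2 * s" "2 * t - 1"] by (auto simp: a_def)
      next
        case 4 then show ?thesis using st key[of "1 - 2 * t" "2 * s - 1"] by (auto simp: a_def)
      qed
    qed
  qed
  ultimately have arc: "arc_in a" unfolding arc_in_def by blast
  have ah: "a (1/2) = p v" using o1(1) by (simp add: a_def)
  have A: "a ` {0..1} = g e1 ` {0..1} \<union> g e2 ` {0..1}"
  proof -
    have "a ` {0..1/2} = og v e1 ` {0..1}"
    proof -
      have "a ` {0..1/2} = og v e1 ` ((\<lambda>t. 1 - 2 * t) ` {0..1/2})" unfolding image_image by (rule image_cong) (auto simp: a_def)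
      also have "(\<lambda>t. 1 - 2 * t) ` {0..1/2} = {0..1::real}"
        using image_affinity_atLeastAtMost[of "-2" 1 0 "1/2::real"] by simp
      finally show ?thesis .
    qed
    moreover have "a ` {1/2..1} = og v e2 ` {0..1}"
    proof -
      have "a x = og v e2 (2 * x - 1)" if "x \<in> {1/2..1}" for x
      proof (cases "x = 1/2")
        case True
        show ?thesis unfolding a_def True using o1(1) o2(1) by simp
      next
        case False
        then show ?thesis using that by (auto simp: a_def)
      qed
      then have "a ` {1/2..1} = og v e2 ` ((\<lambda>t. 2 * t - 1) ` {1/2..1})"
        unfolding image_image by (intro image_cong) auto
      also have "(\<lambda>t. 2 * t - 1) ` {1/2..1} = {0..1::real}"
        using image_affinity_atLeastAtMost[of 2 "-1" "1/2" "1::real"] by simp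
      finally show ?thesis .
    qed
    moreover have "{0..1} = {0..1/2} \<union> {1/2..1::real}" by auto
    ultimately show ?thesis using o1(3) o2(3) by (metis image_Un)
  qed
  let ?A = "a ` {0..1}"
  have half: "(0::real) < 1/2" "1/2 < (1::real)" by auto
  have atop: "a (1/2) \<in> topspace M" unfolding ah using p_top v by blast
  obtain N0 \<kappa> where N0: "openin M N0" "a (1/2) \<in> N0" "N0 \<subseteq> topspace M"
    and k1: "\<And>y. y \<in> N0 - ?A \<Longrightarrow> \<exists>N. openin M N \<and> y \<in> N \<and> (\<forall>z\<in>N. \<kappa> z = (\<kappa> y :: bool))"
    and k2: "\<And>y N b. y \<in> ?A \<inter> N0 \<Longrightarrow> openin M N \<Longrightarrow> y \<in> N \<Longrightarrow> \<exists>z\<in>N - ?A. \<kappa> z = b"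
    and k3: "\<And>y W. y \<in> ?A \<inter> N0 \<Longrightarrow> openin M W \<Longrightarrow> y \<in> W \<Longrightarrow>
       \<exists>N. openin M N \<and> y \<in> N \<and> (\<forall>z\<in>N - ?A. \<forall>z'\<in>N - ?A. \<kappa> z = \<kappa> z' \<longrightarrow>
          (\<exists>K. connectedin M K \<and> K \<subseteq> W - ?A \<and> z \<in> K \<and> z' \<in> K))"
    by (rule arc_in_two_sides[OF arc half openin_topspace atop]) blast
  have A\<Gamma>: "?A \<subseteq> \<Gamma>" unfolding A using g_in_\<Gamma> e by blast
  have "lc N0 \<kappa>"
  proof (rule lcI[OF N0(1)])
    fix z assume "z \<in> N0" "z \<notin> \<Gamma>"
    then obtain N where "openin M N" "z \<in> N" "\<forall>z'\<in>N. \<kappa> z' = \<kappa> z" using k1[of z] A\<Gamma> by blast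
    then show "\<exists>N. openin M N \<and> z \<in> N \<and> (\<forall>z'\<in>N - \<Gamma>. \<kappa> z' = \<kappa> z)" by blast
  qed
  moreover have "flip \<kappa> (g e t) \<longleftrightarrow> e \<in> {e1, e2}" if et: "e \<in> E" "0 < t" "t < 1" "g e t \<in> N0" for e t
  proof (cases "e \<in> {e1, e2}")
    case True
    have yA: "g e t \<in> ?A \<inter> N0" using True et unfolding A by auto
    obtain W where W: "openin M W" "g e t \<in> W" "W \<inter> \<Gamma> \<subseteq> g e ` {0<..<1}" by (rule edge_nbhd[OF et(1-3)])
    have sub: "W \<inter> \<Gamma> \<subseteq> ?A"
    proof -
      have "g e ` {0<..<1} \<subseteq> g e ` {0..1}" by auto
      then show ?thesis using W True unfolding A by blast
    qed
    have "flip \<kappa> (g e t)" unfolding flip_def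
    proof (intro allI impI)
      fix N assume N: "openin M N \<and> g e t \<in> N"
      then have "\<exists>z\<in>N \<inter> W - ?A. \<kappa> z = b" for b using k2[OF yA, of "N \<inter> W" b] W by blast
      then have "\<exists>z\<in>N - \<Gamma>. \<kappa> z = b" for b using sub by blast
      from this[of True] this[of False] show "\<exists>z\<in>N - \<Gamma>. \<exists>z'\<in>N - \<Gamma>. \<kappa> z \<noteq> \<kappa> z'" by blast
    qed
    then show ?thesis using True by blast
  next
    case False
    then have "g e t \<notin> ?A" unfolding A using g_int_disj[OF et(1) _ _ et(2,3)] e by blast
    then obtain N where "openin M N" "g e t \<in> N" "\<forall>z\<in>N. \<kappa> z = \<kappa> (g e t)" using k1 et by blast
    then have "\<not> flip \<kappa> (g e t)" unfolding not_flip_iff by blast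
    then show ?thesis using False by blast
  qed
  ultimately show ?thesis using that[of N0 \<kappa>] N0 ah by metis
qed

text \<open>An even set of edges at \<open>v\<close> splits into pairs, and the colourings of the
  pairs add by \<open>flip_xor_edge\<close>.\<close>

lemma vertex_even_colouring:
  assumes v: "v \<in> V"
  shows "finite D \<Longrightarrow> D \<subseteq> {e\<in>E. v \<in> e} \<Longrightarrow> even (card D) \<Longrightarrow>
    \<exists>W c. lc W c \<and> p v \<in> W \<and> (\<forall>e\<in>E. \<forall>t. 0 < t \<longrightarrow> t < 1 \<longrightarrow> g e t \<in> W \<longrightarrow> (flip c (g e t) \<longleftrightarrow> e \<in> D))"
proof (induction "card D" arbitrary: D rule: less_induct)
  case less
  show ?case
  proof (cases "D = {}")
    case True
    have "lc (topspace M) (\<lambda>_. False)" "p v \<in> topspace M" using lc_const p_top v by auto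
    then show ?thesis using True not_flip_const by blast
  next
    case False
    then obtain e1 where e1: "e1 \<in> D" by blast
    have "card {e1} = 1" by simp
    then have "D \<noteq> {e1}" using less.prems(3) by (metis odd_one)
    then obtain e2 where e2: "e2 \<in> D" "e2 \<noteq> e1" using e1 by blast
    define D' where "D' = D - {e1, e2}"
    have cD: "card D = card D' + 2"
      using e1 e2 less.prems(1) card_Diff_subset[of "{e1,e2}" D] card_mono[of D "{e1,e2}"]
      unfolding D'_def by auto
    have D': "finite D'" "D' \<subseteq> {e\<in>E. v \<in> e}" "even (card D')" "card D' < card D"
      using less.prems cD by (auto simp: D'_def)
    obtain W c where c: "lc W c" "p v \<in> W" "\<And>e t. e \<in> E \<Longrightarrow> 0 < t \<Longrightarrow> t < 1 \<Longrightarrow> g e t \<in> W \<Longrightarrow> flip c (g e t) \<longleftrightarrow> e \<in> D'"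
      using less.hyps[OF D'(4,1,2,3)] by blast
    have "e1 \<in> E" "e2 \<in> E" "e1 \<noteq> e2" "v \<in> e1" "v \<in> e2" using e1 e2 less.prems by auto
    then obtain W' \<kappa> where k: "lc W' \<kappa>" "p v \<in> W'"
       "\<And>e t. e \<in> E \<Longrightarrow> 0 < t \<Longrightarrow> t < 1 \<Longrightarrow> g e t \<in> W' \<Longrightarrow> flip \<kappa> (g e t) \<longleftrightarrow> e \<in> {e1, e2}"
      by (rule vertex_pair_colouring[OF v]) blast
    have "flip (\<lambda>z. c z \<noteq> \<kappa> z) (g e t) \<longleftrightarrow> e \<in> D" if "e \<in> E" "0 < t" "t < 1" "g e t \<in> W \<inter> W'" for e t
      using flip_xor_edge[OF that(1-3) c(1) _ k(1)] c(3)[OF that(1-3)] k(3)[OF that(1-3)] that(4) e1 e2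
      unfolding D'_def by auto
    then show ?thesis using lc_xor[OF c(1) k(1)] c(2) k(2)
      by (intro exI[of _ "W \<inter> W'"] exI[of _ "\<lambda>z. c z \<noteq> \<kappa> z"]) auto
  qed
qed

text \<open>If an odd number of edges at \<open>v\<close> changed colour, adding a colouring for all
  of them but \<open>e0\<close> would leave one that changes across \<open>e0\<close> alone near
  \<open>p v\<close>. But a single arc ending at \<open>p v\<close> does not separate a
  neighbourhood of its end.\<close>

lemma vertex_flip_even:
  assumes v: "v \<in> V" and c: "lc (topspace M) c"
  shows "even (card {e\<in>E. v \<in> e \<and> flip c (g e (1/2))})"
proof (rule ccontr)
  let ?D = "{e\<in>E. v \<in> e \<and> flip c (g e (1/2))}"
  assume odd: "odd (card ?D)"
  then have "?D \<noteq> {}" by (metis card.empty even_zero)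
  then obtain e0 where e0: "e0 \<in> ?D" by blast
  have fD: "finite ?D" using finite_E by simp
  have "card (?D - {e0}) = card ?D - 1" using e0 fD by (simp add: card_Diff_singleton)
  then have "even (card (?D - {e0}))" using odd by (simp add: even_diff_nat)
  then obtain W' c' where c': "lc W' c'" "p v \<in> W'"
     "\<And>e t. e \<in> E \<Longrightarrow> 0 < t \<Longrightarrow> t < 1 \<Longrightarrow> g e t \<in> W' \<Longrightarrow> flip c' (g e t) \<longleftrightarrow> e \<in> ?D - {e0}"
    using vertex_even_colouring[OF v, of "?D - {e0}"] fD by blast
  obtain W1 where W1: "openin M W1" "p v \<in> W1" "\<And>v'. v' \<in> V \<Longrightarrow> p v' \<in> W1 \<Longrightarrow> v' = v"
    "\<And>e t. e \<in> E \<Longrightarrow> t \<in> {0..1} \<Longrightarrow> g e t \<in> W1 \<Longrightarrow> v \<in> e"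
    by (rule vertex_nbhd[OF v]) blast
  let ?W = "W' \<inter> W1" and ?c = "\<lambda>z. c z \<noteq> c' z"
  have oW: "openin M ?W" using W1 c' unfolding lc_def by blast
  have top: "g e t \<in> topspace M" if "e \<in> E" "0 < t" "t < 1" for e t
    using arc_in_topspace[OF arc_g[OF that(1)]] that by auto
  have "lc (topspace M \<inter> W') ?c" by (rule lc_xor[OF c c'(1)])
  then have lc: "lc ?W ?c" using oW openin_subset[OF oW] by (auto intro: lc_subset)
  have fl: "flip ?c (g e t) \<longleftrightarrow> e = e0" if et: "e \<in> E" "0 < t" "t < 1" "g e t \<in> ?W" for e t
  proof -
    have "v \<in> e" using W1(4)[OF et(1), of t] et by simp
    have "flip c (g e t) \<longleftrightarrow> flip c (g e (1/2))"
    proof (rule flip_edge_const[OF et(1-3) _ _ c])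
      show "g e ` {0<..<1} \<subseteq> topspace M" using top[OF et(1)] by auto
    qed auto
    then have "flip c (g e t) \<longleftrightarrow> e \<in> ?D" using et \<open>v \<in> e\<close> by blast
    moreover have "flip c' (g e t) \<longleftrightarrow> e \<in> ?D - {e0}" using c'(3) et by blast
    moreover have "flip ?c (g e t) \<longleftrightarrow> (flip c (g e t) \<noteq> flip c' (g e t))"
      by (rule flip_xor_edge[OF et(1-3) c top[OF et(1-3)] c'(1)]) (use et in auto)
    ultimately show ?thesis using e0 by auto
  qed
  have e0E: "e0 \<in> E" "v \<in> e0" using e0 by auto
  note o = og[OF e0E]
  have "p v \<in> ?W" using c'(2) W1(2) by blast
  then obtain N where N: "openin M N" "p v \<in> N" and con: "\<forall>z\<in>N - g e0 ` {0..1}. \<forall>z'\<in>N - g e0 ` {0..1}.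
          \<exists>K. connectedin M K \<and> K \<subseteq> ?W - g e0 ` {0..1} \<and> z \<in> K \<and> z' \<in> K"
    using arc_in_endpoint[OF o(2) oW, unfolded o(1,3)] by meson
  have A\<Gamma>: "g e0 ` {0..1} \<subseteq> \<Gamma>" using g_in_\<Gamma> e0E by blast
  have same: "?c z = ?c z'" if z: "z \<in> N - \<Gamma>" "z' \<in> N - \<Gamma>" for z z'
  proof -
    have "z \<in> N - g e0 ` {0..1}" "z' \<in> N - g e0 ` {0..1}" using z A\<Gamma> by blast+
    then obtain K where K: "connectedin M K" "K \<subseteq> ?W - g e0 ` {0..1}" "z \<in> K" "z' \<in> K"
      using con by blast
    show ?thesis
    proof (rule no_flip_connected[OF lc _ K(1,2)])
      fix y assume y: "y \<in> ?W \<inter> \<Gamma> - g e0 ` {0..1}"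
      then have "y \<in> \<Gamma>" by blast
      then show "\<not> flip ?c y"
      proof (cases rule: \<Gamma>_cases)
        case (vertex v')
        then have "v' = v" using W1(3) y by blast
        moreover have "p v \<in> g e0 ` {0..1}" using g_ends[OF e0E(1)] e0E(2) by force
        ultimately show ?thesis using vertex y by blast
      next
        case (edge e t)
        then have "e \<noteq> e0" using y by auto
        then show ?thesis using fl edge y by blast
      qed
    qed (use K z in auto)
  qed
  have "openin M (N \<inter> ?W)" "p v \<in> N \<inter> ?W" using N oW c'(2) W1(2) by auto
  then obtain t where t: "0 < t" "t < 1" "g e0 t \<in> N \<inter> ?W"
    using edge_points_near_vertex[OF e0E] by metis
  then have "flip ?c (g e0 t)" using fl e0E by blast
  then show False using same N(1) t unfolding flip_def by (metis IntD1)
qed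

definition even_set :: "'a set set \<Rightarrow> bool" where
  "even_set C \<longleftrightarrow> C \<subseteq> E \<and> (\<forall>v\<in>V. even (card {e\<in>C. v \<in> e}))"

text \<open>A constant works off the drawing and on edges outside \<open>C\<close>, the two sides of
  the edge work on edges in \<open>C\<close>; evenness enters at the vertices, through
  \<open>vertex_even_colouring\<close>.\<close>

lemma local_colouring:
  assumes C: "even_set C" and x: "x \<in> topspace M"
  shows "\<exists>U c. lc U c \<and> x \<in> U \<and> (\<forall>e\<in>E. \<forall>t. 0 < t \<longrightarrow> t < 1 \<longrightarrow> g e t \<in> U \<longrightarrow> (flip c (g e t) \<longleftrightarrow> e \<in> C))"
proof (cases "x \<in> \<Gamma>")
  case False
  have "openin M (topspace M - \<Gamma>)" using closed_\<Gamma> by blast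
  then have "lc (topspace M - \<Gamma>) (\<lambda>_. False)" using lc_const by blast
  then show ?thesis using False x g_in_\<Gamma> by (intro exI[of _ "topspace M - \<Gamma>"] exI[of _ "\<lambda>_. False"]) auto
next
  case True
  then show ?thesis
  proof (cases rule: \<Gamma>_cases)
    case (vertex v)
    let ?D = "{e\<in>C. v \<in> e}"
    have "finite ?D" using C finite_E unfolding even_set_def by (auto intro: finite_subset)
    moreover have "?D \<subseteq> {e\<in>E. v \<in> e}" "even (card ?D)" using C vertex unfolding even_set_def by auto
    ultimately have "\<exists>W c. lc W c \<and> p v \<in> W \<and>
        (\<forall>e\<in>E. \<forall>t. 0 < t \<longrightarrow> t < 1 \<longrightarrow> g e t \<in> W \<longrightarrow> (flip c (g e t) \<longleftrightarrow> e \<in> ?D))"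
      by (rule vertex_even_colouring[OF vertex(1)])
    then obtain W c where c: "lc W c" "p v \<in> W"
       "\<And>e t. e \<in> E \<Longrightarrow> 0 < t \<Longrightarrow> t < 1 \<Longrightarrow> g e t \<in> W \<Longrightarrow> flip c (g e t) \<longleftrightarrow> e \<in> ?D"
      by auto
    obtain W1 where W1: "openin M W1" "p v \<in> W1"
      "\<And>e t. e \<in> E \<Longrightarrow> t \<in> {0..1} \<Longrightarrow> g e t \<in> W1 \<Longrightarrow> v \<in> e"
      using vertex_nbhd[OF vertex(1)] by metis
    have "openin M W" using c unfolding lc_def by blast
    then have "lc (W \<inter> W1) c" using lc_subset[OF c(1)] W1 by blast
    moreover have "flip c (g e t) \<longleftrightarrow> e \<in> C" if "e \<in> E" "0 < t" "t < 1" "g e t \<in> W \<inter> W1" for e t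
      using c(3)[OF that(1-3)] W1(3)[OF that(1), of t] that by auto
    ultimately show ?thesis using c W1 vertex by blast
  next
    case (edge e t)
    obtain N0 \<kappa> where s: "sides N0 \<kappa>" "g e t \<in> N0" "N0 \<inter> \<Gamma> \<subseteq> g e ` {0<..<1}"
      by (rule edge_sides[OF edge(1-3)])
    have only: "e' = e" if "e' \<in> E" "0 < t'" "t' < 1" "g e' t' \<in> N0" for e' t'
    proof (rule ccontr)
      assume "e' \<noteq> e"
      have "g e' t' \<in> \<Gamma>" using g_in_\<Gamma> that by auto
      then have "g e' t' \<in> g e ` {0<..<1}" using s that by blast
      then obtain x where "0 < x" "x < 1" "g e' t' = g e x" by auto
      then show False using g_int_disj[OF that(1) edge(1) \<open>e' \<noteq> e\<close> that(2,3), of x] by simp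
    qed
    have lc: "lc N0 \<kappa>" using s unfolding sides_def by blast
    show ?thesis
    proof (cases "e \<in> C")
      case True
      have "flip \<kappa> (g e' t') \<longleftrightarrow> e' \<in> C" if "e' \<in> E" "0 < t'" "t' < 1" "g e' t' \<in> N0" for e' t'
        using sides_flip[OF s(1), of "g e' t'"] that only[OF that] True g_in_\<Gamma>[of e' t'] by auto
      then show ?thesis using lc s edge by blast
    next
      case False
      have "lc N0 (\<lambda>_. False)" using lc lc_const unfolding lc_def by blast
      moreover have "flip (\<lambda>_. False) (g e' t') \<longleftrightarrow> e' \<in> C" if "e' \<in> E" "0 < t'" "t' < 1" "g e' t' \<in> N0" for e' t'
        using only[OF that] False unfolding flip_def by (auto simp: \<open>e \<notin> C\<close>) (use arc_in_topspace[OF arc_g[OF edge(1)], of t'] that in auto)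
      ultimately show ?thesis using s edge by blast
    qed
  qed
qed

end

section \<open>Local systems with two-element fibres\<close>

text \<open>A double covering of \<open>X\<close>, encoded by its transition function near the diagonal: after labelling
  the two points over each \<open>x\<close> by truth values, \<open>T x y\<close> tells whether moving from \<open>x\<close> to a nearby \<open>y\<close>
  exchanges the labels.  Only the values of \<open>T x y\<close> with \<open>y\<close> close to \<open>x\<close> are meaningful.\<close>

definition loc_sys :: "'c topology \<Rightarrow> ('c \<Rightarrow> 'c \<Rightarrow> bool) \<Rightarrow> bool" where
  "loc_sys X T \<longleftrightarrow> (\<forall>x\<in>topspace X. \<exists>N. openin X N \<and> x \<in> N \<and>
     (\<forall>y\<in>N. \<exists>N'. openin X N' \<and> y \<in> N' \<and> (\<forall>z\<in>N'. T x z = (T x y \<noteq> T y z))))"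

text \<open>A continuous choice of one of the two points over each \<open>x\<close>, that is, a
  trivialisation of the covering encoded by \<open>T\<close>.\<close>

definition sec :: "'c topology \<Rightarrow> ('c \<Rightarrow> 'c \<Rightarrow> bool) \<Rightarrow> ('c \<Rightarrow> bool) \<Rightarrow> bool" where
  "sec X T \<sigma> \<longleftrightarrow> (\<forall>x\<in>topspace X. \<exists>N. openin X N \<and> x \<in> N \<and> (\<forall>y\<in>N. \<sigma> y = (\<sigma> x \<noteq> T x y)))"

lemma loc_sysD:
  assumes "loc_sys X T" "x \<in> topspace X"
  obtains N where "openin X N" "x \<in> N"
    "\<forall>y\<in>N. \<exists>N'. openin X N' \<and> y \<in> N' \<and> (\<forall>z\<in>N'. T x z = (T x y \<noteq> T y z))"
  using assms unfolding loc_sys_def by blast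

lemma secD:
  assumes "sec X T \<sigma>" "x \<in> topspace X"
  obtains N where "openin X N" "x \<in> N" "\<forall>y\<in>N. \<sigma> y = (\<sigma> x \<noteq> T x y)"
  using assms unfolding sec_def by blast

lemma secI:
  assumes "\<And>x. x \<in> topspace X \<Longrightarrow> \<exists>N. openin X N \<and> x \<in> N \<and> (\<forall>y\<in>N. \<sigma> y = (\<sigma> x \<noteq> T x y))"
  shows "sec X T \<sigma>"
  using assms unfolding sec_def by blast

lemma loc_sys_refl:
  assumes "loc_sys X T" "x \<in> topspace X"
  shows "\<not> T x x"
proof -
  obtain N where "x \<in> N" "\<forall>y\<in>N. \<exists>N'. openin X N' \<and> y \<in> N' \<and> (\<forall>z\<in>N'. T x z = (T x y \<noteq> T y z))"
    by (rule loc_sysD[OF assms])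
  then obtain N' where "x \<in> N'" "\<forall>z\<in>N'. T x z = (T x x \<noteq> T x z)" by blast
  then show ?thesis by blast
qed

lemma loc_sys_pull:
  assumes T: "loc_sys X T" and \<phi>: "continuous_map Y X \<phi>"
  shows "loc_sys Y (\<lambda>x y. T (\<phi> x) (\<phi> y))"
  unfolding loc_sys_def
proof
  let ?pre = "\<lambda>N. {y \<in> topspace Y. \<phi> y \<in> N}"
  have op: "openin Y (?pre N)" if "openin X N" for N
    using \<phi> that by (rule openin_continuous_map_preimage)
  fix x assume x: "x \<in> topspace Y"
  then have "\<phi> x \<in> topspace X" using \<phi> by (auto simp: continuous_map_def)
  then obtain N where N: "openin X N" "\<phi> x \<in> N"
     "\<forall>y\<in>N. \<exists>N'. openin X N' \<and> y \<in> N' \<and> (\<forall>z\<in>N'. T (\<phi> x) z = (T (\<phi> x) y \<noteq> T y z))"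
    by (rule loc_sysD[OF T])
  have "\<exists>N'. openin Y N' \<and> y \<in> N' \<and> (\<forall>z\<in>N'. T (\<phi> x) (\<phi> z) = (T (\<phi> x) (\<phi> y) \<noteq> T (\<phi> y) (\<phi> z)))"
    if y: "y \<in> ?pre N" for y
  proof -
    obtain N' where "openin X N'" "\<phi> y \<in> N'" "\<forall>z\<in>N'. T (\<phi> x) z = (T (\<phi> x) (\<phi> y) \<noteq> T (\<phi> y) z)"
      using N(3) y by blast
    then show ?thesis using op[of N'] y by (intro exI[of _ "?pre N'"]) blast
  qed
  then show "\<exists>N. openin Y N \<and> x \<in> N \<and> (\<forall>y\<in>N. \<exists>N'. openin Y N' \<and> y \<in> N' \<and>
      (\<forall>z\<in>N'. T (\<phi> x) (\<phi> z) = (T (\<phi> x) (\<phi> y) \<noteq> T (\<phi> y) (\<phi> z))))"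
    using op[OF N(1)] x N(2) by (intro exI[of _ "?pre N"]) blast
qed

lemma sec_pull:
  assumes s: "sec X T \<sigma>" and \<phi>: "continuous_map Y X \<phi>"
  shows "sec Y (\<lambda>x y. T (\<phi> x) (\<phi> y)) (\<lambda>x. \<sigma> (\<phi> x))"
proof (rule secI)
  fix x assume x: "x \<in> topspace Y"
  then have "\<phi> x \<in> topspace X" using \<phi> by (auto simp: continuous_map_def)
  then obtain N where N: "openin X N" "\<phi> x \<in> N" "\<forall>y\<in>N. \<sigma> y = (\<sigma> (\<phi> x) \<noteq> T (\<phi> x) y)"
    by (rule secD[OF s])
  have "openin Y {y \<in> topspace Y. \<phi> y \<in> N}" using \<phi> N(1) by (rule openin_continuous_map_preimage)
  then show "\<exists>N. openin Y N \<and> x \<in> N \<and> (\<forall>y\<in>N. \<sigma> (\<phi> y) = (\<sigma> (\<phi> x) \<noteq> T (\<phi> x) (\<phi> y)))"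
    using x N by (intro exI[of _ "{y \<in> topspace Y. \<phi> y \<in> N}"]) blast
qed

lemma loc_sys_subtopology: "loc_sys X T \<Longrightarrow> loc_sys (subtopology X S) T"
  using loc_sys_pull[of X T "subtopology X S" "\<lambda>x. x"] by (simp add: continuous_map_from_subtopology)

lemma sec_subtopology: "sec X T \<sigma> \<Longrightarrow> sec (subtopology X S) T \<sigma>"
  using sec_pull[of X T \<sigma> "subtopology X S" "\<lambda>x. x"] by (simp add: continuous_map_from_subtopology)

lemma sec_top_of_subset: "sec (top_of_set S) T \<sigma> \<Longrightarrow> S' \<subseteq> S \<Longrightarrow> sec (top_of_set S') T \<sigma>"
  using sec_subtopology[of "top_of_set S" T \<sigma> S'] by (simp add: subtopology_subtopology Int_absorb1)

lemma loc_sys_top_of_subset: "loc_sys (top_of_set S) T \<Longrightarrow> S' \<subseteq> S \<Longrightarrow> loc_sys (top_of_set S') T"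
  using loc_sys_subtopology[of "top_of_set S" T S'] by (simp add: subtopology_subtopology Int_absorb1)

text \<open>The product of two double coverings. As the structure group has two elements, a section
  of the product is an isomorphism between \<open>T\<close> and \<open>T'\<close>; this is how
  coverings are compared below.\<close>

lemma loc_sys_xor:
  assumes "loc_sys X T" "loc_sys X T'"
  shows "loc_sys X (\<lambda>x y. T x y \<noteq> T' x y)"
  unfolding loc_sys_def
proof
  fix x assume x: "x \<in> topspace X"
  obtain N where N: "openin X N" "x \<in> N"
     "\<forall>y\<in>N. \<exists>N'. openin X N' \<and> y \<in> N' \<and> (\<forall>z\<in>N'. T x z = (T x y \<noteq> T y z))"
    by (rule loc_sysD[OF assms(1) x])
  obtain P where P: "openin X P" "x \<in> P"
     "\<forall>y\<in>P. \<exists>N'. openin X N' \<and> y \<in> N' \<and> (\<forall>z\<in>N'. T' x z = (T' x y \<noteq> T' y z))"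
    by (rule loc_sysD[OF assms(2) x])
  have "\<exists>N'. openin X N' \<and> y \<in> N' \<and> (\<forall>z\<in>N'. (T x z \<noteq> T' x z) = ((T x y \<noteq> T' x y) \<noteq> (T y z \<noteq> T' y z)))"
    if y: "y \<in> N \<inter> P" for y
  proof -
    obtain N' where N': "openin X N'" "y \<in> N'" "\<forall>z\<in>N'. T x z = (T x y \<noteq> T y z)"
      using N(3) y by blast
    obtain P' where P': "openin X P'" "y \<in> P'" "\<forall>z\<in>P'. T' x z = (T' x y \<noteq> T' y z)"
      using P(3) y by blast
    have "(T x z \<noteq> T' x z) = ((T x y \<noteq> T' x y) \<noteq> (T y z \<noteq> T' y z))" if "z \<in> N' \<inter> P'" for z
      using bspec[OF N'(3), of z] bspec[OF P'(3), of z] that by blast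
    then show ?thesis using N'(1,2) P'(1,2) by (intro exI[of _ "N' \<inter> P'"]) blast
  qed
  then show "\<exists>N. openin X N \<and> x \<in> N \<and> (\<forall>y\<in>N. \<exists>N'. openin X N' \<and> y \<in> N' \<and>
      (\<forall>z\<in>N'. (T x z \<noteq> T' x z) = ((T x y \<noteq> T' x y) \<noteq> (T y z \<noteq> T' y z))))"
    using N(1,2) P(1,2) by (intro exI[of _ "N \<inter> P"]) blast
qed

lemma sec_xor:
  assumes "sec X T \<sigma>" "sec X T' \<sigma>'"
  shows "sec X (\<lambda>x y. T x y \<noteq> T' x y) (\<lambda>x. \<sigma> x \<noteq> \<sigma>' x)"
proof (rule secI)
  fix x assume x: "x \<in> topspace X"
  obtain N where N: "openin X N" "x \<in> N" "\<forall>y\<in>N. \<sigma> y = (\<sigma> x \<noteq> T x y)" by (rule secD[OF assms(1) x])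
  obtain P where P: "openin X P" "x \<in> P" "\<forall>y\<in>P. \<sigma>' y = (\<sigma>' x \<noteq> T' x y)" by (rule secD[OF assms(2) x])
  have "(\<sigma> y \<noteq> \<sigma>' y) = ((\<sigma> x \<noteq> \<sigma>' x) \<noteq> (T x y \<noteq> T' x y))" if "y \<in> N \<inter> P" for y
    using bspec[OF N(3), of y] bspec[OF P(3), of y] that by blast
  then show "\<exists>N. openin X N \<and> x \<in> N \<and> (\<forall>y\<in>N. (\<sigma> y \<noteq> \<sigma>' y) = ((\<sigma> x \<noteq> \<sigma>' x) \<noteq> (T x y \<noteq> T' x y)))"
    using N(1,2) P(1,2) by (intro exI[of _ "N \<inter> P"]) blast
qed

lemma sec_cong:
  assumes "sec X T \<sigma>" "\<And>x. x \<in> topspace X \<Longrightarrow> \<sigma>' x = \<sigma> x"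
    "\<And>x y. x \<in> topspace X \<Longrightarrow> y \<in> topspace X \<Longrightarrow> T' x y = T x y"
  shows "sec X T' \<sigma>'"
proof (rule secI)
  fix x assume x: "x \<in> topspace X"
  obtain N where N: "openin X N" "x \<in> N" "\<forall>y\<in>N. \<sigma> y = (\<sigma> x \<noteq> T x y)" by (rule secD[OF assms(1) x])
  have "N \<subseteq> topspace X" using N openin_subset by blast
  then have "\<sigma>' y = (\<sigma>' x \<noteq> T' x y)" if "y \<in> N" for y
    using bspec[OF N(3), of y] assms(2)[of y] assms(2)[of x] assms(3)[of x y] x that by blast
  then show "\<exists>N. openin X N \<and> x \<in> N \<and> (\<forall>y\<in>N. \<sigma>' y = (\<sigma>' x \<noteq> T' x y))"
    using N(1,2) by blast
qed

lemma sec_flip: "sec X T \<sigma> \<Longrightarrow> sec X T (\<lambda>x. \<sigma> x \<noteq> b)"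
proof (rule secI)
  fix x assume s: "sec X T \<sigma>" "x \<in> topspace X"
  obtain N where N: "openin X N" "x \<in> N" "\<forall>y\<in>N. \<sigma> y = (\<sigma> x \<noteq> T x y)" by (rule secD[OF s])
  have "(\<sigma> y \<noteq> b) = ((\<sigma> x \<noteq> b) \<noteq> T x y)" if "y \<in> N" for y
    using bspec[OF N(3) that] by blast
  then show "\<exists>N. openin X N \<and> x \<in> N \<and> (\<forall>y\<in>N. (\<sigma> y \<noteq> b) = ((\<sigma> x \<noteq> b) \<noteq> T x y))" using N(1,2) by blast
qed

text \<open>Over each point two sections of a two-sheeted covering agree or are opposite, and which
  of the two occurs is locally constant.\<close>

lemma sec_diff_const:
  assumes s: "sec X T \<sigma>" "sec X T \<sigma>'" and S: "connectedin X S" "x \<in> S" "y \<in> S"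
  shows "(\<sigma> x \<noteq> \<sigma>' x) = (\<sigma> y \<noteq> \<sigma>' y)"
proof (rule connectedin_locally_constant[OF S(1) _ S(2,3)])
  fix y assume "y \<in> S"
  then have "y \<in> topspace X" using S connectedin_subset_topspace by blast
  then obtain N where "openin X N" "y \<in> N" "\<forall>y'\<in>N. (\<sigma> y' \<noteq> \<sigma>' y') = ((\<sigma> y \<noteq> \<sigma>' y) \<noteq> (T y y' \<noteq> T y y'))"
    by (rule secD[OF sec_xor[OF s]])
  then show "\<exists>N. openin X N \<and> y \<in> N \<and> (\<forall>y'\<in>N \<inter> S. (\<sigma> y' \<noteq> \<sigma>' y') = (\<sigma> y \<noteq> \<sigma>' y))" by blast
qed

lemma sec_paste:
  assumes A: "closedin X A" "closedin X B" "A \<union> B = topspace X"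
    and s: "sec (subtopology X A) T \<sigma>" "sec (subtopology X B) T \<sigma>"
  shows "sec X T \<sigma>"
proof (rule secI)
  fix x assume x: "x \<in> topspace X"
  have near: "\<exists>N. openin X N \<and> x \<in> N \<and> (\<forall>y\<in>N \<inter> C. \<sigma> y = (\<sigma> x \<noteq> T x y))"
    if C: "closedin X C" "sec (subtopology X C) T \<sigma>" for C
  proof (cases "x \<in> C")
    case True
    then have "x \<in> topspace (subtopology X C)" using x by simp
    then obtain N where N: "openin (subtopology X C) N" "x \<in> N" "\<forall>y\<in>N. \<sigma> y = (\<sigma> x \<noteq> T x y)"
      by (rule secD[OF C(2)])
    then obtain N' where "openin X N'" "N = N' \<inter> C" by (auto simp: openin_subtopology)
    then show ?thesis using N by blast
  next
    case False
    then have "openin X (topspace X - C)" "x \<in> topspace X - C" using x C by auto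
    then show ?thesis by blast
  qed
  obtain N where N: "openin X N" "x \<in> N" "\<forall>y\<in>N \<inter> A. \<sigma> y = (\<sigma> x \<noteq> T x y)" using near[OF A(1) s(1)] by blast
  obtain P where P: "openin X P" "x \<in> P" "\<forall>y\<in>P \<inter> B. \<sigma> y = (\<sigma> x \<noteq> T x y)" using near[OF A(2) s(2)] by blast
  have "\<sigma> y = (\<sigma> x \<noteq> T x y)" if "y \<in> N \<inter> P" for y
  proof -
    have "y \<in> A \<or> y \<in> B" using that N(1) A(3) openin_subset by blast
    then show ?thesis using N P that by blast
  qed
  then show "\<exists>N. openin X N \<and> x \<in> N \<and> (\<forall>y\<in>N. \<sigma> y = (\<sigma> x \<noteq> T x y))"
    using N(1,2) P(1,2) by (intro exI[of _ "N \<inter> P"]) blast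
qed

text \<open>On the connected overlap the two sections agree throughout or are opposite throughout;
  in the second case one of them is replaced by its opposite.\<close>

lemma sec_glue:
  assumes A: "closed A" "closed B" "connected (A \<inter> B)"
    and s: "\<exists>\<sigma>. sec (top_of_set A) T \<sigma>" "\<exists>\<sigma>. sec (top_of_set B) T \<sigma>"
  shows "\<exists>\<sigma>. sec (top_of_set (A \<union> B)) T \<sigma>"
proof -
  obtain \<sigma>1 \<sigma>2 where s1: "sec (top_of_set A) T \<sigma>1" and s2: "sec (top_of_set B) T \<sigma>2" using s by blast
  have r: "sec (top_of_set (A \<inter> B)) T \<sigma>1" "sec (top_of_set (A \<inter> B)) T \<sigma>2"
    using s1 s2 by (auto intro: sec_top_of_subset)
  have con: "connectedin (top_of_set (A \<inter> B)) (A \<inter> B)" using A(3) by (simp add: connectedin_subtopology)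
  have "\<exists>b. \<forall>x\<in>A \<inter> B. (\<sigma>1 x \<noteq> \<sigma>2 x) = b"
    using sec_diff_const[OF r con] by blast
  then obtain b where b: "\<And>x. x \<in> A \<inter> B \<Longrightarrow> (\<sigma>1 x \<noteq> \<sigma>2 x) = b" by blast
  define \<sigma> where "\<sigma> x = (if x \<in> A then \<sigma>1 x else (\<sigma>2 x \<noteq> b))" for x
  have "sec (top_of_set A) T \<sigma>"
    using s1 by (rule sec_cong) (auto simp: \<sigma>_def)
  moreover have "sec (top_of_set B) T \<sigma>"
  proof (rule sec_cong[OF sec_flip[OF s2, of b]])
    fix x assume x: "x \<in> topspace (top_of_set B)"
    then show "\<sigma> x = (\<sigma>2 x \<noteq> b)" using b[of x] by (auto simp: \<sigma>_def)
  qed simp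
  moreover have "closedin (top_of_set (A \<union> B)) A" "closedin (top_of_set (A \<union> B)) B"
    using A by (auto intro: closed_subset)
  moreover have "subtopology (top_of_set (A \<union> B)) A = top_of_set A" "subtopology (top_of_set (A \<union> B)) B = top_of_set B"
    by (simp_all add: subtopology_subtopology Int_absorb1)
  ultimately have "sec (top_of_set (A \<union> B)) T \<sigma>"
    using sec_paste[of "top_of_set (A \<union> B)" A B T \<sigma>] by simp
  then show ?thesis by blast
qed

text \<open>The cocycle condition, read with \<open>x\<close> fixed, says that \<open>T x\<close>
  itself is a section near \<open>x\<close>.\<close>

lemma sec_local:
  assumes "loc_sys X T" "x \<in> topspace X"
  obtains N where "openin X N" "x \<in> N" "sec (subtopology X N) T (T x)"
proof -
  obtain N where N: "openin X N" "x \<in> N"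
     "\<forall>y\<in>N. \<exists>N'. openin X N' \<and> y \<in> N' \<and> (\<forall>z\<in>N'. T x z = (T x y \<noteq> T y z))"
    by (rule loc_sysD[OF assms])
  have "sec (subtopology X N) T (T x)"
  proof (rule secI)
    fix y assume "y \<in> topspace (subtopology X N)"
    then have y: "y \<in> N" by simp
    then obtain N' where "openin X N'" "y \<in> N'" "\<forall>z\<in>N'. T x z = (T x y \<noteq> T y z)" using N(3) by blast
    then show "\<exists>N'. openin (subtopology X N) N' \<and> y \<in> N' \<and> (\<forall>z\<in>N'. T x z = (T x y \<noteq> T y z))"
      using y openin_subtopology_Int[of X N' N] by (intro exI[of _ "N' \<inter> N"]) blast
  qed
  then show ?thesis using that N by blast
qed

text \<open>The induced function must satisfy the section condition on an open set around each point
  of \<open>X\<close>. The quotient topology reduces this to openness of the preimage of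
  \<open>O'\<close>, which the section upstairs provides.\<close>

lemma sec_descend:
  assumes q: "quotient_map Y X q" and T: "loc_sys X T" and s: "sec Y (\<lambda>x y. T (q x) (q y)) \<sigma>"
    and fib: "\<And>w w'. w \<in> topspace Y \<Longrightarrow> w' \<in> topspace Y \<Longrightarrow> q w = q w' \<Longrightarrow> \<sigma> w = \<sigma> w'"
  shows "\<exists>s. sec X T s"
proof -
  define s where "s x = \<sigma> (SOME w. w \<in> topspace Y \<and> q w = x)" for x
  have sq: "s (q w) = \<sigma> w" if "w \<in> topspace Y" for w
  proof -
    have "(SOME w'. w' \<in> topspace Y \<and> q w' = q w) \<in> topspace Y \<and> q (SOME w'. w' \<in> topspace Y \<and> q w' = q w) = q w"
      by (rule someI[of _ w]) (use that in simp)
    then show ?thesis using fib that unfolding s_def by blast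
  qed
  have surj: "q ` topspace Y = topspace X" using q by (simp add: quotient_map_def)
  have qc: "continuous_map Y X q" using q quotient_imp_continuous_map by blast
  have "sec X T s"
  proof (rule secI)
    fix x assume x: "x \<in> topspace X"
    obtain N where N: "openin X N" "x \<in> N"
       "\<forall>y\<in>N. \<exists>N'. openin X N' \<and> y \<in> N' \<and> (\<forall>z\<in>N'. T x z = (T x y \<noteq> T y z))"
      by (rule loc_sysD[OF T x])
    define O' where "O' = {y\<in>N. s y = (s x \<noteq> T x y)}"
    have sub: "O' \<subseteq> topspace X" using N(1) openin_subset unfolding O'_def by blast
    have "openin Y {w \<in> topspace Y. q w \<in> O'}"
    proof (subst openin_subopen, intro ballI)
      fix w assume w: "w \<in> {w \<in> topspace Y. q w \<in> O'}"
      then have wt: "w \<in> topspace Y" and qwN: "q w \<in> N" and eq: "\<sigma> w = (s x \<noteq> T x (q w))"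
        using sq[of w] unfolding O'_def by blast+
      obtain N' where N': "openin X N'" "q w \<in> N'" "\<forall>z\<in>N'. T x z = (T x (q w) \<noteq> T (q w) z)"
        using N(3) qwN by blast
      obtain P where P: "openin Y P" "w \<in> P" "\<forall>w'\<in>P. \<sigma> w' = (\<sigma> w \<noteq> T (q w) (q w'))"
        by (rule secD[OF s wt])
      let ?R = "P \<inter> {w' \<in> topspace Y. q w' \<in> N \<inter> N'}"
      have "openin Y {w' \<in> topspace Y. q w' \<in> N \<inter> N'}"
        using N(1) N'(1) by (intro openin_continuous_map_preimage[OF qc]) auto
      then have "openin Y ?R" using P by blast
      moreover have "w \<in> ?R" using P wt qwN N' by blast
      moreover have "?R \<subseteq> {w \<in> topspace Y. q w \<in> O'}"
      proof
        fix w' assume w': "w' \<in> ?R"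
        then have "\<sigma> w' = (\<sigma> w \<noteq> T (q w) (q w'))" "T x (q w') = (T x (q w) \<noteq> T (q w) (q w'))"
          using P(3) N'(3) by blast+
        then have "s (q w') = (s x \<noteq> T x (q w'))" using sq[of w'] w' eq by blast
        then show "w' \<in> {w \<in> topspace Y. q w \<in> O'}" using w' unfolding O'_def by blast
      qed
      ultimately show "\<exists>R. openin Y R \<and> w \<in> R \<and> R \<subseteq> {w \<in> topspace Y. q w \<in> O'}" by blast
    qed
    then have "openin X O'" using q sub unfolding quotient_map_def by blast
    moreover have "x \<in> O'" using N(2) loc_sys_refl[OF T x] by (simp add: O'_def)
    ultimately show "\<exists>N. openin X N \<and> x \<in> N \<and> (\<forall>y\<in>N. s y = (s x \<noteq> T x y))"
      unfolding O'_def by blast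
  qed
  then show ?thesis by blast
qed

section \<open>Sections over the square and the sphere\<close>

lemma closed_Times_interval: "closed (({a..b::real} \<inter> {0..1}) \<times> ({c..d::real} \<inter> {0..1}))"
  by (intro closed_Times closed_Int) auto

lemma connected_Times_interval: "connected (({a..b::real} \<inter> {0..1}) \<times> ({c..d::real} \<inter> {0..1}))"
  by (intro convex_connected convex_Times convex_Int) auto

text \<open>Bisection in place of simple connectedness: local sections are pasted along the second
  coordinate into a section over a thin strip, then strips are pasted along the first. Adjacent
  pieces meet in a convex set, so \<open>sec_glue\<close> applies.\<close>

lemma sec_square:
  assumes T: "loc_sys (top_of_set ({0..1::real} \<times> {0..1::real})) T"
  shows "\<exists>\<sigma>. sec (top_of_set ({0..1} \<times> {0..1})) T \<sigma>"
proof -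
  let ?I = "\<lambda>a b. {a..b::real} \<inter> {0..1}"
  let ?ex = "\<lambda>S. \<exists>\<sigma>. sec (top_of_set S) T \<sigma>"
  have mono: "?ex S'" if "?ex S" "S' \<subseteq> S" for S S' using that sec_top_of_subset by blast
  have local: "\<exists>d>0. ?ex (?I (x - d) (x + d) \<times> ?I (y - d) (y + d))" if xy: "x \<in> {0..1}" "y \<in> {0..1}" for x y
  proof -
    have "(x, y) \<in> topspace (top_of_set ({0..1::real} \<times> {0..1::real}))" using xy by simp
    then obtain N where N: "openin (top_of_set ({0..1::real} \<times> {0..1::real})) N" "(x, y) \<in> N"
       "sec (subtopology (top_of_set ({0..1} \<times> {0..1})) N) T (T (x, y))"
      by (rule sec_local[OF T])
    have sN: "N \<subseteq> {0..1} \<times> {0..1}" using openin_subset[OF N(1)] by simp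
    then have secN: "sec (top_of_set N) T (T (x, y))" using N(3) by (simp add: subtopology_subtopology Int_absorb1)
    obtain e where e: "e > 0" "\<And>z. z \<in> {0..1} \<times> {0..1} \<Longrightarrow> dist z (x, y) < e \<Longrightarrow> z \<in> N"
      using N(1,2) unfolding openin_euclidean_subtopology_iff by metis
    define d where "d = e / 3"
    have "?I (x - d) (x + d) \<times> ?I (y - d) (y + d) \<subseteq> N"
    proof
      fix z assume z: "z \<in> ?I (x - d) (x + d) \<times> ?I (y - d) (y + d)"
      have "dist z (x, y) \<le> dist (fst z) x + dist (snd z) y"
        unfolding dist_prod_def by (simp add: sqrt_sum_squares_le_sum)
      also have "\<dots> \<le> d + d" using z by (intro add_mono) (auto simp: dist_real_def)
      also have "\<dots> < e" using e(1) by (simp add: d_def)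
      finally show "z \<in> N" using e(2) z by auto
    qed
    then have "?ex (?I (x - d) (x + d) \<times> ?I (y - d) (y + d))" using secN sec_top_of_subset by blast
    moreover have "d > 0" using e by (simp add: d_def)
    ultimately show ?thesis by blast
  qed
  have strip: "\<exists>d>0. ?ex (?I (x - d) (x + d) \<times> ?I 0 1)" if x: "x \<in> {0..1}" for x
  proof -
    show ?thesis
    \<comment> \<open>The width of the strip is part of the property, because pasting two pieces
      leaves only the smaller of their widths.\<close>
    proof (rule Bolzano[of 0 1 "\<lambda>a b. \<exists>d>0. ?ex (?I (x - d) (x + d) \<times> ?I a b)"])
      fix a b c :: real
      assume trans: "\<exists>d>0. ?ex (?I (x - d) (x + d) \<times> ?I a b)" "\<exists>d>0. ?ex (?I (x - d) (x + d) \<times> ?I b c)"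
        "a \<le> b" "b \<le> c"
      then obtain d d' where d: "d > 0" "?ex (?I (x - d) (x + d) \<times> ?I a b)"
         "d' > 0" "?ex (?I (x - d') (x + d') \<times> ?I b c)" by blast
      define m where "m = min d d'"
      have m: "m > 0" "m \<le> d" "m \<le> d'" using d by (auto simp: m_def)
      have "?ex (?I (x - m) (x + m) \<times> ?I a b)" by (rule mono[OF d(2)]) (use m in auto)
      moreover have "?ex (?I (x - m) (x + m) \<times> ?I b c)" by (rule mono[OF d(4)]) (use m in auto)
      moreover have "connected ((?I (x - m) (x + m) \<times> ?I a b) \<inter> (?I (x - m) (x + m) \<times> ?I b c))"
      proof -
        have "(?I (x - m) (x + m) \<times> ?I a b) \<inter> (?I (x - m) (x + m) \<times> ?I b c) = ?I (x - m) (x + m) \<times> ?I b b"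
          using trans by auto
        then show ?thesis using connected_Times_interval[of "x - m" "x + m" b b] by simp
      qed
      ultimately have "?ex ((?I (x - m) (x + m) \<times> ?I a b) \<union> (?I (x - m) (x + m) \<times> ?I b c))"
        by (intro sec_glue closed_Times_interval)
      moreover have "(?I (x - m) (x + m) \<times> ?I a b) \<union> (?I (x - m) (x + m) \<times> ?I b c) = ?I (x - m) (x + m) \<times> ?I a c"
        using trans by auto
      ultimately have "?ex (?I (x - m) (x + m) \<times> ?I a c)" by metis
      then show "\<exists>d>0. ?ex (?I (x - d) (x + d) \<times> ?I a c)" using m(1) by blast
    next
      fix y :: real assume "0 \<le> y" "y \<le> 1"
      then have "y \<in> {0..1}" by simp
      then obtain d where d: "d > 0" "?ex (?I (x - d) (x + d) \<times> ?I (y - d) (y + d))"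
        using local[OF x] by blast
      have "\<exists>d>0. ?ex (?I (x - d) (x + d) \<times> ?I a b)" if "a \<le> y \<and> y \<le> b \<and> b - a < d" for a b
      proof -
        have "?ex (?I (x - d) (x + d) \<times> ?I a b)" by (rule mono[OF d(2)]) (use that in auto)
        then show ?thesis using d(1) by blast
      qed
      then show "\<exists>d>0. \<forall>a b. a \<le> y \<and> y \<le> b \<and> b - a < d \<longrightarrow> (\<exists>d>0. ?ex (?I (x - d) (x + d) \<times> ?I a b))"
        using d(1) by blast
    qed simp
  qed
  have "?ex (?I 0 1 \<times> ?I 0 1)"
  proof (rule Bolzano[of 0 1 "\<lambda>a b. ?ex (?I a b \<times> ?I 0 1)"])
    fix a b c :: real
    assume trans: "?ex (?I a b \<times> ?I 0 1)" "?ex (?I b c \<times> ?I 0 1)" "a \<le> b" "b \<le> c"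
    have "connected ((?I a b \<times> ?I 0 1) \<inter> (?I b c \<times> ?I 0 1))"
    proof -
      have "(?I a b \<times> ?I 0 1) \<inter> (?I b c \<times> ?I 0 1) = ?I b b \<times> ?I 0 1" using trans by auto
      then show ?thesis using connected_Times_interval[of b b 0 1] by simp
    qed
    then have "?ex ((?I a b \<times> ?I 0 1) \<union> (?I b c \<times> ?I 0 1))"
      using trans(1,2) by (intro sec_glue closed_Times_interval)
    moreover have "(?I a b \<times> ?I 0 1) \<union> (?I b c \<times> ?I 0 1) = ?I a c \<times> ?I 0 1" using trans by auto
    ultimately show "?ex (?I a c \<times> ?I 0 1)" by metis
  next
    fix x :: real assume "0 \<le> x" "x \<le> 1"
    then have "x \<in> {0..1}" by simp
    then obtain d where d: "d > 0" "?ex (?I (x - d) (x + d) \<times> ?I 0 1)" using strip by blast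
    have "?ex (?I a b \<times> ?I 0 1)" if "a \<le> x \<and> x \<le> b \<and> b - a < d" for a b
      by (rule mono[OF d(2)]) (use that in auto)
    then show "\<exists>d>0. \<forall>a b. a \<le> x \<and> x \<le> b \<and> b - a < d \<longrightarrow> ?ex (?I a b \<times> ?I 0 1)" using d(1) by blast
  qed simp
  then show ?thesis by simp
qed

lemma sec_interval:
  assumes T: "loc_sys (top_of_set {0..1::real}) T"
  shows "\<exists>\<sigma>. sec (top_of_set {0..1}) T \<sigma>"
proof -
  have "continuous_map (top_of_set ({0..1} \<times> {0..1})) (top_of_set {0..1::real}) (fst :: real \<times> real \<Rightarrow> real)"
    by (auto simp: continuous_on_fst)
  from loc_sys_pull[OF T this] obtain \<sigma> where s: "sec (top_of_set ({0..1} \<times> {0..1})) (\<lambda>x y :: real \<times> real. T (fst x) (fst y)) \<sigma>"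
    using sec_square by blast
  have "continuous_map (top_of_set {0..1::real}) (top_of_set ({0..1} \<times> {0..1})) (\<lambda>t. (t, 0::real))"
    by (auto simp: continuous_intros)
  from sec_pull[OF s this] show ?thesis by auto
qed

text \<open>Spherical coordinates on the unit square: polar angle in units of \<open>pi\<close>,
  longitude in units of \<open>2 * pi\<close>. Two opposite sides collapse to the poles, the other
  two become the same meridian.\<close>

definition sph :: "real \<times> real \<Rightarrow> real ^ 3" where
  "sph z = vector [sin (pi * fst z) * cos (2 * pi * snd z), sin (pi * fst z) * sin (2 * pi * snd z), cos (pi * fst z)]"

lemma sph_comp: "sph z $ 1 = sin (pi * fst z) * cos (2 * pi * snd z)"
  "sph z $ 2 = sin (pi * fst z) * sin (2 * pi * snd z)" "sph z $ 3 = cos (pi * fst z)"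
  by (simp_all add: sph_def)

lemma continuous_on_vec3:
  fixes f :: "'c::topological_space \<Rightarrow> real ^ 3"
  assumes "continuous_on S (\<lambda>x. f x $ 1)" "continuous_on S (\<lambda>x. f x $ 2)" "continuous_on S (\<lambda>x. f x $ 3)"
  shows "continuous_on S f"
proof -
  have "continuous_on S (\<lambda>x. \<chi> i. f x $ i)"
    by (rule continuous_on_vec_lambda) (use assms exhaust_3 in metis)
  then show ?thesis by simp
qed

lemma norm_vec3: "norm (x :: real ^ 3) = sqrt ((x $ 1)\<^sup>2 + (x $ 2)\<^sup>2 + (x $ 3)\<^sup>2)"
  by (simp add: norm_vec_def L2_set_def sum_3)

text \<open>A section over the square has to respect the identifications made by \<open>sph\<close>.
  On a side that collapses to a pole the pulled-back covering is constant, hence so is the section.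
  Along the seam the two boundary values differ by a constant, which vanishes because they agree at
  a pole.\<close>

lemma sec_sphere:
  assumes T: "loc_sys (top_of_set (sphere (0 :: real ^ 3) 1)) T"
  shows "\<exists>\<sigma>. sec (top_of_set (sphere 0 1)) T \<sigma>"
proof -
  let ?Q = "{0..1::real} \<times> {0..1::real}"
  have cont: "continuous_on ?Q sph"
    by (rule continuous_on_vec3) (auto simp: sph_comp intro!: continuous_intros)
  have sphere: "sph z \<in> sphere 0 1" for z
  proof -
    have "(sin (pi * fst z) * cos (2 * pi * snd z))\<^sup>2 + (sin (pi * fst z) * sin (2 * pi * snd z))\<^sup>2
        = (sin (pi * fst z))\<^sup>2 * ((cos (2 * pi * snd z))\<^sup>2 + (sin (2 * pi * snd z))\<^sup>2)"
      by (simp only: power_mult_distrib distrib_left)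
    then show ?thesis by (simp add: norm_vec3 sph_comp)
  qed
  have surj: "sphere 0 1 \<subseteq> sph ` ?Q"
  proof
    fix x :: "real ^ 3" assume "x \<in> sphere 0 1"
    then have n: "(x $ 1)\<^sup>2 + (x $ 2)\<^sup>2 + (x $ 3)\<^sup>2 = 1" by (simp add: norm_vec3)
    have "(x $ 3)\<^sup>2 \<le> 1" using n zero_le_power2[of "x $ 1"] zero_le_power2[of "x $ 2"] by linarith
    then have z: "\<bar>x $ 3\<bar> \<le> 1" by (simp add: abs_square_le_1)
    define \<phi> where "\<phi> = arccos (x $ 3) / pi"
    have \<phi>: "\<phi> \<in> {0..1}" "cos (pi * \<phi>) = x $ 3"
      using z arccos_bounded[of "x $ 3"] by (auto simp: \<phi>_def cos_arccos_abs field_simps)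
    have sge: "sin (pi * \<phi>) \<ge> 0" using \<phi>(1) by (intro sin_ge_zero) (auto simp: mult_left_le)
    have s2: "(sin (pi * \<phi>))\<^sup>2 = (x $ 1)\<^sup>2 + (x $ 2)\<^sup>2"
      using n sin_squared_eq[of "pi * \<phi>"] \<phi>(2) by simp
    show "x \<in> sph ` ?Q"
    proof (cases "sin (pi * \<phi>) = 0")
      case True
      then have "x $ 1 = 0" "x $ 2 = 0" using s2 by (auto simp: sum_power2_eq_zero_iff)
      then have "sph (\<phi>, 0) = x" using True \<phi> by (simp add: vec_eq_iff forall_3 sph_comp)
      then show ?thesis using \<phi> by (intro image_eqI[of _ _ "(\<phi>, 0)"]) auto
    next
      case False
      then have "(x $ 1 / sin (pi * \<phi>))\<^sup>2 + (x $ 2 / sin (pi * \<phi>))\<^sup>2 = 1"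
        by (simp add: power_divide add_divide_distrib[symmetric] s2[symmetric])
      then obtain t where t: "0 \<le> t" "t < 2 * pi" "x $ 1 / sin (pi * \<phi>) = cos t" "x $ 2 / sin (pi * \<phi>) = sin t"
        using sincos_total_2pi by metis
      have "sph (\<phi>, t / (2 * pi)) = x"
        using False \<phi> t by (simp add: vec_eq_iff forall_3 sph_comp field_simps)
      then show ?thesis using \<phi> t by (intro image_eqI[of _ _ "(\<phi>, t / (2 * pi))"]) auto
    qed
  qed
  have qc: "continuous_map (top_of_set ?Q) (top_of_set (sphere 0 1)) sph"
    using cont sphere by auto
  have quot: "quotient_map (top_of_set ?Q) (top_of_set (sphere 0 1)) sph"
  proof (rule T1_Spaces.continuous_imp_quotient_map[OF qc])
    show "compact_space (top_of_set ?Q)" by (simp add: compact_space_subtopology compact_Times)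
    show "Hausdorff_space (top_of_set (sphere (0 :: real ^ 3) 1))" by (simp add: Hausdorff_space_subtopology)
    show "sph ` topspace (top_of_set ?Q) = topspace (top_of_set (sphere 0 1))"
      using surj sphere by auto
  qed
  obtain \<sigma> where s: "sec (top_of_set ?Q) (\<lambda>x y. T (sph x) (sph y)) \<sigma>"
    using sec_square[OF loc_sys_pull[OF T qc]] by blast
  have edge0: "continuous_map (top_of_set {0..1::real}) (top_of_set ?Q) (\<lambda>t. (u, t))" if "u \<in> {0..1}" for u
    using that by (auto simp: continuous_intros)
  have edge1: "continuous_map (top_of_set {0..1::real}) (top_of_set ?Q) (\<lambda>t. (t, u))" if "u \<in> {0..1}" for u
    using that by (auto simp: continuous_intros)
  have con: "connectedin (top_of_set {0..1::real}) {0..1}" by (simp add: connectedin_subtopology)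
  have pole: "\<sigma> (u, t) = \<sigma> (u, t')" if u: "u = 0 \<or> u = 1" and t: "t \<in> {0..1}" "t' \<in> {0..1}" for u t t'
  proof -
    have uI: "u \<in> {0..1}" using u by auto
    have same: "sph (u, a) = sph (u, b)" for a b using u by (auto simp: vec_eq_iff forall_3 sph_comp)
    have "sph (u, 0) \<in> topspace (top_of_set (sphere 0 1))" using sphere by simp
    then have F: "\<not> T (sph (u, a)) (sph (u, b))" for a b
      using loc_sys_refl[OF T] same[of a 0] same[of b 0] by metis
    have "sec (top_of_set {0..1}) (\<lambda>_ _. False) (\<lambda>t. \<sigma> (u, t))"
      using sec_pull[OF s edge0[OF uI]] by (rule sec_cong) (use F in auto)
    moreover have "sec (top_of_set {0..1::real}) (\<lambda>_ _. False) (\<lambda>t. False)" by (auto simp: sec_def)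
    ultimately show ?thesis using sec_diff_const[OF _ _ con t] by blast
  qed
  have seam: "\<sigma> (t, 0) = \<sigma> (t, 1)" if t: "t \<in> {0..1}" for t
  proof -
    have same: "sph (a, 0) = sph (a, 1)" for a by (auto simp: vec_eq_iff forall_3 sph_comp)
    have s0: "sec (top_of_set {0..1}) (\<lambda>x y. T (sph (x, 0)) (sph (y, 0))) (\<lambda>t. \<sigma> (t, 0))"
      using sec_pull[OF s edge1[of 0]] by auto
    have s1: "sec (top_of_set {0..1}) (\<lambda>x y. T (sph (x, 0)) (sph (y, 0))) (\<lambda>t. \<sigma> (t, 1))"
      using sec_pull[OF s edge1[of 1]] unfolding same by auto
    have "(\<sigma> (t, 0) \<noteq> \<sigma> (t, 1)) = (\<sigma> (0, 0) \<noteq> \<sigma> (0, 1))"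
      by (rule sec_diff_const[OF s0 s1 con t]) simp
    then show ?thesis using pole[of 0 0 1] by simp
  qed
  show ?thesis
  proof (rule sec_descend[OF quot T s])
    fix w w' assume w: "w \<in> topspace (top_of_set ?Q)" "w' \<in> topspace (top_of_set ?Q)" and eq: "sph w = sph w'"
    obtain a b a' b' where ab: "w = (a, b)" "w' = (a', b')" by (cases w, cases w')
    have r: "a \<in> {0..1}" "b \<in> {0..1}" "a' \<in> {0..1}" "b' \<in> {0..1}" using w ab by auto
    have "cos (pi * a) = cos (pi * a')" using eq ab by (metis sph_comp(3) fst_conv)
    moreover have "0 \<le> pi * a" "pi * a \<le> pi" "0 \<le> pi * a'" "pi * a' \<le> pi" using r by (auto simp: mult_left_le)
    ultimately have "pi * a = pi * a'" using cos_inj_pi by blast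
    then have a: "a = a'" by simp
    show "\<sigma> w = \<sigma> w'"
    proof (cases "a = 0 \<or> a = 1")
      case True
      then have "\<sigma> (a, b) = \<sigma> (a, b')" using r(2,4) by (rule pole)
      then show ?thesis using a ab by simp
    next
      case False
      then have "0 < pi * a" "pi * a < pi" using r by auto
      then have "sin (pi * a) > 0" by (rule sin_gt_zero)
      then have cs: "cos (2 * pi * b) = cos (2 * pi * b')" "sin (2 * pi * b) = sin (2 * pi * b')"
        using arg_cong[OF eq, of "\<lambda>v. v $ 1"] arg_cong[OF eq, of "\<lambda>v. v $ 2"] ab a by (auto simp: sph_comp)
      then obtain n :: int where "2 * pi * b = 2 * pi * b' + 2 * pi * n" using sin_cos_eq_iff by metis
      then have "2 * pi * (b - b') = 2 * pi * n" by (simp add: algebra_simps)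
      then have bn: "b - b' = n" by simp
      then have "real_of_int n \<le> 1" "real_of_int n \<ge> -1" using r by auto
      then have "n = 0 \<or> n = 1 \<or> n = -1" by auto
      then have "b = b' \<or> (b = 1 \<and> b' = 0) \<or> (b = 0 \<and> b' = 1)" using bn r by auto
      then show ?thesis using seam[OF r(1)] ab a by metis
    qed
  qed
qed

section \<open>The sphere with holes\<close>

locale holed =
  fixes n :: nat and c :: "nat \<Rightarrow> real ^ 3" and r :: real
  assumes caps: "disjoint_caps n c r"
begin

definition P :: "(real ^ 3) set" where "P = holed_sphere n c r"

definition rim :: "nat \<Rightarrow> (real ^ 3) set" where "rim i = cap_rim (c i) r"

text \<open>Caps are cut off by planes: unit vectors satisfy |x - c|^2 = 2 - 2 (x . c), so distance
  below \<open>r\<close> means inner product above \<open>\<kappa>\<close>.\<close>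

definition \<kappa> :: real where "\<kappa> = 1 - r\<^sup>2 / 2"

lemma \<kappa>_bounds: "-1 < \<kappa>" "\<kappa> < 1" "\<kappa>\<^sup>2 < 1"
proof -
  have r: "0 < r" "r < 2" using caps by (auto simp: disjoint_caps_def)
  then have "r\<^sup>2 < 2\<^sup>2" by (intro power_strict_mono) auto
  then show a: "-1 < \<kappa>" by (simp add: \<kappa>_def)
  show b: "\<kappa> < 1" using r by (simp add: \<kappa>_def)
  have "\<bar>\<kappa>\<bar> < 1" using a b by auto
  then show "\<kappa>\<^sup>2 < 1" by (simp add: abs_square_less_1)
qed

lemma c_unit: "i < n \<Longrightarrow> norm (c i) = 1"
  using caps by (auto simp: disjoint_caps_def)

lemma c_inner: "i < n \<Longrightarrow> c i \<bullet> c i = 1"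
  using c_unit[of i] by (simp add: norm_eq_1)

lemma dist_unit:
  assumes "norm x = 1" "norm a = 1"
  shows "(dist x a)\<^sup>2 = 2 - 2 * (x \<bullet> a)"
proof -
  have "(dist x a)\<^sup>2 = (x - a) \<bullet> (x - a)" by (simp add: dist_norm power2_norm_eq_inner)
  also have "\<dots> = x \<bullet> x + a \<bullet> a - 2 * (x \<bullet> a)" by (simp add: inner_diff inner_commute)
  also have "\<dots> = 2 - 2 * (x \<bullet> a)" using assms by (simp add: norm_eq_1)
  finally show ?thesis .
qed

lemma cap_iff:
  assumes "norm x = 1" "i < n"
  shows "dist x (c i) < r \<longleftrightarrow> x \<bullet> c i > \<kappa>" "dist x (c i) = r \<longleftrightarrow> x \<bullet> c i = \<kappa>" "dist x (c i) \<le> r \<longleftrightarrow> x \<bullet> c i \<ge> \<kappa>"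
proof -
  have r: "0 < r" using caps by (auto simp: disjoint_caps_def)
  have d: "(dist x (c i))\<^sup>2 = 2 - 2 * (x \<bullet> c i)" using dist_unit assms c_unit by blast
  have lt: "dist x (c i) < r \<longleftrightarrow> (dist x (c i))\<^sup>2 < r\<^sup>2"
    using r abs_square_less_1 power2_less_imp_less[of "dist x (c i)" r] power_strict_mono[of "dist x (c i)" r 2] by auto
  have eq: "dist x (c i) = r \<longleftrightarrow> (dist x (c i))\<^sup>2 = r\<^sup>2" using r by (simp add: power2_eq_iff_nonneg)
  show 1: "dist x (c i) < r \<longleftrightarrow> x \<bullet> c i > \<kappa>" and 2: "dist x (c i) = r \<longleftrightarrow> x \<bullet> c i = \<kappa>"
    unfolding lt eq d \<kappa>_def by auto
  then show "dist x (c i) \<le> r \<longleftrightarrow> x \<bullet> c i \<ge> \<kappa>" by auto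
qed

lemma P_iff: "x \<in> P \<longleftrightarrow> norm x = 1 \<and> (\<forall>i<n. x \<bullet> c i \<le> \<kappa>)"
proof -
  have "x \<in> P \<longleftrightarrow> norm x = 1 \<and> (\<forall>i<n. \<not> dist x (c i) < r)"
    unfolding P_def holed_sphere_def by (auto simp: dist_commute)
  then show ?thesis using cap_iff(1) by (metis not_le)
qed

lemma rim_iff: "i < n \<Longrightarrow> x \<in> rim i \<longleftrightarrow> norm x = 1 \<and> x \<bullet> c i = \<kappa>"
  unfolding rim_def cap_rim_def using cap_iff(2)[of x i] by (auto simp: dist_commute)

lemma cap_unique:
  assumes "norm x = 1" "i < n" "j < n" "x \<bullet> c i \<ge> \<kappa>" "x \<bullet> c j \<ge> \<kappa>"
  shows "i = j"
proof (rule ccontr)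
  assume "i \<noteq> j"
  then have "sphere 0 1 \<inter> cball (c i) r \<inter> cball (c j) r = {}"
    using caps assms unfolding disjoint_caps_def by blast
  moreover have "x \<in> sphere 0 1 \<inter> cball (c i) r \<inter> cball (c j) r"
    using cap_iff(3)[OF assms(1)] assms by (auto simp: dist_commute)
  ultimately show False by blast
qed

lemma rim_other: "i < n \<Longrightarrow> j < n \<Longrightarrow> x \<in> rim i \<Longrightarrow> i \<noteq> j \<Longrightarrow> x \<bullet> c j < \<kappa>"
  using cap_unique[of x i j] rim_iff[of i x] by force

lemma rim_sub: "i < n \<Longrightarrow> rim i \<subseteq> P"
proof
  fix x assume i: "i < n" and x: "x \<in> rim i"
  have "x \<bullet> c j \<le> \<kappa>" if "j < n" for j
    using rim_other[OF i that x] rim_iff[OF i] x by (cases "i = j") force+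
  then show "x \<in> P" using rim_iff[OF i] x P_iff by blast
qed

lemma compact_P: "compact P"
proof -

  have "P = sphere 0 1 \<inter> (\<Inter>i\<in>{..<n}. {x. x \<bullet> c i \<le> \<kappa>})"
    using P_iff by (auto simp: dist_norm)
  moreover have "closed (\<Inter>i\<in>{..<n}. {x. x \<bullet> c i \<le> \<kappa>})"
    by (intro closed_INT ballI closed_Collect_le continuous_intros)
  ultimately show ?thesis by (simp add: compact_Int_closed)
qed

section \<open>Retraction of the punctured sphere and extension over the caps\<close>

text \<open>The radius of the rims as plane circles; their centres are the points
  \<open>\<kappa> *\<^sub>R c i\<close>.\<close>

definition s0 :: real where "s0 = sqrt (1 - \<kappa>\<^sup>2)"

lemma s0: "s0 > 0" "s0\<^sup>2 = 1 - \<kappa>\<^sup>2"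
  using \<kappa>_bounds by (auto simp: s0_def)

definition perp :: "nat \<Rightarrow> real ^ 3 \<Rightarrow> real ^ 3" where "perp i x = x - (x \<bullet> c i) *\<^sub>R c i"

lemma perp_norm:
  assumes "i < n" "norm x = 1"
  shows "(norm (perp i x))\<^sup>2 = 1 - (x \<bullet> c i)\<^sup>2"
proof -
  have "(norm (perp i x))\<^sup>2 = perp i x \<bullet> perp i x" by (simp add: power2_norm_eq_inner)
  also have "\<dots> = x \<bullet> x - (x \<bullet> c i)\<^sup>2"
    unfolding perp_def using c_inner[OF assms(1)]
    by (simp add: inner_diff inner_commute algebra_simps power2_eq_square)
  finally show ?thesis using assms(2) by (simp add: norm_eq_1)
qed

lemma perp_ne:
  assumes "i < n" "norm x = 1" "x \<bullet> c i \<ge> \<kappa>" "x \<noteq> c i"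
  shows "perp i x \<noteq> 0"
proof
  assume "perp i x = 0"
  then have e: "(x \<bullet> c i)\<^sup>2 = 1" using perp_norm[OF assms(1,2)] by simp
  then have "x \<bullet> c i = 1 \<or> x \<bullet> c i = -1" by (simp add: power2_eq_1_iff)
  then have "x \<bullet> c i = 1" using assms(3) \<kappa>_bounds by auto
  then have "x = c i" using \<open>perp i x = 0\<close> by (simp add: perp_def)
  then show False using assms by blast
qed

text \<open>Projection of a cap to its rim along the great circles through its centre: the component
  along \<open>c i\<close> becomes \<open>\<kappa>\<close>, the orthogonal one is rescaled to length
  \<open>s0\<close>. At the centre itself \<open>perp i x\<close> vanishes, hence the punctures in
  \<open>S'\<close>.\<close>

definition retr :: "nat \<Rightarrow> real ^ 3 \<Rightarrow> real ^ 3" where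
  "retr i x = \<kappa> *\<^sub>R c i + (s0 / norm (perp i x)) *\<^sub>R perp i x"

lemma retr_rim:
  assumes "i < n" "norm x = 1" "x \<bullet> c i \<ge> \<kappa>" "x \<noteq> c i"
  shows "retr i x \<in> rim i"
proof -
  let ?q = "perp i x"
  have ne: "norm ?q \<noteq> 0" using perp_ne[OF assms] by simp
  have ort: "?q \<bullet> c i = 0" using c_inner[OF assms(1)] by (simp add: perp_def inner_diff_left)
  have 1: "retr i x \<bullet> c i = \<kappa>"
    using ort c_inner[OF assms(1)] by (simp add: retr_def inner_add_left)
  have "retr i x \<bullet> retr i x = \<kappa>\<^sup>2 + (s0 / norm ?q)\<^sup>2 * (?q \<bullet> ?q)"
    using ort c_inner[OF assms(1)] unfolding retr_def
    by (simp add: inner_add inner_commute algebra_simps power2_eq_square)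
  also have "\<dots> = \<kappa>\<^sup>2 + s0\<^sup>2"
    using ne by (simp add: power_divide power2_norm_eq_inner[symmetric])
  also have "\<dots> = 1" using s0 by simp
  finally have "norm (retr i x) = 1" by (simp add: norm_eq_1)
  then show ?thesis using 1 rim_iff[OF assms(1)] by blast
qed

lemma retr_id:
  assumes "i < n" "x \<in> rim i"
  shows "retr i x = x"
proof -
  have x: "norm x = 1" "x \<bullet> c i = \<kappa>" using rim_iff[OF assms(1)] assms(2) by auto
  have "(norm (perp i x))\<^sup>2 = s0\<^sup>2" using perp_norm[OF assms(1) x(1)] x(2) s0 by simp
  then have "norm (perp i x) = s0" using s0(1) power2_eq_iff_nonneg[of "norm (perp i x)" s0] by simp
  then show ?thesis using s0 x by (simp add: retr_def perp_def)
qed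

definition S' :: "(real ^ 3) set" where "S' = sphere 0 1 - c ` {..<n}"

definition idx :: "real ^ 3 \<Rightarrow> nat" where "idx x = (THE i. i < n \<and> x \<bullet> c i \<ge> \<kappa>)"

lemma idx_eq: "norm x = 1 \<Longrightarrow> i < n \<Longrightarrow> x \<bullet> c i \<ge> \<kappa> \<Longrightarrow> idx x = i"
  unfolding idx_def using cap_unique by (intro the_equality) auto

definition \<rho> :: "real ^ 3 \<Rightarrow> real ^ 3" where "\<rho> x = (if x \<in> P then x else retr (idx x) x)"

lemma \<rho>_cap: "norm x = 1 \<Longrightarrow> i < n \<Longrightarrow> x \<bullet> c i \<ge> \<kappa> \<Longrightarrow> \<rho> x = retr i x"
proof -
  assume a: "norm x = 1" "i < n" "x \<bullet> c i \<ge> \<kappa>"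
  show ?thesis
  proof (cases "x \<in> P")
    case True
    then have "x \<bullet> c i = \<kappa>" using a P_iff by force
    then have "x \<in> rim i" using a rim_iff by blast
    then show ?thesis using True retr_id[OF a(2)] by (simp add: \<rho>_def)
  next
    case False then show ?thesis using idx_eq[OF a] by (simp add: \<rho>_def)
  qed
qed

lemma not_P: "norm x = 1 \<Longrightarrow> x \<notin> P \<Longrightarrow> \<exists>i<n. x \<bullet> c i > \<kappa>"
  using P_iff by force

lemma \<rho>_in_P: "x \<in> S' \<Longrightarrow> \<rho> x \<in> P"
proof -
  assume x: "x \<in> S'"
  show ?thesis
  proof (cases "x \<in> P")
    case True then show ?thesis by (simp add: \<rho>_def)
  next
    case False
    have nx: "norm x = 1" using x by (simp add: S'_def)
    obtain i where i: "i < n" "x \<bullet> c i > \<kappa>" using not_P[OF nx False] by blast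
    moreover have "x \<noteq> c i" using x i by (auto simp: S'_def)
    ultimately have "retr i x \<in> rim i" using retr_rim nx by auto
    then show ?thesis using \<rho>_cap[OF nx i(1)] i rim_sub by auto
  qed
qed

lemma continuous_\<rho>: "continuous_map (top_of_set S') (top_of_set P) \<rho>"
proof -
  have "continuous_map (top_of_set S') euclidean \<rho>"
  \<comment> \<open>Index \<open>n\<close> stands for \<open>P\<close>, the indices below
    \<open>n\<close> for the closed caps.\<close>
  proof (rule pasting_lemma_closed[of "{..n}" _ "\<lambda>i. if i = n then P else {x \<in> S'. x \<bullet> c i \<ge> \<kappa>}" _ "\<lambda>i. if i = n then (\<lambda>x. x) else retr i"])
    show "finite {..n}" by simp
    fix i assume i: "i \<in> {..n}"
    show "closedin (top_of_set S') (if i = n then P else {x \<in> S'. x \<bullet> c i \<ge> \<kappa>})"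
    proof (cases "i = n")
      case True
      have "P \<subseteq> S'"
      proof
        fix x assume x: "x \<in> P"
        have "x \<noteq> c j" if "j < n" for j
          using x that c_inner[OF that] \<kappa>_bounds P_iff[of x] by force
        then show "x \<in> S'" using x P_iff by (auto simp: S'_def)
      qed
      then show ?thesis using True compact_P compact_imp_closed closed_subset by auto
    next
      case False
      have "{x \<in> S'. x \<bullet> c i \<ge> \<kappa>} = S' \<inter> {x. x \<bullet> c i \<ge> \<kappa>}" by auto
      moreover have "closed {x. x \<bullet> c i \<ge> \<kappa>}" by (intro closed_Collect_le continuous_intros)
      ultimately show ?thesis using False by (simp add: closedin_closed_Int)
    qed
    show "continuous_map (subtopology (top_of_set S') (if i = n then P else {x \<in> S'. x \<bullet> c i \<ge> \<kappa>})) euclidean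
       (if i = n then (\<lambda>x. x) else retr i)"
    proof (cases "i = n")
      case True then show ?thesis by (simp add: subtopology_subtopology)
    next
      case False
      then have i: "i < n" using i by simp
      have "continuous_on {x \<in> S'. x \<bullet> c i \<ge> \<kappa>} (retr i)"
        unfolding retr_def perp_def
      proof (intro continuous_intros ballI)
        fix x assume "x \<in> {x \<in> S'. x \<bullet> c i \<ge> \<kappa>}"
        then show "norm (x - (x \<bullet> c i) *\<^sub>R c i) \<noteq> 0"
          using perp_ne[OF i, of x] i by (auto simp: S'_def perp_def)
      qed
      moreover have "S' \<inter> {x \<in> S'. \<kappa> \<le> x \<bullet> c i} = {x \<in> S'. \<kappa> \<le> x \<bullet> c i}" by auto
      ultimately show ?thesis using False by (simp add: subtopology_subtopology)
    qed
  next
    fix i j x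
    assume ij: "i \<in> {..n}" "j \<in> {..n}"
      and x: "x \<in> topspace (top_of_set S') \<inter> (if i = n then P else {x \<in> S'. x \<bullet> c i \<ge> \<kappa>}) \<inter> (if j = n then P else {x \<in> S'. x \<bullet> c j \<ge> \<kappa>})"
    have nx: "norm x = 1" using x by (simp add: S'_def)
    have "(if i = n then (\<lambda>x. x) else retr i) x = \<rho> x" if "i \<in> {..n}" "x \<in> (if i = n then P else {x \<in> S'. x \<bullet> c i \<ge> \<kappa>})" for i
      using that \<rho>_cap[OF nx, of i] by (auto simp: \<rho>_def split: if_splits)
    from this[OF ij(1) IntD2[OF IntD1[OF x]]] this[OF ij(2) IntD2[OF x]]
    show "(if i = n then (\<lambda>x. x) else retr i) x = (if j = n then (\<lambda>x. x) else retr j) x"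
      by (rule trans[OF _ sym])
  next
    fix x assume x: "x \<in> topspace (top_of_set S')"
    have nx: "norm x = 1" using x by (simp add: S'_def)
    show "\<exists>j. j \<in> {..n} \<and> x \<in> (if j = n then P else {x \<in> S'. x \<bullet> c j \<ge> \<kappa>}) \<and> \<rho> x = (if j = n then (\<lambda>x. x) else retr j) x"
    proof (cases "x \<in> P")
      case True then show ?thesis by (intro exI[of _ n]) (simp add: \<rho>_def)
    next
      case False
      then obtain i where i: "i < n" "x \<bullet> c i > \<kappa>" using not_P nx by blast
      then show ?thesis using x \<rho>_cap[OF nx i(1)] by (intro exI[of _ i]) auto
    qed
  qed
  then show ?thesis using \<rho>_in_P by (auto simp: continuous_map_in_subtopology)
qed

text \<open>The sections over the rims allow the covering to be extended over the caps to the whole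
  sphere, where \<open>sec_sphere\<close> provides a section; its restriction to \<open>P\<close> is
  the desired one.\<close>

lemma sec_holed:
  assumes T: "loc_sys (top_of_set P) T" and rims: "\<And>i. i < n \<Longrightarrow> \<exists>\<sigma>. sec (top_of_set (rim i)) T \<sigma>"
  shows "\<exists>\<sigma>. sec (top_of_set P) T \<sigma>"
proof -
  obtain s where s: "\<And>i. i < n \<Longrightarrow> sec (top_of_set (rim i)) T (s i)" using rims by metis
  define cp where "cp x = (\<exists>i<n. x \<bullet> c i > \<kappa>)" for x
  \<comment> \<open>Over an open cap the sheets are relabelled by the rim section, pulled back along
    \<open>\<rho>\<close>; elsewhere \<open>gg\<close> is False. In the new labels the covering is
    constant over a cap, so \<open>T'\<close> is False for two points of one open cap, including the
    centre, where \<open>\<rho>\<close> has no meaning.\<close>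
  define gg where "gg x = (cp x \<and> s (idx x) (\<rho> x))" for x
  define T' where "T' x y = ((\<not> (\<exists>i<n. x \<bullet> c i > \<kappa> \<and> y \<bullet> c i > \<kappa>)) \<and> ((gg x \<noteq> T (\<rho> x) (\<rho> y)) \<noteq> gg y))" for x y
  let ?S = "sphere (0 :: real ^ 3) 1"
  have cpP: "cp x \<longleftrightarrow> x \<notin> P" if "norm x = 1" for x
    using that P_iff unfolding cp_def by (metis not_le)
  have opS': "openin (top_of_set ?S) S'"
    unfolding S'_def by (intro openin_diff) (auto intro!: closed_subset finite_imp_closed c_unit)
  have pre: "openin (top_of_set ?S) {z \<in> S'. \<rho> z \<in> N}" if "openin (top_of_set P) N" for N
  proof -
    have "openin (top_of_set S') {z \<in> topspace (top_of_set S'). \<rho> z \<in> N}"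
      by (rule openin_continuous_map_preimage[OF continuous_\<rho> that])
    then show ?thesis using opS' openin_trans by auto
  qed
  have opcap: "openin (top_of_set ?S) {y \<in> ?S. y \<bullet> c i > \<kappa>}" for i
  proof -
    have "open {y. y \<bullet> c i > \<kappa>}" by (intro open_Collect_less continuous_intros)
    moreover have "{y \<in> ?S. y \<bullet> c i > \<kappa>} = ?S \<inter> {y. y \<bullet> c i > \<kappa>}" by auto
    ultimately show ?thesis by (metis openin_open_Int)
  qed
  have "loc_sys (top_of_set ?S) T'"
    unfolding loc_sys_def
  proof
    fix x assume "x \<in> topspace (top_of_set ?S)"
    then have nx: "norm x = 1" by simp
    show "\<exists>N. openin (top_of_set ?S) N \<and> x \<in> N \<and> (\<forall>y\<in>N. \<exists>N'. openin (top_of_set ?S) N' \<and> y \<in> N' \<and>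
       (\<forall>z\<in>N'. T' x z = (T' x y \<noteq> T' y z)))"
    proof (cases "cp x")
      case True
      then obtain i where i: "i < n" "x \<bullet> c i > \<kappa>" by (auto simp: cp_def)
      let ?N = "{y \<in> ?S. y \<bullet> c i > \<kappa>}"
      have F: "\<not> T' y z" if "y \<in> ?N" "z \<in> ?N" for y z
        using that i(1) unfolding T'_def by blast
      have "x \<in> ?N" using i nx by simp
      then have "\<forall>y\<in>?N. y \<in> ?N \<and> (\<forall>z\<in>?N. T' x z = (T' x y \<noteq> T' y z))" using F by blast
      then show ?thesis using opcap[of i] \<open>x \<in> ?N\<close> by blast
    next
      case False
      then have xP: "x \<in> P" using cpP nx by blast
      have xS': "x \<in> S'"
      proof -
        have "x \<noteq> c j" if "j < n" for j using xP that c_inner[OF that] \<kappa>_bounds P_iff[of x] by force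
        then show ?thesis using nx by (auto simp: S'_def)
      qed
      have \<rho>x: "\<rho> x = x" using xP by (simp add: \<rho>_def)
      have T'x: "T' x y = (T x (\<rho> y) \<noteq> gg y)" for y
        using False unfolding T'_def \<rho>x gg_def cp_def by blast
      have "x \<in> topspace (top_of_set P)" using xP by simp
      then obtain N0 where N0: "openin (top_of_set P) N0" "x \<in> N0"
        "\<forall>y\<in>N0. \<exists>N'. openin (top_of_set P) N' \<and> y \<in> N' \<and> (\<forall>z\<in>N'. T x z = (T x y \<noteq> T y z))"
        by (rule loc_sysD[OF T])
      let ?N = "{z \<in> S'. \<rho> z \<in> N0}"
      have "\<exists>N'. openin (top_of_set ?S) N' \<and> y \<in> N' \<and> (\<forall>z\<in>N'. T' x z = (T' x y \<noteq> T' y z))"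
        if y: "y \<in> ?N" for y
      proof -
        have ny: "norm y = 1" using y by (simp add: S'_def)
        obtain N1 where N1: "openin (top_of_set P) N1" "\<rho> y \<in> N1" "\<forall>z\<in>N1. T x z = (T x (\<rho> y) \<noteq> T (\<rho> y) z)"
          using N0(3) y by blast
        let ?N1 = "{z \<in> S'. \<rho> z \<in> N1}"
        show ?thesis
        proof (cases "cp y")
          case False
          have T'y: "T' y z = (T (\<rho> y) (\<rho> z) \<noteq> gg z)" for z
            using False unfolding T'_def gg_def cp_def by blast
          have "\<not> gg y" using False by (simp add: gg_def)
          then have "T' x z = (T' x y \<noteq> T' y z)" if "z \<in> ?N1" for z
            using N1(3) that unfolding T'x T'y by blast
          then show ?thesis using pre[OF N1(1)] y N1(2) by (intro exI[of _ ?N1]) blast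
        next
          case True
          then obtain i where i: "i < n" "y \<bullet> c i > \<kappa>" by (auto simp: cp_def)
          have capi: "\<rho> z \<in> rim i \<and> idx z = i \<and> cp z" if "z \<in> S'" "z \<bullet> c i > \<kappa>" for z
          proof -
            have "norm z = 1" "z \<noteq> c i" using that i by (auto simp: S'_def)
            then show ?thesis using retr_rim[OF i(1)] \<rho>_cap[OF _ i(1)] idx_eq[OF _ i(1)] that i(1)
              by (auto simp: cp_def)
          qed
          have y': "\<rho> y \<in> rim i" "idx y = i" using capi y i by auto
          then have "\<rho> y \<in> topspace (top_of_set (rim i))" by simp
          then obtain R0 where R0: "openin (top_of_set (rim i)) R0" "\<rho> y \<in> R0" "\<forall>z\<in>R0. s i z = (s i (\<rho> y) \<noteq> T (\<rho> y) z)"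
            by (rule secD[OF s[OF i(1)]])
          obtain W where W: "open W" "R0 = rim i \<inter> W" using R0(1) by (auto simp: openin_open)
          have oW: "openin (top_of_set P) (P \<inter> W)" using W by blast
          let ?N2 = "?N1 \<inter> {z \<in> S'. \<rho> z \<in> P \<inter> W} \<inter> {z \<in> ?S. z \<bullet> c i > \<kappa>}"
          have "openin (top_of_set ?S) ?N2" using pre[OF N1(1)] pre[OF oW] opcap[of i] by blast
          moreover have "y \<in> ?N2" using y N1(2) R0(2) W i ny \<rho>_in_P[of y] by auto
          moreover have "T' x z = (T' x y \<noteq> T' y z)" if z: "z \<in> ?N2" for z
          proof -
            have F: "\<not> T' y z" using z i unfolding T'_def by blast
            have zr: "\<rho> z \<in> rim i" "idx z = i" "cp z" using capi[of z] z by blast+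
            then have "\<rho> z \<in> R0" using z W by blast
            then have a: "s i (\<rho> z) = (s i (\<rho> y) \<noteq> T (\<rho> y) (\<rho> z))" using R0(3) by blast
            have b: "T x (\<rho> z) = (T x (\<rho> y) \<noteq> T (\<rho> y) (\<rho> z))" using N1(3) z by blast
            have "gg z = s i (\<rho> z)" "gg y = s i (\<rho> y)" using zr y' True by (auto simp: gg_def)
            then show ?thesis using F a b unfolding T'x by blast
          qed
          ultimately show ?thesis by blast
        qed
      qed
      then show ?thesis using pre[OF N0(1)] xS' N0(2) \<rho>x by (intro exI[of _ ?N]) (auto simp del: not_iff)
    qed
  qed
  then obtain \<sigma> where "sec (top_of_set ?S) T' \<sigma>" using sec_sphere by blast
  then have "sec (top_of_set P) T' \<sigma>"
    by (rule sec_top_of_subset) (auto simp: P_iff)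
  then have "sec (top_of_set P) T \<sigma>"
  proof (rule sec_cong)
    fix x y assume "x \<in> topspace (top_of_set P)" "y \<in> topspace (top_of_set P)"
    then have xy: "x \<in> P" "y \<in> P" by auto
    then have "\<not> cp x" "\<not> cp y" using cpP P_iff by blast+
    then show "T x y = T' x y" using xy unfolding T'_def gg_def \<rho>_def cp_def by auto
  qed simp
  then show ?thesis by blast
qed

text \<open>An orthogonal map carries a standard horizontal circle to the rim. The last property,
  half a turn as antipodal map of the rim, serves the crosscaps.\<close>

lemma rim_param:
  assumes i: "i < n"
  obtains e :: "real \<Rightarrow> real ^ 3" where "continuous_on {0..1} e" "e ` {0..1} = rim i" "e 0 = e 1"
    "\<And>s t. s \<in> {0..1} \<Longrightarrow> t \<in> {0..1} \<Longrightarrow> e s = e t \<Longrightarrow> s = t \<or> (s = 0 \<and> t = 1) \<or> (s = 1 \<and> t = 0)"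
    "\<And>t. e (t + 1/2) = (2 * \<kappa>) *\<^sub>R c i - e t"
proof -
  obtain F where F: "orthogonal_transformation F" "F (axis 3 1 :: real ^ 3) = c i"
    by (rule orthogonal_transformation_exists_1[of "axis 3 1 :: real ^ 3" "c i"]) (use c_unit[OF i] in auto)
  have lin: "linear F" and iso: "\<And>x y. F x \<bullet> F y = x \<bullet> y" using F by (auto simp: orthogonal_transformation_def)
  have surj: "surj F" using F orthogonal_transformation_surj by blast
  have inj: "inj F" using F orthogonal_transformation_inj by blast
  define v :: "real \<Rightarrow> real ^ 3" where "v t = vector [s0 * cos (2 * pi * t), s0 * sin (2 * pi * t), \<kappa>]" for t
  have vc: "v t $ 1 = s0 * cos (2 * pi * t)" "v t $ 2 = s0 * sin (2 * pi * t)" "v t $ 3 = \<kappa>" for t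
    by (simp_all add: v_def)
  define e where "e t = F (v t)" for t
  have "continuous_on {0..1} v" by (rule continuous_on_vec3) (auto simp: vc intro!: continuous_intros)
  then have cont: "continuous_on {0..1} e"
    unfolding e_def using lin linear_continuous_on_compose by blast
  have vn: "norm (v t) = 1" for t
  proof -
    have "(s0 * cos (2 * pi * t))\<^sup>2 + (s0 * sin (2 * pi * t))\<^sup>2 = s0\<^sup>2 * ((cos (2 * pi * t))\<^sup>2 + (sin (2 * pi * t))\<^sup>2)"
      by (simp only: power_mult_distrib distrib_left)
    then show ?thesis using s0 by (simp add: norm_vec3 vc)
  qed
  have Fn: "norm (F x) = norm x" for x using F(1) by (rule orthogonal_transformation_norm)
  have Fc: "F x \<bullet> c i = x $ 3" for x
    using iso[of x "axis 3 1"] F(2) by (simp add: inner_axis)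
  have im: "e ` {0..1} = rim i"
  proof
    show "e ` {0..1} \<subseteq> rim i"
    proof
      fix x assume "x \<in> e ` {0..1}"
      then obtain t where t: "x = F (v t)" by (auto simp: e_def)
      have "norm x = 1" "x \<bullet> c i = \<kappa>" using Fn[of "v t"] vn[of t] Fc[of "v t"] vc(3)[of t] unfolding t by simp_all
      then show "x \<in> rim i" using rim_iff[OF i] by blast
    qed
    show "rim i \<subseteq> e ` {0..1}"
    proof
      fix x assume x: "x \<in> rim i"
      obtain y where y: "x = F y" using surj by (metis surjD)
      have n: "norm y = 1" "y $ 3 = \<kappa>" using x rim_iff[OF i, of x] Fn[of y] Fc[of y] unfolding y by simp_all
      then have "(y $ 1)\<^sup>2 + (y $ 2)\<^sup>2 = s0\<^sup>2" using s0(2) by (simp add: norm_vec3)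
      then have "(y $ 1 / s0)\<^sup>2 + (y $ 2 / s0)\<^sup>2 = 1"
        using s0(1) by (simp add: power_divide add_divide_distrib[symmetric])
      then obtain t where t: "0 \<le> t" "t < 2 * pi" "y $ 1 / s0 = cos t" "y $ 2 / s0 = sin t"
        using sincos_total_2pi by metis
      have "v (t / (2 * pi)) = y"
        using s0(1) n t by (simp add: vec_eq_iff forall_3 vc field_simps)
      then show "x \<in> e ` {0..1}" using y t by (intro image_eqI[of _ _ "t / (2 * pi)"]) (auto simp: e_def)
    qed
  qed
  have e01: "e 0 = e 1" by (simp add: e_def v_def)
  have injp: "s = t \<or> (s = 0 \<and> t = 1) \<or> (s = 1 \<and> t = 0)" if st: "s \<in> {0..1}" "t \<in> {0..1}" "e s = e t" for s t
  proof -
    have eq: "v s = v t" using st(3) inj by (simp add: e_def inj_eq)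
    have "cos (2 * pi * s) = cos (2 * pi * t)" "sin (2 * pi * s) = sin (2 * pi * t)"
      using arg_cong[OF eq, of "\<lambda>v. v $ 1"] arg_cong[OF eq, of "\<lambda>v. v $ 2"] s0(1) by (auto simp: vc)
    then obtain m :: int where "2 * pi * s = 2 * pi * t + 2 * pi * m" using sin_cos_eq_iff by metis
    then have "2 * pi * (s - t) = 2 * pi * m" by (simp add: algebra_simps)
    then have bn: "s - t = m" by simp
    then have "real_of_int m \<le> 1" "real_of_int m \<ge> -1" using st by auto
    then have "m = 0 \<or> m = 1 \<or> m = -1" by auto
    then show ?thesis using bn st by auto
  qed
  have anti: "e (t + 1/2) = (2 * \<kappa>) *\<^sub>R c i - e t" for t
  proof -
    have "2 * pi * (t + 1/2) = 2 * pi * t + pi" by (simp add: algebra_simps)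
    then have "v (t + 1/2) = (2 * \<kappa>) *\<^sub>R axis 3 1 - v t"
      by (simp add: vec_eq_iff forall_3 vc axis_def)
    then show ?thesis unfolding e_def using lin F(2) by (simp add: linear_diff linear_scale)
  qed
  show ?thesis by (rule that[OF cont im e01 injp anti])
qed

lemma rim_connected: "i < n \<Longrightarrow> connected (rim i)"
  by (metis rim_param connected_Icc connected_continuous_image)

text \<open>Equal values of \<open>\<sigma>\<close> at 0 and 1 express trivial holonomy round the
  rim; the section then descends from the interval to the circle.\<close>

lemma sec_rim:
  assumes i: "i < n" and T: "loc_sys (top_of_set (rim i)) T"
    and e: "continuous_on {0..1::real} e" "e ` {0..1} = rim i" "e 0 = e 1"
    "\<And>s t. s \<in> {0..1} \<Longrightarrow> t \<in> {0..1} \<Longrightarrow> e s = e t \<Longrightarrow> s = t \<or> (s = 0 \<and> t = 1) \<or> (s = 1 \<and> t = 0)"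
    and s: "sec (top_of_set {0..1}) (\<lambda>x y. T (e x) (e y)) \<sigma>" "\<sigma> 0 = \<sigma> (1::real)"
  shows "\<exists>\<sigma>. sec (top_of_set (rim i)) T \<sigma>"
proof (rule sec_descend[OF _ T s(1)])
  show "quotient_map (top_of_set {0..1}) (top_of_set (rim i)) e"
  proof (rule T1_Spaces.continuous_imp_quotient_map)
    show "continuous_map (top_of_set {0..1}) (top_of_set (rim i)) e" using e(1,2) by auto
    show "compact_space (top_of_set {0..1::real})" by (simp add: compact_space_subtopology)
    show "Hausdorff_space (top_of_set (rim i))" by (simp add: Hausdorff_space_subtopology)
    show "e ` topspace (top_of_set {0..1}) = topspace (top_of_set (rim i))" using e by simp
  qed
  fix w w' :: real assume "w \<in> topspace (top_of_set {0..1})" "w' \<in> topspace (top_of_set {0..1})" "e w = e w'"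
  then show "\<sigma> w = \<sigma> w'" using e(4)[of w w'] s(2) by auto
qed

end

section \<open>Gluing the rims\<close>

text \<open>Handles and crosscaps are treated alike: each rim is identified with a rim (possibly itself)
  by the restriction of a linear isometric involution \<open>\<mu> i\<close> that maps the cap \<open>i\<close> to the cap \<open>\<pi> i\<close>.\<close>

locale glued_sphere = holed n c r for n c r +
  fixes M :: "'b topology" and f :: "real ^ 3 \<Rightarrow> 'b" and \<pi> :: "nat \<Rightarrow> nat" and \<mu> :: "nat \<Rightarrow> real ^ 3 \<Rightarrow> real ^ 3"
  assumes quot: "quotient_map (top_of_set P) M f"
    and \<pi>: "i < n \<Longrightarrow> \<pi> i < n"
    and \<mu>_orth: "i < n \<Longrightarrow> orthogonal_transformation (\<mu> i)"
    and \<mu>_inv: "i < n \<Longrightarrow> \<mu> i (\<mu> i x) = x"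
    and \<mu>_c: "i < n \<Longrightarrow> \<mu> i (c i) = c (\<pi> i)"
    and \<mu>_ne: "i < n \<Longrightarrow> x \<in> rim i \<Longrightarrow> \<mu> i x \<noteq> x"
    and fib: "x \<in> P \<Longrightarrow> y \<in> P \<Longrightarrow> f x = f y \<longleftrightarrow> x = y \<or> (\<exists>i<n. x \<in> rim i \<and> y = \<mu> i x)"
begin

lemma f_cont: "continuous_map (top_of_set P) M f"
  using quot quotient_imp_continuous_map by blast

lemma f_surj: "f ` P = topspace M"
  using quot by (simp add: quotient_map_def)

lemma \<mu>_inner: "i < n \<Longrightarrow> \<mu> i x \<bullet> \<mu> i y = x \<bullet> y"
  using \<mu>_orth by (simp add: orthogonal_transformation_def)

lemma \<mu>_inner_swap: "i < n \<Longrightarrow> \<mu> i x \<bullet> y = x \<bullet> \<mu> i y"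
  using \<mu>_inner[of i x "\<mu> i y"] \<mu>_inv[of i y] by simp

lemma \<mu>_norm: "i < n \<Longrightarrow> norm (\<mu> i x) = norm x"
  using \<mu>_orth orthogonal_transformation_norm by blast

lemma \<mu>_cap: "i < n \<Longrightarrow> \<mu> i x \<bullet> c (\<pi> i) = x \<bullet> c i"
  using \<mu>_inner[of i x "c i"] \<mu>_c[of i] by simp

lemma \<mu>_cap': "i < n \<Longrightarrow> \<mu> i x \<bullet> c i = x \<bullet> c (\<pi> i)"
  using \<mu>_inner_swap[of i x "c i"] \<mu>_c[of i] by simp

lemma \<mu>_rim: "i < n \<Longrightarrow> x \<in> rim i \<Longrightarrow> \<mu> i x \<in> rim (\<pi> i)"
  using rim_iff[of i x] rim_iff[of "\<pi> i" "\<mu> i x"] \<pi>[of i] \<mu>_norm[of i x] \<mu>_cap[of i x] by simp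

lemma \<mu>_lin: "i < n \<Longrightarrow> linear (\<mu> i)"
  using \<mu>_orth by (simp add: orthogonal_transformation_def)

lemma \<mu>_cont: "i < n \<Longrightarrow> continuous_on S (\<mu> i)"
  using \<mu>_lin by (simp add: linear_continuous_on linear_conv_bounded_linear)

lemma f_\<mu>: "i < n \<Longrightarrow> x \<in> rim i \<Longrightarrow> f (\<mu> i x) = f x"
proof -
  assume i: "i < n" and x: "x \<in> rim i"
  then have "x \<in> P" "\<mu> i x \<in> P" using rim_sub \<mu>_rim \<pi> by blast+
  then have "f x = f (\<mu> i x)" using fib i x by blast
  then show ?thesis by simp
qed

lemma M_compact: "compact_space M"
proof -
  have "compactin (top_of_set P) P" using compact_P by (simp add: compactin_subtopology)
  then have "compactin M (f ` P)" using f_cont image_compactin by blast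
  then show ?thesis using f_surj by (simp add: compact_space_def)
qed

text \<open>The saturation of a compact \<open>K\<close> adds the images of its finitely many
  intersections with rims under the maps \<open>\<mu> i\<close>, so it is compact and
  \<open>f\<close> is a closed map. A closed continuous image of a normal Hausdorff space is again
  Hausdorff.\<close>

lemma M_Hausdorff: "Hausdorff_space M"
proof -
  have cl: "closed_map (top_of_set P) M f"
    unfolding closed_map_def
  proof (intro allI impI)
    fix K assume K: "closedin (top_of_set P) K"
    then have KP: "K \<subseteq> P" using closedin_subset by fastforce
    have cK: "compact K" using K compact_P closedin_compact by blast
    let ?L = "K \<union> (\<Union>i\<in>{..<n}. \<mu> i ` (K \<inter> rim i))"
    have "compact (\<mu> i ` (K \<inter> rim i))" if "i < n" for i
    proof (rule compact_continuous_image[OF \<mu>_cont[OF that]])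
      have "rim i = P \<inter> {x. x \<bullet> c i = \<kappa>}" using rim_iff[OF that] rim_sub[OF that] P_iff by auto
      moreover have "closed {x. x \<bullet> c i = \<kappa>}" by (intro closed_Collect_eq continuous_intros)
      ultimately have "compact (rim i)" using compact_P by (simp add: compact_Int_closed)
      then show "compact (K \<inter> rim i)" using cK by (simp add: compact_Int)
    qed
    then have "compact ?L" using cK by (intro compact_Un compact_UN) auto
    moreover have eq: "{x \<in> topspace (top_of_set P). f x \<in> f ` K} = ?L"
    proof
      show "?L \<subseteq> {x \<in> topspace (top_of_set P). f x \<in> f ` K}"
      proof
        fix x assume "x \<in> ?L"
        then consider "x \<in> K" | i y where "i < n" "y \<in> K" "y \<in> rim i" "x = \<mu> i y" by blast
        then show "x \<in> {x \<in> topspace (top_of_set P). f x \<in> f ` K}"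
        proof cases
          case 1 then show ?thesis using KP by auto
        next
          case 2
          then have "x \<in> P" using \<mu>_rim rim_sub \<pi> by blast
          moreover have "f x = f y" using 2 f_\<mu> by simp
          ultimately show ?thesis using 2 by auto
        qed
      qed
      show "{x \<in> topspace (top_of_set P). f x \<in> f ` K} \<subseteq> ?L"
      proof
        fix x assume "x \<in> {x \<in> topspace (top_of_set P). f x \<in> f ` K}"
        then obtain y where "x \<in> P" "y \<in> K" "f y = f x" by auto
        then have "y = x \<or> (\<exists>i<n. y \<in> rim i \<and> x = \<mu> i y)" using fib KP by blast
        then show "x \<in> ?L" using \<open>y \<in> K\<close> by blast
      qed
    qed
    ultimately have "closedin (top_of_set P) {x \<in> topspace (top_of_set P). f x \<in> f ` K}"
      by (metis (no_types, lifting) closed_subset compact_imp_closed mem_Collect_eq subsetI topspace_euclidean_subtopology)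
    moreover have "f ` K \<subseteq> topspace M" using KP f_surj by blast
    ultimately show "closedin M (f ` K)" using quot by (simp add: quotient_map_closedin)
  qed
  have "compact_space (top_of_set P)" using compact_P by (simp add: compact_space_subtopology)
  moreover have "Hausdorff_space (top_of_set P)" by (simp add: Hausdorff_space_subtopology)
  ultimately have "normal_space (top_of_set P)" using compact_Hausdorff_or_regular_imp_normal_space by blast
  then show ?thesis
    using normal_Hausdorff_space_closed_continuous_map_image[OF _ _ cl f_cont] f_surj \<open>Hausdorff_space (top_of_set P)\<close> by simp
qed

section \<open>Charts of the glued sphere\<close>

text \<open>The frame is made for the projection along \<open>k\<close>, a chart of the open
  hemisphere around \<open>k\<close>, which contains \<open>w\<close>. In the coordinates given by
  \<open>a\<close> and \<open>b\<close> the point \<open>w\<close> then lies on the real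
  axis.\<close>

lemma frame:
  fixes a w :: "real ^ 3"
  assumes a: "norm a = 1" and w: "norm w = 1" "(w \<bullet> a)\<^sup>2 < 1"
  obtains b k where "a \<bullet> b = 0" "a \<bullet> k = 0" "b \<bullet> k = 0" "b \<bullet> b = 1" "k \<bullet> k = 1" "w \<bullet> b = 0" "w \<bullet> k > 0"
    "\<And>z. z = (z \<bullet> a) *\<^sub>R a + (z \<bullet> b) *\<^sub>R b + (z \<bullet> k) *\<^sub>R k"
proof -
  obtain F where F: "orthogonal_transformation F" "F (axis 1 1 :: real ^ 3) = a"
    by (rule orthogonal_transformation_exists_1[of "axis 1 1 :: real ^ 3" a]) (use a in auto)
  have lin: "linear F" and iso: "\<And>x y. F x \<bullet> F y = x \<bullet> y" using F by (auto simp: orthogonal_transformation_def)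
  have surj: "surj F" using F orthogonal_transformation_surj by blast
  obtain w' where w': "w = F w'" using surjD[OF surj, of w] by blast
  have Fa: "F x \<bullet> a = x $ 1" for x using iso[of x "axis 1 1"] F(2) by (simp add: inner_axis)
  have nw: "norm w' = 1" using w(1) w' F(1) orthogonal_transformation_norm by metis
  define s where "s = sqrt ((w' $ 2)\<^sup>2 + (w' $ 3)\<^sup>2)"
  have "(w' $ 1)\<^sup>2 < 1" using w(2) w' Fa by simp
  then have "(w' $ 2)\<^sup>2 + (w' $ 3)\<^sup>2 > 0" using nw by (simp add: norm_vec3)
  then have s: "s > 0" "s\<^sup>2 = (w' $ 2)\<^sup>2 + (w' $ 3)\<^sup>2" by (auto simp: s_def)
  define p where "p = w' $ 2 / s"
  define q where "q = w' $ 3 / s"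
  have pq: "p * p + q * q = 1"
  proof -
    have "p * p + q * q = ((w' $ 2)\<^sup>2 + (w' $ 3)\<^sup>2) / s\<^sup>2"
      by (simp add: p_def q_def power2_eq_square add_divide_distrib)
    then show ?thesis using s(1) unfolding s(2)[symmetric] by simp
  qed
  define b' :: "real ^ 3" where "b' = vector [0, - q, p]"
  define k' :: "real ^ 3" where "k' = vector [0, p, q]"
  have bk: "b' $ 1 = 0" "b' $ 2 = - q" "b' $ 3 = p" "k' $ 1 = 0" "k' $ 2 = p" "k' $ 3 = q"
    by (simp_all add: b'_def k'_def)
  have in3: "x \<bullet> y = x $ 1 * y $ 1 + x $ 2 * y $ 2 + x $ 3 * y $ 3" for x y :: "real ^ 3"
    by (simp add: inner_vec_def sum_3)
  have exp': "z = (z $ 1) *\<^sub>R axis 1 1 + (z \<bullet> b') *\<^sub>R b' + (z \<bullet> k') *\<^sub>R k'" for z :: "real ^ 3"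
  proof -
    have 2: "(z $ 2 * - q + z $ 3 * p) * - q + (z $ 2 * p + z $ 3 * q) * p = z $ 2 * (p * p + q * q)" by algebra
    have 3: "(z $ 2 * - q + z $ 3 * p) * p + (z $ 2 * p + z $ 3 * q) * q = z $ 3 * (p * p + q * q)" by algebra
    show ?thesis
      using 2 3 unfolding pq by (simp add: vec_eq_iff forall_3 in3 bk axis_def)
  qed
  have "w' \<bullet> b' = 0" using s(1) by (simp add: in3 bk p_def q_def)
  moreover have "w' \<bullet> k' > 0"
  proof -
    have "w' \<bullet> k' = ((w' $ 2)\<^sup>2 + (w' $ 3)\<^sup>2) / s"
      by (simp add: in3 bk p_def q_def power2_eq_square add_divide_distrib)
    also have "\<dots> = s" using s by (metis less_numeral_extra(3) nonzero_mult_div_cancel_left power2_eq_square)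
    finally show ?thesis using s by simp
  qed
  moreover have "F z = (F z \<bullet> a) *\<^sub>R a + (F z \<bullet> F b') *\<^sub>R F b' + (F z \<bullet> F k') *\<^sub>R F k'" for z
  proof -
    have "F z = F ((z $ 1) *\<^sub>R axis 1 1 + (z \<bullet> b') *\<^sub>R b' + (z \<bullet> k') *\<^sub>R k')" using exp'[of z] by simp
    also have "\<dots> = (z $ 1) *\<^sub>R a + (z \<bullet> b') *\<^sub>R F b' + (z \<bullet> k') *\<^sub>R F k'"
      using lin F(2) by (simp add: linear_add linear_scale)
    finally show ?thesis unfolding iso Fa .
  qed
  then have "z = (z \<bullet> a) *\<^sub>R a + (z \<bullet> F b') *\<^sub>R F b' + (z \<bullet> F k') *\<^sub>R F k'" for z
    using surjD[OF surj, of z] by metis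
  moreover have "a \<bullet> F b' = 0" "a \<bullet> F k' = 0" using Fa bk by (simp_all add: inner_commute)
  moreover have "b' \<bullet> k' = 0" "b' \<bullet> b' = 1" "k' \<bullet> k' = 1" using pq by (simp_all add: in3 bk)
  ultimately show ?thesis using that[of "F b'" "F k'"] iso w' by simp
qed

text \<open>On the open unit disc \<open>X\<close> inverts the orthogonal projection of the
  hemisphere around \<open>k\<close> to the plane of \<open>a\<close> and \<open>b\<close>.\<close>

lemma sphere_coordinates:
  fixes a b k :: "real ^ 3" and X :: "complex \<Rightarrow> real ^ 3"
  assumes on: "a \<bullet> a = 1" "b \<bullet> b = 1" "k \<bullet> k = 1" "a \<bullet> b = 0" "a \<bullet> k = 0" "b \<bullet> k = 0"
    and exp: "\<And>z. z = (z \<bullet> a) *\<^sub>R a + (z \<bullet> b) *\<^sub>R b + (z \<bullet> k) *\<^sub>R k"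
    and X_def: "X = (\<lambda>d. Re d *\<^sub>R a + Im d *\<^sub>R b + sqrt (1 - (cmod d)\<^sup>2) *\<^sub>R k)"
  shows "X d \<bullet> a = Re d" "X d \<bullet> b = Im d" "X d \<bullet> k = sqrt (1 - (cmod d)\<^sup>2)"
    "cmod d < 1 \<Longrightarrow> norm (X d) = 1" "continuous_on D X"
    "norm z = 1 \<Longrightarrow> z \<bullet> k > 0 \<Longrightarrow> X (Complex (z \<bullet> a) (z \<bullet> b)) = z"
    "norm z = 1 \<Longrightarrow> z \<bullet> k > 0 \<Longrightarrow> cmod (Complex (z \<bullet> a) (z \<bullet> b)) < 1"
proof -
  have on': "b \<bullet> a = 0" "k \<bullet> a = 0" "k \<bullet> b = 0" using on by (simp_all add: inner_commute)
  show ia: "X d \<bullet> a = Re d" and ib: "X d \<bullet> b = Im d" and ik: "X d \<bullet> k = sqrt (1 - (cmod d)\<^sup>2)" for d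
    using on on' by (simp_all add: X_def inner_add_left)
  have sq: "z \<bullet> z = (z \<bullet> a)\<^sup>2 + (z \<bullet> b)\<^sup>2 + (z \<bullet> k)\<^sup>2" for z
  proof -
    have "z \<bullet> z = z \<bullet> ((z \<bullet> a) *\<^sub>R a + (z \<bullet> b) *\<^sub>R b + (z \<bullet> k) *\<^sub>R k)" using exp[of z] by simp
    then show ?thesis by (simp add: inner_add_right power2_eq_square)
  qed
  show "norm (X d) = 1" if "cmod d < 1"
  proof -
    have le: "(cmod d)\<^sup>2 \<le> 1" using that by (simp add: power_le_one)
    have "X d \<bullet> X d = (Re d)\<^sup>2 + (Im d)\<^sup>2 + (sqrt (1 - (cmod d)\<^sup>2))\<^sup>2" using sq[of "X d"] ia ib ik by simp
    also have "\<dots> = 1" using le by (simp add: cmod_power2)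
    finally show ?thesis by (simp add: norm_eq_1)
  qed
  show "continuous_on D X" unfolding X_def by (intro continuous_intros)
  assume z: "norm z = 1" "z \<bullet> k > 0"
  have 1: "1 = (z \<bullet> a)\<^sup>2 + (z \<bullet> b)\<^sup>2 + (z \<bullet> k)\<^sup>2" using sq[of z] z by (simp add: norm_eq_1)
  then have "sqrt (1 - (cmod (Complex (z \<bullet> a) (z \<bullet> b)))\<^sup>2) = z \<bullet> k"
    using z(2) by (simp add: cmod_power2 real_sqrt_unique)
  then show "X (Complex (z \<bullet> a) (z \<bullet> b)) = z" using exp[of z] by (simp add: X_def)
  have "(z \<bullet> k)\<^sup>2 > 0" using z(2) by simp
  then have "(cmod (Complex (z \<bullet> a) (z \<bullet> b)))\<^sup>2 < 1" using 1 unfolding cmod_power2 complex.sel by linarith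
  then show "cmod (Complex (z \<bullet> a) (z \<bullet> b)) < 1" by (simp add: abs_square_less_1[of "cmod _", simplified])
qed

lemma chart_of_open_map:
  fixes D :: "complex set"
  assumes D: "open D" and cont: "continuous_map (top_of_set D) M \<Theta>" and inj: "inj_on \<Theta> D"
    and op: "\<And>D'. open D' \<Longrightarrow> D' \<subseteq> D \<Longrightarrow> openin M (\<Theta> ` D')" and x: "x \<in> \<Theta> ` D"
  shows "\<exists>(D :: complex set) U \<phi>. open D \<and> openin M U \<and> x \<in> U \<and> homeomorphic_map (top_of_set D) (subtopology M U) \<phi>"
proof -
  have "open_map (top_of_set D) M \<Theta>"
    unfolding open_map_def using op D by (auto simp: openin_open_eq)
  then have "embedding_map (top_of_set D) M \<Theta>"
    using cont inj injective_open_imp_embedding_map by fastforce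
  then have "homeomorphic_map (top_of_set D) (subtopology M (\<Theta> ` D)) \<Theta>"
    by (simp add: embedding_map_def)
  moreover have "openin M (\<Theta> ` D)" using op[of D] D by simp
  ultimately show ?thesis using D x by (intro exI[of _ D] exI[of _ "\<Theta> ` D"] exI[of _ \<Theta>]) simp
qed

lemma quot_open: "U \<subseteq> topspace M \<Longrightarrow> openin (top_of_set P) {y \<in> P. f y \<in> U} \<Longrightarrow> openin M U"
  using quot unfolding quotient_map_def by simp

text \<open>Where all cap inequalities are strict the fibres of \<open>f\<close> are single points,
  so the hemisphere chart descends to \<open>M\<close>.\<close>

lemma chart_interior:
  assumes w: "w \<in> P" and nr: "\<And>i. i < n \<Longrightarrow> w \<bullet> c i < \<kappa>"
  shows "\<exists>(D :: complex set) U \<phi>. open D \<and> openin M U \<and> f w \<in> U \<and> homeomorphic_map (top_of_set D) (subtopology M U) \<phi>"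
proof -
  have nw: "norm w = 1" using w P_iff by blast
  \<comment> \<open>A coordinate axis will do: the squares of the three coordinates of
    \<open>w\<close> add up to 1, so they are not all at least 1.\<close>
  have "\<exists>a. norm a = 1 \<and> (w \<bullet> a)\<^sup>2 < 1"
  proof (rule ccontr)
    assume no: "\<not> ?thesis"
    have "(w $ j)\<^sup>2 \<ge> 1" for j
    proof -
      have "norm (axis j 1 :: real ^ 3) = 1" by simp
      then have "\<not> (w \<bullet> axis j 1)\<^sup>2 < 1" using no by blast
      then show ?thesis by (simp add: inner_axis)
    qed
    from this[of 1] this[of 2] this[of 3] show False using nw by (simp add: norm_vec3)
  qed
  then obtain a where a: "norm a = 1" "(w \<bullet> a)\<^sup>2 < 1" by blast
  obtain b k where fr: "a \<bullet> b = 0" "a \<bullet> k = 0" "b \<bullet> k = 0" "b \<bullet> b = 1" "k \<bullet> k = 1" "w \<bullet> b = 0" "w \<bullet> k > 0"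
    and exp: "\<And>z. z = (z \<bullet> a) *\<^sub>R a + (z \<bullet> b) *\<^sub>R b + (z \<bullet> k) *\<^sub>R k"
    by (rule frame[OF a(1) nw a(2)]) blast
  have aa: "a \<bullet> a = 1" using a by (simp add: norm_eq_1)
  define X where "X = (\<lambda>d::complex. Re d *\<^sub>R a + Im d *\<^sub>R b + sqrt (1 - (cmod d)\<^sup>2) *\<^sub>R k)"
  note sc = sphere_coordinates[OF aa fr(4,5,1,2,3) exp X_def]
  define d0 where "d0 = Complex (w \<bullet> a) (w \<bullet> b)"
  have Xd0: "X d0 = w" "cmod d0 < 1" using sc(6,7)[OF nw fr(7)] by (simp_all add: d0_def)
  define D where "D = {d. cmod d < 1} \<inter> (\<Inter>i\<in>{..<n}. {d. X d \<bullet> c i < \<kappa>})"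
  have oD: "open D" unfolding D_def
    by (intro open_Int open_INT open_Collect_less continuous_intros sc(5) finite_lessThan ballI)
  have d0D: "d0 \<in> D" using Xd0 nr by (simp add: D_def)
  have XP: "X d \<in> P" if "d \<in> D" for d
    using that sc(4)[of d] P_iff[of "X d"] by (force simp: D_def)
  have fX: "f y = f (X d) \<longleftrightarrow> y = X d" if "y \<in> P" "d \<in> D" for y d
  proof -
    have "X d \<notin> rim i" if "i < n" for i using \<open>d \<in> D\<close> that rim_iff[OF that] by (force simp: D_def)
    then show ?thesis using fib[OF XP[OF that(2)] that(1)] by metis
  qed
  show ?thesis
  proof (rule chart_of_open_map[OF oD, of "f \<circ> X"])
    have "continuous_map (top_of_set D) (top_of_set P) X" using sc(5) XP by auto
    then show "continuous_map (top_of_set D) M (f \<circ> X)" using f_cont continuous_map_compose by blast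
    show "inj_on (f \<circ> X) D"
    proof (rule inj_onI)
      fix d d' assume d: "d \<in> D" "d' \<in> D" "(f \<circ> X) d = (f \<circ> X) d'"
      then have "X d = X d'" using fX[OF XP[OF d(1)] d(2)] by simp
      then have "Re d = Re d'" "Im d = Im d'" using sc(1,2) by metis+
      then show "d = d'" by (simp add: complex_eq_iff)
    qed
    show "f w \<in> (f \<circ> X) ` D" using d0D Xd0 by force
    fix D' assume D': "open D'" "D' \<subseteq> D"
    show "openin M ((f \<circ> X) ` D')"
    proof (rule quot_open)
      show "(f \<circ> X) ` D' \<subseteq> topspace M" using XP D' f_surj by auto
      have "{y \<in> P. f y \<in> (f \<circ> X) ` D'} = P \<inter> ({y. y \<bullet> k > 0} \<inter> (\<lambda>y. Complex (y \<bullet> a) (y \<bullet> b)) -` D')"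
      proof (intro equalityI subsetI)
        fix y assume "y \<in> {y \<in> P. f y \<in> (f \<circ> X) ` D'}"
        then obtain d where d: "y \<in> P" "d \<in> D'" "f y = f (X d)" by auto
        then have y: "y = X d" using fX D' by blast
        have "(cmod d)\<^sup>2 < 1" using d D' by (auto simp: D_def abs_square_less_1[of "cmod d", simplified])
        then have "y \<bullet> k > 0" using sc(3)[of d] y by simp
        moreover have "Complex (y \<bullet> a) (y \<bullet> b) = d" using sc(1,2) y by (simp add: complex_eq_iff)
        ultimately show "y \<in> P \<inter> ({y. y \<bullet> k > 0} \<inter> (\<lambda>y. Complex (y \<bullet> a) (y \<bullet> b)) -` D')" using d by simp
      next
        fix y assume y: "y \<in> P \<inter> ({y. y \<bullet> k > 0} \<inter> (\<lambda>y. Complex (y \<bullet> a) (y \<bullet> b)) -` D')"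
        then have "X (Complex (y \<bullet> a) (y \<bullet> b)) = y" using sc(6)[of y] P_iff by blast
        then have "f y = (f \<circ> X) (Complex (y \<bullet> a) (y \<bullet> b))" by simp
        then show "y \<in> {y \<in> P. f y \<in> (f \<circ> X) ` D'}" using y by blast
      qed
      moreover have "open ({y. y \<bullet> k > 0} \<inter> (\<lambda>y. Complex (y \<bullet> a) (y \<bullet> b)) -` D')"
        using D'(1) by (intro open_Int open_Collect_less open_vimage continuous_intros continuous_on_Complex) auto
      then have "openin (top_of_set P) (P \<inter> ({y. y \<bullet> k > 0} \<inter> (\<lambda>y. Complex (y \<bullet> a) (y \<bullet> b)) -` D'))"
        by (rule openin_open_Int)
      ultimately show "openin (top_of_set P) {y \<in> P. f y \<in> (f \<circ> X) ` D'}" by (simp only:)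
    qed
  qed
qed

text \<open>Two half discs are joined along the rim. With \<open>a = c j\<close> the rim is the line
  of real part \<open>\<kappa>\<close>. To its left \<open>X d\<close> already lies in
  \<open>P\<close>; to its right \<open>d\<close> is reflected back by \<open>R\<close> and
  \<open>\<mu> j\<close> carries the point to the part of \<open>P\<close> adjacent to rim
  \<open>\<pi> j\<close>.\<close>

lemma chart_rim:
  assumes j: "j < n" and w: "w \<in> rim j"
  shows "\<exists>(D :: complex set) U \<phi>. open D \<and> openin M U \<and> f w \<in> U \<and> homeomorphic_map (top_of_set D) (subtopology M U) \<phi>"
proof -
  define a where "a = c j"
  have nw: "norm w = 1" and wa: "w \<bullet> a = \<kappa>" using w rim_iff[OF j] by (auto simp: a_def)
  have a1: "norm a = 1" and aa: "a \<bullet> a = 1" using c_unit[OF j] c_inner[OF j] by (auto simp: a_def)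
  have k1: "(w \<bullet> a)\<^sup>2 < 1" using wa \<kappa>_bounds by simp
  obtain b k where fr: "a \<bullet> b = 0" "a \<bullet> k = 0" "b \<bullet> k = 0" "b \<bullet> b = 1" "k \<bullet> k = 1" "w \<bullet> b = 0" "w \<bullet> k > 0"
    and exp: "\<And>z. z = (z \<bullet> a) *\<^sub>R a + (z \<bullet> b) *\<^sub>R b + (z \<bullet> k) *\<^sub>R k"
    by (rule frame[OF a1 nw k1]) blast
  define X where "X = (\<lambda>d::complex. Re d *\<^sub>R a + Im d *\<^sub>R b + sqrt (1 - (cmod d)\<^sup>2) *\<^sub>R k)"
  note sc = sphere_coordinates[OF aa fr(4,5,1,2,3) exp X_def]
  define Y where "Y = (\<lambda>z. Complex (z \<bullet> a) (z \<bullet> b))"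
  define R where "R = (\<lambda>d::complex. Complex (2 * \<kappa> - Re d) (Im d))"
  let ?\<mu> = "\<mu> j"
  have RR: "R (R d) = d" for d by (simp add: R_def complex_eq_iff)
  have contR: "continuous_on S R" for S unfolding R_def by (intro continuous_intros continuous_on_Complex)
  define d0 where "d0 = Complex \<kappa> 0"
  have Xd0: "X d0 = w" "cmod d0 < 1" using sc(6,7)[OF nw fr(7)] fr(6) wa by (simp_all add: d0_def)
  have Rd0: "R d0 = d0" by (simp add: R_def d0_def)
  \<comment> \<open>Half the distance between \<open>w\<close> and its partner, so that on
    \<open>D\<close> no value of \<open>X\<close> is the partner of another one
    (\<open>sep\<close>).\<close>
  define \<delta> where "\<delta> = dist w (?\<mu> w) / 2"
  have \<delta>: "\<delta> > 0" using \<mu>_ne[OF j w] by (simp add: \<delta>_def)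
  define D1 where "D1 = {d. cmod d < 1} \<inter> {d. dist (X d) w < \<delta>} \<inter>
     ((\<Inter>i\<in>{..<n} - {j}. {d. X d \<bullet> c i < \<kappa>}) \<inter> (\<Inter>i\<in>{..<n} - {\<pi> j}. {d. ?\<mu> (X d) \<bullet> c i < \<kappa>}))"
  have \<mu>X: "continuous_on S (\<lambda>d. ?\<mu> (X d))" for S
    using continuous_on_compose[OF sc(5)[of S] \<mu>_cont[OF j]] by (simp add: o_def)
  have oD1: "open D1" unfolding D1_def
    by (intro open_Int open_INT open_Collect_less continuous_intros sc(5) \<mu>X ballI) auto
  define D where "D = D1 \<inter> R -` D1"
  have oD: "open D" unfolding D_def using oD1 contR by (intro open_Int open_vimage) auto
  have RD: "R d \<in> D" if "d \<in> D" for d using that RR by (simp add: D_def)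
  have "?\<mu> w \<in> rim (\<pi> j)" using \<mu>_rim[OF j w] .
  then have "d0 \<in> D1"
    using Xd0 \<delta> rim_other[OF j _ w] rim_other[OF \<pi>[OF j], of _ "?\<mu> w"] by (auto simp: D1_def)
  then have d0D: "d0 \<in> D" using Rd0 by (simp add: D_def)
  have D: "cmod d < 1" "norm (X d) = 1" "i < n \<Longrightarrow> i \<noteq> j \<Longrightarrow> X d \<bullet> c i < \<kappa>" "i < n \<Longrightarrow> i \<noteq> \<pi> j \<Longrightarrow> ?\<mu> (X d) \<bullet> c i < \<kappa>"
     "dist (X d) w < \<delta>" "X d \<bullet> k > 0" "Y (X d) = d" if "d \<in> D" for d i
  proof -
    show 1: "cmod d < 1" "i < n \<Longrightarrow> i \<noteq> j \<Longrightarrow> X d \<bullet> c i < \<kappa>" "i < n \<Longrightarrow> i \<noteq> \<pi> j \<Longrightarrow> ?\<mu> (X d) \<bullet> c i < \<kappa>" "dist (X d) w < \<delta>"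
      using that by (auto simp: D_def D1_def)
    show "norm (X d) = 1" using sc(4) 1 by blast
    have "(cmod d)\<^sup>2 < 1" using 1(1) by (simp add: abs_square_less_1[of "cmod d", simplified])
    then show "X d \<bullet> k > 0" using sc(3)[of d] by simp
    show "Y (X d) = d" using sc(1,2) by (simp add: Y_def complex_eq_iff)
  qed
  have sep: "X d \<noteq> ?\<mu> (X d')" if "d \<in> D" "d' \<in> D" for d d'
  proof
    assume eq: "X d = ?\<mu> (X d')"
    have "dist (?\<mu> (X d')) (?\<mu> w) = dist (X d') w"
      unfolding dist_norm using \<mu>_norm[OF j, of "X d' - w"] linear_diff[OF \<mu>_lin[OF j]] by simp
    then have "dist w (?\<mu> w) \<le> dist (X d) w + dist (X d') w"
      using dist_triangle[of w "?\<mu> w" "X d"] eq by (simp add: dist_commute)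
    then show False using D(5)[OF that(1)] D(5)[OF that(2)] by (simp add: \<delta>_def)
  qed
  have XP: "X d \<in> P" if d: "d \<in> D" "Re d \<le> \<kappa>" for d
  proof -
    have "X d \<bullet> c i \<le> \<kappa>" if "i < n" for i
      using D(3)[OF d(1) that] sc(1)[of d] d(2) by (cases "i = j") (auto simp: a_def)
    then show ?thesis using P_iff D(2)[OF d(1)] by blast
  qed
  have \<mu>XP: "?\<mu> (X (R d)) \<in> P" if d: "d \<in> D" "Re d \<ge> \<kappa>" for d
  proof -
    have "?\<mu> (X (R d)) \<bullet> c i \<le> \<kappa>" if "i < n" for i
      using D(4)[OF RD[OF d(1)] that] sc(1)[of "R d"] d(2) \<mu>_cap[OF j, of "X (R d)"]
      by (cases "i = \<pi> j") (auto simp: a_def R_def)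
    then show ?thesis using P_iff D(2)[OF RD[OF d(1)]] \<mu>_norm[OF j] by metis
  qed
  have rimj: "X d \<in> rim j" if "d \<in> D" "Re d = \<kappa>" for d
    using rim_iff[OF j, of "X d"] D(2)[OF that(1)] sc(1)[of d] that(2) by (simp add: a_def)
  define \<Theta> where "\<Theta> d = (if Re d \<le> \<kappa> then f (X d) else f (?\<mu> (X (R d))))" for d
  have \<Theta>_hi: "\<Theta> d = f (?\<mu> (X (R d)))" if d: "d \<in> D" "Re d \<ge> \<kappa>" for d
  proof (cases "Re d = \<kappa>")
    case True
    then have "R d = d" by (simp add: R_def complex_eq_iff)
    then show ?thesis using f_\<mu>[OF j rimj[OF d(1) True]] True by (simp add: \<Theta>_def)
  qed (use d in \<open>auto simp: \<Theta>_def\<close>)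
  \<comment> \<open>Both halves of the chart at once. For \<open>d\<close> ranging over an open set
    the right side is an open condition on \<open>y\<close>, whence \<open>\<Theta>\<close> is open;
    with \<open>sep\<close> it also yields injectivity.\<close>
  have char: "f y = \<Theta> d \<longleftrightarrow> (y \<bullet> k > 0 \<and> Y y = d) \<or> (?\<mu> y \<bullet> k > 0 \<and> R (Y (?\<mu> y)) = d)"
    if y: "y \<in> P" and d: "d \<in> D" for y d
  proof
    assume eq: "f y = \<Theta> d"
    show "(y \<bullet> k > 0 \<and> Y y = d) \<or> (?\<mu> y \<bullet> k > 0 \<and> R (Y (?\<mu> y)) = d)"
    proof (cases "Re d \<le> \<kappa>")
      case True
      then have "f (X d) = f y" using eq by (simp add: \<Theta>_def)
      then have "X d = y \<or> (\<exists>i<n. X d \<in> rim i \<and> y = \<mu> i (X d))" using fib[OF XP[OF d True] y] by blast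
      then show ?thesis
      proof
        assume "X d = y" then show ?thesis using D(6,7)[OF d] by blast
      next
        assume "\<exists>i<n. X d \<in> rim i \<and> y = \<mu> i (X d)"
        then obtain i where i: "i < n" "X d \<in> rim i" "y = \<mu> i (X d)" by blast
        have "i = j"
        proof (rule ccontr)
          assume "i \<noteq> j"
          then show False using D(3)[OF d i(1)] rim_iff[OF i(1)] i(2) by auto
        qed
        then have "?\<mu> y = X d" using i \<mu>_inv[OF j] by simp
        moreover have "Re d = \<kappa>" using i(2) \<open>i = j\<close> rim_iff[OF j] sc(1)[of d] by (simp add: a_def)
        then have "R d = d" by (simp add: R_def complex_eq_iff)
        ultimately show ?thesis using D(6,7)[OF d] by simp
      qed
    next
      case False
      then have hi: "Re d \<ge> \<kappa>" by simp
      let ?q = "?\<mu> (X (R d))"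
      have "f ?q = f y" using eq \<Theta>_hi[OF d hi] by simp
      moreover have "?q \<notin> rim i" if "i < n" for i
      proof (cases "i = \<pi> j")
        case True
        have "?q \<bullet> c (\<pi> j) = X (R d) \<bullet> a" using \<mu>_cap[OF j] by (simp add: a_def)
        also have "\<dots> = 2 * \<kappa> - Re d" using sc(1)[of "R d"] by (simp add: R_def)
        finally show ?thesis using False True rim_iff[OF that] by auto
      next
        case False
        then show ?thesis using D(4)[OF RD[OF d] that] rim_iff[OF that] by auto
      qed
      ultimately have "?q = y" using fib[OF \<mu>XP[OF d hi] y] by blast
      then have "?\<mu> y = X (R d)" using \<mu>_inv[OF j] by metis
      then show ?thesis using D(6,7)[OF RD[OF d]] RR by simp
    qed
  next
    assume "(y \<bullet> k > 0 \<and> Y y = d) \<or> (?\<mu> y \<bullet> k > 0 \<and> R (Y (?\<mu> y)) = d)"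
    then show "f y = \<Theta> d"
    proof
      assume a: "y \<bullet> k > 0 \<and> Y y = d"
      then have "X d = y" using sc(6)[of y] y P_iff by (auto simp: Y_def)
      moreover have "Re d \<le> \<kappa>" using a y P_iff j by (auto simp: Y_def a_def)
      ultimately show ?thesis by (simp add: \<Theta>_def)
    next
      assume a: "?\<mu> y \<bullet> k > 0 \<and> R (Y (?\<mu> y)) = d"
      have "norm (?\<mu> y) = 1" using y P_iff \<mu>_norm[OF j] by metis
      then have "X (Y (?\<mu> y)) = ?\<mu> y" using sc(6) a by (simp add: Y_def)
      moreover have Rd: "R d = Y (?\<mu> y)" using a RR by metis
      ultimately have "?\<mu> (X (R d)) = y" using \<mu>_inv[OF j] by simp
      moreover have "Re d \<ge> \<kappa>"
      proof -
        have "?\<mu> y \<bullet> c j = y \<bullet> c (\<pi> j)" using \<mu>_cap'[OF j] .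
        also have "\<dots> \<le> \<kappa>" using y P_iff \<pi>[OF j] by blast
        finally have "Re (R d) \<le> \<kappa>" using Rd by (simp add: Y_def a_def)
        then show ?thesis by (simp add: R_def)
      qed
      ultimately show ?thesis using \<Theta>_hi[OF d] by simp
    qed
  qed
  show ?thesis
  proof (rule chart_of_open_map[OF oD, of \<Theta>])
    have contX: "continuous_map (top_of_set {d\<in>D. Re d \<le> \<kappa>}) M (\<lambda>d. f (X d))"
    proof -
      have "continuous_map (top_of_set {d\<in>D. Re d \<le> \<kappa>}) (top_of_set P) X" using sc(5) XP by auto
      from continuous_map_compose[OF this f_cont] show ?thesis by (simp add: o_def)
    qed
    have cont\<mu>: "continuous_map (top_of_set {d\<in>D. \<kappa> \<le> Re d}) M (\<lambda>d. f (?\<mu> (X (R d))))"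
    proof -
      have "continuous_on {d\<in>D. \<kappa> \<le> Re d} (\<lambda>d. ?\<mu> (X (R d)))"
        using continuous_on_compose[OF contR \<mu>X] by (simp add: o_def)
      then have "continuous_map (top_of_set {d\<in>D. \<kappa> \<le> Re d}) (top_of_set P) (\<lambda>d. ?\<mu> (X (R d)))" using \<mu>XP by auto
      from continuous_map_compose[OF this f_cont] show ?thesis by (simp add: o_def)
    qed
    show "continuous_map (top_of_set D) M \<Theta>"
      unfolding \<Theta>_def
    proof (rule continuous_map_cases_le)
      have "D \<inter> {d \<in> D. Re d \<le> \<kappa>} = {d \<in> D. Re d \<le> \<kappa>}" "D \<inter> {d \<in> D. \<kappa> \<le> Re d} = {d \<in> D. \<kappa> \<le> Re d}" by auto
      then show "continuous_map (subtopology (top_of_set D) {x \<in> topspace (top_of_set D). Re x \<le> \<kappa>}) M (\<lambda>d. f (X d))"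
        "continuous_map (subtopology (top_of_set D) {x \<in> topspace (top_of_set D). \<kappa> \<le> Re x}) M (\<lambda>d. f (?\<mu> (X (R d))))"
        using contX cont\<mu> by (simp_all add: subtopology_subtopology)
      fix d assume "d \<in> topspace (top_of_set D)" "Re d = \<kappa>"
      then show "f (X d) = f (?\<mu> (X (R d)))" using \<Theta>_hi[of d] by (simp add: \<Theta>_def)
    qed (auto intro!: continuous_intros)
    have rep: "\<exists>y\<in>P. (y = X d \<or> y = ?\<mu> (X (R d))) \<and> f y = \<Theta> d" if "d \<in> D" for d
      using XP[OF that] \<mu>XP[OF that] \<Theta>_hi[OF that] by (cases "Re d \<le> \<kappa>") (auto simp: \<Theta>_def)
    show "inj_on \<Theta> D"
    proof (rule inj_onI)
      fix d d' assume d: "d \<in> D" "d' \<in> D" "\<Theta> d = \<Theta> d'"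
      obtain y where y: "y \<in> P" "y = X d \<or> y = ?\<mu> (X (R d))" "f y = \<Theta> d" using rep[OF d(1)] by blast
      have f': "(y \<bullet> k > 0 \<and> Y y = d') \<or> (?\<mu> y \<bullet> k > 0 \<and> R (Y (?\<mu> y)) = d')" using char[OF y(1) d(2)] y(3) d(3) by simp
      have ny: "norm y = 1" using y P_iff by blast
      have nmy: "norm (?\<mu> y) = 1" using ny \<mu>_norm[OF j] by simp
      from y(2) show "d = d'"
      proof
        assume yX: "y = X d"
        from f' show ?thesis
        proof
          assume "?\<mu> y \<bullet> k > 0 \<and> R (Y (?\<mu> y)) = d'"
          then have "?\<mu> y = X (R d')" using sc(6)[OF nmy] RR by (metis Y_def)
          then have "X d = ?\<mu> (X (R d'))" using yX \<mu>_inv[OF j] by metis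
          then show ?thesis using sep[OF d(1) RD[OF d(2)]] by blast
        qed (use yX D(7)[OF d(1)] in simp)
      next
        assume yX: "y = ?\<mu> (X (R d))"
        from f' show ?thesis
        proof
          assume "y \<bullet> k > 0 \<and> Y y = d'"
          then have "X d' = ?\<mu> (X (R d))" using sc(6)[OF ny] yX by (metis Y_def)
          then show ?thesis using sep[OF d(2) RD[OF d(1)]] by blast
        next
          assume "?\<mu> y \<bullet> k > 0 \<and> R (Y (?\<mu> y)) = d'"
          moreover have "?\<mu> y = X (R d)" using yX \<mu>_inv[OF j] by simp
          ultimately show ?thesis using D(7)[OF RD[OF d(1)]] RR by simp
        qed
      qed
    qed
    have "\<Theta> d0 = f w" using Xd0 by (simp add: \<Theta>_def d0_def)
    then show "f w \<in> \<Theta> ` D" using d0D by (metis image_eqI)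
    fix D' assume D': "open D'" "D' \<subseteq> D"
    show "openin M (\<Theta> ` D')"
    proof (rule quot_open)
      show "\<Theta> ` D' \<subseteq> topspace M"
      proof
        fix u assume "u \<in> \<Theta> ` D'"
        then obtain d where d: "d \<in> D" "u = \<Theta> d" using D' by blast
        then obtain y where "y \<in> P" "f y = u" using rep[OF d(1)] by blast
        then show "u \<in> topspace M" using f_surj by blast
      qed
      let ?U = "({y. y \<bullet> k > 0} \<inter> Y -` D') \<union> ({y. ?\<mu> y \<bullet> k > 0} \<inter> (\<lambda>y. R (Y (?\<mu> y))) -` D')"
      have "{y \<in> P. f y \<in> \<Theta> ` D'} = P \<inter> ?U"
      proof (intro equalityI subsetI)
        fix y assume "y \<in> {y \<in> P. f y \<in> \<Theta> ` D'}"
        then obtain d where "y \<in> P" "d \<in> D'" "f y = \<Theta> d" by blast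
        then show "y \<in> P \<inter> ?U" using char[of y d] D' by blast
      next
        fix y assume y: "y \<in> P \<inter> ?U"
        then consider "y \<bullet> k > 0" "Y y \<in> D'" | "?\<mu> y \<bullet> k > 0" "R (Y (?\<mu> y)) \<in> D'" by blast
        then show "y \<in> {y \<in> P. f y \<in> \<Theta> ` D'}"
        proof cases
          case 1 then show ?thesis using char[of y "Y y"] y D' by blast
        next
          case 2 then show ?thesis using char[of y "R (Y (?\<mu> y))"] y D' by blast
        qed
      qed
      moreover have "open ?U"
      proof -
        have cY: "continuous_on S Y" for S unfolding Y_def by (intro continuous_intros continuous_on_Complex)
        have "continuous_on UNIV (\<lambda>y. R (Y (?\<mu> y)))"
          using continuous_on_compose[OF continuous_on_compose[OF \<mu>_cont[OF j, of UNIV] cY] contR] by (simp add: o_def)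
        then show ?thesis
          using D'(1) cY[of UNIV] by (intro open_Un open_Int open_Collect_less open_vimage continuous_intros \<mu>_cont[OF j])
      qed
      then have "openin (top_of_set P) (P \<inter> ?U)" by (rule openin_open_Int)
      ultimately show "openin (top_of_set P) {y \<in> P. f y \<in> \<Theta> ` D'}" by (simp only:)
    qed
  qed
qed

lemma M_surface: "surface M"
proof
  show "Hausdorff_space M" by (rule M_Hausdorff)
  fix x assume "x \<in> topspace M"
  then obtain w where w: "w \<in> P" "x = f w" using f_surj by blast
  show "\<exists>(D :: complex set) U \<phi>. open D \<and> openin M U \<and> x \<in> U \<and> homeomorphic_map (top_of_set D) (subtopology M U) \<phi>"
  proof (cases "\<exists>j<n. w \<in> rim j")
    case True then show ?thesis using chart_rim w by blast
  next
    case False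
    have "w \<bullet> c i < \<kappa>" if "i < n" for i
      using w False P_iff rim_iff[OF that] that by (metis order_le_less)
    then show ?thesis using chart_interior w by blast
  qed
qed

text \<open>As \<open>f\<close> identifies \<open>x\<close> with \<open>\<mu> i x\<close>, both
  \<open>\<sigma>\<close> and its composition with \<open>\<mu> i\<close> are sections of one
  covering over the connected rim. So each gluing carries a single sign.\<close>

lemma sec_rim_sign:
  assumes s: "sec (top_of_set P) (\<lambda>x y. T (f x) (f y)) \<sigma>" and i: "i < n" and x: "x \<in> rim i" "y \<in> rim i"
  shows "(\<sigma> x \<noteq> \<sigma> (\<mu> i x)) = (\<sigma> y \<noteq> \<sigma> (\<mu> i y))"
proof -
  have s1: "sec (top_of_set (rim i)) (\<lambda>x y. T (f x) (f y)) \<sigma>" using s rim_sub[OF i] by (rule sec_top_of_subset)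
  have "continuous_map (top_of_set (rim i)) (top_of_set P) (\<mu> i)"
    using \<mu>_cont[OF i] \<mu>_rim[OF i] rim_sub[OF \<pi>[OF i]] by auto
  from sec_pull[OF s this] have "sec (top_of_set (rim i)) (\<lambda>x y. T (f x) (f y)) (\<lambda>x. \<sigma> (\<mu> i x))"
    by (rule sec_cong) (auto simp: f_\<mu>[OF i])
  moreover have "connectedin (top_of_set (rim i)) (rim i)"
    using rim_connected[OF i] by (simp add: connectedin_subtopology)
  ultimately show ?thesis using sec_diff_const[OF s1] x by blast
qed

lemma sec_to_M:
  assumes T: "loc_sys M T" and s: "sec (top_of_set P) (\<lambda>x y. T (f x) (f y)) \<sigma>"
    and inv: "\<And>i x. i < n \<Longrightarrow> x \<in> rim i \<Longrightarrow> \<sigma> (\<mu> i x) = \<sigma> x"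
  shows "\<exists>s. sec M T s"
proof (rule sec_descend[OF quot T s])
  fix w w' assume "w \<in> topspace (top_of_set P)" "w' \<in> topspace (top_of_set P)" "f w = f w'"
  then show "\<sigma> w = \<sigma> w'" using fib[of w w'] inv by auto
qed

lemma loc_sys_P: "loc_sys M T \<Longrightarrow> loc_sys (top_of_set P) (\<lambda>x y. T (f x) (f y))"
  using loc_sys_pull f_cont by blast

end

section \<open>Counting the invariants of double coverings\<close>

text \<open>The largest fibre is at least of average size. Passing to a fibre plays the part of
  passing to the kernel of a linear map over the two-element field.\<close>

lemma pigeonhole_fibre:
  assumes Z: "finite Z" "Z \<noteq> {}" and B: "finite B" "h ` Z \<subseteq> B"
  obtains K where "K \<subseteq> Z" "K \<noteq> {}" "card Z \<le> card B * card K" "\<And>x y. x \<in> K \<Longrightarrow> y \<in> K \<Longrightarrow> h x = h y"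
proof -
  let ?F = "\<lambda>b. {z\<in>Z. h z = b}"
  have "finite ((\<lambda>b. card (?F b)) ` h ` Z)" "(\<lambda>b. card (?F b)) ` h ` Z \<noteq> {}" using Z by auto
  then obtain b where b: "b \<in> h ` Z" "Max ((\<lambda>b. card (?F b)) ` h ` Z) = card (?F b)"
    using Max_in[of "(\<lambda>b. card (?F b)) ` h ` Z"] by fastforce
  have bmax: "card (?F b') \<le> card (?F b)" if "b' \<in> h ` Z" for b'
    unfolding b(2)[symmetric] using Z that by (intro Max_ge) auto
  have "Z = (\<Union>b\<in>h ` Z. ?F b)" by auto
  moreover have "card (\<Union>b\<in>h ` Z. ?F b) \<le> (\<Sum>b\<in>h ` Z. card (?F b))" using Z by (intro card_UN_le) auto
  ultimately have "card Z \<le> (\<Sum>b\<in>h ` Z. card (?F b))" by (simp only:)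
  also have "\<dots> \<le> card (h ` Z) * card (?F b)" using sum_bounded_above[of "h ` Z" "\<lambda>b. card (?F b)" "card (?F b)"] bmax by simp
  also have "\<dots> \<le> card B * card (?F b)" using card_mono[OF B] by simp
  finally have "card Z \<le> card B * card (?F b)" .
  moreover have "?F b \<noteq> {}" using b(1) by blast
  ultimately show ?thesis by (intro that[of "?F b"]) auto
qed

context glued_sphere
begin

text \<open>If two coverings that are trivial over \<open>P\<close> have the same gluing signs, the
  sum of their sections is invariant under all gluings and descends to \<open>M\<close>. One rim of
  each identified pair suffices for the signs, because both rims share the same involution.\<close>

lemma sign_step:
  assumes Z: "finite Z" "Z \<noteq> {}" and S: "\<And>C. C \<in> Z \<Longrightarrow> loc_sys M (S C)"
    and sg: "\<And>C. C \<in> Z \<Longrightarrow> \<exists>\<sigma>. sec (top_of_set P) (\<lambda>x y. S C (f x) (f y)) \<sigma>"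
    and J: "J \<subseteq> {..<n}" "\<And>i. i < n \<Longrightarrow> i \<in> J \<or> \<pi> i \<in> J" and \<mu>\<pi>: "\<And>i. i < n \<Longrightarrow> \<mu> (\<pi> i) = \<mu> i"
  obtains K where "K \<subseteq> Z" "K \<noteq> {}" "card Z \<le> 2 ^ card J * card K"
    "\<And>C C'. C \<in> K \<Longrightarrow> C' \<in> K \<Longrightarrow> \<exists>s. sec M (\<lambda>x y. S C x y \<noteq> S C' x y) s"
proof -
  obtain \<sigma> where \<sigma>: "\<And>C. C \<in> Z \<Longrightarrow> sec (top_of_set P) (\<lambda>x y. S C (f x) (f y)) (\<sigma> C)" using sg by metis
  have "\<forall>i<n. \<exists>x. x \<in> rim i" by (metis rim_param atLeastAtMost_iff image_eqI less_eq_real_def zero_less_one)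
  then obtain b where b: "\<And>i. i < n \<Longrightarrow> b i \<in> rim i" by metis
  define \<epsilon> where "\<epsilon> C = {i\<in>J. \<sigma> C (b i) \<noteq> \<sigma> C (\<mu> i (b i))}" for C
  have fJ: "finite J" using J(1) finite_subset by blast
  have "\<epsilon> ` Z \<subseteq> Pow J" by (auto simp: \<epsilon>_def)
  then obtain K where K: "K \<subseteq> Z" "K \<noteq> {}" "card Z \<le> card (Pow J) * card K" "\<And>x y. x \<in> K \<Longrightarrow> y \<in> K \<Longrightarrow> \<epsilon> x = \<epsilon> y"
    using pigeonhole_fibre[OF Z, of "Pow J" \<epsilon>] fJ by (metis finite_Pow_iff)
  have "\<exists>s. sec M (\<lambda>x y. S C x y \<noteq> S C' x y) s" if C: "C \<in> K" "C' \<in> K" for C C'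
  proof -
    have CZ: "C \<in> Z" "C' \<in> Z" using C K by auto
    let ?s = "\<lambda>x. \<sigma> C x \<noteq> \<sigma> C' x"
    have inJ: "?s (\<mu> i x) = ?s x" if i: "i \<in> J" "x \<in> rim i" for i x
    proof -
      have iN: "i < n" using i J by auto
      have "(\<sigma> C x \<noteq> \<sigma> C (\<mu> i x)) = (\<sigma> C (b i) \<noteq> \<sigma> C (\<mu> i (b i)))"
        by (rule sec_rim_sign[OF \<sigma>[OF CZ(1)] iN i(2) b[OF iN]])
      moreover have "(\<sigma> C' x \<noteq> \<sigma> C' (\<mu> i x)) = (\<sigma> C' (b i) \<noteq> \<sigma> C' (\<mu> i (b i)))"
        by (rule sec_rim_sign[OF \<sigma>[OF CZ(2)] iN i(2) b[OF iN]])
      moreover have "(i \<in> \<epsilon> C) = (i \<in> \<epsilon> C')" using K(4)[OF C] by simp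
      ultimately show ?thesis using i(1) unfolding \<epsilon>_def by blast
    qed
    have all: "?s (\<mu> i x) = ?s x" if i: "i < n" "x \<in> rim i" for i x
    proof (cases "i \<in> J")
      case False
      then have "\<pi> i \<in> J" using J(2) i by blast
      then have "?s (\<mu> (\<pi> i) (\<mu> i x)) = ?s (\<mu> i x)" using inJ[OF _ \<mu>_rim[OF i]] by blast
      then show ?thesis using \<mu>\<pi>[OF i(1)] \<mu>_inv[OF i(1)] by simp
    qed (use inJ i in blast)
    show ?thesis
      by (rule sec_to_M[OF loc_sys_xor[OF S[OF CZ(1)] S[OF CZ(2)]] sec_xor[OF \<sigma>[OF CZ(1)] \<sigma>[OF CZ(2)]] all])
  qed
  then show ?thesis using that[of K] K fJ by (simp add: card_Pow)
qed

end

section \<open>Handles and crosscaps as instances of the gluing\<close>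

lemma orthogonal_mirror: "orthogonal_transformation (mirror a b)"
  unfolding orthogonal_transformation_def
proof (intro conjI allI)
  let ?v = "a - b"
  show "linear (mirror a b)"
  proof
    fix x y :: "real ^ 3" and t :: real
    show "mirror a b (x + y) = mirror a b x + mirror a b y"
      unfolding mirror_def by (simp only: inner_add_left distrib_left add_divide_distrib scaleR_add_left) simp
    have "2 * ((t *\<^sub>R x) \<bullet> ?v) / (?v \<bullet> ?v) = t * (2 * (x \<bullet> ?v) / (?v \<bullet> ?v))" by simp
    then show "mirror a b (t *\<^sub>R x) = t *\<^sub>R mirror a b x"
      unfolding mirror_def by (simp only: scaleR_diff_right scaleR_scaleR)
  qed
  fix x y :: "real ^ 3"
  define \<alpha> where "\<alpha> = 2 * (x \<bullet> ?v) / (?v \<bullet> ?v)"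
  define \<beta> where "\<beta> = 2 * (y \<bullet> ?v) / (?v \<bullet> ?v)"
  have "(x - \<alpha> *\<^sub>R ?v) \<bullet> (y - \<beta> *\<^sub>R ?v) = x \<bullet> y - \<beta> * (x \<bullet> ?v) - \<alpha> * (y \<bullet> ?v) + \<alpha> * (\<beta> * (?v \<bullet> ?v))"
    by (simp only: inner_diff_left[of x "\<alpha> *\<^sub>R ?v"] inner_diff_right[of _ y "\<beta> *\<^sub>R ?v"] inner_scaleR_left inner_scaleR_right inner_commute[of ?v y])
      (simp add: algebra_simps)
  also have "\<dots> = x \<bullet> y"
  proof (cases "?v \<bullet> ?v = 0")
    case True then show ?thesis by (simp add: \<alpha>_def \<beta>_def)
  next
    case False
    then have "\<beta> * (?v \<bullet> ?v) = 2 * (y \<bullet> ?v)" by (simp only: \<beta>_def) simp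
    moreover have "\<beta> * (x \<bullet> ?v) = \<alpha> * (y \<bullet> ?v)" by (simp add: \<alpha>_def \<beta>_def)
    ultimately show ?thesis by simp
  qed
  finally show "mirror a b x \<bullet> mirror a b y = x \<bullet> y" by (simp only: mirror_def \<alpha>_def \<beta>_def)
qed

lemma mirror_swap:
  assumes "norm a = 1" "norm b = 1" "a \<noteq> b"
  shows "mirror a b a = b"
proof -
  have "(a - b) \<bullet> (a - b) = 2 * (a \<bullet> (a - b))"
    using assms by (simp add: inner_diff inner_commute norm_eq_1)
  moreover have "(a - b) \<bullet> (a - b) \<noteq> 0" using assms by simp
  ultimately show ?thesis by (simp add: mirror_def)
qed

lemma mirror_commute: "mirror a b = mirror b a"
proof
  fix x :: "real ^ 3"
  have "x \<bullet> (b - a) = - (x \<bullet> (a - b))" "(b - a) \<bullet> (b - a) = (a - b) \<bullet> (a - b)"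
    by (simp_all add: inner_diff inner_commute)
  then have "mirror b a x = x - (2 * (- (x \<bullet> (a - b))) / ((a - b) \<bullet> (a - b))) *\<^sub>R (- (a - b))"
    by (simp only: mirror_def minus_diff_eq)
  also have "\<dots> = mirror a b x"
    unfolding mirror_def by (metis (no_types) divide_minus_left mult_minus_right scaleR_minus_left scaleR_minus_right minus_minus)
  finally show "mirror a b x = mirror b a x" by simp
qed

lemma mirror_involution: "mirror a b (mirror a b x) = x"
proof (cases "a = b")
  case False
  let ?v = "a - b"
  have v: "?v \<bullet> ?v \<noteq> 0" using False by simp
  define t where "t = 2 * (x \<bullet> ?v) / (?v \<bullet> ?v)"
  have m: "mirror a b x = x - t *\<^sub>R ?v" by (simp add: mirror_def t_def)
  have "2 * ((x - t *\<^sub>R ?v) \<bullet> ?v) / (?v \<bullet> ?v) = - t"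
  proof -
    have "t * (?v \<bullet> ?v) = 2 * (x \<bullet> ?v)" using v by (simp add: t_def)
    moreover have "(x - t *\<^sub>R ?v) \<bullet> ?v = x \<bullet> ?v - t * (?v \<bullet> ?v)" by (simp only: inner_diff_left inner_scaleR_left)
    ultimately have "(x - t *\<^sub>R ?v) \<bullet> ?v = - (x \<bullet> ?v)" by simp
    then show ?thesis by (simp add: t_def)
  qed
  then have "mirror a b (x - t *\<^sub>R ?v) = (x - t *\<^sub>R ?v) - (- t) *\<^sub>R ?v" by (simp only: mirror_def)
  then have "mirror a b (mirror a b x) = (x - t *\<^sub>R ?v) - (- t) *\<^sub>R ?v" unfolding m .
  then show ?thesis by simp
qed (simp add: mirror_def)

text \<open>The caps \<open>2 * k\<close> and \<open>2 * k + 1\<close> form a handle, and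
  \<open>i div 2\<close> gives both of them the same mirror, which is its own inverse. The two
  directions of \<open>handle_glued\<close> become the even and the odd indices.\<close>

lemma handles_glued:
  assumes "disjoint_caps (2 * h) c r" "quotient_map (top_of_set (holed_sphere (2 * h) c r)) M f"
    and fib: "\<forall>x\<in>holed_sphere (2 * h) c r. \<forall>y\<in>holed_sphere (2 * h) c r.
           f x = f y \<longleftrightarrow> x = y \<or> handle_glued h c r x y \<or> handle_glued h c r y x"
  shows "glued_sphere (2 * h) c r M f (\<lambda>i. if even i then i + 1 else i - 1)
     (\<lambda>i. mirror (c (2 * (i div 2))) (c (2 * (i div 2) + 1)))" (is "glued_sphere _ _ _ _ _ ?\<pi> ?\<mu>")
proof -
  interpret holed "2 * h" c r by unfold_locales (rule assms(1))
  have \<pi>: "?\<pi> i < 2 * h" "?\<pi> i \<noteq> i" if "i < 2 * h" for i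
    using that by (auto elim!: evenE oddE)
  have pair: "?\<mu> i = mirror (c i) (c (?\<pi> i))" for i
  proof (cases "even i")
    case True then show ?thesis by (auto elim!: evenE)
  next
    case False
    then obtain k where "i = 2 * k + 1" by (auto elim!: oddE)
    then show ?thesis using mirror_commute by simp
  qed
  have ne: "c i \<noteq> c j" if "i < 2 * h" "j < 2 * h" "i \<noteq> j" for i j
    using cap_unique[of "c i" i j] that c_unit c_inner \<kappa>_bounds by force
  have \<mu>c: "?\<mu> i (c i) = c (?\<pi> i)" if "i < 2 * h" for i
    unfolding pair using that \<pi> ne c_unit by (intro mirror_swap) metis+
  have \<mu>orth: "orthogonal_transformation (?\<mu> i)" for i
    by (rule orthogonal_mirror)
  have \<mu>rim: "?\<mu> i x \<in> rim (?\<pi> i)" if i: "i < 2 * h" "x \<in> rim i" for i x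
  proof -
    have "norm (?\<mu> i x) = norm x" using \<mu>orth orthogonal_transformation_norm by blast
    moreover have "?\<mu> i x \<bullet> ?\<mu> i (c i) = x \<bullet> c i" using \<mu>orth unfolding orthogonal_transformation_def by blast
    ultimately show ?thesis
      using rim_iff[OF i(1), of x] rim_iff[OF \<pi>(1)[OF i(1)], of "?\<mu> i x"] i(2) \<mu>c[OF i(1)] by simp
  qed
  show ?thesis
  proof
    show "quotient_map (top_of_set P) M f" using assms(2) by (simp add: P_def)
    show "?\<pi> i < 2 * h" if "i < 2 * h" for i using \<pi>(1)[OF that] .
    show "orthogonal_transformation (?\<mu> i)" if "i < 2 * h" for i by (rule \<mu>orth)
    show "?\<mu> i (?\<mu> i x) = x" if "i < 2 * h" for i x by (rule mirror_involution)
    show "?\<mu> i (c i) = c (?\<pi> i)" if "i < 2 * h" for i using \<mu>c[OF that] .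
    show "?\<mu> i x \<noteq> x" if i: "i < 2 * h" "x \<in> rim i" for i x
    proof
      assume "?\<mu> i x = x"
      then have "x \<in> rim (?\<pi> i)" using \<mu>rim[OF i] by simp
      then show False using rim_other[OF i(1) \<pi>(1)[OF i(1)] i(2)] rim_iff[OF \<pi>(1)[OF i(1)]] \<pi>(2)[OF i(1)] by force
    qed
    fix x y assume xy: "x \<in> P" "y \<in> P"
    have 1: "handle_glued h c r x y \<longleftrightarrow> (\<exists>i<2 * h. even i \<and> x \<in> rim i \<and> y = ?\<mu> i x)" for x y
    proof
      assume "handle_glued h c r x y"
      then obtain k where k: "k < h" "x \<in> cap_rim (c (2 * k)) r" "y = mirror (c (2 * k)) (c (2 * k + 1)) x"
        unfolding handle_glued_def by blast
      then show "\<exists>i<2 * h. even i \<and> x \<in> rim i \<and> y = ?\<mu> i x"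
        by (intro exI[of _ "2 * k"]) (auto simp: rim_def)
    next
      assume "\<exists>i<2 * h. even i \<and> x \<in> rim i \<and> y = ?\<mu> i x"
      then obtain i where i: "i < 2 * h" "even i" "x \<in> rim i" "y = ?\<mu> i x" by blast
      then obtain k where "i = 2 * k" by (auto elim!: evenE)
      then show "handle_glued h c r x y" using i unfolding handle_glued_def rim_def by auto
    qed
    have 2: "handle_glued h c r y x \<longleftrightarrow> (\<exists>i<2 * h. odd i \<and> x \<in> rim i \<and> y = ?\<mu> i x)"
    proof
      assume "handle_glued h c r y x"
      then obtain i where i: "i < 2 * h" "even i" "y \<in> rim i" "x = ?\<mu> i y" using 1[of y x] by blast
      then have "x \<in> rim (i + 1)" "i + 1 < 2 * h" using \<mu>rim[OF i(1,3)] \<pi>(1)[OF i(1)] by auto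
      moreover have "y = ?\<mu> i x" using i(4) mirror_involution by simp
      then have "y = ?\<mu> (i + 1) x" using i(2) by (auto elim!: evenE)
      ultimately show "\<exists>i<2 * h. odd i \<and> x \<in> rim i \<and> y = ?\<mu> i x" using i(2) by (intro exI[of _ "i + 1"]) simp
    next
      assume "\<exists>i<2 * h. odd i \<and> x \<in> rim i \<and> y = ?\<mu> i x"
      then obtain i where i: "i < 2 * h" "odd i" "x \<in> rim i" "y = ?\<mu> i x" by blast
      then have "y \<in> rim (i - 1)" "i - 1 < 2 * h" "even (i - 1)" using \<mu>rim[OF i(1,3)] \<pi>(1)[OF i(1)] by auto
      moreover have "x = ?\<mu> i y" using i(4) mirror_involution by simp
      then have "x = ?\<mu> (i - 1) y" using i(2) by (auto elim!: oddE)
      ultimately show "handle_glued h c r y x" using 1[of y x] by blast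
    qed
    show "f x = f y \<longleftrightarrow> x = y \<or> (\<exists>i<2 * h. x \<in> rim i \<and> y = ?\<mu> i x)"
      using fib xy 1[of x y] 2 unfolding P_def by blast
  qed
qed

text \<open>\<open>rim_antipode\<close> is only affine. On the rim, where
  \<open>x \<bullet> c i = \<kappa>\<close>, it agrees with the half-turn about the axis
  \<open>c i\<close>, which is linear and orthogonal as \<open>glued_sphere\<close> demands.\<close>

lemma crosscaps_glued:
  assumes "disjoint_caps q c r" "quotient_map (top_of_set (holed_sphere q c r)) M f"
    and fib: "\<forall>x\<in>holed_sphere q c r. \<forall>y\<in>holed_sphere q c r. f x = f y \<longleftrightarrow> x = y \<or> crosscap_glued q c r x y"
  shows "glued_sphere q c r M f (\<lambda>i. i) (\<lambda>i x. (2 * (x \<bullet> c i)) *\<^sub>R c i - x)"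
proof -
  interpret holed q c r by unfold_locales (rule assms(1))

  show ?thesis
  proof
    show "quotient_map (top_of_set P) M f" using assms(2) by (simp add: P_def)
    fix i assume i: "i < q"
    show "i < q" by (rule i)
    show "orthogonal_transformation (\<lambda>x. (2 * (x \<bullet> c i)) *\<^sub>R c i - x)"
      unfolding orthogonal_transformation_def
    proof (intro conjI allI)
      show "linear (\<lambda>x. (2 * (x \<bullet> c i)) *\<^sub>R c i - x)"
        by (rule linearI) (simp_all add: inner_add_left algebra_simps)
      fix x y :: "real ^ 3"
      show "((2 * (x \<bullet> c i)) *\<^sub>R c i - x) \<bullet> ((2 * (y \<bullet> c i)) *\<^sub>R c i - y) = x \<bullet> y"
        using c_inner[OF i] by (simp add: inner_diff inner_commute algebra_simps)
    qed
    show "(2 * (((2 * (x \<bullet> c i)) *\<^sub>R c i - x) \<bullet> c i)) *\<^sub>R c i - ((2 * (x \<bullet> c i)) *\<^sub>R c i - x) = x" for x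
      using c_inner[OF i] by (simp add: inner_diff_left)
    show "(2 * (c i \<bullet> c i)) *\<^sub>R c i - c i = c i" using c_inner[OF i] by (simp add: scaleR_2)
    fix x assume x: "x \<in> rim i"
    show "(2 * (x \<bullet> c i)) *\<^sub>R c i - x \<noteq> x"
    proof
      assume "(2 * (x \<bullet> c i)) *\<^sub>R c i - x = x"
      then have "2 *\<^sub>R x = (2 * (x \<bullet> c i)) *\<^sub>R c i" by (simp add: scaleR_2 diff_eq_eq)
      then have "norm (2 *\<^sub>R x) = norm ((2 * (x \<bullet> c i)) *\<^sub>R c i)" by simp
      then show False using x rim_iff[OF i] c_unit[OF i] \<kappa>_bounds by simp
    qed
  next
    fix x y assume xy: "x \<in> P" "y \<in> P"
    have "crosscap_glued q c r x y \<longleftrightarrow> (\<exists>i<q. x \<in> rim i \<and> y = (2 * (x \<bullet> c i)) *\<^sub>R c i - x)"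
    proof -
      have "rim_antipode (c i) r x = (2 * (x \<bullet> c i)) *\<^sub>R c i - x" if "i < q" "x \<in> rim i" for i
        using rim_iff[OF that(1)] that(2) by (simp add: rim_antipode_def \<kappa>_def)
      then show ?thesis unfolding crosscap_glued_def rim_def[symmetric] by metis
    qed
    then show "f x = f y \<longleftrightarrow> x = y \<or> (\<exists>i<q. x \<in> rim i \<and> y = (2 * (x \<bullet> c i)) *\<^sub>R c i - x)"
      using fib xy unfolding P_def by blast
  qed
qed

text \<open>A handle contributes two binary invariants: the holonomy round its rim and the sign of
  its gluing. Fixing all holonomies costs a factor \<open>2 ^ h\<close> and makes quotients of
  coverings trivial over \<open>P\<close>; fixing all signs costs another
  \<open>2 ^ h\<close>.\<close>

lemma handles_sections:
  assumes M: "sphere_with_handles h M" and Z: "finite Z" "Z \<noteq> {}" and T: "\<And>C. C \<in> Z \<Longrightarrow> loc_sys M (T C)"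
  shows "\<exists>K\<subseteq>Z. K \<noteq> {} \<and> card Z \<le> 2 ^ (2 * h) * card K \<and> (\<forall>C\<in>K. \<forall>C'\<in>K. \<exists>s. sec M (\<lambda>x y. T C x y \<noteq> T C' x y) s)"
proof -
  obtain c r f where M': "disjoint_caps (2 * h) c r" "quotient_map (top_of_set (holed_sphere (2 * h) c r)) M f"
     "\<forall>x\<in>holed_sphere (2 * h) c r. \<forall>y\<in>holed_sphere (2 * h) c r.
           f x = f y \<longleftrightarrow> x = y \<or> handle_glued h c r x y \<or> handle_glued h c r y x"
    using M unfolding sphere_with_handles_def by blast
  let ?\<pi> = "\<lambda>i::nat. if even i then i + 1 else i - 1"
  let ?\<mu> = "\<lambda>i. mirror (c (2 * (i div 2))) (c (2 * (i div 2) + 1))"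
  interpret glued_sphere "2 * h" c r M f ?\<pi> ?\<mu> using handles_glued[OF M'] .
  define Q where "Q i e \<longleftrightarrow> continuous_on {0..1} e \<and> e ` {0..1} = rim (2 * i) \<and> e 0 = e 1 \<and>
      (\<forall>s\<in>{0..1}. \<forall>t\<in>{0..1}. e s = e t \<longrightarrow> s = t \<or> (s = 0 \<and> t = 1) \<or> (s = 1 \<and> t = 0))"
    for i and e :: "real \<Rightarrow> real ^ 3"
  have exQ: "\<exists>e. Q i e" if "i < h" for i
  proof -
    have i: "2 * i < 2 * h" using that by simp
    obtain e :: "real \<Rightarrow> real ^ 3" where e: "continuous_on {0..1} e" "e ` {0..1} = rim (2 * i)" "e 0 = e 1"
      "\<And>s t. s \<in> {0..1} \<Longrightarrow> t \<in> {0..1} \<Longrightarrow> e s = e t \<Longrightarrow> s = t \<or> (s = 0 \<and> t = 1) \<or> (s = 1 \<and> t = 0)"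
      "\<And>t. e (t + 1/2) = (2 * \<kappa>) *\<^sub>R c (2 * i) - e t"
      by (rule rim_param[OF i]) blast
    show ?thesis unfolding Q_def
      by (intro exI[of _ e] conjI ballI impI e(1-4)) assumption+
  qed
  define e where "e i = (SOME e. Q i e)" for i
  have Qe: "Q i (e i)" if "i < h" for i unfolding e_def using exQ[OF that] by (rule someI_ex)
  have e: "\<And>i. i < h \<Longrightarrow> continuous_on {0..1} (e i)"
     "\<And>i. i < h \<Longrightarrow> e i ` {0..1} = rim (2 * i)" "\<And>i. i < h \<Longrightarrow> e i 0 = e i 1"
     "\<And>i s t. i < h \<Longrightarrow> s \<in> {0..1} \<Longrightarrow> t \<in> {0..1} \<Longrightarrow> e i s = e i t \<Longrightarrow> s = t \<or> (s = 0 \<and> t = 1) \<or> (s = 1 \<and> t = 0)"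
    using Qe unfolding Q_def by blast+
  have ecm: "continuous_map (top_of_set {0..1}) (top_of_set P) (e i)" if "i < h" for i
    using e(1,2)[OF that] rim_sub[of "2 * i"] that by auto
  have "\<exists>\<tau>. sec (top_of_set {0..1}) (\<lambda>x y. T C (f (e i x)) (f (e i y))) \<tau>" if "C \<in> Z" "i < h" for C i
    using sec_interval[OF loc_sys_pull[OF loc_sys_P[OF T[OF that(1)]] ecm[OF that(2)]]] .
  then obtain \<tau> where \<tau>: "\<And>C i. C \<in> Z \<Longrightarrow> i < h \<Longrightarrow> sec (top_of_set {0..1}) (\<lambda>x y. T C (f (e i x)) (f (e i y))) (\<tau> C i)"
    by metis
  define hol where "hol C = {i\<in>{..<h}. \<tau> C i 0 \<noteq> \<tau> C i 1}" for C
  have "hol ` Z \<subseteq> Pow {..<h}" by (auto simp: hol_def)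
  then obtain K1 where K1: "K1 \<subseteq> Z" "K1 \<noteq> {}" "card Z \<le> card (Pow {..<h}) * card K1" "\<And>x y. x \<in> K1 \<Longrightarrow> y \<in> K1 \<Longrightarrow> hol x = hol y"
    using pigeonhole_fibre[OF Z, of "Pow {..<h}" hol] by (metis finite_Pow_iff finite_lessThan)
  obtain C0 where C0: "C0 \<in> K1" using K1 by blast
  \<comment> \<open>Dividing by one fixed member \<open>C0\<close> of the class cancels the common
    holonomy on the rims.\<close>
  define S where "S C = (\<lambda>x y. T C x y \<noteq> T C0 x y)" for C
  have S: "loc_sys M (S C)" if "C \<in> K1" for C
    unfolding S_def using loc_sys_xor T that C0 K1(1) by blast
  have secP: "\<exists>\<sigma>. sec (top_of_set P) (\<lambda>x y. S C (f x) (f y)) \<sigma>" if C: "C \<in> K1" for C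
  proof (rule sec_holed[OF loc_sys_P[OF S[OF C]]])
    fix i assume i: "i < 2 * h"
    have ev: "\<exists>\<sigma>. sec (top_of_set (rim (2 * k))) (\<lambda>x y. S C (f x) (f y)) \<sigma>" if k: "k < h" for k
    proof -
      have k2: "2 * k < 2 * h" using k by simp
      have CZ: "C \<in> Z" "C0 \<in> Z" using C C0 K1 by auto
      have s: "sec (top_of_set {0..1}) (\<lambda>x y. S C (f (e k x)) (f (e k y))) (\<lambda>t. \<tau> C k t \<noteq> \<tau> C0 k t)"
        unfolding S_def by (rule sec_xor[OF \<tau>[OF CZ(1) k] \<tau>[OF CZ(2) k]])
      have "(k \<in> hol C) = (k \<in> hol C0)" using K1(4)[OF C C0] by simp
      then have eq: "(\<tau> C k 0 \<noteq> \<tau> C0 k 0) = (\<tau> C k 1 \<noteq> \<tau> C0 k 1)" using k unfolding hol_def by blast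
      have ls: "loc_sys (top_of_set (rim (2 * k))) (\<lambda>x y. S C (f x) (f y))"
        using loc_sys_top_of_subset[OF loc_sys_P[OF S[OF C]] rim_sub[OF k2]] .
      show ?thesis by (rule sec_rim[OF k2 ls e(1-3)[OF k] e(4)[OF k] s eq])
    qed
    show "\<exists>\<sigma>. sec (top_of_set (rim i)) (\<lambda>x y. S C (f x) (f y)) \<sigma>"
    proof (cases "even i")
      case True
      then obtain k where "i = 2 * k" by (auto elim!: evenE)
      then show ?thesis using ev[of k] i by simp
    next
      case False
      then obtain k where k: "i = 2 * k + 1" by (auto elim!: oddE)
      then have "k < h" using i by simp
      then obtain \<sigma> where \<sigma>: "sec (top_of_set (rim (2 * k))) (\<lambda>x y. S C (f x) (f y)) \<sigma>" using ev by blast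
      have "continuous_map (top_of_set (rim i)) (top_of_set (rim (2 * k))) (?\<mu> i)"
        using \<mu>_cont[OF i] \<mu>_rim[OF i] k by auto
      from sec_pull[OF \<sigma> this] have "sec (top_of_set (rim i)) (\<lambda>x y. S C (f x) (f y)) (\<lambda>x. \<sigma> (?\<mu> i x))"
        by (rule sec_cong) (use f_\<mu>[OF i] in auto)
      then show ?thesis by blast
    qed
  qed
  let ?J = "(\<lambda>k. 2 * k) ` {..<h}"
  have cJ: "card ?J = h" by (subst card_image) (auto simp: inj_on_def)
  have J: "?J \<subseteq> {..<2 * h}" "\<And>i. i < 2 * h \<Longrightarrow> i \<in> ?J \<or> ?\<pi> i \<in> ?J"
    by (auto elim!: evenE oddE)
  have \<mu>\<pi>: "?\<mu> (?\<pi> i) = ?\<mu> i" for i by (auto elim!: evenE oddE)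
  have fK1: "finite K1" using K1 Z finite_subset by blast
  obtain K where K: "K \<subseteq> K1" "K \<noteq> {}" "card K1 \<le> 2 ^ card ?J * card K"
    "\<And>C C'. C \<in> K \<Longrightarrow> C' \<in> K \<Longrightarrow> \<exists>s. sec M (\<lambda>x y. S C x y \<noteq> S C' x y) s"
    by (rule sign_step[OF fK1 K1(2) S secP J \<mu>\<pi>]) auto
  have "card Z \<le> 2 ^ h * card K1" using K1(3) by (simp add: card_Pow)
  also have "\<dots> \<le> 2 ^ h * (2 ^ h * card K)" using K(3) cJ by simp
  also have "\<dots> = 2 ^ (2 * h) * card K" by (simp add: power_add[symmetric] mult_2)
  finally have "card Z \<le> 2 ^ (2 * h) * card K" .
  moreover have "\<exists>s. sec M (\<lambda>x y. T C x y \<noteq> T C' x y) s" if CC: "C \<in> K" "C' \<in> K" for C C'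
  proof -
    obtain s where "sec M (\<lambda>x y. S C x y \<noteq> S C' x y) s" using K(4)[OF CC] by blast
    then have "sec M (\<lambda>x y. T C x y \<noteq> T C' x y) s" by (rule sec_cong) (auto simp: S_def)
    then show ?thesis by blast
  qed
  ultimately show ?thesis using K(1,2) K1(1) by (intro exI[of _ K]) blast
qed

text \<open>The rim of a crosscap covers its image circle twice, so its holonomy is a square and
  trivial in a group of order two. What remains is one gluing sign per crosscap.\<close>

lemma crosscaps_sections:
  assumes M: "sphere_with_crosscaps q M" and Z: "finite Z" "Z \<noteq> {}" and T: "\<And>C. C \<in> Z \<Longrightarrow> loc_sys M (T C)"
  shows "\<exists>K\<subseteq>Z. K \<noteq> {} \<and> card Z \<le> 2 ^ q * card K \<and> (\<forall>C\<in>K. \<forall>C'\<in>K. \<exists>s. sec M (\<lambda>x y. T C x y \<noteq> T C' x y) s)"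
proof -
  obtain c r f where M': "disjoint_caps q c r" "quotient_map (top_of_set (holed_sphere q c r)) M f"
     "\<forall>x\<in>holed_sphere q c r. \<forall>y\<in>holed_sphere q c r. f x = f y \<longleftrightarrow> x = y \<or> crosscap_glued q c r x y"
    using M unfolding sphere_with_crosscaps_def by blast
  interpret glued_sphere q c r M f "\<lambda>i. i" "\<lambda>i x. (2 * (x \<bullet> c i)) *\<^sub>R c i - x" using crosscaps_glued[OF M'] .
  have secP: "\<exists>\<sigma>. sec (top_of_set P) (\<lambda>x y. T C (f x) (f y)) \<sigma>" if C: "C \<in> Z" for C
  proof (rule sec_holed[OF loc_sys_P[OF T[OF C]]])
    fix i assume i: "i < q"
    obtain e :: "real \<Rightarrow> real ^ 3" where e: "continuous_on {0..1} e" "e ` {0..1} = rim i" "e 0 = e 1"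
      "\<And>s t. s \<in> {0..1} \<Longrightarrow> t \<in> {0..1} \<Longrightarrow> e s = e t \<Longrightarrow> s = t \<or> (s = 0 \<and> t = 1) \<or> (s = 1 \<and> t = 0)"
      "\<And>t. e (t + 1/2) = (2 * \<kappa>) *\<^sub>R c i - e t"
      by (rule rim_param[OF i]) blast
    have ecm: "continuous_map (top_of_set {0..1}) (top_of_set P) e" using e(1,2) rim_sub[OF i] by auto
    obtain \<tau> where \<tau>: "sec (top_of_set {0..1}) (\<lambda>x y. T C (f (e x)) (f (e y))) \<tau>"
      using sec_interval[OF loc_sys_pull[OF loc_sys_P[OF T[OF C]] ecm]] by blast
    have fe: "f (e (t + 1/2)) = f (e t)" if "t \<in> {0..1}" for t
    proof -
      have "e t \<in> rim i" using e(2) that by blast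
      then have "f ((2 * (e t \<bullet> c i)) *\<^sub>R c i - e t) = f (e t)" "e t \<bullet> c i = \<kappa>" using f_\<mu>[OF i] rim_iff[OF i] by auto
      then show ?thesis using e(5)[of t] by simp
    qed
    have sub: "{0..1/2} \<subseteq> {0..1::real}" by auto
    have s1: "sec (top_of_set {0..1/2}) (\<lambda>x y. T C (f (e x)) (f (e y))) \<tau>" using \<tau> sub by (rule sec_top_of_subset)
    have "continuous_map (top_of_set {0..1/2}) (top_of_set {0..1}) (\<lambda>t::real. t + 1/2)"
      by (auto intro!: continuous_intros)
    from sec_pull[OF \<tau> this] have s2: "sec (top_of_set {0..1/2}) (\<lambda>x y. T C (f (e x)) (f (e y))) (\<lambda>t. \<tau> (t + 1/2))"
      by (rule sec_cong) (use fe in auto)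
    have con: "connectedin (top_of_set {0..1/2::real}) {0..1/2}" by (simp add: connectedin_subtopology)
    \<comment> \<open>The two halves of the rim lie over the same circle in \<open>M\<close>, so
      \<open>\<tau>\<close> changes by the same amount along both, and the changes cancel.\<close>
    have "(\<tau> 0 \<noteq> \<tau> (0 + 1/2)) = (\<tau> (1/2) \<noteq> \<tau> (1/2 + 1/2))" by (rule sec_diff_const[OF s1 s2 con]) auto
    then have eq: "\<tau> 0 = \<tau> 1" by (simp del: not_iff) blast
    have ls: "loc_sys (top_of_set (rim i)) (\<lambda>x y. T C (f x) (f y))"
      using loc_sys_top_of_subset[OF loc_sys_P[OF T[OF C]] rim_sub[OF i]] .
    show "\<exists>\<sigma>. sec (top_of_set (rim i)) (\<lambda>x y. T C (f x) (f y)) \<sigma>" by (rule sec_rim[OF i ls e(1-3) e(4) \<tau> eq])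
  qed
  have J: "{..<q} \<subseteq> {..<q}" "\<And>i. i < q \<Longrightarrow> i \<in> {..<q} \<or> i \<in> {..<q}" by auto
  obtain K where "K \<subseteq> Z" "K \<noteq> {}" "card Z \<le> 2 ^ card {..<q} * card K"
    "\<And>C C'. C \<in> K \<Longrightarrow> C' \<in> K \<Longrightarrow> \<exists>s. sec M (\<lambda>x y. T C x y \<noteq> T C' x y) s"
    by (rule sign_step[OF Z T secP J refl]) auto
  then show ?thesis by (intro exI[of _ K]) simp
qed

section \<open>Faces and Euler's inequality\<close>

context surface_graph
begin

section \<open>The double covering of an even edge set\<close>

definition good :: "'a set set \<Rightarrow> 'b \<Rightarrow> 'b set \<Rightarrow> ('b \<Rightarrow> bool) \<Rightarrow> bool" where
  "good C x U c \<longleftrightarrow> lc U c \<and> x \<in> U \<and>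
     (\<forall>e\<in>E. \<forall>t. 0 < t \<longrightarrow> t < 1 \<longrightarrow> g e t \<in> U \<longrightarrow> (flip c (g e t) \<longleftrightarrow> e \<in> C))"

lemma goodD:
  assumes "good C x U c"
  shows "lc U c" "x \<in> U" "e \<in> E \<Longrightarrow> 0 < t \<Longrightarrow> t < 1 \<Longrightarrow> g e t \<in> U \<Longrightarrow> flip c (g e t) \<longleftrightarrow> e \<in> C"
  using assms unfolding good_def by simp_all

text \<open>The points of the covering over \<open>x\<close> are the two local colourings for
  \<open>C\<close> near \<open>x\<close>. One of them is chosen as \<open>cc x\<close>, and
  \<open>T x y\<close> tells whether the choices at \<open>x\<close> and \<open>y\<close> are
  opposite near \<open>y\<close>.\<close>

definition monodromy :: "'a set set \<Rightarrow> ('b \<Rightarrow> 'b set) \<Rightarrow> ('b \<Rightarrow> 'b \<Rightarrow> bool) \<Rightarrow> ('b \<Rightarrow> 'b \<Rightarrow> bool) \<Rightarrow> bool" where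
  "monodromy C U cc T \<longleftrightarrow> (\<forall>x\<in>topspace M. good C x (U x) (cc x)) \<and>
     (\<forall>x\<in>topspace M. \<forall>y\<in>U x. \<exists>N. openin M N \<and> y \<in> N \<and> N \<subseteq> U x \<inter> U y \<and> (\<forall>z\<in>N - \<Gamma>. (cc x z \<noteq> cc y z) = T x y))"

text \<open>Two colourings for the same \<open>C\<close> change across the same edges, so their sum
  changes across no edge and, by \<open>vertex_no_flip\<close>, at no vertex. It is constant near
  \<open>y\<close>, and its continuation there is \<open>T x y\<close>.\<close>

lemma monodromy_exists:
  assumes C: "even_set C"
  shows "\<exists>U cc T. monodromy C U cc T"
proof -
  have "\<forall>x\<in>topspace M. \<exists>U c. good C x U c"
    using local_colouring[OF C] unfolding good_def by blast
  then obtain U cc where U: "\<And>x. x \<in> topspace M \<Longrightarrow> good C x (U x) (cc x)" by metis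
  have "\<exists>N. openin M N \<and> y \<in> N \<and> N \<subseteq> U x \<inter> U y \<and> (\<forall>z\<in>N - \<Gamma>. (cc x z \<noteq> cc y z) = extend (\<lambda>z. cc x z \<noteq> cc y z) y)"
    if x: "x \<in> topspace M" and y: "y \<in> U x" for x y
  proof -
    note gx = goodD[OF U[OF x]]
    have yt: "y \<in> topspace M" using y lc_open[OF gx(1)] openin_subset by blast
    note gy = goodD[OF U[OF yt]]
    have lc: "lc (U x \<inter> U y) (\<lambda>z. cc x z \<noteq> cc y z)" by (rule lc_xor[OF gx(1) gy(1)])
    have nfe: "\<not> flip (\<lambda>z. cc x z \<noteq> cc y z) (g e t)" if et: "e \<in> E" "0 < t" "t < 1" "g e t \<in> U x \<inter> U y" for e t
      using flip_xor_edge[OF et(1-3) gx(1) _ gy(1)] gx(3)[OF et(1-3)] gy(3)[OF et(1-3)] et(4) by blast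
    have yU: "y \<in> U x \<inter> U y" using y gy(2) by blast
    have nf: "\<not> flip (\<lambda>z. cc x z \<noteq> cc y z) y" if "y \<in> \<Gamma>"
      using that
    proof (cases rule: \<Gamma>_cases)
      case (vertex v)
      then show ?thesis using vertex_no_flip[OF vertex(1) lc _ nfe] yU by blast
    next
      case (edge e t)
      then show ?thesis using nfe yU by blast
    qed
    show ?thesis by (rule extend_nbhd[OF lc yU nf]) blast+
  qed
  then show ?thesis unfolding monodromy_def using U
    by (intro exI[of _ U] exI[of _ cc] exI[of _ "\<lambda>x y. extend (\<lambda>z. cc x z \<noteq> cc y z) y"] conjI ballI)
qed

lemma monodromyD:
  assumes "monodromy C U cc T" "x \<in> topspace M"
  shows "good C x (U x) (cc x)"
    and "y \<in> U x \<Longrightarrow> \<exists>N. openin M N \<and> y \<in> N \<and> N \<subseteq> U x \<inter> U y \<and> (\<forall>z\<in>N - \<Gamma>. (cc x z \<noteq> cc y z) = T x y)"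
  using assms unfolding monodromy_def by simp_all

text \<open>The three comparisons in the cocycle condition are evaluated at one common point off
  \<open>\<Gamma>\<close>, supplied by \<open>complement_dense\<close>.\<close>

lemma monodromy_loc_sys:
  assumes m: "monodromy C U cc T"
  shows "loc_sys M T"
  unfolding loc_sys_def
proof
  fix x assume x: "x \<in> topspace M"
  note gx = goodD[OF monodromyD(1)[OF m x]]
  have oU: "openin M (U x)" using lc_open[OF gx(1)] .
  have "\<exists>N'. openin M N' \<and> y \<in> N' \<and> (\<forall>z\<in>N'. T x z = (T x y \<noteq> T y z))" if y: "y \<in> U x" for y
  proof -
    have yt: "y \<in> topspace M" using y oU openin_subset by blast
    obtain N where N: "openin M N" "y \<in> N" "N \<subseteq> U x \<inter> U y" "\<forall>z\<in>N - \<Gamma>. (cc x z \<noteq> cc y z) = T x y"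
      using monodromyD(2)[OF m x y] by blast
    have "T x z = (T x y \<noteq> T y z)" if z: "z \<in> N" for z
    proof -
      obtain N1 where N1: "openin M N1" "z \<in> N1" "\<forall>w\<in>N1 - \<Gamma>. (cc x w \<noteq> cc z w) = T x z"
        using monodromyD(2)[OF m x, of z] z N(3) by blast
      obtain N2 where N2: "openin M N2" "z \<in> N2" "\<forall>w\<in>N2 - \<Gamma>. (cc y w \<noteq> cc z w) = T y z"
        using monodromyD(2)[OF m yt, of z] z N(3) by blast
      have "openin M (N \<inter> N1 \<inter> N2)" "z \<in> N \<inter> N1 \<inter> N2" using N N1 N2 z by auto
      then obtain w where w: "w \<in> N \<inter> N1 \<inter> N2 - \<Gamma>" using complement_dense by blast
      have "(cc x w \<noteq> cc y w) = T x y" "(cc x w \<noteq> cc z w) = T x z" "(cc y w \<noteq> cc z w) = T y z"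
        using N(4) N1(3) N2(3) w by blast+
      then show ?thesis by blast
    qed
    then show ?thesis using N by blast
  qed
  then show "\<exists>N. openin M N \<and> x \<in> N \<and> (\<forall>y\<in>N. \<exists>N'. openin M N' \<and> y \<in> N' \<and> (\<forall>z\<in>N'. T x z = (T x y \<noteq> T y z)))"
    using oU gx(2) by blast
qed

lemma flip_cong:
  assumes "openin M N" "y \<in> N" "\<And>z. z \<in> N - \<Gamma> \<Longrightarrow> c z = (b \<noteq> c' z)" "flip c' y"
  shows "flip c y"
  unfolding flip_def
proof (intro allI impI)
  fix N' assume "openin M N' \<and> y \<in> N'"
  then have "openin M (N \<inter> N') \<and> y \<in> N \<inter> N'" using assms by auto
  then obtain z z' where z: "z \<in> N \<inter> N' - \<Gamma>" "z' \<in> N \<inter> N' - \<Gamma>" "c' z \<noteq> c' z'" using assms(4) unfolding flip_def by meson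
  then have "c z \<noteq> c z'" using assms(3)[of z] assms(3)[of z'] by blast
  then show "\<exists>z\<in>N' - \<Gamma>. \<exists>z'\<in>N' - \<Gamma>. c z \<noteq> c z'" using z by blast
qed

lemma flip_cong_iff:
  assumes "openin M N" "y \<in> N" "\<And>z. z \<in> N - \<Gamma> \<Longrightarrow> c z = (b \<noteq> c' z)"
  shows "flip c y \<longleftrightarrow> flip c' y"
proof
  show "flip c' y \<Longrightarrow> flip c y" by (rule flip_cong[OF assms])
  have "\<And>z. z \<in> N - \<Gamma> \<Longrightarrow> c' z = (b \<noteq> c z)" using assms(3) by blast
  then show "flip c y \<Longrightarrow> flip c' y" by (rule flip_cong[OF assms(1,2)])
qed

text \<open>The sum of local colourings for \<open>C\<close> and \<open>C'\<close> changes exactly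
  across the symmetric difference, but it depends on the choices made at each point. The section
  \<open>s\<close> corrects these choices into one global colouring.\<close>

lemma section_colouring:
  assumes m: "monodromy C U cc T" and m': "monodromy C' U' cc' T'"
    and s: "sec M (\<lambda>x y. T x y \<noteq> T' x y) s"
  shows "\<exists>col. lc (topspace M) col \<and> (\<forall>e\<in>E. flip col (g e (1/2)) \<longleftrightarrow> (e \<in> C) \<noteq> (e \<in> C'))"
proof -
  \<comment> \<open>The colouring chosen at \<open>z\<close> is evaluated at \<open>z\<close>
    itself; \<open>near\<close> shows that this agrees with a fixed local colouring on a
    neighbourhood of each point.\<close>
  define col where "col z = (s z \<noteq> (cc z z \<noteq> cc' z z))" for z
  have near: "\<exists>N. openin M N \<and> x \<in> N \<and> N \<subseteq> U x \<inter> U' x \<and> (\<forall>z\<in>N - \<Gamma>. col z = (s x \<noteq> (cc x z \<noteq> cc' x z)))"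
    if x: "x \<in> topspace M" for x
  proof -
    note gx = goodD[OF monodromyD(1)[OF m x]] and gx' = goodD[OF monodromyD(1)[OF m' x]]
    obtain N where N: "openin M N" "x \<in> N" "\<forall>z\<in>N. s z = (s x \<noteq> (T x z \<noteq> T' x z))" by (rule secD[OF s x])
    let ?N = "N \<inter> (U x \<inter> U' x)"
    have "col z = (s x \<noteq> (cc x z \<noteq> cc' x z))" if z: "z \<in> ?N - \<Gamma>" for z
    proof -
      have "\<exists>N. openin M N \<and> z \<in> N \<and> N \<subseteq> U x \<inter> U z \<and> (\<forall>w\<in>N - \<Gamma>. (cc x w \<noteq> cc z w) = T x z)"
        using monodromyD(2)[OF m x, of z] z by blast
      then have 1: "(cc x z \<noteq> cc z z) = T x z" using z by blast
      have "\<exists>N. openin M N \<and> z \<in> N \<and> N \<subseteq> U' x \<inter> U' z \<and> (\<forall>w\<in>N - \<Gamma>. (cc' x w \<noteq> cc' z w) = T' x z)"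
        using monodromyD(2)[OF m' x, of z] z by blast
      then have 2: "(cc' x z \<noteq> cc' z z) = T' x z" using z by blast
      have "s z = (s x \<noteq> (T x z \<noteq> T' x z))" using N(3) z by blast
      then show ?thesis unfolding col_def using 1 2 by blast
    qed
    moreover have "openin M ?N" "x \<in> ?N" using N lc_open[OF gx(1)] lc_open[OF gx'(1)] gx(2) gx'(2) by auto
    ultimately show ?thesis by (intro exI[of _ ?N]) blast
  qed
  have "lc (topspace M) col"
  proof (rule lcI)
    fix z assume z: "z \<in> topspace M" "z \<notin> \<Gamma>"
    note gx = goodD[OF monodromyD(1)[OF m z(1)]] and gx' = goodD[OF monodromyD(1)[OF m' z(1)]]
    obtain N where N: "openin M N" "z \<in> N" "N \<subseteq> U z \<inter> U' z" "\<forall>w\<in>N - \<Gamma>. col w = (s z \<noteq> (cc z w \<noteq> cc' z w))"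
      using near[OF z(1)] by blast
    have "z \<in> U z \<inter> U' z" using gx gx' by blast
    then obtain N' where N': "openin M N'" "z \<in> N'" "\<forall>w\<in>N' - \<Gamma>. (cc z w \<noteq> cc' z w) = (cc z z \<noteq> cc' z z)"
      using lcD[OF lc_xor[OF gx(1) gx'(1)] _ z(2)] by blast
    have "\<forall>w\<in>N \<inter> N' - \<Gamma>. col w = col z" using N(2,4) N'(2,3) z(2) by blast
    then show "\<exists>N. openin M N \<and> z \<in> N \<and> (\<forall>z'\<in>N - \<Gamma>. col z' = col z)"
      using N N' by (intro exI[of _ "N \<inter> N'"]) blast
  qed simp
  moreover have "flip col (g e (1/2)) \<longleftrightarrow> (e \<in> C) \<noteq> (e \<in> C')" if e: "e \<in> E" for e
  proof -
    let ?x = "g e (1/2)"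
    have x: "?x \<in> topspace M" using arc_in_topspace[OF arc_g[OF e]] by simp
    note gx = goodD[OF monodromyD(1)[OF m x]] and gx' = goodD[OF monodromyD(1)[OF m' x]]
    obtain N where N: "openin M N" "?x \<in> N" "\<forall>w\<in>N - \<Gamma>. col w = (s ?x \<noteq> (cc ?x w \<noteq> cc' ?x w))"
      using near[OF x] by blast
    have "flip col ?x \<longleftrightarrow> flip (\<lambda>w. cc ?x w \<noteq> cc' ?x w) ?x"
      by (rule flip_cong_iff[OF N(1,2)]) (use N(3) in blast)
    also have "\<dots> \<longleftrightarrow> (flip (cc ?x) ?x \<noteq> flip (cc' ?x) ?x)"
      by (rule flip_xor_edge[OF e _ _ gx(1,2) gx'(1,2)]) auto
    also have "\<dots> \<longleftrightarrow> (e \<in> C) \<noteq> (e \<in> C')"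
      using gx(3)[OF e, of "1/2"] gx'(3)[OF e, of "1/2"] gx(2) gx'(2) by simp
    finally show ?thesis .
  qed
  ultimately show ?thesis by blast
qed

section \<open>Faces and the two sides of an edge\<close>

definition Faces :: "'b set set" where "Faces = embedding_faces M V E p g"

lemma Faces_def': "Faces = connected_components_of (subtopology M (topspace M - \<Gamma>))"
  unfolding Faces_def embedding_faces_def \<Gamma>_def ..

lemma face_unique: "F \<in> Faces \<Longrightarrow> F' \<in> Faces \<Longrightarrow> z \<in> F \<Longrightarrow> z \<in> F' \<Longrightarrow> F = F'"
  unfolding Faces_def' using pairwise_disjoint_connected_components_of
  by (metis disjnt_iff pairwiseD)

lemma face_connected: "F \<in> Faces \<Longrightarrow> connectedin M F" and face_sub: "F \<in> Faces \<Longrightarrow> F \<subseteq> topspace M - \<Gamma>"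
  and face_nonempty: "F \<in> Faces \<Longrightarrow> F \<noteq> {}"
proof -
  assume F: "F \<in> Faces"
  then have "connectedin (subtopology M (topspace M - \<Gamma>)) F"
    unfolding Faces_def' by (rule connectedin_connected_components_of)
  then show "connectedin M F" "F \<subseteq> topspace M - \<Gamma>" by (auto simp: connectedin_subtopology)
  show "F \<noteq> {}" using F unfolding Faces_def' by (rule nonempty_connected_components_of)
qed

lemma face_cover: "z \<in> topspace M - \<Gamma> \<Longrightarrow> \<exists>F\<in>Faces. z \<in> F"
  using Union_connected_components_of[of "subtopology M (topspace M - \<Gamma>)"] unfolding Faces_def' by auto

lemma connected_in_face:
  assumes K: "connectedin M K" "K \<subseteq> topspace M - \<Gamma>" and z: "z \<in> K" "z \<in> F" and F: "F \<in> Faces"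
  shows "K \<subseteq> F"
proof -
  have "connectedin (subtopology M (topspace M - \<Gamma>)) K" using K by (simp add: connectedin_subtopology)
  then show ?thesis
    using F z connected_components_of_maximal[of F "subtopology M (topspace M - \<Gamma>)" K]
    unfolding Faces_def' disjnt_def by blast
qed

definition ind :: "'b set set \<Rightarrow> 'b \<Rightarrow> bool" where "ind \<Psi> z \<longleftrightarrow> (\<exists>F\<in>\<Psi>. z \<in> F)"

lemma ind_face: "\<Psi> \<subseteq> Faces \<Longrightarrow> F \<in> Faces \<Longrightarrow> z \<in> F \<Longrightarrow> ind \<Psi> z \<longleftrightarrow> F \<in> \<Psi>"
  unfolding ind_def using face_unique by blast

lemma ind_lc: "\<Psi> \<subseteq> Faces \<Longrightarrow> lc (topspace M) (ind \<Psi>)"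
proof (rule lcI)
  fix z assume \<Psi>: "\<Psi> \<subseteq> Faces" and z: "z \<in> topspace M" "z \<notin> \<Gamma>"
  have "openin M (topspace M - \<Gamma>)" using closed_\<Gamma> by blast
  then obtain N where N: "openin M N" "z \<in> N" "N \<subseteq> topspace M - \<Gamma>" "connectedin M N"
    using punctured_connected_nbhd[of "topspace M - \<Gamma>" z] z by blast
  obtain F where F: "F \<in> Faces" "z \<in> F" using face_cover z by blast
  have "N \<subseteq> F" by (rule connected_in_face[OF N(4,3,2) F(2,1)])
  then have "\<forall>z'\<in>N - \<Gamma>. ind \<Psi> z' = ind \<Psi> z" using ind_face[OF \<Psi> F(1)] F(2) by blast
  then show "\<exists>N. openin M N \<and> z \<in> N \<and> (\<forall>z'\<in>N - \<Gamma>. ind \<Psi> z' = ind \<Psi> z)" using N by blast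
qed simp

text \<open>By \<open>sides_connect\<close> each side of the edge near its midpoint lies in a single
  face. These two faces may coincide.\<close>

lemma edge_faces:
  assumes e: "e \<in> E"
  shows "\<exists>F1\<in>Faces. \<exists>F2\<in>Faces. \<forall>\<Psi>. \<Psi> \<subseteq> Faces \<longrightarrow>
     (flip (ind \<Psi>) (g e (1/2)) \<longleftrightarrow> (F1 \<in> \<Psi>) \<noteq> (F2 \<in> \<Psi>)) \<and> (extend (ind \<Psi>) (g e (1/2)) \<longrightarrow> F1 \<in> \<Psi> \<and> F2 \<in> \<Psi>)"
proof -
  let ?y = "g e (1/2)"
  obtain N0 k where s: "sides N0 k" "?y \<in> N0" "N0 \<inter> \<Gamma> \<subseteq> g e ` {0<..<1}"
    by (rule edge_sides[OF e, of "1/2"]) auto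
  have y: "?y \<in> N0 \<inter> \<Gamma>" using s g_in_\<Gamma>[OF e] by auto
  have yt: "?y \<in> topspace M" using arc_in_topspace[OF arc_g[OF e]] by simp
  obtain N where N: "openin M N" "?y \<in> N" "\<forall>z\<in>N - \<Gamma>. \<forall>z'\<in>N - \<Gamma>. k z = k z' \<longrightarrow>
      (\<exists>K. connectedin M K \<and> K \<subseteq> topspace M - \<Gamma> \<and> z \<in> K \<and> z' \<in> K)"
    using sides_connect[OF s(1) y openin_topspace yt] by blast
  have NM: "N \<subseteq> topspace M" using N openin_subset by blast
  have "\<exists>F\<in>Faces. \<forall>z\<in>N - \<Gamma>. k z = b \<longrightarrow> z \<in> F" for b
  proof -
    obtain z0 where z0: "z0 \<in> N - \<Gamma>" "k z0 = b" using sides_dense[OF s(1) y N(1,2)] by blast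
    obtain F where F: "F \<in> Faces" "z0 \<in> F" using face_cover z0 NM by blast
    have "z \<in> F" if "z \<in> N - \<Gamma>" "k z = b" for z
    proof -
      have "k z0 = k z" using z0 that by simp
      then obtain K where "connectedin M K" "K \<subseteq> topspace M - \<Gamma>" "z0 \<in> K" "z \<in> K"
        using N(3) z0(1) \<open>z \<in> N - \<Gamma>\<close> by blast
      then show ?thesis using connected_in_face F by blast
    qed
    then show ?thesis using F by blast
  qed
  from this[of True] this[of False] obtain F1 F2 where F: "F1 \<in> Faces" "F2 \<in> Faces"
    "\<forall>z\<in>N - \<Gamma>. k z = True \<longrightarrow> z \<in> F1" "\<forall>z\<in>N - \<Gamma>. k z = False \<longrightarrow> z \<in> F2" by blast
  have "(flip (ind \<Psi>) ?y \<longleftrightarrow> (F1 \<in> \<Psi>) \<noteq> (F2 \<in> \<Psi>)) \<and> (extend (ind \<Psi>) ?y \<longrightarrow> F1 \<in> \<Psi> \<and> F2 \<in> \<Psi>)"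
    if \<Psi>: "\<Psi> \<subseteq> Faces" for \<Psi>
  proof -
    have v: "ind \<Psi> z = (if k z then F1 \<in> \<Psi> else F2 \<in> \<Psi>)" if "z \<in> N - \<Gamma>" for z
      using that F(3,4) ind_face[OF \<Psi> F(1), of z] ind_face[OF \<Psi> F(2), of z] by (cases "k z") auto
    have both: "\<exists>z\<in>N' \<inter> N - \<Gamma>. k z = b" if "openin M N'" "?y \<in> N'" for N' b
      using sides_dense[OF s(1) y, of "N' \<inter> N"] that N by blast
    have ex: "\<exists>z\<in>N' - \<Gamma>. ind \<Psi> z = (F1 \<in> \<Psi>)" "\<exists>z\<in>N' - \<Gamma>. ind \<Psi> z = (F2 \<in> \<Psi>)" if "openin M N'" "?y \<in> N'" for N'
      using both[OF that, of True] both[OF that, of False] v by (metis DiffD1 DiffD2 DiffI IntD1 IntD2)+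
    have "flip (ind \<Psi>) ?y \<longleftrightarrow> (F1 \<in> \<Psi>) \<noteq> (F2 \<in> \<Psi>)"
    proof
      assume "flip (ind \<Psi>) ?y"
      then obtain z z' where "z \<in> N - \<Gamma>" "z' \<in> N - \<Gamma>" "ind \<Psi> z \<noteq> ind \<Psi> z'" using N(1,2) unfolding flip_def by blast
      then show "(F1 \<in> \<Psi>) \<noteq> (F2 \<in> \<Psi>)" using v[of z] v[of z'] by (auto split: if_splits)
    next
      assume ne: "(F1 \<in> \<Psi>) \<noteq> (F2 \<in> \<Psi>)"
      show "flip (ind \<Psi>) ?y" unfolding flip_def
      proof (intro allI impI)
        fix N' assume "openin M N' \<and> ?y \<in> N'"
        then show "\<exists>z\<in>N' - \<Gamma>. \<exists>z'\<in>N' - \<Gamma>. ind \<Psi> z \<noteq> ind \<Psi> z'" using ex[of N'] ne by metis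
      qed
    qed
    moreover have "F1 \<in> \<Psi> \<and> F2 \<in> \<Psi>" if "extend (ind \<Psi>) ?y"
    proof -
      obtain N' where "openin M N'" "?y \<in> N'" "\<forall>z\<in>N' - \<Gamma>. ind \<Psi> z" using \<open>extend (ind \<Psi>) ?y\<close> unfolding extend_def by blast
      then show ?thesis using ex[of N'] by blast
    qed
    ultimately show ?thesis by blast
  qed
  then show ?thesis using F(1,2) by blast
qed

text \<open>A substitute for connectedness of the surface. If no edge bounds the union of
  \<open>\<Psi>\<close>, its indicator continues over all of \<open>M\<close>. Were the continuation
  False along \<open>\<Gamma>\<close>, a face in \<open>\<Psi>\<close> would be closed, hence
  compact, whereas faces are open discs. So it is True somewhere on \<open>\<Gamma>\<close>, and the
  connected graph carries this to every edge.\<close>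

lemma no_flip_all:
  assumes comp: "compact_space M" and conn: "connected_graph V E"
    and cell: "\<And>F. F \<in> Faces \<Longrightarrow> subtopology M F homeomorphic_space top_of_set (ball (0 :: real ^ 2) 1)"
    and \<Psi>: "\<Psi> \<subseteq> Faces" "\<Psi> \<noteq> {}" and nf: "\<And>e. e \<in> E \<Longrightarrow> \<not> flip (ind \<Psi>) (g e (1/2))" and e: "e \<in> E"
  shows "extend (ind \<Psi>) (g e (1/2))"
proof -
  have lc: "lc (topspace M) (ind \<Psi>)" using ind_lc \<Psi> by blast
  have gt: "g e t \<in> topspace M" if "e \<in> E" "t \<in> {0..1}" for e t using arc_in_topspace[OF arc_g[OF that(1)] that(2)] .
  have nfe: "\<not> flip (ind \<Psi>) (g e t)" if "e \<in> E" "0 < t" "t < 1" for e t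
  proof -
    have "flip (ind \<Psi>) (g e t) \<longleftrightarrow> flip (ind \<Psi>) (g e (1/2))"
      by (rule flip_edge_const[OF that _ _ lc]) (use gt[OF that(1)] in auto)
    then show ?thesis using nf that by blast
  qed
  have nfv: "\<not> flip (ind \<Psi>) (p v)" if "v \<in> V" for v
    by (rule vertex_no_flip[OF that lc p_top[OF that] nfe])
  have nf\<Gamma>: "\<not> flip (ind \<Psi>) y" if "y \<in> \<Gamma>" for y
    using that by (cases rule: \<Gamma>_cases) (use nfe nfv in blast)+
  let ?ex = "extend (ind \<Psi>)"
  have loc: "\<exists>N. openin M N \<and> y \<in> N \<and> (\<forall>y'\<in>N. ?ex y' = ?ex y)" if y: "y \<in> topspace M" for y
    by (rule extend_nbhd[OF lc y nf\<Gamma>]) blast+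
  have op: "openin M {y \<in> topspace M. ?ex y = b}" for b
  proof (subst openin_subopen, intro ballI)
    fix y assume y: "y \<in> {y \<in> topspace M. ?ex y = b}"
    then obtain N where N: "openin M N" "y \<in> N" "\<forall>y'\<in>N. ?ex y' = ?ex y" using loc by blast
    then have "N \<subseteq> {y \<in> topspace M. ?ex y = b}" using y openin_subset[OF N(1)] by blast
    then show "\<exists>N. openin M N \<and> y \<in> N \<and> N \<subseteq> {y \<in> topspace M. ?ex y = b}" using N by blast
  qed
  have exv: "?ex z = ind \<Psi> z" if "z \<in> topspace M - \<Gamma>" for z using extend_lc[OF lc that] .
  have "\<exists>y\<in>\<Gamma>. ?ex y"
  proof (rule ccontr)
    assume no: "\<not> ?thesis"
    obtain F where F: "F \<in> \<Psi>" using \<Psi> by blast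
    then have FF: "F \<in> Faces" using \<Psi> by blast
    let ?W = "{y \<in> topspace M. ?ex y = True}"
    have W\<Gamma>: "?W \<subseteq> topspace M - \<Gamma>" using no by blast
    have "closedin M ?W"
    proof -
      have "topspace M - ?W = {y \<in> topspace M. ?ex y = False}" by blast
      then show ?thesis using op[of False] unfolding closedin_def by simp
    qed
    have FW: "F \<subseteq> ?W"
    proof
      fix z assume z: "z \<in> F"
      then have zt: "z \<in> topspace M - \<Gamma>" using face_sub[OF FF] by blast
      then have "?ex z" using exv ind_face[OF \<Psi>(1) FF z] F by blast
      then show "z \<in> ?W" using zt by blast
    qed
    have "closedin (subtopology M (topspace M - \<Gamma>)) F"
      using FF unfolding Faces_def' by (rule closedin_connected_components_of)
    then obtain K where K: "closedin M K" "F = K \<inter> (topspace M - \<Gamma>)" unfolding closedin_subtopology by blast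
    have "F = K \<inter> ?W" using K(2) FW W\<Gamma> by blast
    then have "closedin M F" using K(1) \<open>closedin M ?W\<close> by (metis closedin_Int)
    then have "compactin M F" using comp closedin_compact_space by blast
    then have "compact_space (subtopology M F)" by (simp add: compactin_subspace)
    then have "compact_space (top_of_set (ball (0 :: real ^ 2) 1))"
      using cell[OF FF] homeomorphic_compact_space by blast
    then have "compact (ball (0 :: real ^ 2) 1)" by (simp add: compact_space_def compactin_subtopology)
    then have "closed (ball (0 :: real ^ 2) 1)" by (rule compact_imp_closed)
    then have "ball (0 :: real ^ 2) 1 = cball 0 1" using closure_ball[of 1 "0 :: real ^ 2"] by (simp add: closure_closed)
    then show False by (simp add: ball_eq_cball_iff)
  qed
  then obtain y where y: "y \<in> \<Gamma>" "?ex y" by blast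
  have con: "?ex a = ?ex b" if K: "connectedin M K" "a \<in> K" "b \<in> K" for K a b
  proof (rule connectedin_locally_constant[OF K(1) _ K(2,3)])
    fix y assume "y \<in> K"
    then have "y \<in> topspace M" using K(1) connectedin_subset_topspace by blast
    then show "\<exists>N. openin M N \<and> y \<in> N \<and> (\<forall>y'\<in>N \<inter> K. ?ex y' = ?ex y)" using loc[of y] by blast
  qed
  have edge: "?ex (g e s) = ?ex (g e t)" if "e \<in> E" "s \<in> {0..1}" "t \<in> {0..1}" for e s t
    using con[OF arc_in_segment(2)[OF arc_g[OF that(1)], of 0 1]] that by simp
  have adj: "?ex (p u) = ?ex (p w)" if uw: "{u, w} \<in> E" for u w
  proof -
    have ends: "{g {u, w} 0, g {u, w} 1} = {p u, p w}" using g_ends[OF uw] by simp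
    have "?ex (g {u, w} 0) = ?ex (g {u, w} 1)" using edge[OF uw, of 0 1] by simp
    then show ?thesis using ends by (metis doubleton_eq_iff)
  qed
  have "?ex (p u) = ?ex (p w)" if "(u, w) \<in> (adjacency E)\<^sup>*" for u w
    using that by (induction rule: rtrancl_induct) (auto simp: adjacency_def adj)
  then have V: "?ex (p u) = ?ex (p w)" if "u \<in> V" "w \<in> V" for u w
    using conn that unfolding connected_graph_def by blast
  have end0: "\<exists>v\<in>V. ?ex (g e t) = ?ex (p v)" if et: "e \<in> E" "t \<in> {0..1}" for e t
  proof -
    have "g e 0 \<in> p ` e" using g_ends[OF et(1)] by blast
    then obtain v where "v \<in> V" "g e 0 = p v" using edge_sub[OF et(1)] by blast
    then show ?thesis using edge[OF et(1,2), of 0] by auto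
  qed
  have "\<exists>v\<in>V. ?ex (p v)"
    using y(1)
  proof (cases rule: \<Gamma>_cases)
    case (vertex v) then show ?thesis using y by blast
  next
    case (edge e' t)
    then show ?thesis using end0[of e' t] y(2) by auto
  qed
  moreover obtain v where "v \<in> V" "?ex (g e (1/2)) = ?ex (p v)" using end0[OF e, of "1/2"] by auto
  ultimately show ?thesis using V by blast
qed

section \<open>Even edge sets against colourings of the faces\<close>

lemma parity_sym_diff:
  assumes "finite A" "finite B"
  shows "even (card ((A - B) \<union> (B - A))) \<longleftrightarrow> (even (card A) \<longleftrightarrow> even (card B))"
proof -
  have "card A = card (A - B) + card (A \<inter> B)" "card B = card (B - A) + card (A \<inter> B)"
    using card_Diff_subset_Int[of A B] card_Diff_subset_Int[of B A] assms
    by (metis Int_Diff_Un Int_Diff_disjoint card_Un_disjoint finite_Diff finite_Int add.commute Int_commute)+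
  moreover have "card ((A - B) \<union> (B - A)) = card (A - B) + card (B - A)"
    using assms by (intro card_Un_disjoint) auto
  ultimately show ?thesis by auto
qed

lemma handshake:
  assumes "D \<subseteq> E"
  shows "(\<Sum>v\<in>V. card {e\<in>D. v \<in> e}) = 2 * card D"
proof -
  have fD: "finite D" using assms finite_E finite_subset by blast
  have "(\<Sum>v\<in>V. card {e\<in>D. v \<in> e}) = (\<Sum>v\<in>V. \<Sum>e\<in>D. if v \<in> e then 1 else 0)"
    using fD by (intro sum.cong) (auto simp: sum.If_cases Int_def)
  also have "\<dots> = (\<Sum>e\<in>D. \<Sum>v\<in>V. if v \<in> e then 1 else 0)" by (rule sum.swap)
  also have "\<dots> = (\<Sum>e\<in>D. 2)"
  proof (rule sum.cong[OF refl])
    fix e assume "e \<in> D"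
    then have "e \<subseteq> V" "card e = 2" using assms edge_sub edge_card by auto
    then have "V \<inter> e = e" by blast
    then show "(\<Sum>v\<in>V. if v \<in> e then 1 else 0) = (2::nat)" using \<open>card e = 2\<close> finite_V by (simp add: sum.If_cases)
  qed
  finally show ?thesis by simp
qed

text \<open>An edge set is mapped to its odd vertices other than \<open>v0\<close>. Symmetric
  differences within one fibre are even away from \<open>v0\<close>, and at \<open>v0\<close> by the
  handshake identity, so the largest fibre supplies enough even sets.\<close>

lemma many_even_sets:
  assumes "V \<noteq> {}"
  shows "2 ^ card E \<le> 2 ^ (card V - 1) * card {C. even_set C}"
proof -
  obtain v0 where v0: "v0 \<in> V" using assms by blast
  define h where "h D = {v\<in>V - {v0}. odd (card {e\<in>D. v \<in> e})}" for D
  have "h ` Pow E \<subseteq> Pow (V - {v0})" by (auto simp: h_def)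
  then obtain K where K: "K \<subseteq> Pow E" "K \<noteq> {}" "card (Pow E) \<le> card (Pow (V - {v0})) * card K"
     "\<And>x y. x \<in> K \<Longrightarrow> y \<in> K \<Longrightarrow> h x = h y"
    using pigeonhole_fibre[of "Pow E" "Pow (V - {v0})" h] finite_E finite_V
    by (metis Pow_not_empty finite_Diff finite_Pow_iff)
  obtain D0 where D0: "D0 \<in> K" using K by blast
  define sd where "sd D = (D - D0) \<union> (D0 - D)" for D :: "'a set set"
  have "inj_on sd K" unfolding sd_def inj_on_def by blast
  moreover have "sd ` K \<subseteq> {C. even_set C}"
  proof
    fix C assume "C \<in> sd ` K"
    then obtain D where D: "D \<in> K" "C = sd D" by blast
    have DE: "D \<subseteq> E" "D0 \<subseteq> E" using D D0 K by auto
    have CE: "C \<subseteq> E" using DE D(2) by (auto simp: sd_def)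
    have fin: "finite D" "finite D0" using DE finite_E finite_subset by blast+
    have par: "even (card {e\<in>C. v \<in> e})" if v: "v \<in> V" "v \<noteq> v0" for v
    proof -
      have "{e\<in>C. v \<in> e} = ({e\<in>D. v \<in> e} - {e\<in>D0. v \<in> e}) \<union> ({e\<in>D0. v \<in> e} - {e\<in>D. v \<in> e})"
        unfolding D(2) sd_def by blast
      moreover have "(v \<in> h D) = (v \<in> h D0)" using K(4)[OF D(1) D0] by simp
      then have "even (card {e\<in>D. v \<in> e}) = even (card {e\<in>D0. v \<in> e})" using v unfolding h_def by blast
      ultimately show ?thesis using parity_sym_diff[of "{e\<in>D. v \<in> e}" "{e\<in>D0. v \<in> e}"] fin by simp
    qed
    have "even (card {e\<in>C. v0 \<in> e})"
    proof -
      have "(\<Sum>v\<in>V. card {e\<in>C. v \<in> e}) = card {e\<in>C. v0 \<in> e} + (\<Sum>v\<in>V - {v0}. card {e\<in>C. v \<in> e})"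
        using v0 finite_V by (rule sum.remove[rotated])
      moreover have "even (\<Sum>v\<in>V - {v0}. card {e\<in>C. v \<in> e})" using par by (intro dvd_sum) auto
      moreover have "even (\<Sum>v\<in>V. card {e\<in>C. v \<in> e})" unfolding handshake[OF CE] by simp
      ultimately show ?thesis by (simp only: even_add)
    qed
    then have "even_set C" unfolding even_set_def using CE par by blast
    then show "C \<in> {C. even_set C}" by blast
  qed
  moreover have "finite {C. even_set C}"
    using finite_E by (auto simp: even_set_def intro: finite_subset[of _ "Pow E"])
  ultimately have "card K \<le> card {C. even_set C}" using card_inj_on_le by blast
  moreover have "card (Pow E) = 2 ^ card E" "card (Pow (V - {v0})) = 2 ^ (card V - 1)"
    using finite_E finite_V v0 by (simp_all add: card_Pow card_Diff_singleton)
  ultimately show ?thesis using K(3) by (metis le_trans mult_le_mono2)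
qed

text \<open>A colouring normalised to be False on one face amounts to a set of other faces, and
  through its flips it determines \<open>C\<close> relative to the fixed \<open>C0\<close>.\<close>

lemma few_colourings:
  assumes fin: "finite Faces" "Faces \<noteq> {}" and K: "finite K" "K \<noteq> {}" "\<And>C. C \<in> K \<Longrightarrow> C \<subseteq> E"
    and col: "\<And>C C'. C \<in> K \<Longrightarrow> C' \<in> K \<Longrightarrow>
      \<exists>col. lc (topspace M) col \<and> (\<forall>e\<in>E. flip col (g e (1/2)) \<longleftrightarrow> (e \<in> C) \<noteq> (e \<in> C'))"
  shows "card K \<le> 2 ^ (card Faces - 1)"
proof -
  obtain C0 where C0: "C0 \<in> K" using K by blast
  obtain F0 where F0: "F0 \<in> Faces" using fin by blast
  obtain z0 where z0: "z0 \<in> F0" using face_nonempty F0 by blast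
  have "\<forall>C\<in>K. \<exists>col. lc (topspace M) col \<and> \<not> col z0 \<and> (\<forall>e\<in>E. flip col (g e (1/2)) \<longleftrightarrow> (e \<in> C) \<noteq> (e \<in> C0))"
  proof
    fix C assume "C \<in> K"
    then obtain cl where cl: "lc (topspace M) cl" "\<forall>e\<in>E. flip cl (g e (1/2)) \<longleftrightarrow> (e \<in> C) \<noteq> (e \<in> C0)" using col C0 by blast
    let ?c = "\<lambda>z. cl z0 \<noteq> cl z"
    have "lc (topspace M \<inter> topspace M) ?c" by (rule lc_xor[OF lc_const[OF openin_topspace] cl(1)])
    moreover have "flip ?c (g e (1/2)) \<longleftrightarrow> flip cl (g e (1/2))" if "e \<in> E" for e
      by (rule flip_cong_iff[OF openin_topspace]) (use arc_in_topspace[OF arc_g[OF that]] in auto)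
    ultimately show "\<exists>col. lc (topspace M) col \<and> \<not> col z0 \<and> (\<forall>e\<in>E. flip col (g e (1/2)) \<longleftrightarrow> (e \<in> C) \<noteq> (e \<in> C0))"
      using cl(2) by (intro exI[of _ ?c]) simp
  qed
  then obtain cl where cl: "\<And>C. C \<in> K \<Longrightarrow> lc (topspace M) (cl C)" "\<And>C. C \<in> K \<Longrightarrow> \<not> cl C z0"
     "\<And>C e. C \<in> K \<Longrightarrow> e \<in> E \<Longrightarrow> flip (cl C) (g e (1/2)) \<longleftrightarrow> (e \<in> C) \<noteq> (e \<in> C0)" by metis
  define \<Psi> where "\<Psi> C = {F\<in>Faces. \<exists>z\<in>F. cl C z}" for C
  have val: "cl C z \<longleftrightarrow> F \<in> \<Psi> C" if "C \<in> K" "F \<in> Faces" "z \<in> F" for C F z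
  proof -
    have "cl C z = cl C z'" if "z' \<in> F" for z'
      using lc_connected[OF cl(1)[OF \<open>C \<in> K\<close>] face_connected[OF \<open>F \<in> Faces\<close>] face_sub[OF \<open>F \<in> Faces\<close>] \<open>z \<in> F\<close> that] .
    then show ?thesis using that unfolding \<Psi>_def by blast
  qed
  have "\<Psi> ` K \<subseteq> Pow (Faces - {F0})"
  proof -
    have "F0 \<notin> \<Psi> C" if "C \<in> K" for C using val[OF that F0 z0] cl(2)[OF that] by blast
    then show ?thesis unfolding \<Psi>_def by blast
  qed
  moreover have "inj_on \<Psi> K"
  proof (rule inj_onI)
    fix C C' assume CC: "C \<in> K" "C' \<in> K" "\<Psi> C = \<Psi> C'"
    have same: "cl C z = cl C' z" if "z \<in> topspace M - \<Gamma>" for z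
      using face_cover[OF that] val[OF CC(1)] val[OF CC(2)] CC(3) by blast
    have "(e \<in> C) = (e \<in> C')" if e: "e \<in> E" for e
    proof -
      have "flip (cl C) (g e (1/2)) \<longleftrightarrow> flip (cl C') (g e (1/2))"
        by (rule flip_cong_iff[OF openin_topspace, of _ _ False]) (use arc_in_topspace[OF arc_g[OF e]] same in auto)
      then show ?thesis using cl(3)[OF CC(1) e] cl(3)[OF CC(2) e] by blast
    qed
    then show "C = C'" using K(3) CC(1,2) by blast
  qed
  ultimately have "card K \<le> card (Pow (Faces - {F0}))"
    using fin by (intro card_inj_on_le) auto
  then show ?thesis using fin F0 by (simp add: card_Pow card_Diff_singleton)
qed

text \<open>The constant 2 records two normalisations: one vertex is exempt in
  \<open>many_even_sets\<close> and one face is fixed in \<open>few_colourings\<close>.\<close>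

lemma Euler_inequality:
  assumes fin: "finite Faces" "Faces \<noteq> {}" "V \<noteq> {}"
    and secs: "\<And>(Z :: 'a set set set) T. finite Z \<Longrightarrow> Z \<noteq> {} \<Longrightarrow> (\<And>C. C \<in> Z \<Longrightarrow> loc_sys M (T C)) \<Longrightarrow>
      \<exists>K\<subseteq>Z. K \<noteq> {} \<and> card Z \<le> 2 ^ k * card K \<and> (\<forall>C\<in>K. \<forall>C'\<in>K. \<exists>s. sec M (\<lambda>x y. T C x y \<noteq> T C' x y) s)"
  shows "int (card E) + 2 - int k \<le> int (card V) + int (card Faces)"
proof -
  let ?Z = "{C. even_set C}"
  have fZ: "finite ?Z" using finite_E by (auto simp: even_set_def intro: finite_subset[of _ "Pow E"])
  have "even_set {}" by (simp add: even_set_def)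
  then have neZ: "?Z \<noteq> {}" by blast
  have "\<forall>C\<in>?Z. \<exists>U cc T. monodromy C U cc T" using monodromy_exists by blast
  then obtain U cc T where m: "\<And>C. C \<in> ?Z \<Longrightarrow> monodromy C (U C) (cc C) (T C)" by metis
  have "loc_sys M (T C)" if "C \<in> ?Z" for C using monodromy_loc_sys[OF m[OF that]] .
  then obtain K where K: "K \<subseteq> ?Z" "K \<noteq> {}" "card ?Z \<le> 2 ^ k * card K"
     "\<forall>C\<in>K. \<forall>C'\<in>K. \<exists>s. sec M (\<lambda>x y. T C x y \<noteq> T C' x y) s"
    using secs[OF fZ neZ, of T] by blast
  have "card K \<le> 2 ^ (card Faces - 1)"
  proof (rule few_colourings[OF fin(1,2)])
    show "finite K" using K fZ finite_subset by blast
    show "K \<noteq> {}" by (rule K)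
    show "C \<subseteq> E" if "C \<in> K" for C using K(1) that by (auto simp: even_set_def)
    fix C C' assume CC: "C \<in> K" "C' \<in> K"
    then obtain s where s: "sec M (\<lambda>x y. T C x y \<noteq> T C' x y) s" using K(4) by blast
    have "C \<in> ?Z" "C' \<in> ?Z" using CC K(1) by blast+
    then show "\<exists>col. lc (topspace M) col \<and> (\<forall>e\<in>E. flip col (g e (1/2)) \<longleftrightarrow> (e \<in> C) \<noteq> (e \<in> C'))"
      by (rule section_colouring[OF m m s])
  qed
  then have "card ?Z \<le> 2 ^ k * 2 ^ (card Faces - 1)" using K(3) by (meson le_trans mult_le_mono2)
  then have "2 ^ card E \<le> 2 ^ (card V - 1) * (2 ^ k * 2 ^ (card Faces - 1) :: nat)"
    using many_even_sets[OF fin(3)] by (meson le_trans mult_le_mono2)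
  also have "\<dots> = 2 ^ ((card V - 1) + (k + (card Faces - 1)))" by (simp add: power_add)
  finally have "card E \<le> (card V - 1) + (k + (card Faces - 1))" by (rule power_le_imp_le_exp[rotated]) simp
  moreover have "card V \<ge> 1" "card Faces \<ge> 1" using fin finite_V by (simp_all add: Suc_le_eq card_gt_0_iff)
  ultimately show ?thesis by linarith
qed

end

text \<open>All that the discharging learns about the embedding. The names \<open>l\<close> and
  \<open>r\<close> of the faces on the two sides of an edge carry no orientation. The closure
  property says that no family of faces is cut off from the rest.\<close>

theorem embedding_faces_structure:
  fixes V :: "'a set" and M :: "'b topology"
  assumes simple: "simple_graph V E" and conn: "connected_graph V E" and E: "E \<noteq> {}"
    and surf: "(\<exists>h. sphere_with_handles h M \<and> chi = 2 - 2 * int h) \<or>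
         (\<exists>q\<ge>1. sphere_with_crosscaps q M \<and> chi = 2 - int q)"
    and cell: "two_cell_embedding M V E p g"
  obtains \<Phi> :: "'b set set" and l r where "finite \<Phi>" "\<And>e. e \<in> E \<Longrightarrow> l e \<in> \<Phi> \<and> r e \<in> \<Phi>"
    "\<And>F v. F \<in> \<Phi> \<Longrightarrow> v \<in> V \<Longrightarrow> even (card {e\<in>E. v \<in> e \<and> (l e = F) \<noteq> (r e = F)})"
    "\<And>\<Psi> e. \<Psi> \<subseteq> \<Phi> \<Longrightarrow> \<Psi> \<noteq> {} \<Longrightarrow> (\<And>e. e \<in> E \<Longrightarrow> (l e \<in> \<Psi>) = (r e \<in> \<Psi>)) \<Longrightarrow> e \<in> E \<Longrightarrow> l e \<in> \<Psi> \<and> r e \<in> \<Psi>"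
    "int (card E) + chi \<le> int (card V) + int (card \<Phi>)"
proof -
  obtain k where k: "chi = 2 - int k" and surfM: "surface M" and comp: "compact_space M"
    and secs: "\<And>(Z :: 'a set set set) T. finite Z \<Longrightarrow> Z \<noteq> {} \<Longrightarrow> (\<And>C. C \<in> Z \<Longrightarrow> loc_sys M (T C)) \<Longrightarrow>
      \<exists>K\<subseteq>Z. K \<noteq> {} \<and> card Z \<le> 2 ^ k * card K \<and> (\<forall>C\<in>K. \<forall>C'\<in>K. \<exists>s. sec M (\<lambda>x y. T C x y \<noteq> T C' x y) s)"
  proof -
    from surf show ?thesis
    proof (elim disjE exE conjE)
      fix h assume h: "sphere_with_handles h M" "chi = 2 - 2 * int h"
      obtain c r f where M': "disjoint_caps (2 * h) c r" "quotient_map (top_of_set (holed_sphere (2 * h) c r)) M f"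
        "\<forall>x\<in>holed_sphere (2 * h) c r. \<forall>y\<in>holed_sphere (2 * h) c r.
           f x = f y \<longleftrightarrow> x = y \<or> handle_glued h c r x y \<or> handle_glued h c r y x"
        using h(1) unfolding sphere_with_handles_def by blast
      show ?thesis
        by (rule that[of "2 * h", OF _ glued_sphere.M_surface[OF handles_glued[OF M']]
              glued_sphere.M_compact[OF handles_glued[OF M']] handles_sections[OF h(1)]]) (use h(2) in simp_all)
    next
      fix q assume q: "sphere_with_crosscaps q M" "chi = 2 - int q"
      obtain c r f where M': "disjoint_caps q c r" "quotient_map (top_of_set (holed_sphere q c r)) M f"
        "\<forall>x\<in>holed_sphere q c r. \<forall>y\<in>holed_sphere q c r. f x = f y \<longleftrightarrow> x = y \<or> crosscap_glued q c r x y"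
        using q(1) unfolding sphere_with_crosscaps_def by blast
      show ?thesis
        by (rule that[of q, OF _ glued_sphere.M_surface[OF crosscaps_glued[OF M']]
              glued_sphere.M_compact[OF crosscaps_glued[OF M']] crosscaps_sections[OF q(1)]]) (use q(2) in simp_all)
    qed
  qed
  interpret surface M by (rule surfM)
  have iso: "\<exists>e\<in>E. v \<in> e" if v: "v \<in> V" for v
  proof -
    obtain e where e: "e \<in> E" using E by blast
    then have "e \<subseteq> V" "card e = 2" using simple by (auto simp: simple_graph_def)
    then obtain u where u: "u \<in> e" "u \<in> V" by (metis card.empty ex_in_conv subsetD zero_neq_numeral)
    show ?thesis
    proof (cases "u = v")
      case False
      have "(v, u) \<in> (adjacency E)\<^sup>*" using conn u v unfolding connected_graph_def by blast
      then obtain y where "(v, y) \<in> adjacency E" using False by (metis converse_rtranclE)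
      then show ?thesis unfolding adjacency_def by blast
    qed (use e u in blast)
  qed
  interpret surface_graph M V E p g
    by unfold_locales (use simple cell iso in \<open>auto simp: two_cell_embedding_def\<close>)
  have cellF: "subtopology M F homeomorphic_space top_of_set (ball (0 :: real ^ 2) 1)" if "F \<in> Faces" for F
    using cell that unfolding two_cell_embedding_def Faces_def by blast
  obtain l where "\<And>e. e \<in> E \<Longrightarrow> l e \<in> Faces \<and> (\<exists>F2\<in>Faces. \<forall>\<Psi>. \<Psi> \<subseteq> Faces \<longrightarrow>
     (flip (ind \<Psi>) (g e (1/2)) \<longleftrightarrow> (l e \<in> \<Psi>) \<noteq> (F2 \<in> \<Psi>)) \<and> (extend (ind \<Psi>) (g e (1/2)) \<longrightarrow> l e \<in> \<Psi> \<and> F2 \<in> \<Psi>))"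
    using edge_faces by metis
  then obtain r where lr: "\<And>e. e \<in> E \<Longrightarrow> l e \<in> Faces \<and> r e \<in> Faces \<and> (\<forall>\<Psi>. \<Psi> \<subseteq> Faces \<longrightarrow>
     (flip (ind \<Psi>) (g e (1/2)) \<longleftrightarrow> (l e \<in> \<Psi>) \<noteq> (r e \<in> \<Psi>)) \<and> (extend (ind \<Psi>) (g e (1/2)) \<longrightarrow> l e \<in> \<Psi> \<and> r e \<in> \<Psi>))"
    by metis
  have cl: "l e \<in> \<Psi> \<and> r e \<in> \<Psi>"
    if "\<Psi> \<subseteq> Faces" "\<Psi> \<noteq> {}" "\<And>e. e \<in> E \<Longrightarrow> (l e \<in> \<Psi>) = (r e \<in> \<Psi>)" "e \<in> E" for \<Psi> e
  proof -
    have "\<not> flip (ind \<Psi>) (g e (1/2))" if "e \<in> E" for e using lr[OF that] \<open>\<Psi> \<subseteq> Faces\<close> \<open>\<And>e. e \<in> E \<Longrightarrow> (l e \<in> \<Psi>) = (r e \<in> \<Psi>)\<close>[OF that] by blast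
    then have "extend (ind \<Psi>) (g e (1/2))" using no_flip_all[OF comp conn cellF that(1,2)] that(4) by blast
    then show ?thesis using lr[OF that(4)] that(1) by blast
  qed
  \<comment> \<open>A face that touches no edge would form a closed family by itself, contrary to
    \<open>cl\<close>. Finiteness of \<open>Faces\<close> follows.\<close>
  have "Faces \<subseteq> l ` E \<union> r ` E"
  proof
    fix F assume F: "F \<in> Faces"
    show "F \<in> l ` E \<union> r ` E"
    proof (rule ccontr)
      assume no: "F \<notin> l ` E \<union> r ` E"
      obtain e where e: "e \<in> E" using E by blast
      have "l e \<in> {F}" using cl[of "{F}" e] F e no by blast
      then show False using no e by blast
    qed
  qed
  then have fin: "finite Faces" using finite_E by (meson finite_Un finite_imageI finite_subset)
  have ne: "Faces \<noteq> {}" using lr E by blast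
  have neV: "V \<noteq> {}" using conn by (simp add: connected_graph_def)
  have ev: "even (card {e\<in>E. v \<in> e \<and> (l e = F) \<noteq> (r e = F)})" if F: "F \<in> Faces" and v: "v \<in> V" for F v
  proof -
    have "{e\<in>E. v \<in> e \<and> (l e = F) \<noteq> (r e = F)} = {e\<in>E. v \<in> e \<and> flip (ind {F}) (g e (1/2))}"
      using lr F by auto
    then show ?thesis using vertex_flip_even[OF v ind_lc[of "{F}"]] F by simp
  qed
  have eul: "int (card E) + chi \<le> int (card V) + int (card Faces)"
  proof -
    have "int (card E) + 2 - int k \<le> int (card V) + int (card Faces)"
      by (rule Euler_inequality[OF fin ne neV]) (rule secs)
    then show ?thesis using k by linarith
  qed
  show ?thesis by (rule that[OF fin _ ev cl eul]) (use lr in blast)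
qed

section \<open>Discharging\<close>

text \<open>\<open>D1\<close> and \<open>D2\<close> are \<open>B' \<ge> 2 * s - 1\<close> unfolded:
  \<open>D1\<close> comes from \<open>b1\<close>, and \<open>D2\<close> from the maximum in
  \<open>b3\<close>, where the entry with \<open>- 3\<close> turns into the bound
  \<open>2 * s + 2\<close>.\<close>

locale face_structure =
  fixes V :: "'a set" and E :: "'a set set" and \<Phi> :: "'f set" and l r :: "'a set \<Rightarrow> 'f"
    and chi :: int and s :: nat and I :: "'a set"
  assumes simple: "simple_graph V E" and conn: "connected_graph V E"
    and fin_\<Phi>: "finite \<Phi>" and lr: "e \<in> E \<Longrightarrow> l e \<in> \<Phi> \<and> r e \<in> \<Phi>"
    and boundary_even: "F \<in> \<Phi> \<Longrightarrow> v \<in> V \<Longrightarrow> even (card {e\<in>E. v \<in> e \<and> (l e = F) \<noteq> (r e = F)})"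
    and boundary_closed: "\<Psi> \<subseteq> \<Phi> \<Longrightarrow> \<Psi> \<noteq> {} \<Longrightarrow> (\<And>e. e \<in> E \<Longrightarrow> (l e \<in> \<Psi>) = (r e \<in> \<Psi>)) \<Longrightarrow> e \<in> E \<Longrightarrow> l e \<in> \<Psi> \<and> r e \<in> \<Psi>"
    and euler: "int (card E) + chi \<le> int (card V) + int (card \<Phi>)"
    and s4: "s \<ge> 4" and Vs: "\<exists>v\<in>V. vertex_degree E v = s"
    and D1: "x \<in> V \<Longrightarrow> y \<in> V \<Longrightarrow> x \<noteq> y \<Longrightarrow> {x, y} \<in> E \<or> (\<exists>w. {x, w} \<in> E \<and> {w, y} \<in> E) \<Longrightarrow>
       2 * s \<le> vertex_degree E x + vertex_degree E y"
    and D2: "{x, y} \<in> E \<Longrightarrow> 2 * s + 2 \<le> vertex_degree E x + vertex_degree E y \<or>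
       2 * s + card (neighbourhood E x \<inter> neighbourhood E y) \<le> vertex_degree E x + vertex_degree E y"
    and I_sub: "I \<subseteq> {v\<in>V. vertex_degree E v = s}" and I_ind: "x \<in> I \<Longrightarrow> y \<in> I \<Longrightarrow> {x, y} \<notin> E"
    and I_max: "v \<in> V \<Longrightarrow> vertex_degree E v = s \<Longrightarrow> v \<notin> I \<Longrightarrow> \<exists>u\<in>I. {u, v} \<in> E"
begin

abbreviation dg :: "'a \<Rightarrow> nat" where "dg \<equiv> vertex_degree E"
abbreviation nb :: "'a \<Rightarrow> 'a set" where "nb \<equiv> neighbourhood E"

lemma finite_V: "finite V" and finite_E: "finite E" and edge_sub: "e \<in> E \<Longrightarrow> e \<subseteq> V"
  and edge_card: "e \<in> E \<Longrightarrow> card e = 2"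
proof -
  show V: "finite V" and *: "e \<in> E \<Longrightarrow> e \<subseteq> V" "e \<in> E \<Longrightarrow> card e = 2" for e
    using simple by (auto simp: simple_graph_def)
  have "E \<subseteq> Pow V" using *(1) by blast
  then show "finite E" using V finite_subset by blast
qed

lemma edgeD: "{x, y} \<in> E \<Longrightarrow> x \<in> V \<and> y \<in> V \<and> x \<noteq> y"
  using edge_sub[of "{x, y}"] edge_card[of "{x, y}"] by auto

lemma edgeE:
  assumes "e \<in> E" "v \<in> e"
  obtains w where "e = {v, w}" "w \<noteq> v"
proof -
  obtain a b where ab: "e = {a, b}" "a \<noteq> b" using edge_card[OF assms(1)] by (meson card_2_iff)
  show ?thesis
  proof (cases "v = a")
    case True then show ?thesis using that[of b] ab by simp
  next
    case False
    then have "v = b" using assms ab by simp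
    then show ?thesis using that[of a] ab by auto
  qed
qed

lemma nb_iff: "y \<in> nb x \<longleftrightarrow> {x, y} \<in> E"
  by (simp add: neighbourhood_def)

lemma nb_sym: "y \<in> nb x \<longleftrightarrow> x \<in> nb y"
  by (simp add: nb_iff insert_commute)

lemma nb_sub: "nb x \<subseteq> V"
  using edgeD by (auto simp: nb_iff)

lemma finite_nb: "finite (nb x)"
  using nb_sub finite_V finite_subset by blast

lemma card_nb: "card (nb x) = dg x"
  by (simp add: vertex_degree_def)

lemma dart_sum:
  fixes X :: "'a set \<Rightarrow> int"
  assumes "E0 \<subseteq> E"
  shows "(\<Sum>v\<in>V. \<Sum>w\<in>nb v. if {v, w} \<in> E0 then X {v, w} else 0) = 2 * (\<Sum>e\<in>E0. X e)"
proof -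
  let ?D = "SIGMA v:V. nb v"
  have fD: "finite ?D" using finite_V finite_nb by (intro finite_SigmaI) auto
  have "(\<Sum>v\<in>V. \<Sum>w\<in>nb v. if {v, w} \<in> E0 then X {v, w} else 0) = (\<Sum>(v, w)\<in>?D. if {v, w} \<in> E0 then X {v, w} else 0)"
    using finite_V finite_nb by (subst sum.Sigma) auto
  also have "\<dots> = (\<Sum>e\<in>E. \<Sum>d\<in>{d\<in>?D. {fst d, snd d} = e}. case d of (v, w) \<Rightarrow> if {v, w} \<in> E0 then X {v, w} else 0)"
    by (rule sum.group[symmetric, OF fD finite_E]) (auto simp: nb_iff)
  also have "\<dots> = (\<Sum>e\<in>E. if e \<in> E0 then 2 * X e else 0)"
  proof (rule sum.cong[OF refl])
    fix e assume e: "e \<in> E"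
    then obtain a b where ab: "e = {a, b}" "a \<noteq> b" using edge_card by (meson card_2_iff)
    have "{d\<in>?D. {fst d, snd d} = e} = {(a, b), (b, a)}"
      using e edgeD ab by (auto simp: nb_iff doubleton_eq_iff insert_commute)
    then show "(\<Sum>d\<in>{d\<in>?D. {fst d, snd d} = e}. case d of (v, w) \<Rightarrow> if {v, w} \<in> E0 then X {v, w} else 0)
        = (if e \<in> E0 then 2 * X e else 0)"
      using ab by (simp add: insert_commute)
  qed
  also have "\<dots> = (\<Sum>e\<in>E0. 2 * X e)"
    using assms finite_E by (simp add: sum.If_cases Int_absorb1)
  finally show ?thesis by (simp add: sum_distrib_left)
qed

lemma degree_sum: "(\<Sum>v\<in>V. int (dg v)) = 2 * int (card E)"
proof -
  have "(\<Sum>v\<in>V. int (dg v)) = (\<Sum>v\<in>V. \<Sum>w\<in>nb v. if {v, w} \<in> E then 1 else 0)"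
    by (intro sum.cong refl) (simp add: nb_iff card_nb[symmetric])
  then show ?thesis using dart_sum[of E "\<lambda>_. 1"] by simp
qed

lemma dg_pos: "v \<in> V \<Longrightarrow> dg v \<ge> 1"
proof -
  assume v: "v \<in> V"
  obtain u where u: "u \<in> V" "dg u = s" using Vs by blast
  show ?thesis
  proof (cases "u = v")
    case True then show ?thesis using u s4 by simp
  next
    case False
    have "(v, u) \<in> (adjacency E)\<^sup>*" using conn u v unfolding connected_graph_def by blast
    then obtain y where "(v, y) \<in> adjacency E" using False by (metis converse_rtranclE)
    then have "y \<in> nb v" by (simp add: adjacency_def nb_iff)
    then have "card (nb v) > 0" using finite_nb card_gt_0_iff by blast
    then show ?thesis by (simp add: card_nb)
  qed
qed

definition A :: "'a set" where "A = {x\<in>V. dg x < s}"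
definition L :: "'a set" where "L = {x\<in>V. dg x = 1}"
text \<open>A pendant edge has the same face on both sides (\<open>B1_sub\<close>). Counted into
  lengths, it would make a face bounded by a triangle look long.\<close>

definition E' :: "'a set set" where "E' = {e\<in>E. \<forall>x\<in>e. dg x \<noteq> 1}"

lemma E'_sub: "E' \<subseteq> E" by (auto simp: E'_def)
lemma finite_E': "finite E'" using E'_sub finite_E finite_subset by blast

lemma adj_sum: "{x, y} \<in> E \<Longrightarrow> 2 * s \<le> dg x + dg y"
  using D1 edgeD by blast

lemma A_nbr:
  assumes "x \<in> A" "{x, y} \<in> E"
  shows "dg y \<ge> s + 1" "y \<notin> A" "y \<notin> I"
proof -
  have "2 * s \<le> dg x + dg y" using adj_sum assms by blast
  then show "dg y \<ge> s + 1" using assms by (simp add: A_def)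
  then show "y \<notin> A" "y \<notin> I" using I_sub by (auto simp: A_def)
qed

text \<open>\<open>D1\<close> applies at distance two as well, so a vertex of degree below
  \<open>s\<close> forces degrees above \<open>s\<close> on everything within two steps.\<close>

lemma NA_nbr:
  assumes "x \<in> A" "{x, y} \<in> E" "{y, z} \<in> E" "z \<noteq> x"
  shows "2 * s \<le> dg x + dg z" "z \<notin> A" "dg z \<noteq> s" "z \<notin> I"
proof -
  show d: "2 * s \<le> dg x + dg z" using D1[of x z] assms edgeD by blast
  then show "z \<notin> A" "dg z \<noteq> s" using assms(1) by (auto simp: A_def)
  then show "z \<notin> I" using I_sub by auto
qed

lemma I_facts: "u \<in> I \<Longrightarrow> u \<in> V \<and> dg u = s \<and> u \<notin> A"
  using I_sub by (auto simp: A_def)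

lemma I_nbr: "u \<in> I \<Longrightarrow> {u, y} \<in> E \<Longrightarrow> dg y \<ge> s \<and> y \<notin> I \<and> y \<notin> A"
  using adj_sum[of u y] I_facts[of u] I_ind[of u y] by (auto simp: A_def)

lemma edge_E': "{x, y} \<in> E \<Longrightarrow> dg x \<noteq> 1 \<Longrightarrow> dg y \<noteq> 1 \<Longrightarrow> {x, y} \<in> E'"
  by (auto simp: E'_def)

lemma card_E: "card E = card E' + card L"
proof -
  have "\<exists>y. nb x = {y}" if "x \<in> L" for x
    using that card_nb[of x] by (simp add: L_def card_1_singleton_iff)
  then obtain t where t: "\<And>x. x \<in> L \<Longrightarrow> nb x = {t x}" by metis
  have "E - E' = (\<lambda>x. {x, t x}) ` L"
  proof (intro equalityI subsetI)
    fix e assume e: "e \<in> E - E'"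
    then obtain x where x: "x \<in> e" "dg x = 1" by (auto simp: E'_def)
    then obtain w where w: "e = {x, w}" using e edgeE by blast
    have xL: "x \<in> L" using x e edge_sub by (auto simp: L_def)
    have "w \<in> nb x" using w e by (simp add: nb_iff)
    then show "e \<in> (\<lambda>x. {x, t x}) ` L" using t[OF xL] xL w by auto
  next
    fix e assume "e \<in> (\<lambda>x. {x, t x}) ` L"
    then obtain x where x: "x \<in> L" "e = {x, t x}" by blast
    then have "{x, t x} \<in> E" using t[OF x(1)] nb_iff by blast
    then show "e \<in> E - E'" using x by (auto simp: E'_def L_def)
  qed
  moreover have "inj_on (\<lambda>x. {x, t x}) L"
  proof (rule inj_onI)
    fix x y assume xy: "x \<in> L" "y \<in> L" "{x, t x} = {y, t y}"
    show "x = y"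
    proof (rule ccontr)
      assume "x \<noteq> y"
      then have "t x = y" using xy by (auto simp: doubleton_eq_iff)
      then have "{x, y} \<in> E" using t[OF xy(1)] nb_iff by blast
      then show False using adj_sum[of x y] xy s4 by (simp add: L_def)
    qed
  qed
  ultimately have "card (E - E') = card L" by (simp add: card_image)
  moreover have "card (E - E') + card E' = card E"
    using E'_sub finite_E finite_E' card_Diff_subset[of E' E] card_mono[of E E'] by simp
  ultimately show ?thesis by simp
qed

section \<open>Face boundaries and lengths\<close>

definition fc :: "'a set \<Rightarrow> bool \<Rightarrow> 'f" where "fc e b = (if b then l e else r e)"

text \<open>The boundary of \<open>F\<close> modulo 2. The edges in \<open>B2 F\<close> have
  \<open>F\<close> on both sides and count twice towards its length.\<close>

definition B1 :: "'f \<Rightarrow> 'a set set" where "B1 F = {e\<in>E. (l e = F) \<noteq> (r e = F)}"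
definition B2 :: "'f \<Rightarrow> 'a set set" where "B2 F = {e\<in>E'. l e = F \<and> r e = F}"

definition len :: "'f \<Rightarrow> nat" where "len F = (\<Sum>e\<in>E'. of_bool (l e = F) + of_bool (r e = F))"

lemma fc_in: "e \<in> E \<Longrightarrow> fc e b \<in> \<Phi>"
  using lr by (auto simp: fc_def)

text \<open>Parity stands in for the cyclic order at a vertex: a boundary edge at \<open>v\<close>
  cannot be the only one.\<close>

lemma corner:
  assumes F: "F \<in> \<Phi>" and e: "{v, w} \<in> B1 F"
  obtains u where "u \<noteq> w" "{v, u} \<in> B1 F"
proof -
  let ?S = "{e\<in>E. v \<in> e \<and> (l e = F) \<noteq> (r e = F)}"
  have eE: "{v, w} \<in> E" using e by (simp add: B1_def)
  then have v: "v \<in> V" using edgeD by blast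
  have in1: "{v, w} \<in> ?S" using e by (simp add: B1_def)
  have "card ?S \<noteq> 1" using boundary_even[OF F v] by (metis odd_one)
  then have "?S \<noteq> {{v, w}}" by (metis card_1_singleton_iff One_nat_def)
  then obtain e' where e': "e' \<in> ?S" "e' \<noteq> {v, w}" using in1 by blast
  then obtain u where "e' = {v, u}" using edgeE by blast
  then show ?thesis using that[of u] e' by (auto simp: B1_def)
qed

lemma B1_sub:
  assumes F: "F \<in> \<Phi>"
  shows "B1 F \<subseteq> E'"
proof
  fix e assume e: "e \<in> B1 F"
  then have eE: "e \<in> E" by (simp add: B1_def)
  have "dg x \<noteq> 1" if x: "x \<in> e" for x
  proof
    assume d: "dg x = 1"
    obtain w where w: "e = {x, w}" using edgeE[OF eE x] by blast
    obtain u where u: "u \<noteq> w" "{x, u} \<in> B1 F" using corner[OF F, of x w] e w by blast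
    have "{w, u} \<subseteq> nb x" using u(2) eE w by (auto simp: nb_iff B1_def)
    then have "card {w, u} \<le> card (nb x)" using finite_nb card_mono by blast
    then show False using d u(1) by (simp add: card_nb)
  qed
  then show "e \<in> E'" using eE by (simp add: E'_def)
qed

lemma finite_B: "finite (B1 F)" "finite (B2 F)"
  using finite_E finite_E' by (simp_all add: B1_def B2_def)

lemma len_eq:
  assumes "F \<in> \<Phi>"
  shows "len F = card (B1 F) + 2 * card (B2 F)"
proof -
  have "len F = (\<Sum>e\<in>E'. of_bool (e \<in> B1 F) + 2 * of_bool (e \<in> B2 F))"
    unfolding len_def by (intro sum.cong refl) (use E'_sub in \<open>auto simp: B1_def B2_def\<close>)
  also have "\<dots> = card (B1 F) + 2 * card (B2 F)"
  proof -
    have "(\<Sum>e\<in>E'. of_bool (e \<in> B1 F)) = card (B1 F)"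
      using B1_sub[OF assms] finite_E' by (simp add: Int_absorb1)
    moreover have "(\<Sum>e\<in>E'. of_bool (e \<in> B2 F)) = card (B2 F)"
    proof -
      have "B2 F \<subseteq> E'" by (auto simp: B2_def)
      then show ?thesis using finite_E' by (simp add: Int_absorb1)
    qed
    ultimately show ?thesis by (simp add: sum.distrib sum_distrib_left[symmetric])
  qed
  finally show ?thesis .
qed

lemma len_sum: "(\<Sum>F\<in>\<Phi>. int (len F) * X F) = (\<Sum>e\<in>E'. X (l e) + X (r e))"
proof -
  have one: "(\<Sum>F\<in>\<Phi>. of_bool (a = F) * X F) = X a" if "a \<in> \<Phi>" for a
  proof -
    have "(\<Sum>F\<in>\<Phi>. of_bool (a = F) * X F) = (\<Sum>F\<in>\<Phi>. if a = F then X F else 0)" by (intro sum.cong) auto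
    then show ?thesis using fin_\<Phi> that by simp
  qed
  have "(\<Sum>F\<in>\<Phi>. int (len F) * X F) = (\<Sum>F\<in>\<Phi>. \<Sum>e\<in>E'. (of_bool (l e = F) + of_bool (r e = F)) * X F)"
    by (simp add: len_def sum_distrib_right)
  also have "\<dots> = (\<Sum>e\<in>E'. \<Sum>F\<in>\<Phi>. (of_bool (l e = F) + of_bool (r e = F)) * X F)" by (rule sum.swap)
  also have "\<dots> = (\<Sum>e\<in>E'. X (l e) + X (r e))"
  proof (rule sum.cong[OF refl])
    fix e assume "e \<in> E'"
    then have "l e \<in> \<Phi>" "r e \<in> \<Phi>" using lr E'_sub by auto
    then show "(\<Sum>F\<in>\<Phi>. (of_bool (l e = F) + of_bool (r e = F)) * X F) = X (l e) + X (r e)"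
      by (simp add: distrib_right sum.distrib one)
  qed
  finally show ?thesis .
qed

lemma card_E'_ge: "card E' \<ge> 4"
proof -
  obtain v where v: "v \<in> V" "dg v = s" using Vs by blast
  have "(\<lambda>w. {v, w}) ` nb v \<subseteq> E'"
  proof
    fix e assume "e \<in> (\<lambda>w. {v, w}) ` nb v"
    then obtain w where w: "{v, w} \<in> E" "e = {v, w}" by (auto simp: nb_iff)
    then have "dg w \<ge> s" using adj_sum[OF w(1)] v by simp
    then show "e \<in> E'" using w v s4 by (auto simp: E'_def)
  qed
  moreover have "inj_on (\<lambda>w. {v, w}) (nb v)" by (auto simp: inj_on_def doubleton_eq_iff)
  ultimately have "card (nb v) \<le> card E'" using finite_E' card_inj_on_le by blast
  then show ?thesis using v s4 by (simp add: card_nb)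
qed

text \<open>By \<open>boundary_closed\<close> for the single face \<open>F\<close>, it lies on both
  sides of every edge, and at least four edges are not pendant.\<close>

lemma B1_empty:
  assumes F: "F \<in> \<Phi>" and "B1 F = {}"
  shows "len F \<ge> 8"
proof -
  have "l e = F \<and> r e = F" if "e \<in> E" for e
  proof -
    have "l e \<in> {F} \<and> r e \<in> {F}"
    proof (rule boundary_closed[OF _ _ _ that])
      show "(l e \<in> {F}) = (r e \<in> {F})" if "e \<in> E" for e using assms(2) that by (auto simp: B1_def)
    qed (use F in auto)
    then show ?thesis by simp
  qed
  then have "B2 F = E'" using E'_sub by (auto simp: B2_def)
  then show ?thesis using len_eq[OF F] card_E'_ge by simp
qed

lemma three_edges:
  assumes F: "F \<in> \<Phi>" and e: "{x, y} \<in> B1 F"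
  obtains a b where "a \<noteq> y" "b \<noteq> x" "{x, a} \<in> B1 F" "{y, b} \<in> B1 F" "a \<noteq> x" "b \<noteq> y" "x \<noteq> y"
    "card {{x, y}, {x, a}, {y, b}} = 3"
proof -
  obtain a where a: "a \<noteq> y" "{x, a} \<in> B1 F" using corner[OF F e] by blast
  have "{y, x} \<in> B1 F" using e by (simp add: insert_commute)
  then obtain b where b: "b \<noteq> x" "{y, b} \<in> B1 F" using corner[OF F] by blast
  have ne: "x \<noteq> y" "a \<noteq> x" "b \<noteq> y" using e a b edgeD by (auto simp: B1_def)
  have "{x, y} \<noteq> {x, a}" "{x, y} \<noteq> {y, b}" "{x, a} \<noteq> {y, b}" using a b ne by (auto simp: doubleton_eq_iff)
  then show ?thesis using that[of a b] a b ne by simp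
qed

lemma len_ge3:
  assumes F: "F \<in> \<Phi>"
  shows "len F \<ge> 3"
proof (cases "B1 F = {}")
  case True then show ?thesis using B1_empty[OF F] by simp
next
  case False
  then obtain e where e: "e \<in> B1 F" by blast
  then have "e \<in> E" by (simp add: B1_def)
  then obtain x y where xy: "e = {x, y}" using edge_card by (meson card_2_iff)
  obtain a b where ab: "{x, a} \<in> B1 F" "{y, b} \<in> B1 F" "card {{x, y}, {x, a}, {y, b}} = 3"
    using three_edges[OF F, of x y] e xy by metis
  then have "{{x, y}, {x, a}, {y, b}} \<subseteq> B1 F" using e xy by blast
  then have "3 \<le> card (B1 F)" using ab(3) finite_B card_mono by metis
  then show ?thesis using len_eq[OF F] by simp
qed

lemma B1_card_ge3:
  assumes F: "F \<in> \<Phi>" and "B1 F \<noteq> {}"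
  shows "card (B1 F) \<ge> 3"
proof -
  obtain e where e: "e \<in> B1 F" using assms by blast
  then have "e \<in> E" by (simp add: B1_def)
  then obtain x y where xy: "e = {x, y}" using edge_card by (meson card_2_iff)
  obtain a b where ab: "{x, a} \<in> B1 F" "{y, b} \<in> B1 F" "card {{x, y}, {x, a}, {y, b}} = 3"
    using three_edges[OF F, of x y] e xy by metis
  then have "{{x, y}, {x, a}, {y, b}} \<subseteq> B1 F" using e xy by blast
  then show ?thesis using ab(3) finite_B card_mono by metis
qed

text \<open>A non-empty boundary has at least three edges, and an edge with \<open>F\<close> on both
  sides would add two more; length 4 leaves no room for that.\<close>

lemma len_le4:
  assumes F: "F \<in> \<Phi>" and "len F \<le> 4"
  shows "B2 F = {}" "card (B1 F) = len F"
proof -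
  have "B1 F \<noteq> {}" using B1_empty[OF F] assms(2) by auto
  then have "card (B1 F) \<ge> 3" using B1_card_ge3[OF F] by blast
  then have "card (B2 F) = 0" using len_eq[OF F] assms(2) by linarith
  then show "B2 F = {}" using finite_B by simp
  then show "card (B1 F) = len F" using len_eq[OF F] by simp
qed

lemma side_B1:
  assumes "e \<in> E'" "len (fc e b) \<le> 4"
  shows "e \<in> B1 (fc e b)"
proof -
  have "fc e b \<in> \<Phi>" using assms fc_in E'_sub by blast
  then have "e \<notin> B2 (fc e b)" using len_le4(1) assms(2) by blast
  then show ?thesis using assms E'_sub by (auto simp: B1_def B2_def fc_def split: if_splits)
qed

lemma sides_ne: "e \<in> E' \<Longrightarrow> len (fc e b) \<le> 4 \<Longrightarrow> fc e (\<not> b) \<noteq> fc e b"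
  using side_B1[of e b] by (auto simp: B1_def fc_def split: if_splits)

text \<open>Corners at \<open>x\<close> and \<open>y\<close> supply the two other edges. A further
  corner at the end \<open>a\<close> makes them meet, since no fourth edge is left.\<close>

lemma triangle:
  assumes F: "F \<in> \<Phi>" and e: "{x, y} \<in> B1 F" and 3: "len F = 3"
  obtains z where "z \<noteq> x" "z \<noteq> y" "x \<noteq> y" "B1 F = {{x, y}, {x, z}, {y, z}}" "{x, z} \<in> E" "{y, z} \<in> E"
proof -
  obtain a b where ab: "a \<noteq> y" "b \<noteq> x" "{x, a} \<in> B1 F" "{y, b} \<in> B1 F" "a \<noteq> x" "b \<noteq> y" "x \<noteq> y"
     "card {{x, y}, {x, a}, {y, b}} = 3" by (rule three_edges[OF F e])
  have "{{x, y}, {x, a}, {y, b}} \<subseteq> B1 F" using ab e by blast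
  moreover have "card (B1 F) = 3" using len_le4(2)[OF F] 3 by simp
  ultimately have B: "B1 F = {{x, y}, {x, a}, {y, b}}" using ab(8) finite_B card_subset_eq by metis
  have "{a, x} \<in> B1 F" using ab(3) by (simp add: insert_commute)
  then obtain u where u: "u \<noteq> x" "{a, u} \<in> B1 F" using corner[OF F] by blast
  then have "a = b" using B ab by (auto simp: doubleton_eq_iff)
  then show ?thesis using that[of a] B ab by (auto simp: B1_def)
qed

text \<open>With the same third vertex both faces would have the same boundary and together form a
  family closed under crossing edges. By \<open>boundary_closed\<close> every non-pendant edge would
  then belong to this one triangle, but there are at least four such edges.\<close>

lemma two_triangles:
  assumes e: "{x, y} \<in> E'" and t: "len (l {x, y}) = 3" "len (r {x, y}) = 3"
  shows "card (nb x \<inter> nb y) \<ge> 2"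
proof -
  let ?F = "l {x, y}" and ?G = "r {x, y}"
  have eE: "{x, y} \<in> E" using e E'_sub by blast
  have FG: "?F \<in> \<Phi>" "?G \<in> \<Phi>" using lr eE by auto
  have b: "{x, y} \<in> B1 ?F" "{x, y} \<in> B1 ?G"
    using side_B1[OF e, of True] side_B1[OF e, of False] t by (auto simp: fc_def)
  then have ne: "?F \<noteq> ?G" by (auto simp: B1_def)
  obtain z where z: "z \<noteq> x" "z \<noteq> y" "B1 ?F = {{x, y}, {x, z}, {y, z}}" "{x, z} \<in> E" "{y, z} \<in> E"
    using triangle[OF FG(1) b(1) t(1)] by metis
  obtain z' where z': "z' \<noteq> x" "z' \<noteq> y" "B1 ?G = {{x, y}, {x, z'}, {y, z'}}" "{x, z'} \<in> E" "{y, z'} \<in> E"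
    using triangle[OF FG(2) b(2) t(2)] by metis
  have "z \<noteq> z'"
  proof
    assume zz: "z = z'"
    then have BB: "B1 ?F = B1 ?G" using z z' by simp
    let ?\<Psi> = "{?F, ?G}"
    have "l e \<in> ?\<Psi> \<and> r e \<in> ?\<Psi>" if "e \<in> E" for e
    proof (rule boundary_closed[OF _ _ _ that])
      fix e assume e: "e \<in> E"
      have "e \<in> B1 ?F \<longleftrightarrow> e \<in> B1 ?G" using BB by simp
      then show "(l e \<in> ?\<Psi>) = (r e \<in> ?\<Psi>)" using e ne unfolding B1_def by auto
    qed (use FG in auto)
    moreover have "B2 ?F = {}" "B2 ?G = {}" using len_le4(1) FG t by simp_all
    ultimately have "E' \<subseteq> B1 ?F" using E'_sub unfolding B1_def B2_def by blast
    then have "card E' \<le> card (B1 ?F)" using finite_B card_mono by blast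
    then show False using len_le4(2)[OF FG(1)] t card_E'_ge by simp
  qed
  then have "card {z, z'} = 2" by simp
  moreover have "{z, z'} \<subseteq> nb x \<inter> nb y" using z z' by (auto simp: nb_iff)
  ultimately show ?thesis using finite_nb card_mono by (metis finite_Int)
qed

definition nt :: "'a \<Rightarrow> 'a \<Rightarrow> nat" where
  "nt x y = of_bool (len (l {x, y}) \<noteq> 3) + of_bool (len (r {x, y}) \<noteq> 3)"

lemma nt_bound:
  assumes e: "{x, y} \<in> E'"
  shows "2 \<le> nt x y + card (nb x \<inter> nb y)"
proof -
  have eE: "{x, y} \<in> E" using e E'_sub by blast
  have one: "card (nb x \<inter> nb y) \<ge> 1" if t: "len (fc {x, y} b) = 3" for b
  proof -
    have "fc {x, y} b \<in> \<Phi>" using fc_in eE by blast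
    moreover have "{x, y} \<in> B1 (fc {x, y} b)" using side_B1[OF e] t by simp
    ultimately obtain z where "{x, z} \<in> E" "{y, z} \<in> E" by (rule triangle[OF _ _ t])
    then have "z \<in> nb x \<inter> nb y" by (simp add: nb_iff)
    then have "card (nb x \<inter> nb y) > 0" using finite_nb card_gt_0_iff by blast
    then show ?thesis by simp
  qed
  show ?thesis
    using one[of True] one[of False] two_triangles[OF e] by (auto simp: nt_def fc_def)
qed

lemma nt_degree:
  assumes e: "{x, y} \<in> E'"
  shows "2 * s \<le> dg x + dg y" "dg x + dg y = 2 * s \<Longrightarrow> nt x y = 2" "dg x + dg y = 2 * s + 1 \<Longrightarrow> nt x y \<ge> 1"
proof -
  have eE: "{x, y} \<in> E" using e E'_sub by blast
  show "2 * s \<le> dg x + dg y" using adj_sum eE by blast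
  have "nt x y \<le> 2" by (simp add: nt_def)
  then show "dg x + dg y = 2 * s \<Longrightarrow> nt x y = 2" "dg x + dg y = 2 * s + 1 \<Longrightarrow> nt x y \<ge> 1"
    using D2[OF eE] nt_bound[OF e] by auto
qed

text \<open>The share of the charge that the corner of the edge \<open>{v, w}\<close> at \<open>v\<close> receives from the face on
  side \<open>b\<close>.  All charges are scaled by \<open>84\<close>, so that a face of length \<open>k\<close> has \<open>28 * (k - 3)\<close> to give,
  which is at least \<open>q F\<close> per side.\<close>

definition q :: "'f \<Rightarrow> int" where "q F = (if len F = 4 then 7 else 11)"

text \<open>Marks a neighbour of a low vertex along the face. On a quadrilateral it receives 4
  instead of 3 at its other edge, which \<open>NA_gain\<close> adds to the account of the low
  vertex.\<close>

definition active :: "'a \<Rightarrow> 'f \<Rightarrow> bool" where "active v F \<longleftrightarrow> (\<exists>x\<in>A. {x, v} \<in> B1 F)"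

text \<open>A low vertex takes all that the side offers. A vertex of \<open>I\<close> takes 2, on a
  triangle at the expense of its neighbour, elsewhere out of \<open>q F\<close>, whose rest goes to
  the neighbour. Two ordinary ends receive 4 each, or 3 on a quadrilateral unless active: 3 + 4 = 7
  is what a quadrilateral can give.\<close>

definition G :: "'a \<Rightarrow> 'a \<Rightarrow> bool \<Rightarrow> int" where
  "G v w b = (let F = fc {v, w} b in
     if len F = 3 then (if v \<in> I then 2 else if w \<in> I then -2 else 0)
     else if v \<in> A then q F else if w \<in> A then 0
     else if v \<in> I then 2 else if w \<in> I then q F - 2
     else if len F = 4 \<and> \<not> active v F then 3 else 4)"

text \<open>Let \<open>x\<close> and \<open>x'\<close> be the low neighbours of \<open>v\<close> and
  \<open>w\<close> on the quadrilateral. If they differ, the corners at both must be the one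
  remaining edge, making two low vertices adjacent. If they coincide, \<open>v\<close>,
  \<open>w\<close>, \<open>x\<close> span a triangle, and parity forces the fourth boundary edge to
  be one of its sides again.\<close>

lemma not_both_active:
  assumes F: "F \<in> \<Phi>" "len F = 4" and e: "{v, w} \<in> B1 F" "v \<notin> A" "w \<notin> A"
  shows "\<not> (active v F \<and> active w F)"
proof
  assume "active v F \<and> active w F"
  then obtain x x' where x: "x \<in> A" "{x, v} \<in> B1 F" "x' \<in> A" "{x', w} \<in> B1 F" unfolding active_def by blast
  have card4: "card (B1 F) = 4" using len_le4(2)[OF F(1)] F(2) by simp
  have vw: "v \<noteq> w" using e edgeD by (auto simp: B1_def)
  have xs: "x \<noteq> v" "x \<noteq> w" "x' \<noteq> v" "x' \<noteq> w" using x e by auto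
  let ?T = "{{x, v}, {v, w}, {x', w}}"
  have T3: "card ?T = 3" using xs vw by (auto simp: doubleton_eq_iff card_insert_if)
  have T: "?T \<subseteq> B1 F" using x e by blast
  have "card (B1 F - ?T) = 1" using card4 T3 T finite_B by (simp add: card_Diff_subset)
  then obtain f where f: "B1 F - ?T = {f}" by (meson card_1_singletonE)
  have "?T \<union> (B1 F - ?T) = B1 F" using T by (rule Diff_partition)
  then have B: "B1 F = insert f ?T" unfolding f by simp
  obtain u where u: "u \<noteq> v" "{x, u} \<in> B1 F" using corner[OF F(1) x(2)] by blast
  obtain u' where u': "u' \<noteq> w" "{x', u'} \<in> B1 F" using corner[OF F(1) x(4)] by blast
  have uE: "{x, u} \<in> E" "{x', u'} \<in> E" using u u' by (auto simp: B1_def)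
  have uA: "u \<notin> A" using A_nbr(2)[OF x(1) uE(1)] .
  have "x = x'"
  proof (rule ccontr)
    assume xx: "x \<noteq> x'"
    have "{x, u} \<noteq> {x, v}" using u(1) by (simp add: doubleton_eq_iff)
    moreover have "{x, u} \<noteq> {v, w}" "{x, u} \<noteq> {x', w}" using xs xx by (metis insertI1 insertE singletonD)+
    ultimately have "{x, u} = f" using u(2) unfolding B by simp

    have "{x', u'} \<noteq> {x', w}" using u'(1) by (simp add: doubleton_eq_iff)
    moreover have "{x', u'} \<noteq> {v, w}" "{x', u'} \<noteq> {x, v}" using xs xx by (metis insertI1 insertE singletonD)+
    ultimately have "{x', u'} = f" using u'(2) unfolding B by simp
    then have "x' \<in> {x, u}" using \<open>{x, u} = f\<close> by blast
    then show False using xx x(3) uA by simp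
  qed
  have "f \<notin> ?T" using f by blast
  then have TB: "B1 F = insert f {{x, v}, {v, w}, {x, w}}" "f \<notin> {{x, v}, {v, w}, {x, w}}"
    using B unfolding \<open>x = x'\<close>[symmetric] by simp_all
  have "f \<in> B1 F" using B by blast
  then have "card f = 2" using edge_card by (simp add: B1_def)
  then obtain a b where ab: "f = {a, b}" by (meson card_2_iff)
  have inT: "a \<in> {x, v, w}" if "{a, b} \<in> B1 F" for a b
    using that
  proof -
    assume ab: "{a, b} \<in> B1 F"
    obtain b' where b': "b' \<noteq> b" "{a, b'} \<in> B1 F" using corner[OF F(1) ab] by blast
    have "{a, b} \<noteq> {a, b'}" using b' by (auto simp: doubleton_eq_iff)
    moreover have "{a, b} = f \<or> {a, b} \<in> {{x, v}, {v, w}, {x, w}}" using ab unfolding TB(1) by (rule insertE) simp_all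
    moreover have "{a, b'} = f \<or> {a, b'} \<in> {{x, v}, {v, w}, {x, w}}" using b'(2) unfolding TB(1) by (rule insertE) simp_all
    ultimately have "{a, b} \<in> {{x, v}, {v, w}, {x, w}} \<or> {a, b'} \<in> {{x, v}, {v, w}, {x, w}}" by metis
    then have "a \<in> {x, v} \<or> a \<in> {v, w} \<or> a \<in> {x, w}" by (metis insertE insertI1 singletonD)
    then show ?thesis by blast
  qed
  have "{a, b} \<in> B1 F" "{b, a} \<in> B1 F" using \<open>f \<in> B1 F\<close> ab by (simp_all add: insert_commute)
  then have "a \<in> {x, v, w}" "b \<in> {x, v, w}" using inT by blast+
  moreover have "a \<noteq> b" using \<open>{a, b} \<in> B1 F\<close> edgeD[of a b] by (simp add: B1_def)
  ultimately have "{a, b} = {x, v} \<or> {a, b} = {v, w} \<or> {a, b} = {x, w}" by (elim insertE emptyE) (simp_all add: insert_commute)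
  then show False using TB(2) unfolding ab by simp
qed

text \<open>On a triangle the two shares cancel. The tight ordinary case is the quadrilateral, where
  \<open>not_both_active\<close> keeps the sum at 3 + 4.\<close>

lemma G_side:
  assumes e: "{v, w} \<in> E'"
  shows "G v w b + G w v b \<le> (if len (fc {v, w} b) = 3 then 0 else q (fc {v, w} b))"
proof -
  have eE: "{v, w} \<in> E" using e E'_sub by blast
  have F: "fc {v, w} b \<in> \<Phi>" using fc_in eE by blast
  have wv: "{w, v} = {v, w}" by blast
  have nA: "\<not> (v \<in> A \<and> w \<in> A)" using A_nbr(2)[of v w] eE by blast
  have nI: "\<not> (v \<in> I \<and> w \<in> I)" using I_ind eE by blast
  have AI: "v \<in> A \<Longrightarrow> w \<notin> I \<and> v \<notin> I" "w \<in> A \<Longrightarrow> v \<notin> I \<and> w \<notin> I"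
    using A_nbr(3)[of v w] A_nbr(3)[of w v] eE I_facts wv by auto
  have act: "\<not> (active v (fc {v, w} b) \<and> active w (fc {v, w} b))" if "len (fc {v, w} b) = 4" "v \<notin> A" "w \<notin> A"
    using not_both_active[OF F that(1) _ that(2,3)] side_B1[OF e] that(1) by simp
  show ?thesis
    unfolding G_def wv Let_def q_def using nA nI AI act by auto
qed

definition H :: "'a \<Rightarrow> 'a \<times> bool \<Rightarrow> int" where
  "H v d = (if {v, fst d} \<in> E' then G v (fst d) (snd d) else 0)"

text \<open>An edge at \<open>v\<close> together with one of its sides. Flags take the place of
  corners, which would need a cyclic order of the edges.\<close>

definition flags :: "'a \<Rightarrow> ('a \<times> bool) set" where "flags v = nb v \<times> UNIV"

definition gain :: "'a \<Rightarrow> int" where "gain v = sum (H v) (flags v)"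

lemma finite_flags: "finite (flags v)"
  using finite_nb by (simp add: flags_def)

lemma card_flags: "card (flags v) = 2 * dg v"
  by (simp add: flags_def card_cartesian_product card_nb)

lemma gain_alt: "gain v = (\<Sum>w\<in>nb v. H v (w, True) + H v (w, False))"
proof -
  have "gain v = (\<Sum>w\<in>nb v. \<Sum>b\<in>UNIV. H v (w, b))"
    unfolding gain_def flags_def by (simp add: sum.cartesian_product)
  then show ?thesis by (simp add: UNIV_bool add.commute)
qed

lemma gain_sum: "(\<Sum>v\<in>V. gain v) \<le> 56 * int (card E') - 84 * int (card \<Phi>)"
proof -
  let ?m = "\<lambda>F. if len F = 3 then 0 else q F"
  have swap: "(\<Sum>v\<in>V. \<Sum>w\<in>nb v. X v w) = (\<Sum>v\<in>V. \<Sum>w\<in>nb v. X w v)" for X :: "'a \<Rightarrow> 'a \<Rightarrow> int"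
  proof -
    have "(\<Sum>v\<in>V. \<Sum>w\<in>nb v. X v w) = (\<Sum>(v, w)\<in>(SIGMA v:V. nb v). X v w)"
      using finite_V finite_nb by (subst sum.Sigma) auto
    also have "\<dots> = (\<Sum>(v, w)\<in>(SIGMA v:V. nb v). X w v)"
      by (rule sum.reindex_bij_witness[of _ "\<lambda>(v, w). (w, v)" "\<lambda>(v, w). (w, v)"]) (use nb_sym nb_sub in auto)
    also have "\<dots> = (\<Sum>v\<in>V. \<Sum>w\<in>nb v. X w v)"
      using finite_V finite_nb by (subst sum.Sigma) auto
    finally show ?thesis .
  qed
  let ?Hs = "\<lambda>v w. H v (w, True) + H v (w, False)"
  have "2 * (\<Sum>v\<in>V. gain v) = (\<Sum>v\<in>V. \<Sum>w\<in>nb v. ?Hs v w) + (\<Sum>v\<in>V. \<Sum>w\<in>nb v. ?Hs w v)"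
    unfolding gain_alt swap[of "\<lambda>v w. ?Hs w v"] by simp
  also have "\<dots> = (\<Sum>v\<in>V. \<Sum>w\<in>nb v. ?Hs v w + ?Hs w v)" by (simp add: sum.distrib)
  also have "\<dots> \<le> (\<Sum>v\<in>V. \<Sum>w\<in>nb v. if {v, w} \<in> E' then ?m (l {v, w}) + ?m (r {v, w}) else 0)"
  proof (intro sum_mono)
    fix v w assume "w \<in> nb v"
    have wv: "{w, v} = {v, w}" by blast
    show "?Hs v w + ?Hs w v \<le> (if {v, w} \<in> E' then ?m (l {v, w}) + ?m (r {v, w}) else 0)"
      using G_side[of v w True] G_side[of v w False] by (auto simp: H_def wv fc_def)
  qed
  also have "\<dots> = 2 * (\<Sum>e\<in>E'. ?m (l e) + ?m (r e))" by (rule dart_sum[OF E'_sub])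
  also have "(\<Sum>e\<in>E'. ?m (l e) + ?m (r e)) = (\<Sum>F\<in>\<Phi>. int (len F) * ?m F)" by (rule len_sum[symmetric])
  finally have "(\<Sum>v\<in>V. gain v) \<le> (\<Sum>F\<in>\<Phi>. int (len F) * ?m F)" by simp
  also have "\<dots> \<le> (\<Sum>F\<in>\<Phi>. 28 * int (len F) - 84)"
  proof (rule sum_mono)
    fix F assume "F \<in> \<Phi>"
    then have "len F \<ge> 3" by (rule len_ge3)
    \<comment> \<open>Equality at lengths 3 and 4; from length 5 on,
      \<open>17 * len F \<ge> 85\<close> exceeds 84.\<close>
    then show "int (len F) * ?m F \<le> 28 * int (len F) - 84" by (auto simp: q_def)
  qed
  also have "\<dots> = 28 * (\<Sum>F\<in>\<Phi>. int (len F) * 1) - 84 * int (card \<Phi>)"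
    by (simp add: sum_subtractf sum_distrib_left)
  also have "(\<Sum>F\<in>\<Phi>. int (len F) * 1) = 2 * int (card E')" unfolding len_sum by simp
  finally show ?thesis by simp
qed

text \<open>The values of \<open>tgt\<close> sum to \<open>6 * rhs\<close>; \<open>fin v\<close> is the surplus of the final charge of \<open>v\<close> over its
  target.  The summand 56 at a leaf is the contribution of its pendant edge, which \<open>E'\<close> and \<open>len\<close>
  ignore.\<close>

definition tgt :: "'a \<Rightarrow> int" where
  "tgt v = (if v \<in> I then 18 * int s - 84 else if dg v \<ge> s then 12 * (int s - 5)
     else if dg v \<le> 2 then 12 * (int s - 3) else 12 * (int s - int (dg v)))"

definition fin :: "'a \<Rightarrow> int" where
  "fin v = 14 * (int (dg v) - 6) + (if dg v = 1 then 56 else 0) + gain v - tgt v"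

definition rhs :: int where
  "rhs = (int s - 4) * int (card I) + 2 * (int s - 5) * int (card V)
     + 4 * int (card (verts_of_degree_le V E 2)) + 2 * (\<Sum>j = 3..s - 1. (5 - int j) * int (card (verts_of_degree V E j)))"

lemma tgt_sum: "(\<Sum>v\<in>V. tgt v) = 6 * rhs"
proof -
  have IV: "I \<subseteq> V" using I_sub by blast
  have 1: "(\<Sum>v\<in>V. of_bool (v \<in> I)) = int (card I)" using finite_V IV by (simp add: Int_absorb1)
  have 2: "(\<Sum>v\<in>V. of_bool (dg v \<le> 2)) = int (card (verts_of_degree_le V E 2))"
    using finite_V by (simp add: verts_of_degree_le_def Int_def)
  have 3: "(\<Sum>v\<in>V. \<Sum>j = 3..s - 1. (5 - int j) * of_bool (dg v = j)) = (\<Sum>j = 3..s - 1. (5 - int j) * int (card (verts_of_degree V E j)))"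
  proof -
    have "(\<Sum>v\<in>V. of_bool (dg v = j)) = int (card (verts_of_degree V E j))" for j
      using finite_V by (simp add: verts_of_degree_def Int_def)
    then show ?thesis by (subst sum.swap) (simp add: sum_distrib_left[symmetric])
  qed
  have "tgt v = 6 * (int s - 4) * of_bool (v \<in> I) + 12 * (int s - 5) + 24 * of_bool (dg v \<le> 2)
      + 12 * (\<Sum>j = 3..s - 1. (5 - int j) * of_bool (dg v = j))" if "v \<in> V" for v
  proof -
    have sm: "(\<Sum>j = 3..s - 1. (5 - int j) * of_bool (dg v = j)) = (if 3 \<le> dg v \<and> dg v \<le> s - 1 then 5 - int (dg v) else 0)"
    proof -
      have "(\<Sum>j = 3..s - 1. (5 - int j) * of_bool (dg v = j)) = (\<Sum>j = 3..s - 1. if dg v = j then 5 - int j else 0)"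
        by (intro sum.cong) auto
      then show ?thesis by simp
    qed
    have "v \<in> I \<Longrightarrow> dg v = s" using I_facts by blast
    then show ?thesis unfolding sm tgt_def using s4 by (auto simp: algebra_simps)
  qed
  then have "(\<Sum>v\<in>V. tgt v) = (\<Sum>v\<in>V. 6 * (int s - 4) * of_bool (v \<in> I) + 12 * (int s - 5) + 24 * of_bool (dg v \<le> 2)
      + 12 * (\<Sum>j = 3..s - 1. (5 - int j) * of_bool (dg v = j)))" by (rule sum.cong[OF refl])
  also have "\<dots> = 6 * (int s - 4) * (\<Sum>v\<in>V. of_bool (v \<in> I)) + 12 * (int s - 5) * int (card V)
     + 24 * (\<Sum>v\<in>V. of_bool (dg v \<le> 2)) + 12 * (\<Sum>v\<in>V. \<Sum>j = 3..s - 1. (5 - int j) * of_bool (dg v = j))"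
    by (simp only: sum.distrib sum_distrib_left sum_constant) simp
  also have "\<dots> = 6 * rhs" unfolding 1 2 3 rhs_def by (simp add: algebra_simps)
  finally show ?thesis .
qed

text \<open>Each edge contributes 28 through the degrees and 56 through the face lengths or, if
  pendant, through its leaf. With -84 per vertex and per face this is 84 times Euler's
  expression.\<close>

lemma fin_sum: "(\<Sum>v\<in>V. fin v) \<le> - 84 * chi - 6 * rhs"
proof -
  have "(\<Sum>v\<in>V. fin v) = 14 * (\<Sum>v\<in>V. int (dg v)) - 84 * int (card V) + (\<Sum>v\<in>V. if dg v = 1 then 56 else 0)
      + (\<Sum>v\<in>V. gain v) - (\<Sum>v\<in>V. tgt v)"
    unfolding fin_def by (simp add: sum.distrib sum_subtractf sum_distrib_left algebra_simps)
  moreover have "(\<Sum>v\<in>V. if dg v = 1 then 56 else 0 :: int) = 56 * int (card L)"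
    using finite_V by (simp add: sum.If_cases L_def Int_def)
  moreover have "int (card E) = int (card E') + int (card L)" using card_E by simp
  ultimately show ?thesis using degree_sum gain_sum tgt_sum euler by linarith
qed

end

section \<open>Final charges of vertices and of groups around low vertices\<close>

context face_structure
begin

definition NA :: "'a set" where "NA = (\<Union>x\<in>A. nb x)"
text \<open>Low vertices have disjoint closed neighbourhoods (\<open>nb_disjoint\<close>). These are
  balanced as groups, whereas the vertices left over in \<open>R\<close> are examined one at a
  time.\<close>

definition R :: "'a set" where "R = V - (A \<union> NA)"

lemma H_nonneg:
  assumes "w \<notin> I \<or> v \<in> I \<or> len (fc {v, w} b) \<noteq> 3"
  shows "H v (w, b) \<ge> 0"
  using assms by (auto simp: H_def G_def q_def Let_def)

lemma H_ge:
  assumes "{v, w} \<in> E'" "v \<notin> A" "v \<notin> I" "w \<notin> A" "len (fc {v, w} b) \<noteq> 3"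
  shows "H v (w, b) \<ge> 3" "w \<in> I \<Longrightarrow> H v (w, b) = q (fc {v, w} b) - 2"
  using assms by (auto simp: H_def G_def q_def Let_def)

lemma H_ge_neg2: "H v d \<ge> -2"
  by (auto simp: H_def G_def q_def Let_def)

lemma q_ge: "q F \<ge> 7" by (simp add: q_def)

lemma gain_ge_sum:
  assumes "S \<subseteq> flags v" "\<And>d. d \<in> flags v - S \<Longrightarrow> H v d \<ge> 0"
  shows "gain v \<ge> sum (H v) S"
  unfolding gain_def using assms finite_flags by (intro sum_mono2) auto

lemma fc_B1: "e \<in> B1 F \<Longrightarrow> fc e (l e = F) = F"
  by (auto simp: B1_def fc_def)

lemma nt_pos: "nt x y \<ge> 1 \<Longrightarrow> \<exists>b. len (fc {x, y} b) \<noteq> 3"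
proof (rule ccontr)
  assume "nt x y \<ge> 1" and "\<not> (\<exists>b. len (fc {x, y} b) \<noteq> 3)"
  then have "len (fc {x, y} True) = 3" "len (fc {x, y} False) = 3" by blast+
  then show False using \<open>nt x y \<ge> 1\<close> by (simp add: nt_def fc_def)
qed

lemma nt_2: "nt x y = 2 \<Longrightarrow> len (fc {x, y} b) \<noteq> 3"
  by (cases b) (auto simp: nt_def fc_def of_bool_def split: if_splits)

lemma not_nb_self: "x \<notin> nb x"
  using edgeD[of x x] by (auto simp: nb_iff)

lemma dg_not1: "dg v \<ge> s \<Longrightarrow> dg v \<noteq> 1"
  using s4 by simp

lemma I_edge:
  assumes "u \<in> I" "{v, u} \<in> E"
  shows "{v, u} \<in> E'" "v \<notin> A" "v \<notin> I" "dg v \<ge> s"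
proof -
  have "{u, v} \<in> E" using assms by (simp add: insert_commute)
  then have *: "dg v \<ge> s \<and> v \<notin> I \<and> v \<notin> A" using I_nbr assms by blast
  then show "v \<notin> A" "v \<notin> I" "dg v \<ge> s" by auto
  show "{v, u} \<in> E'" using edge_E'[OF assms(2)] * I_facts[OF assms(1)] s4 by auto
qed

text \<open>Each of the \<open>2 * s\<close> flags yields 2, and \<open>14 * (s - 6) + 4 * s\<close>
  is the target by design.\<close>

lemma fin_I:
  assumes u: "u \<in> I"
  shows "fin u = 0"
proof -
  have "H u d = 2" if "d \<in> flags u" for d
  proof -
    have e: "{u, fst d} \<in> E" using that by (auto simp: flags_def nb_iff)
    then have "{fst d, u} \<in> E" by (simp add: insert_commute)
    from I_edge[OF u this] show ?thesis using u I_facts[OF u] by (auto simp: H_def G_def Let_def insert_commute)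
  qed
  then have "gain u = 2 * int (card (flags u))" unfolding gain_def by simp
  then show ?thesis using I_facts[OF u] card_flags[of u] dg_not1[of u] u by (simp add: fin_def tgt_def)
qed

lemma corner_flag:
  assumes F: "F \<in> \<Phi>" and e: "{v, w} \<in> B1 F"
  obtains u b where "u \<noteq> w" "u \<in> nb v" "{v, u} \<in> E'" "{v, u} \<in> B1 F" "fc {v, u} b = F"
proof -
  obtain u where u: "u \<noteq> w" "{v, u} \<in> B1 F" using corner[OF F e] by blast
  have "fc {v, u} (l {v, u} = F) = F" using fc_B1[OF u(2)] .
  then show ?thesis using that[of u] u B1_sub[OF F] by (auto simp: B1_def nb_iff)
qed

text \<open>Maximality gives a neighbour \<open>u\<close> in \<open>I\<close>, and an edge of degree
  sum \<open>2 * s\<close> has no triangular side. Each side of \<open>{v, u}\<close> yields 9 from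
  a long face, or 5 from a quadrilateral and at least 3 more at the other edge of that quadrilateral
  at \<open>v\<close>. The total of 16 covers the need \<open>24 - 2 * s\<close>.\<close>

lemma fin_Vs:
  assumes v: "v \<in> V" "dg v = s" "v \<notin> I"
  shows "fin v \<ge> 0"
proof -
  obtain u where u: "u \<in> I" "{u, v} \<in> E" using I_max[OF v] by blast
  have vu: "{v, u} \<in> E" using u by (simp add: insert_commute)
  note ie = I_edge[OF u(1) vu]
  have nt2: "nt v w = 2" if "w \<in> I" "{v, w} \<in> E" for w
    using nt_degree(2)[OF I_edge(1)[OF that]] v I_facts[OF that(1)] by simp
  have n3: "len (fc {v, w} b) \<noteq> 3" if "w \<in> I" "{v, w} \<in> E" for w b
    using nt_2[OF nt2[OF that]] .
  have nbA: "w \<notin> A" if "{v, w} \<in> E" for w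
    using A_nbr(1)[of w v] that v by (auto simp: insert_commute)
  have nonneg: "H v d \<ge> 0" if "d \<in> flags v" for d
  proof -
    have "{v, fst d} \<in> E" using that by (auto simp: flags_def nb_iff)
    then have "H v (fst d, snd d) \<ge> 0" using n3[of "fst d"] by (intro H_nonneg) blast
    then show ?thesis by simp
  qed
  have Hu: "H v (u, b) = q (fc {v, u} b) - 2" for b
    using H_ge(2)[OF ie(1,2,3) _ n3[OF u(1) vu]] u(1) I_facts by blast
  have uf: "(u, b) \<in> flags v" for b using vu by (simp add: flags_def nb_iff)
  have cf: "\<exists>d. d \<in> flags v \<and> fst d \<noteq> u \<and> fc {v, fst d} (snd d) = fc {v, u} b \<and> H v d \<ge> 3"
    if 4: "len (fc {v, u} b) = 4" for b
  proof -
    have F: "fc {v, u} b \<in> \<Phi>" using fc_in vu by blast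
    have "{v, u} \<in> B1 (fc {v, u} b)" using side_B1[OF ie(1)] 4 by simp
    then obtain w b' where w: "w \<noteq> u" "w \<in> nb v" "{v, w} \<in> E'" "fc {v, w} b' = fc {v, u} b"
      using corner_flag[OF F] by metis
    have "H v (w, b') \<ge> 3" using H_ge(1)[OF w(3) ie(2,3)] nbA w 4 by (simp add: nb_iff)
    then show ?thesis using w by (intro exI[of _ "(w, b')"]) (simp add: flags_def)
  qed
  let ?F = "fc {v, u} True" and ?G = "fc {v, u} False"
  have "gain v \<ge> 16"
  proof -
    consider "len ?F \<noteq> 4 \<and> len ?G \<noteq> 4" | "len ?F = 4 \<and> len ?G \<noteq> 4" | "len ?F \<noteq> 4 \<and> len ?G = 4" | "len ?F = 4 \<and> len ?G = 4" by blast
    then show ?thesis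
    proof cases
      case 1
      have "sum (H v) {(u, True), (u, False)} \<le> gain v" by (rule gain_ge_sum) (use uf nonneg in auto)
      then show ?thesis using 1 Hu by (simp add: q_def)
    next
      case 2
      then obtain d where d: "d \<in> flags v" "fst d \<noteq> u" "H v d \<ge> 3" using cf[of True] by blast
      have "sum (H v) {(u, True), (u, False), d} \<le> gain v" by (rule gain_ge_sum) (use uf nonneg d in auto)
      moreover have "(u, True) \<noteq> d" "(u, False) \<noteq> d" using d by auto
      ultimately show ?thesis using 2 Hu d by (simp add: q_def)
    next
      case 3
      then obtain d where d: "d \<in> flags v" "fst d \<noteq> u" "H v d \<ge> 3" using cf[of False] by blast
      have "sum (H v) {(u, True), (u, False), d} \<le> gain v" by (rule gain_ge_sum) (use uf nonneg d in auto)
      moreover have "(u, True) \<noteq> d" "(u, False) \<noteq> d" using d by auto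
      ultimately show ?thesis using 3 Hu d by (simp add: q_def)
    next
      case 4
      then obtain d where d: "d \<in> flags v" "fst d \<noteq> u" "fc {v, fst d} (snd d) = ?F" "H v d \<ge> 3" using cf[of True] by blast
      obtain d' where d': "d' \<in> flags v" "fst d' \<noteq> u" "fc {v, fst d'} (snd d') = ?G" "H v d' \<ge> 3" using cf[of False] 4 by blast
      have "?F \<noteq> ?G" using sides_ne[OF ie(1), of False] 4 by simp
      then have "d \<noteq> d'" using d d' by auto
      have "sum (H v) {(u, True), (u, False), d, d'} \<le> gain v" by (rule gain_ge_sum) (use uf nonneg d d' in auto)
      moreover have "(u, True) \<noteq> d" "(u, False) \<noteq> d" "(u, True) \<noteq> d'" "(u, False) \<noteq> d'" using d d' by auto
      ultimately show ?thesis using 4 Hu d d' \<open>d \<noteq> d'\<close> by (simp add: q_def)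
    qed
  qed
  then show ?thesis using v s4 dg_not1[of v] by (simp add: fin_def tgt_def)
qed

text \<open>Flags sorted by their effect on a vertex of \<open>R\<close> outside \<open>I\<close>:
  those in \<open>TI\<close> cost 2, those in \<open>TN\<close> are neutral, those in
  \<open>NT\<close> bring at least 3.\<close>

definition TI :: "'a \<Rightarrow> ('a \<times> bool) set" where "TI v = {d\<in>flags v. fst d \<in> I \<and> len (fc {v, fst d} (snd d)) = 3}"
definition TN :: "'a \<Rightarrow> ('a \<times> bool) set" where "TN v = {d\<in>flags v. fst d \<notin> I \<and> len (fc {v, fst d} (snd d)) = 3}"
definition NT :: "'a \<Rightarrow> ('a \<times> bool) set" where "NT v = {d\<in>flags v. len (fc {v, fst d} (snd d)) \<noteq> 3}"

lemma R_facts: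
  assumes "v \<in> R" "{v, w} \<in> E"
  shows "v \<in> V" "v \<notin> A" "w \<notin> A" "dg v \<ge> s" "dg w \<ge> s" "{v, w} \<in> E'"
proof -
  show v: "v \<in> V" "v \<notin> A" using assms by (auto simp: R_def)
  show w: "w \<notin> A"
  proof
    assume "w \<in> A"
    then have "v \<in> NA" using assms(2) by (auto simp: NA_def nb_iff insert_commute)
    then show False using assms by (simp add: R_def)
  qed
  show d: "dg v \<ge> s" "dg w \<ge> s" using v w edgeD[OF assms(2)] by (auto simp: A_def)
  show "{v, w} \<in> E'" using edge_E'[OF assms(2)] dg_not1 d by blast
qed

lemma flags_split: "card (TI v) + card (TN v) + card (NT v) = 2 * dg v"
proof -
  have "flags v = TI v \<union> TN v \<union> NT v" by (auto simp: TI_def TN_def NT_def)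
  moreover have "TI v \<inter> TN v = {}" "(TI v \<union> TN v) \<inter> NT v = {}" by (auto simp: TI_def TN_def NT_def)
  moreover have "finite (TI v)" "finite (TN v)" "finite (NT v)" using finite_flags by (auto simp: TI_def TN_def NT_def)
  ultimately have "card (flags v) = card (TI v) + card (TN v) + card (NT v)" by (simp add: card_Un_disjoint)
  then show ?thesis using card_flags by simp
qed

text \<open>A triangular face has two edges at \<open>v\<close>, and independence lets at most one
  lead into \<open>I\<close>. Passing to the other edge of the same face is injective because the
  two sides of an edge of a triangle belong to different faces. In case of equality every flag in
  \<open>TN\<close> is such a partner, and the third edge of the triangle joins its end to
  \<open>I\<close>.\<close>

lemma TI_TN:
  assumes v: "v \<in> R" "v \<notin> I"
  shows "card (TI v) \<le> card (TN v)" "card (TI v) = card (TN v) \<Longrightarrow> d \<in> TN v \<Longrightarrow> \<exists>u\<in>I. {u, fst d} \<in> E"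
proof -
  let ?f = "\<lambda>d. fc {v, fst d} (snd d)"
  have ex: "\<exists>d'. d' \<in> TN v \<and> ?f d' = ?f d \<and> {fst d, fst d'} \<in> E" if d: "d \<in> TI v" for d
  proof -
    obtain u b where ub: "d = (u, b)" by (cases d)
    have e: "{v, u} \<in> E" and u: "u \<in> I" and t: "len (fc {v, u} b) = 3"
      using d ub by (auto simp: TI_def flags_def nb_iff)
    have F: "fc {v, u} b \<in> \<Phi>" using fc_in e by blast
    have B: "{v, u} \<in> B1 (fc {v, u} b)" using side_B1[OF R_facts(6)[OF v(1) e]] t by simp
    obtain z where z: "z \<noteq> v" "z \<noteq> u" "v \<noteq> u" "B1 (fc {v, u} b) = {{v, u}, {v, z}, {u, z}}" "{v, z} \<in> E" "{u, z} \<in> E"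
      by (rule triangle[OF F B t])
    have "{v, z} \<in> B1 (fc {v, u} b)" using z by simp
    then have "fc {v, z} (l {v, z} = fc {v, u} b) = fc {v, u} b" by (rule fc_B1)
    moreover have "z \<notin> I" using I_ind[OF u] z(6) by blast
    ultimately show ?thesis using z t ub
      by (intro exI[of _ "(z, l {v, z} = fc {v, u} b)"]) (auto simp: TN_def flags_def nb_iff)
  qed
  define j where "j d = (SOME d'. d' \<in> TN v \<and> ?f d' = ?f d \<and> {fst d, fst d'} \<in> E)" for d
  have j: "j d \<in> TN v" "?f (j d) = ?f d" "{fst d, fst (j d)} \<in> E" if "d \<in> TI v" for d
    using someI_ex[OF ex[OF that]] unfolding j_def by auto
  have inj: "inj_on j (TI v)"
  proof (rule inj_onI)
    fix d1 d2 assume d: "d1 \<in> TI v" "d2 \<in> TI v" "j d1 = j d2"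
    define z where "z = fst (j d1)"
    define F where "F = ?f (j d1)"
    have f12: "?f d1 = F" "?f d2 = F" using j(2)[OF d(1)] j(2)[OF d(2)] d(3) by (simp_all add: F_def)
    have e: "{v, fst d1} \<in> E" "{v, fst d2} \<in> E" "{v, z} \<in> E"
      using d j(1)[OF d(1)] by (auto simp: TI_def TN_def flags_def nb_iff z_def)
    have t: "len F = 3" using d(1) f12 by (simp add: TI_def)
    have zI: "z \<notin> I" "fst d1 \<in> I" "fst d2 \<in> I" using d j(1)[OF d(1)] by (auto simp: TI_def TN_def z_def)
    have B: "{v, fst d1} \<in> B1 F" "{v, fst d2} \<in> B1 F" "{v, z} \<in> B1 F"
      using side_B1[OF R_facts(6)[OF v(1) e(1)], of "snd d1"] side_B1[OF R_facts(6)[OF v(1) e(2)], of "snd d2"]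
        side_B1[OF R_facts(6)[OF v(1) e(3)], of "snd (j d1)"] f12 t by (simp_all add: F_def z_def)
    have F\<Phi>: "F \<in> \<Phi>" using fc_in e(1) f12(1) by blast
    obtain y where y: "y \<noteq> v" "B1 F = {{v, z}, {v, y}, {z, y}}" using triangle[OF F\<Phi> B(3) t] by metis
    have pick: "u = y" if "{v, u} \<in> B1 F" "u \<in> I" "{v, u} \<in> E" for u
    proof -
      have "u \<noteq> z" using that zI by blast
      moreover have "v \<notin> {z, y}" using y e(3) edgeD by blast
      ultimately show ?thesis using that(1) unfolding y(2) by (auto simp: doubleton_eq_iff)
    qed
    have u: "fst d1 = fst d2" using pick[OF B(1) zI(2) e(1)] pick[OF B(2) zI(3) e(2)] by simp
    have "snd d1 = snd d2"
    proof (rule ccontr)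
      assume "snd d1 \<noteq> snd d2"
      then have "snd d2 = (\<not> snd d1)" by blast
      then show False using sides_ne[OF R_facts(6)[OF v(1) e(1)], of "snd d1"] f12 t u by simp
    qed
    then show "d1 = d2" using u by (simp add: prod_eq_iff)
  qed
  have fTN: "finite (TN v)" using finite_flags by (simp add: TN_def)
  have sub: "j ` TI v \<subseteq> TN v" using j(1) by blast
  show "card (TI v) \<le> card (TN v)" using card_inj_on_le[OF inj sub fTN] .
  assume eq: "card (TI v) = card (TN v)" and d: "d \<in> TN v"
  have "j ` TI v = TN v" using card_subset_eq[OF fTN sub] eq card_image[OF inj] by simp
  then obtain d0 where "d0 \<in> TI v" "d = j d0" using d by blast
  then show "\<exists>u\<in>I. {u, fst d} \<in> E" using j(3)[of d0] by (auto simp: TI_def)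
qed

lemma gain_R:
  assumes v: "v \<in> R" "v \<notin> I"
  shows "gain v \<ge> 3 * int (card (NT v)) - 2 * int (card (TI v))"
proof -
  have "H v d \<ge> 3 * of_bool (d \<in> NT v) - 2 * of_bool (d \<in> TI v)" if d: "d \<in> flags v" for d
  proof -
    obtain w b where wb: "d = (w, b)" by (cases d)
    have e: "{v, w} \<in> E" using d wb by (auto simp: flags_def nb_iff)
    note rf = R_facts[OF v(1) e]
    show ?thesis
    proof (cases "d \<in> NT v")
      case True
      then have "H v (w, b) \<ge> 3" using H_ge(1)[OF rf(6,2) v(2) rf(3)] wb by (simp add: NT_def)
      then show ?thesis using True wb by (simp add: TI_def NT_def)
    next
      case False
      show ?thesis
      proof (cases "d \<in> TI v")
        case True then show ?thesis using False H_ge_neg2[of v d] by simp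
      next
        case nT: False
        then have "w \<notin> I" using False d wb by (auto simp: TI_def NT_def)
        then show ?thesis using False nT H_nonneg[of w v b] wb by simp
      qed
    qed
  qed
  then have "gain v \<ge> (\<Sum>d\<in>flags v. 3 * of_bool (d \<in> NT v) - 2 * of_bool (d \<in> TI v))"
    unfolding gain_def by (rule sum_mono)
  also have "(\<Sum>d\<in>flags v. 3 * of_bool (d \<in> NT v) - 2 * of_bool (d \<in> TI v)) = 3 * int (card (NT v)) - 2 * int (card (TI v))"
  proof -
    have "NT v \<subseteq> flags v" "TI v \<subseteq> flags v" by (auto simp: NT_def TI_def)
    then show ?thesis using finite_flags by (simp add: sum_subtractf sum_distrib_left[symmetric] Int_absorb1)
  qed
  finally show ?thesis .
qed

text \<open>At most half of the \<open>2 * dg v\<close> flags lie in \<open>TI\<close>, so the loss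
  is at most \<open>2 * dg v\<close>; this turns the coefficient 14 into 12.\<close>

lemma fin_R_big:
  assumes v: "v \<in> R" "v \<notin> I" "dg v \<ge> s + 1"
  shows "fin v \<ge> 14 * int (dg v) - 12 * int s - 24 + 3 * int (card (NT v)) - 2 * int (card (TI v))"
    "dg v \<ge> s + 2 \<Longrightarrow> fin v \<ge> 12 * (int (dg v) - int s - 2)"
proof -
  have f: "fin v = 14 * int (dg v) - 12 * int s - 24 + gain v"
    using v dg_not1[of v] by (simp add: fin_def tgt_def)
  then show 1: "fin v \<ge> 14 * int (dg v) - 12 * int s - 24 + 3 * int (card (NT v)) - 2 * int (card (TI v))"
    using gain_R[OF v(1,2)] by simp
  have "2 * card (TI v) \<le> 2 * dg v" using TI_TN(1)[OF v(1,2)] flags_split[of v] by linarith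
  then have "int (card (TI v)) \<le> int (dg v)" by simp
  moreover have "int (card (NT v)) \<ge> 0" by simp
  ultimately show "fin v \<ge> 12 * (int (dg v) - int s - 2)" using 1 unfolding right_diff_distrib by linarith
qed

text \<open>An edge to \<open>I\<close> has degree sum \<open>2 * s + 1\<close>, hence a
  non-triangular side, which brings at least 5; the other side costs at most 2.\<close>

lemma gain_s1:
  assumes v: "v \<in> R" "dg v = s + 1"
  shows "w \<in> nb v \<Longrightarrow> H v (w, True) + H v (w, False) \<ge> (if w \<in> I then 3 else 0)"
    and "gain v \<ge> 3 * int (card (nb v \<inter> I))"
proof -
  have vI: "v \<notin> I" using I_facts v by auto
  show *: "H v (w, True) + H v (w, False) \<ge> (if w \<in> I then 3 else 0)" if w: "w \<in> nb v" for w
  proof (cases "w \<in> I")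
    case True
    have e: "{v, w} \<in> E" using w by (simp add: nb_iff)
    note rf = R_facts[OF v(1) e]
    have "nt v w \<ge> 1" using nt_degree(3)[OF rf(6)] v(2) I_facts[OF True] by simp
    then obtain b where b: "len (fc {v, w} b) \<noteq> 3" using nt_pos by blast
    have "H v (w, b) \<ge> 5" using H_ge(2)[OF rf(6,2) vI rf(3) b True] q_ge[of "fc {v, w} b"] by simp
    moreover have "H v (w, \<not> b) \<ge> -2" by (rule H_ge_neg2)
    ultimately show ?thesis using True by (cases b) auto
  next
    case False
    then show ?thesis using H_nonneg[of w v True] H_nonneg[of w v False] by simp
  qed
  have "gain v \<ge> (\<Sum>w\<in>nb v. if w \<in> I then 3 else 0)" unfolding gain_alt using * by (rule sum_mono)
  then show "gain v \<ge> 3 * int (card (nb v \<inter> I))" using finite_nb by (simp add: sum.If_cases)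
qed

text \<open>The base value \<open>2 * s - 10\<close> is non-negative from \<open>s = 5\<close> on
  and equals -2 for \<open>s = 4\<close>, which is why that case is treated apart.\<close>

lemma fin_s1:
  assumes v: "v \<in> R" "dg v = s + 1"
  shows "fin v = 2 * int s - 10 + gain v"
proof -
  have vI: "v \<notin> I" using I_facts v by auto
  then show ?thesis using v dg_not1[of v] by (simp add: fin_def tgt_def)
qed

lemma fin_R:
  assumes v: "v \<in> R" and "dg v = s + 1 \<Longrightarrow> s \<ge> 5"
  shows "fin v \<ge> 0"
proof -
  have "v \<in> V" "dg v \<ge> s" using v by (auto simp: R_def A_def)
  then consider "v \<in> I" | "v \<notin> I" "dg v = s" | "dg v = s + 1" | "v \<notin> I" "dg v \<ge> s + 2" by linarith
  then show ?thesis
  proof cases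
    case 1 then show ?thesis using fin_I by simp
  next
    case 2 then show ?thesis using fin_Vs \<open>v \<in> V\<close> by blast
  next
    case 3 then show ?thesis using fin_s1[OF v 3] gain_s1(2)[OF v 3] assms(2) by simp
  next
    case 4
    have "dg v \<ge> s + 1" using 4 by simp
    from fin_R_big(2)[OF v 4(1) this 4(2)] show ?thesis using 4(2) by simp
  qed
qed

text \<open>The neighbours of \<open>y\<close> are within two steps of the low vertex, hence outside
  \<open>I\<close>, so \<open>y\<close> pays nothing. On a quadrilateral at \<open>{x, y}\<close> it
  receives 4 at its other edge; added to the 7 for \<open>x\<close>, such a side is worth 11, like a
  side of a longer face.\<close>

lemma NA_gain:
  assumes x: "x \<in> A" "{x, y} \<in> E" "dg x \<noteq> 1"
  shows "gain y \<ge> 4 * (of_bool (len (l {x, y}) = 4) + of_bool (len (r {x, y}) = 4))"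
proof -
  note yf = A_nbr[OF x(1,2)]
  have e': "{x, y} \<in> E'" using edge_E'[OF x(2,3)] yf(1) s4 by simp
  have yx: "{y, x} = {x, y}" by blast
  have nI: "w \<notin> I" if "w \<in> nb y" for w
    using NA_nbr(4)[OF x(1,2), of w] that I_facts x(1) by (cases "w = x") (auto simp: nb_iff)
  have nonneg: "H y d \<ge> 0" if "d \<in> flags y" for d
  proof -
    have "fst d \<notin> I" using nI that by (auto simp: flags_def)
    then have "H y (fst d, snd d) \<ge> 0" by (intro H_nonneg) blast
    then show ?thesis by simp
  qed
  have cf: "\<exists>d. d \<in> flags y \<and> fc {y, fst d} (snd d) = fc {x, y} b \<and> H y d \<ge> 4" if 4: "len (fc {x, y} b) = 4" for b
  proof -
    have F: "fc {x, y} b \<in> \<Phi>" using fc_in x(2) by blast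
    have B: "{x, y} \<in> B1 (fc {x, y} b)" using side_B1[OF e'] 4 by simp
    then have "{y, x} \<in> B1 (fc {x, y} b)" unfolding yx .
    then obtain u b' where u: "u \<noteq> x" "u \<in> nb y" "{y, u} \<in> E'" "fc {y, u} b' = fc {x, y} b"
      using corner_flag[OF F] by metis
    have uA: "u \<notin> A" using NA_nbr(2)[OF x(1,2) _ u(1)] u(2) by (simp add: nb_iff)
    have "active y (fc {x, y} b)" using x(1) B by (auto simp: active_def)
    then have "H y (u, b') = 4" using u uA yf nI[OF u(2)] 4 by (auto simp: H_def G_def Let_def)
    then show ?thesis using u by (intro exI[of _ "(u, b')"]) (simp add: flags_def)
  qed
  let ?F = "fc {x, y} True" and ?G = "fc {x, y} False"
  have fg: "l {x, y} = ?F" "r {x, y} = ?G" by (simp_all add: fc_def)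
  have g0: "gain y \<ge> 0" using gain_ge_sum[of "{}" y] nonneg by simp
  have g1: "gain y \<ge> 4" if t4: "len (fc {x, y} b) = 4" for b
  proof -
    obtain d where d: "d \<in> flags y" "H y d \<ge> 4" using cf[OF t4] by blast
    have "sum (H y) {d} \<le> gain y" by (rule gain_ge_sum) (use d nonneg in auto)
    then show ?thesis using d by simp
  qed
  have g2: "gain y \<ge> 8" if 4: "len ?F = 4" "len ?G = 4"
  proof -
    obtain d where d: "d \<in> flags y" "fc {y, fst d} (snd d) = ?F" "H y d \<ge> 4" using cf[OF 4(1)] by blast
    obtain d' where d': "d' \<in> flags y" "fc {y, fst d'} (snd d') = ?G" "H y d' \<ge> 4" using cf[OF 4(2)] by blast
    have "?F \<noteq> ?G" using sides_ne[OF e', of False] 4 by simp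
    then have "d \<noteq> d'" using d d' by auto
    have "sum (H y) {d, d'} \<le> gain y" by (rule gain_ge_sum) (use d d' nonneg in auto)
    then show ?thesis using d d' \<open>d \<noteq> d'\<close> by simp
  qed
  show ?thesis unfolding fg using g0 g1[of True] g1[of False] g2 by auto
qed

text \<open>A vertex of low degree has a deficit; its neighbours, which it shares with no other such
  vertex, make up for it.\<close>

lemma fin_group:
  assumes x: "x \<in> A"
  shows "fin x + (\<Sum>y\<in>nb x. fin y) \<ge> 0"
proof -
  have xV: "x \<in> V" "dg x < s" using x by (auto simp: A_def)
  have xI: "x \<notin> I" using I_facts x by blast
  have fy: "fin y = 14 * int (dg y) - 12 * int s - 24 + gain y" if "y \<in> nb x" for y
  proof -
    have e: "{x, y} \<in> E" using that by (simp add: nb_iff)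
    have "dg y \<noteq> 1" using A_nbr(1)[OF x e] s4 by simp
    then show ?thesis using A_nbr[OF x e] by (simp add: fin_def tgt_def)
  qed
  show ?thesis
  proof (cases "dg x = 1")
    case True
    obtain y where y: "nb x = {y}" using card_nb[of x] True by (auto simp: card_1_singleton_iff)
    have e: "{x, y} \<in> E" using y nb_iff by blast
    have g: "gain x = 0" unfolding gain_def by (rule sum.neutral) (use True in \<open>auto simp: H_def E'_def\<close>)
    have "gain y \<ge> 0"
    proof -
      have "H y d \<ge> 0" if "d \<in> flags y" for d
      proof -
        have "fst d \<notin> I" using NA_nbr(4)[OF x e, of "fst d"] that xI by (cases "fst d = x") (auto simp: flags_def nb_iff)
        then have "H y (fst d, snd d) \<ge> 0" by (intro H_nonneg) blast
        then show ?thesis by simp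
      qed
      then show ?thesis unfolding gain_def by (rule sum_nonneg)
    qed
    \<comment> \<open>The leaf lacks \<open>12 * s - 22\<close> and its neighbour, of degree at
      least \<open>2 * s - 1\<close>, has at least \<open>16 * s - 38\<close> to spare. The balance
      \<open>4 * s - 16\<close> vanishes for \<open>s = 4\<close>.\<close>
    moreover have "2 * s \<le> 1 + dg y" using adj_sum[OF e] True by simp
    moreover have "fin x = 22 - 12 * int s" using True xI xV g by (simp add: fin_def tgt_def)
    ultimately show ?thesis using y fy[of y] s4 by simp
  next
    case False
    then have j2: "dg x \<ge> 2" using dg_pos[OF xV(1)] by simp
    let ?h = "\<lambda>y. H x (y, True) + H x (y, False)"
    \<comment> \<open>Every non-triangular side of \<open>{x, y}\<close> is worth 11 to the group,
      by \<open>NA_gain\<close>.\<close>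
    have per: "?h y + gain y \<ge> 11 * int (nt x y)" if "y \<in> nb x" for y
    proof -
      have e: "{x, y} \<in> E" using that by (simp add: nb_iff)
      have e': "{x, y} \<in> E'" using edge_E'[OF e False] A_nbr(1)[OF x e] s4 by simp
      have Hx: "H x (y, b) = (if len (fc {x, y} b) = 3 then 0 else q (fc {x, y} b))" for b
        using e' x xI A_nbr(3)[OF x e] by (simp add: H_def G_def Let_def)
      show ?thesis using NA_gain[OF x e False] unfolding Hx by (auto simp: nt_def fc_def q_def)
    qed
    have e': "{x, y} \<in> E'" if "y \<in> nb x" for y
      using edge_E'[of x y] A_nbr(1)[OF x, of y] s4 that False by (simp add: nb_iff)
    have total: "fin x + (\<Sum>y\<in>nb x. fin y) = 14 * (int (dg x) - 6) - tgt x + (\<Sum>y\<in>nb x. 14 * int (dg y) - 12 * int s - 24 + (?h y + gain y))"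
    proof -
      have "(\<Sum>y\<in>nb x. fin y) = (\<Sum>y\<in>nb x. 14 * int (dg y) - 12 * int s - 24 + gain y)" using fy by (intro sum.cong) auto
      then show ?thesis unfolding fin_def[of x] gain_alt[of x] using False by (simp add: sum.distrib)
    qed
    have low: "(\<Sum>y\<in>nb x. 14 * int (dg y) - 12 * int s - 24 + (?h y + gain y)) \<ge> int (dg x) * k"
      if "\<And>y. y \<in> nb x \<Longrightarrow> 14 * int (dg y) - 12 * int s - 24 + 11 * int (nt x y) \<ge> k" for k
    proof -
      have "(\<Sum>y\<in>nb x. k) \<le> (\<Sum>y\<in>nb x. 14 * int (dg y) - 12 * int s - 24 + (?h y + gain y))"
      proof (rule sum_mono)
        fix y assume "y \<in> nb x"
        from that[OF this] per[OF this] show "k \<le> 14 * int (dg y) - 12 * int s - 24 + (?h y + gain y)"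
          by (rule order_trans[OF _ add_left_mono])
      qed
      then show ?thesis by (simp add: card_nb)
    qed
    show ?thesis
    proof (cases "dg x = 2")
      case True
      \<comment> \<open>A vertex of degree 2 has at most one common neighbour with \<open>y\<close>,
        so one non-triangular side is certain. The minimum is at degree sum \<open>2 * s\<close>,
        where both sides count; the group then keeps at least \<open>20 * s - 80\<close>.\<close>
      have "14 * int (dg y) - 12 * int s - 24 + 11 * int (nt x y) \<ge> 16 * int s - 30" if y: "y \<in> nb x" for y
      proof -
        note nd = nt_degree[OF e'[OF y]]
        have "nb x \<inter> nb y \<subseteq> nb x - {y}" using not_nb_self[of y] by blast
        then have "card (nb x \<inter> nb y) \<le> card (nb x - {y})" by (rule card_mono[OF finite_Diff[OF finite_nb]])
        also have "\<dots> = 1" using y finite_nb True card_nb[of x] by (simp add: card_Diff_singleton)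
        finally have "nt x y \<ge> 1" using nt_bound[OF e'[OF y]] by simp
        show ?thesis
        proof (cases "dg x + dg y = 2 * s")
          case eq: True then show ?thesis using nd(2) True by simp
        next
          case False then show ?thesis using nd(1) \<open>nt x y \<ge> 1\<close> True by simp
        qed
      qed
      from low[OF this] have "(\<Sum>y\<in>nb x. 14 * int (dg y) - 12 * int s - 24 + (?h y + gain y)) \<ge> 2 * (16 * int s - 30)"
        using True by simp
      moreover have "tgt x = 12 * (int s - 3)" using True xI xV by (simp add: tgt_def)
      ultimately show ?thesis unfolding total using True s4 by simp
    next
      case n2: False
      then have j3: "dg x \<ge> 3" using j2 by simp
      define j where "j = int (dg x)"
      \<comment> \<open>Each of the first two increases of the degree of \<open>y\<close> brings 14
        and costs at most one side worth 11, so the minimum is at degree sum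
        \<open>2 * s\<close>.\<close>
      have "14 * int (dg y) - 12 * int s - 24 + 11 * int (nt x y) \<ge> 16 * int s - 14 * j - 2" if y: "y \<in> nb x" for y
      proof -
        note nd = nt_degree[OF e'[OF y]]
        consider "dg x + dg y = 2 * s" | "dg x + dg y = 2 * s + 1" | "dg x + dg y \<ge> 2 * s + 2" using nd(1) by linarith
        then show ?thesis using nd(2,3) by cases (auto simp: j_def)
      qed
      from low[OF this] have lw: "(\<Sum>y\<in>nb x. 14 * int (dg y) - 12 * int s - 24 + (?h y + gain y)) \<ge> j * (16 * int s - 14 * j - 2)"
        by (simp add: j_def)
      have t: "tgt x = 12 * (int s - j)" using j3 xI xV by (simp add: tgt_def j_def)
      have jb: "j \<ge> 3" "int s \<ge> j + 1" using j3 xV by (simp_all add: j_def)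
      \<comment> \<open>Expanded around the extreme case \<open>s = j + 1\<close>. The remainder
        \<open>2 * (j * j) + 28 * j - 96\<close> is 6 at \<open>j = 3\<close> and grows with
        \<open>j\<close>.\<close>
      have "14 * (j - 6) - 12 * (int s - j) + j * (16 * int s - 14 * j - 2)
          = (16 * j - 12) * (int s - j - 1) + 2 * (j * j) + 28 * j - 96"
        by (simp add: algebra_simps)
      moreover have "(16 * j - 12) * (int s - j - 1) \<ge> 0" using jb by (intro mult_nonneg_nonneg) auto
      moreover have "3 * 3 \<le> j * j" using jb by (intro mult_mono) auto
      ultimately have "14 * (j - 6) - 12 * (int s - j) + j * (16 * int s - 14 * j - 2) \<ge> 0" using jb by linarith
      then show ?thesis unfolding total t using lw by (simp add: j_def)
    qed
  qed
qed

lemma nb_disjoint: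
  assumes "x \<in> A" "x' \<in> A" "x \<noteq> x'"
  shows "insert x (nb x) \<inter> insert x' (nb x') = {}"
proof -
  have "x \<notin> nb x'" "x' \<notin> nb x" using A_nbr(2) assms by (auto simp: nb_iff)
  moreover have "nb x \<inter> nb x' = {}"
  proof (rule ccontr)
    assume "nb x \<inter> nb x' \<noteq> {}"
    then obtain y where "{x, y} \<in> E" "{y, x'} \<in> E" by (auto simp: nb_iff insert_commute)
    then show False using NA_nbr(2)[of x y x'] assms by auto
  qed
  ultimately show ?thesis using assms by blast
qed

lemma finite_A: "finite A" using finite_V by (simp add: A_def)

lemma fin_total: "(\<Sum>v\<in>V. fin v) \<ge> (\<Sum>v\<in>R. fin v)"
proof -
  let ?U = "\<Union>x\<in>A. insert x (nb x)"
  have U: "?U = A \<union> NA" by (auto simp: NA_def)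
  have UV: "?U \<subseteq> V" using nb_sub by (auto simp: A_def)
  have "(\<Sum>v\<in>V. fin v) = (\<Sum>v\<in>R. fin v) + (\<Sum>v\<in>?U. fin v)"
    using sum.subset_diff[OF UV finite_V, of fin] by (simp add: R_def U)
  also have "(\<Sum>v\<in>?U. fin v) = (\<Sum>x\<in>A. \<Sum>v\<in>insert x (nb x). fin v)"
    using finite_A finite_nb nb_disjoint by (intro sum.UNION_disjoint) auto
  also have "\<dots> = (\<Sum>x\<in>A. fin x + (\<Sum>y\<in>nb x. fin y))"
  proof (rule sum.cong[OF refl])
    fix x
    show "(\<Sum>v\<in>insert x (nb x). fin v) = fin x + (\<Sum>y\<in>nb x. fin y)" using finite_nb not_nb_self by simp
  qed
  finally show ?thesis using sum_nonneg[of A "\<lambda>x. fin x + (\<Sum>y\<in>nb x. fin y)"] fin_group by simp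
qed

lemma bound_ge5: "s \<ge> 5 \<Longrightarrow> rhs \<le> - 14 * chi"
proof -
  assume "s \<ge> 5"
  then have "(\<Sum>v\<in>R. fin v) \<ge> 0" using fin_R by (intro sum_nonneg) blast
  then show ?thesis using fin_total fin_sum by linarith
qed

section \<open>The case s = 4\<close>

definition bad :: "'a \<Rightarrow> bool" where "bad v \<longleftrightarrow> v \<in> R \<and> dg v = 5 \<and> NT v = {}"

text \<open>Degree 5 starts at -2. One non-triangular flag already brings 3. Next to
  \<open>I\<close> a gain of 6 is reached: 3 for each of two neighbours in \<open>I\<close>, or,
  with one such neighbour, 9 - 2 from a long face on its edge, or 3 on that edge and 3 at the next
  edge of a quadrilateral.\<close>

lemma fin_R4:
  assumes s: "s = 4" and v: "v \<in> R"
  shows "bad v \<Longrightarrow> fin v \<ge> -2" "\<not> bad v \<Longrightarrow> fin v \<ge> 0"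
    "dg v = 5 \<Longrightarrow> nb v \<inter> I \<noteq> {} \<Longrightarrow> fin v \<ge> 4"
proof -
  have b: "fin v \<ge> -2 + 3 * int (card (nb v \<inter> I))" if "dg v = 5"
    using fin_s1[OF v] gain_s1(2)[OF v] that s by simp
  then show "bad v \<Longrightarrow> fin v \<ge> -2" by (simp add: bad_def)
  show i: "fin v \<ge> 4" if d: "dg v = 5" and m: "nb v \<inter> I \<noteq> {}"
  proof (cases "card (nb v \<inter> I) \<ge> 2")
    case True then show ?thesis using b[OF d] by simp
  next
    case False
    have "card (nb v \<inter> I) > 0" using m finite_nb by (simp add: card_gt_0_iff)
    then have "card (nb v \<inter> I) = 1" using False by simp
    then obtain u where u: "nb v \<inter> I = {u}" by (meson card_1_singletonE)
    then have uI: "u \<in> I" and un: "u \<in> nb v" by auto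
    have e: "{v, u} \<in> E" using un by (simp add: nb_iff)
    note rf = R_facts[OF v e]
    have vI: "v \<notin> I" using I_facts d s by auto
    have d1: "dg v = s + 1" using d s by simp
    have "nt v u \<ge> 1" using nt_degree(3)[OF rf(6)] d s I_facts[OF uI] by simp
    then obtain b where b3: "len (fc {v, u} b) \<noteq> 3" using nt_pos by blast
    have Hb: "H v (u, b) = q (fc {v, u} b) - 2" using H_ge(2)[OF rf(6,2) vI rf(3) b3 uI] .
    have Hsum: "H v (u, True) + H v (u, False) = H v (u, b) + H v (u, \<not> b)" by (cases b) auto
    have "gain v \<ge> 6"
    proof (cases "len (fc {v, u} b) = 4")
      case True
      have F: "fc {v, u} b \<in> \<Phi>" using fc_in e by blast
      have "{v, u} \<in> B1 (fc {v, u} b)" using side_B1[OF rf(6)] True by simp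
      then obtain w b' where w: "w \<noteq> u" "w \<in> nb v" "{v, w} \<in> E'" "fc {v, w} b' = fc {v, u} b"
        using corner_flag[OF F] by metis
      have wI: "w \<notin> I" using w u by blast
      have wE: "{v, w} \<in> E" using w by (simp add: nb_iff)
      have "H v (w, b') \<ge> 3" using H_ge(1)[OF w(3) rf(2) vI R_facts(3)[OF v wE]] w(4) True by simp
      moreover have "H v (w, \<not> b') \<ge> 0" using wI by (intro H_nonneg) blast
      ultimately have hw: "H v (w, True) + H v (w, False) \<ge> 3" by (cases b') auto
      have hu: "H v (u, True) + H v (u, False) \<ge> 3" using gain_s1(1)[OF v d1 un] uI by simp
      have "(\<Sum>w\<in>{u, w}. H v (w, True) + H v (w, False)) \<le> gain v"
        unfolding gain_alt
      proof (rule sum_mono2[OF finite_nb])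
        show "{u, w} \<subseteq> nb v" using un w by blast
        fix z assume "z \<in> nb v - {u, w}"
        then show "0 \<le> H v (z, True) + H v (z, False)" using gain_s1(1)[OF v d1, of z] by (auto split: if_splits)
      qed
      then show ?thesis using hw hu w(1) by simp
    next
      case False
      have "H v (u, True) + H v (u, False) \<ge> 7" using Hsum Hb H_ge_neg2[of v "(u, \<not> b)"] False by (simp add: q_def)
      moreover have "(\<Sum>w\<in>{u}. H v (w, True) + H v (w, False)) \<le> gain v"
        unfolding gain_alt
      proof (rule sum_mono2[OF finite_nb])
        show "{u} \<subseteq> nb v" using un by blast
        fix z assume "z \<in> nb v - {u}"
        then show "0 \<le> H v (z, True) + H v (z, False)" using gain_s1(1)[OF v d1, of z] by (auto split: if_splits)
      qed
      ultimately show ?thesis by simp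
    qed
    then show ?thesis using fin_s1[OF v d1] s by simp
  qed
  show "fin v \<ge> 0" if nb: "\<not> bad v"
  proof (cases "dg v = 5")
    case False then show ?thesis using fin_R[OF v] s by simp
  next
    case d: True
    show ?thesis
    proof (cases "nb v \<inter> I = {}")
      case False then show ?thesis using i[OF d] by simp
    next
      case True
      have "NT v \<noteq> {}" using nb v d by (simp add: bad_def)
      moreover have "finite (NT v)" using finite_flags by (simp add: NT_def)
      ultimately have "card (NT v) \<ge> 1" by (simp add: Suc_le_eq card_gt_0_iff)
      moreover have "TI v = {}" using True by (auto simp: TI_def flags_def)
      moreover have "v \<notin> I" using I_facts d s by auto
      ultimately have "gain v \<ge> 3" using gain_R[OF v] by simp
      then show ?thesis using fin_s1[OF v] d s by simp
    qed
  qed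
qed

text \<open>A vertex of degree \<open>s\<close> has no low vertex within two steps. A bad neighbour
  is impossible because an edge of degree sum 9 has a non-triangular side.\<close>

lemma V4_nbhd:
  assumes s: "s = 4" and u: "u \<in> V" "dg u = 4"
  shows "u \<in> R" "\<not> bad u" "w \<in> nb u \<Longrightarrow> w \<in> R \<and> \<not> bad w"
proof -
  have uA: "u \<notin> A" unfolding A_def using u s by simp
  have uNA: "u \<notin> NA"
  proof
    assume "u \<in> NA"
    then obtain x where "x \<in> A" "{x, u} \<in> E" by (auto simp: NA_def nb_iff)
    then show False using A_nbr(1) u s by force
  qed
  then show uR: "u \<in> R" using uA u by (simp add: R_def)
  show "\<not> bad u" using u by (simp add: bad_def)
  assume w: "w \<in> nb u"
  have e: "{u, w} \<in> E" using w by (simp add: nb_iff)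
  have wA: "w \<notin> A" using R_facts(3)[OF uR e] .
  have "w \<notin> NA"
  proof
    assume "w \<in> NA"
    then obtain x where x: "x \<in> A" "{x, w} \<in> E" by (auto simp: NA_def nb_iff)
    have "{w, u} \<in> E" using e by (simp add: insert_commute)
    moreover have "u \<noteq> x" using x uA by blast
    ultimately show False using NA_nbr(3)[OF x] u s by blast
  qed
  then have wR: "w \<in> R" using wA w nb_sub by (auto simp: R_def)
  moreover have "\<not> bad w"
  proof
    assume b: "bad w"
    then have d: "dg w = 5" "NT w = {}" by (auto simp: bad_def)
    have e': "{w, u} \<in> E'" using R_facts(6)[OF wR] e by (simp add: insert_commute)
    have "nt w u \<ge> 1" using nt_degree(3)[OF e'] d u s by simp
    then obtain b where "len (fc {w, u} b) \<noteq> 3" using nt_pos by blast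
    then have "(u, b) \<in> NT w" using e by (simp add: NT_def flags_def nb_iff insert_commute)
    then show False using d by blast
  qed
  ultimately show "w \<in> R \<and> \<not> bad w" by blast
qed

text \<open>For \<open>s = 4\<close> the term with \<open>I\<close> vanishes and
  \<open>rhs = - 2 * \<delta>\<close>. If the bound fails, the bad set \<open>Z\<close> has at least
  \<open>6 * (7 * chi - \<delta>)\<close> members, but at most \<open>\<delta> - 5\<close>, since
  \<open>R\<close> has at most \<open>\<delta>\<close> vertices and contains a closed neighbourhood
  of a vertex of degree 4 free of bad ones. The few remaining values leave so little slack that the
  graph could not be connected.\<close>

lemma bound_4:
  assumes s: "s = 4" and chi: "chi \<le> 2"
  shows "rhs \<le> - 14 * chi"
proof (rule ccontr)
  assume contra: "\<not> ?thesis"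
  define Z where "Z = {v\<in>R. bad v}"
  define \<delta> where "\<delta> = int (card V) - 2 * int (card A)"
  have finR: "finite R" using finite_V by (simp add: R_def)
  have rhs: "rhs = - 2 * \<delta>"
  proof -
    have "A = verts_of_degree_le V E 2 \<union> verts_of_degree V E 3" "verts_of_degree_le V E 2 \<inter> verts_of_degree V E 3 = {}"
      unfolding A_def using s by (auto simp: verts_of_degree_le_def verts_of_degree_def)
    then have "card A = card (verts_of_degree_le V E 2) + card (verts_of_degree V E 3)"
      using finite_V by (simp add: card_Un_disjoint verts_of_degree_le_def verts_of_degree_def)
    then show ?thesis unfolding rhs_def \<delta>_def using s by simp
  qed
  have \<delta>chi: "\<delta> < 7 * chi" using contra rhs by simp
  \<comment> \<open>Every low vertex has a neighbour and their neighbourhoods are disjoint, so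
    \<open>NA\<close> is at least as large as \<open>A\<close>.\<close>
  have cardR: "int (card R) \<le> \<delta>"
  proof -
    have "card NA = (\<Sum>x\<in>A. card (nb x))"
      unfolding NA_def using finite_A finite_nb nb_disjoint by (intro card_UN_disjoint) auto
    also have "\<dots> \<ge> (\<Sum>x\<in>A. 1)"
    proof (rule sum_mono)
      fix x assume "x \<in> A"
      then show "1 \<le> card (nb x)" using dg_pos[of x] by (simp add: card_nb A_def)
    qed
    finally have "card NA \<ge> card A" by simp
    moreover have "A \<inter> NA = {}" using A_nbr(2) by (auto simp: NA_def nb_iff)
    moreover have "finite NA" using finite_A finite_nb by (simp add: NA_def)
    moreover have "A \<union> NA \<subseteq> V" using nb_sub by (auto simp: A_def NA_def)
    moreover from calculation have "card (A \<union> NA) \<le> card V" using finite_V card_mono by blast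
    ultimately have "card (A \<union> NA) \<ge> 2 * card A" "card R = card V - card (A \<union> NA)" "card (A \<union> NA) \<le> card V"
      using finite_A by (auto simp: card_Un_disjoint R_def card_Diff_subset)
    then show ?thesis by (simp add: \<delta>_def)
  qed
  have slack: "(\<Sum>v\<in>S. fin v) - 2 * int (card Z) \<le> 12 * \<delta> - 84 * chi" if S: "S \<subseteq> R - Z" for S
  proof -
    have "(\<Sum>v\<in>R. fin v) = (\<Sum>v\<in>R - Z. fin v) + (\<Sum>v\<in>Z. fin v)"
      using finR by (intro sum.subset_diff) (auto simp: Z_def)
    moreover have "(\<Sum>v\<in>S. fin v) \<le> (\<Sum>v\<in>R - Z. fin v)"
      using finR S fin_R4(2)[OF s] by (intro sum_mono2) (auto simp: Z_def)
    moreover have "(\<Sum>v\<in>Z. -2) \<le> (\<Sum>v\<in>Z. fin v)" using fin_R4(1)[OF s] by (intro sum_mono) (auto simp: Z_def)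
    ultimately show ?thesis using fin_total fin_sum rhs by simp
  qed
  have count: "int (card Z) + int (card S) \<le> \<delta>" if S: "S \<subseteq> R - Z" for S
  proof -
    have "Z \<union> S \<subseteq> R" "Z \<inter> S = {}" using S by (auto simp: Z_def)
    moreover have "finite Z" "finite S" using finR S finite_subset by (auto simp: Z_def)
    ultimately have "card Z + card S \<le> card R" using card_mono[OF finR, of "Z \<union> S"] by (simp add: card_Un_disjoint)
    then show ?thesis using cardR by simp
  qed
  obtain u where u: "u \<in> V" "dg u = 4" using Vs s by blast
  have nbS: "insert u (nb u) \<subseteq> R - Z" if "u \<in> V" "dg u = 4" for u
    using V4_nbhd[OF s that] by (auto simp: Z_def)
  have c5: "card (insert u (nb u)) = 5" using not_nb_self finite_nb u by (simp add: card_nb)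
  have Z0: "- 2 * int (card Z) \<le> 12 * \<delta> - 84 * chi" using slack[of "{}"] by simp
  have Z5: "int (card Z) + 5 \<le> \<delta>" using count[OF nbS[OF u]] c5 by simp
  \<comment> \<open>At least 6 bad vertices give \<open>\<delta> \<ge> 11\<close>, hence
    \<open>chi = 2\<close>. Then \<open>\<delta> \<le> 12\<close> would ask for at least 12 bad
    vertices and allow at most 7.\<close>
  have chi2: "chi = 2" using \<delta>chi Z0 Z5 chi by linarith
  have \<delta>13: "\<delta> = 13" using \<delta>chi Z0 Z5 chi2 by linarith
  have Z6: "int (card Z) \<ge> 6" "int (card Z) \<le> 8" using Z0 Z5 chi2 \<delta>13 by linarith+
  have slack': "(\<Sum>v\<in>S. fin v) \<le> 2 * int (card Z) - 12" if "S \<subseteq> R - Z" for S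
    using slack[OF that] chi2 \<delta>13 by simp
  \<comment> \<open>By \<open>D2\<close> adjacent vertices of degree 4 have no common neighbour, so
    their neighbourhoods occupy 8 vertices of \<open>R - Z\<close>; with at least 6 bad vertices
    this exceeds 13.\<close>
  have indep: "{a, b} \<notin> E" if a: "a \<in> V" "dg a = 4" and b: "b \<in> V" "dg b = 4" for a b
  proof
    assume e: "{a, b} \<in> E"
    have "card (nb a \<inter> nb b) = 0" using D2[OF e] a b s by simp
    then have "nb a \<inter> nb b = {}" using finite_nb by simp
    then have "card (nb a \<union> nb b) = 8" using finite_nb a b by (simp add: card_Un_disjoint card_nb)
    then show False using count[of "nb a \<union> nb b"] nbS[OF a] nbS[OF b] Z6 \<delta>13 by simp
  qed
  have IV4: "v \<in> I" if "v \<in> V" "dg v = 4" for v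
    using I_max[of v] that indep s I_facts by blast
  have d5: "dg t \<ge> 5" "t \<in> R" "t \<notin> Z" "t \<notin> I" if "v \<in> V" "dg v = 4" "t \<in> nb v" for v t
  proof -
    show t: "t \<in> R" "t \<notin> Z" using nbS[OF that(1,2)] that(3) by auto
    then have "t \<in> V" "dg t \<ge> s" by (auto simp: R_def A_def)
    then have "t \<in> V" "dg t \<ge> 4" using s by simp_all
    moreover have "dg t \<noteq> 4" using indep[OF that(1,2), of t] that(3) \<open>t \<in> V\<close> by (auto simp: nb_iff)
    ultimately show "dg t \<ge> 5" by simp
    then show "t \<notin> I" using I_facts s by force
  qed
  have meets: "nb t \<inter> I \<noteq> {}" if "v \<in> V" "dg v = 4" "t \<in> nb v" for v t
    using IV4[OF that(1,2)] that(3) nb_sym by blast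
  define V4 where "V4 = {v\<in>V. dg v = 4}"
  have I_eq: "I = V4" using IV4 I_facts s by (auto simp: V4_def)
  have finV4: "finite V4" using finite_V by (simp add: V4_def)
  show False
  proof (cases "card V4 \<le> 1")
    case True
    have one: "I \<subseteq> {u}"
    proof
      fix x assume "x \<in> I"
      then show "x \<in> {u}" using True u finV4 unfolding I_eq by (auto simp: V4_def card_le_Suc0_iff_eq)
    qed
    \<comment> \<open>Four neighbours with a surplus of 4 each need 16, against an available slack
      of \<open>2 * card Z - 12 \<le> 4\<close>.\<close>
    have "fin t \<ge> 4" if t: "t \<in> nb u" for t
    proof (cases "dg t = 5")
      case True
      then show ?thesis using fin_R4(3)[OF s d5(2)[OF u t]] meets[OF u t] by blast
    next
      case False
      then have d6: "dg t \<ge> 6" using d5(1)[OF u t] by simp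
      have "TI t \<subseteq> {u} \<times> UNIV" using one by (auto simp: TI_def)
      then have "card (TI t) \<le> card ({u} \<times> (UNIV :: bool set))" by (intro card_mono) auto
      then have "card (TI t) \<le> 2" by (simp add: card_cartesian_product)
      moreover have "dg t \<ge> s + 1" using d6 s by simp
      ultimately show ?thesis using fin_R_big(1)[OF d5(2,4)[OF u t]] d6 s by simp
    qed
    then have "(\<Sum>t\<in>nb u. 4) \<le> (\<Sum>t\<in>nb u. fin t)" by (rule sum_mono)
    moreover have "(\<Sum>t\<in>nb u. fin t) \<le> 2 * int (card Z) - 12" using slack' nbS[OF u] by blast
    ultimately show False using Z6 u by (simp add: card_nb)
  next
    case False
    \<comment> \<open>A second vertex of degree 4 raises the count in \<open>R - Z\<close> to six,
      so at most 7 vertices are bad and the slack drops to 2.\<close>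
    have Z7: "int (card Z) \<le> 7"
    proof -
      have "V4 \<inter> nb u = {}" using d5(1)[OF u] by (force simp: V4_def)
      then have "card (V4 \<union> nb u) = card V4 + 4" using finV4 finite_nb u by (simp add: card_Un_disjoint card_nb)
      moreover have "V4 \<union> nb u \<subseteq> R - Z" using nbS u by (auto simp: V4_def)
      ultimately show ?thesis using count[of "V4 \<union> nb u"] False \<delta>13 by simp
    qed
    \<comment> \<open>A surplus of at most 2 excludes degree 5 next to \<open>I\<close> and degrees
      above 6. At degree 6 it forces triangles on all sides and as many flags in \<open>TI\<close>
      as in \<open>TN\<close>, and then the equality case of \<open>TI_TN\<close> applies to every
      neighbour of \<open>t\<close>.\<close>
    have closed: "w \<in> I \<or> nb w \<inter> I \<noteq> {}" if v: "v \<in> V" "dg v = 4" and t: "t \<in> nb v" and w: "w \<in> nb t" for v t w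
    proof -
      note tf = d5[OF v t]
      have le2: "fin t \<le> 2" using slack'[of "{t}"] tf Z7 by simp
      have "dg t \<noteq> 5" using fin_R4(3)[OF s tf(2)] meets[OF v t] le2 by force
      then have d6': "dg t \<ge> 6" using tf(1) by simp
      have ts: "dg t \<ge> s + 1" using d6' s by simp
      have "dg t \<le> 6"
        using fin_R_big(2)[OF tf(2,4) ts] d6' le2 s by simp
      then have d6: "dg t = 6" using d6' by simp
      have f: "fin t \<ge> 12 + 3 * int (card (NT t)) - 2 * int (card (TI t))"
        using fin_R_big(1)[OF tf(2,4) ts] d6 s by simp
      have sp: "card (TI t) + card (TN t) + card (NT t) = 12" using flags_split[of t] d6 by simp
      have le: "card (TI t) \<le> card (TN t)" using TI_TN(1)[OF tf(2,4)] .
      have NT0: "card (NT t) = 0" using f sp le le2 by linarith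
      have TI5: "card (TI t) \<ge> 5" using f NT0 le2 by linarith
      have "finite (NT t)" using finite_flags by (simp add: NT_def)
      then have NTe: "NT t = {}" using NT0 by simp
      have "TI t = (nb t \<inter> I) \<times> UNIV"
        using NTe by (auto simp: TI_def NT_def flags_def)
      \<comment> \<open>With triangles on all sides, both flags of each edge into \<open>I\<close>
        belong to \<open>TI\<close>. An even number that is at least 5 and at most half of 12 is
        6.\<close>
      then have "even (card (TI t))" by (simp add: card_cartesian_product)
      then have "card (TI t) \<noteq> 5" by (metis odd_numeral)
      then have eq: "card (TI t) = card (TN t)" using TI5 sp le NT0 by linarith
      show ?thesis
      proof (cases "w \<in> I")
        case False
        have "(w, True) \<in> TN t" using NTe w False by (auto simp: TN_def NT_def flags_def)
        then obtain x where "x \<in> I" "{x, w} \<in> E" using TI_TN(2)[OF tf(2,4) eq] by force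
        then have "x \<in> nb w \<inter> I" by (simp add: nb_iff insert_commute)
        then show ?thesis by blast
      qed simp
    qed
    \<comment> \<open>\<open>I\<close> together with its neighbours is closed under adjacency, so by
      connectedness it contains every vertex, although no bad vertex can belong to it.\<close>
    have inQ: "w \<in> I \<or> nb w \<inter> I \<noteq> {}" if "(u, w) \<in> (adjacency E)\<^sup>*" for w
      using that
    proof (induction rule: rtrancl_induct)
      case base then show ?case using IV4[OF u] by blast
    next
      case (step y z)
      have yz: "{y, z} \<in> E" using step(2) by (simp add: adjacency_def)
      from step(3) show ?case
      proof
        assume "y \<in> I"
        moreover have "y \<in> nb z" using yz by (simp add: nb_iff insert_commute)
        ultimately show ?thesis by blast
      next
        assume "nb y \<inter> I \<noteq> {}"
        then obtain v where v: "v \<in> I" "y \<in> nb v" using nb_sym by blast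
        then have "v \<in> V" "dg v = 4" using I_facts s by auto
        then show ?thesis using closed v(2) yz by (simp add: nb_iff)
      qed
    qed
    have "Z \<noteq> {}" using Z6 by auto
    then obtain z where z: "z \<in> Z" by blast
    then have zV: "z \<in> V" by (simp add: Z_def R_def)
    have "(u, z) \<in> (adjacency E)\<^sup>*" using conn u zV unfolding connected_graph_def by blast
    then have "z \<in> I \<or> nb z \<inter> I \<noteq> {}" by (rule inQ)
    then show False
    proof
      assume "z \<in> I"
      then have "dg z = s" using I_facts by blast
      moreover have "dg z = 5" using z by (simp add: Z_def bad_def)
      ultimately show False using s by simp
    next
      assume "nb z \<inter> I \<noteq> {}"
      then obtain v where v: "v \<in> I" "z \<in> nb v" using nb_sym by blast
      then have "v \<in> V" "dg v = 4" using I_facts s by auto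
      then show False using nbS v(2) z by blast
    qed
  qed
qed

theorem discharging_bound: "chi \<le> 2 \<Longrightarrow> rhs \<le> - 14 * chi"
  using bound_ge5 bound_4 s4 by (cases "s = 4") auto

end

section \<open>Upper bounds on the bondage number\<close>

lemma simple_graphD:
  assumes "simple_graph V E"
  shows "finite V" "finite E" "{x, y} \<in> E \<Longrightarrow> x \<in> V \<and> y \<in> V \<and> x \<noteq> y" "finite (neighbourhood E x)"
proof -
  show V: "finite V" using assms by (simp add: simple_graph_def)
  have "E \<subseteq> Pow V" using assms by (auto simp: simple_graph_def)
  then show "finite E" using V finite_subset by blast
  show e: "x \<in> V \<and> y \<in> V \<and> x \<noteq> y" if "{x, y} \<in> E" for x y
  proof -
    have "{x, y} \<subseteq> V" "card {x, y} = 2" using assms that unfolding simple_graph_def by blast+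
    then show ?thesis by auto
  qed
  have "neighbourhood E x \<subseteq> V" using e by (auto simp: neighbourhood_def)
  then show "finite (neighbourhood E x)" using V finite_subset by blast
qed

lemma finite_dominating: "finite V \<Longrightarrow> finite {D. dominating_set V E D}"
  by (rule finite_subset[of _ "Pow V"]) (auto simp: dominating_set_def)

lemma dominating_set_UNIV: "dominating_set V E V"
  by (simp add: dominating_set_def)

lemma bondage_number_le:
  assumes V: "finite V" and F: "F \<subseteq> E"
    and smaller: "\<And>D. dominating_set V (E - F) D \<Longrightarrow> \<exists>D'. dominating_set V E D' \<and> card D' < card D"
  shows "bondage_number V E \<le> card F"
proof -
  let ?S = "\<lambda>E. card ` {D. dominating_set V E D}"
  have fin: "finite (?S E')" and ne: "?S E' \<noteq> {}" for E'
    using finite_dominating[OF V] dominating_set_UNIV by blast+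
  have "Min (?S (E - F)) \<in> ?S (E - F)" using Min_in[OF fin ne] .
  then obtain D where D: "dominating_set V (E - F) D" "domination_number V (E - F) = card D"
    unfolding domination_number_def by blast
  obtain D' where D': "dominating_set V E D'" "card D' < card D" using smaller[OF D(1)] by blast
  have "domination_number V E \<le> card D'" unfolding domination_number_def by (rule Min_le[OF fin]) (use D' in blast)
  then have "domination_number V (E - F) > domination_number V E" using D D' by simp
  then show ?thesis unfolding bondage_number_def by (intro Least_le) (use F in blast)
qed

lemma isolating_dominates:
  assumes iso: "\<And>y. {u, y} \<in> E \<Longrightarrow> {u, y} \<in> F" and u: "u \<in> V" and V: "finite V"
    and D: "dominating_set V (E - F) D" and z: "z \<in> D" "z \<noteq> u" "{u, z} \<in> E"
  shows "\<exists>D'. dominating_set V E D' \<and> card D' < card D"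
proof -
  have DV: "D \<subseteq> V" "finite D" using D V finite_subset by (auto simp: dominating_set_def)
  have "u \<in> D"
  proof (rule ccontr)
    assume "u \<notin> D"
    then obtain y where "{u, y} \<in> E - F" using D u unfolding dominating_set_def by blast
    then show False using iso by blast
  qed
  have "dominating_set V E (D - {u})"
    unfolding dominating_set_def
  proof (intro conjI ballI)
    fix x assume x: "x \<in> V - (D - {u})"
    show "\<exists>y\<in>D - {u}. {x, y} \<in> E"
    proof (cases "x = u")
      case True then show ?thesis using z by blast
    next
      case False
      then obtain y where y: "y \<in> D" "{x, y} \<in> E - F" using D x unfolding dominating_set_def by blast
      then have "y \<noteq> u" using iso[of x] by (auto simp: insert_commute)
      then show ?thesis using y by blast
    qed
  qed (use DV in blast)
  moreover have "card (D - {u}) < card D" using \<open>u \<in> D\<close> DV by (meson card_Diff1_less)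
  ultimately show ?thesis by blast
qed

text \<open>Delete every edge at \<open>u\<close> and those edges at \<open>v\<close> that do not lead to a common neighbour.\<close>

lemma bondage_le_adjacent:
  assumes G: "simple_graph V E" and e: "{u, v} \<in> E"
  shows "int (bondage_number V E) \<le> int (vertex_degree E u) + int (vertex_degree E v) - 1
    - int (card (neighbourhood E u \<inter> neighbourhood E v))"
proof -
  let ?N = "neighbourhood E"
  note G = simple_graphD[OF G]
  define C where "C = insert u (?N u \<inter> ?N v)"
  define F where "F = (\<lambda>y. {u, y}) ` ?N u \<union> (\<lambda>y. {v, y}) ` (?N v - C)"
  have uv: "u \<in> V" "v \<in> V" "u \<noteq> v" using G(3) e by auto
  have uN: "u \<notin> ?N u" using G(3)[of u u] by (auto simp: neighbourhood_def)
  have "bondage_number V E \<le> card F"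
  proof (rule bondage_number_le[OF G(1)])
    show "F \<subseteq> E" by (auto simp: F_def neighbourhood_def)
    fix D assume D: "dominating_set V (E - F) D"
    have iso: "{u, y} \<in> F" if "{u, y} \<in> E" for y using that by (auto simp: F_def neighbourhood_def)
    show "\<exists>D'. dominating_set V E D' \<and> card D' < card D"
    proof (cases "v \<in> D")
      case True
      show ?thesis by (rule isolating_dominates[OF iso uv(1) G(1) D True _ e]) (use uv in auto)
    next
      case False
      then obtain z where z: "z \<in> D" "{v, z} \<in> E - F" using D uv unfolding dominating_set_def by blast
      then have "z \<in> C" by (auto simp: F_def neighbourhood_def)
      moreover have "z \<noteq> u" using z iso[of v] e by (auto simp: insert_commute)
      ultimately have "{u, z} \<in> E" by (simp add: C_def neighbourhood_def)
      show ?thesis by (rule isolating_dominates[OF iso uv(1) G(1) D z(1) \<open>z \<noteq> u\<close> \<open>{u, z} \<in> E\<close>])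
    qed
  qed
  moreover have "card F \<le> card (?N u) + card (?N v - C)"
    unfolding F_def using card_Un_le card_image_le[of "?N u"] card_image_le[of "?N v - C"] G(4)
    by (meson add_mono finite_Diff order_trans)
  moreover have C: "C \<subseteq> ?N v" using e by (auto simp: C_def neighbourhood_def insert_commute)
  moreover have "card C = card (?N u \<inter> ?N v) + 1" using uN G(4) by (simp add: C_def)
  moreover have "card (?N v - C) = card (?N v) - card C" "card C \<le> card (?N v)"
    using C G(4) by (auto intro: card_Diff_subset card_mono finite_subset)
  ultimately show ?thesis by (simp add: vertex_degree_def)
qed

text \<open>Delete every edge at \<open>u\<close> or \<open>v\<close> except \<open>{v, w}\<close>; if a dominating set of the rest
  contains both \<open>u\<close> and \<open>v\<close>, then \<open>w\<close> can replace them.\<close>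

lemma bondage_le_common_neighbour:
  assumes G: "simple_graph V E" and w: "{u, w} \<in> E" "{w, v} \<in> E" and "u \<noteq> v"
  shows "int (bondage_number V E) \<le> int (vertex_degree E u) + int (vertex_degree E v) - 1"
proof -
  let ?N = "neighbourhood E"
  note G = simple_graphD[OF G]
  define F where "F = (\<lambda>y. {u, y}) ` ?N u \<union> (\<lambda>y. {v, y}) ` (?N v - {w})"
  have V: "u \<in> V" "v \<in> V" "w \<in> V" "u \<noteq> w" "v \<noteq> w" using G(3)[OF w(1)] G(3)[OF w(2)] by auto
  have vw: "{v, w} \<in> E" using w by (simp add: insert_commute)
  have "bondage_number V E \<le> card F"
  proof (rule bondage_number_le[OF G(1)])
    show "F \<subseteq> E" by (auto simp: F_def neighbourhood_def)
    fix D assume D: "dominating_set V (E - F) D"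
    have iso: "{u, y} \<in> F" if "{u, y} \<in> E" for y using that by (auto simp: F_def neighbourhood_def)
    have isov: "y = w" if "{v, y} \<in> E - F" for y using that by (auto simp: F_def neighbourhood_def)
    have fD: "finite D" "D \<subseteq> V" using D G(1) finite_subset by (auto simp: dominating_set_def)
    have uD: "u \<in> D"
    proof (rule ccontr)
      assume "u \<notin> D"
      then obtain y where "{u, y} \<in> E - F" using D V unfolding dominating_set_def by blast
      then show False using iso by blast
    qed
    show "\<exists>D'. dominating_set V E D' \<and> card D' < card D"
    proof (cases "w \<in> D")
      case True
      show ?thesis by (rule isolating_dominates[OF iso V(1) G(1) D True _ w(1)]) (use V in auto)
    next
      case False
      have vD: "v \<in> D"
      proof (rule ccontr)
        assume "v \<notin> D"
        then obtain y where "y \<in> D" "{v, y} \<in> E - F" using D V unfolding dominating_set_def by blast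
        then show False using isov False by blast
      qed
      let ?D = "insert w (D - {u, v})"
      have "dominating_set V E ?D"
        unfolding dominating_set_def
      proof (intro conjI ballI)
        fix x assume x: "x \<in> V - ?D"
        show "\<exists>y\<in>?D. {x, y} \<in> E"
        proof (cases "x = u \<or> x = v")
          case True then show ?thesis using w vw by blast
        next
          case xuv: False
          then obtain y where y: "y \<in> D" "{x, y} \<in> E - F" using D x unfolding dominating_set_def by blast
          have "y \<noteq> u" using y iso[of x] by (auto simp: insert_commute)
          moreover have "y \<noteq> v" using y isov[of x] x by (auto simp: insert_commute)
          ultimately show ?thesis using y by blast
        qed
      qed (use fD V in blast)
      moreover have "card ?D < card D"
      proof -
        have "card (D - {u, v}) = card D - card {u, v}" "card {u, v} \<le> card D"
          using uD vD fD by (auto intro!: card_Diff_subset card_mono)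
        then show ?thesis using \<open>u \<noteq> v\<close> False fD by simp
      qed
      ultimately show ?thesis by blast
    qed
  qed
  moreover have "card F \<le> card (?N u) + card (?N v - {w})"
    unfolding F_def using card_Un_le card_image_le[of "?N u"] card_image_le[of "?N v - {w}"] G(4)
    by (meson add_mono finite_Diff order_trans)
  moreover have wN: "w \<in> ?N v" using vw by (simp add: neighbourhood_def)
  moreover have "card (?N v - {w}) = card (?N v) - 1" "card (?N v) > 0"
    using wN G(4) by (auto simp: card_gt_0_iff)
  ultimately show ?thesis by (simp add: vertex_degree_def)
qed

section \<open>The parameter B' as an upper bound\<close>

lemma graph_dist_1_2:
  assumes "x \<noteq> y"
  shows "1 \<le> graph_dist E x y" "graph_dist E x y \<le> 2 \<longleftrightarrow> {x, y} \<in> E \<or> (\<exists>w. {x, w} \<in> E \<and> {w, y} \<in> E)"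
proof -
  let ?S = "{n. (x, y) \<in> adjacency E ^^ n}"
  have n0: "n \<noteq> 0" if "n \<in> ?S" for n using that assms by (cases n) auto
  have "1 \<le> enat n" if "n \<in> ?S" for n using n0[OF that] by (simp add: one_enat_def)
  then show "1 \<le> graph_dist E x y" unfolding graph_dist_def by (rule INF_greatest)
  have one: "1 \<in> ?S \<longleftrightarrow> {x, y} \<in> E" by (simp add: adjacency_def)
  have two: "2 \<in> ?S \<longleftrightarrow> (\<exists>w. {x, w} \<in> E \<and> {w, y} \<in> E)"
    by (auto simp: numeral_2_eq_2 adjacency_def)
  have "graph_dist E x y \<le> 2 \<longleftrightarrow> 1 \<in> ?S \<or> 2 \<in> ?S"
  proof
    assume le: "graph_dist E x y \<le> 2"
    show "1 \<in> ?S \<or> 2 \<in> ?S"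
    proof (rule ccontr)
      assume no: "\<not> (1 \<in> ?S \<or> 2 \<in> ?S)"
      have "3 \<le> enat n" if n: "n \<in> ?S" for n
      proof -
        have "n \<noteq> 1" "n \<noteq> 2" using n no by blast+
        then have "3 \<le> n" using n0[OF n] by linarith
        then show ?thesis by (simp add: numeral_eq_enat)
      qed
      then have "3 \<le> graph_dist E x y" unfolding graph_dist_def by (rule INF_greatest)
      then have "(3 :: enat) \<le> 2" using le by (rule order_trans)
      then show False by simp
    qed
  next
    assume "1 \<in> ?S \<or> 2 \<in> ?S"
    then obtain n where n: "n \<in> ?S" "n \<le> 2" by (metis one_le_numeral order_refl)
    have "graph_dist E x y \<le> enat n" unfolding graph_dist_def by (rule INF_lower[OF n(1)])
    also have "\<dots> \<le> 2" using n(2) by (simp add: numeral_eq_enat)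
    finally show "graph_dist E x y \<le> 2" .
  qed
  then show "graph_dist E x y \<le> 2 \<longleftrightarrow> {x, y} \<in> E \<or> (\<exists>w. {x, w} \<in> E \<and> {w, y} \<in> E)" using one two by simp
qed

lemma graph_dist_self: "graph_dist E x x = 0"
proof -
  have "graph_dist E x x \<le> enat 0" unfolding graph_dist_def by (rule INF_lower) simp
  then show ?thesis by (simp add: zero_enat_def[symmetric])
qed

lemma b1_altdef:
  "b1 V E = Min {int (vertex_degree E x) + int (vertex_degree E y) - 1 | x y.
     x \<in> V \<and> y \<in> V \<and> x \<noteq> y \<and> ({x, y} \<in> E \<or> (\<exists>w. {x, w} \<in> E \<and> {w, y} \<in> E))}"
proof -
  have "1 \<le> graph_dist E x y \<and> graph_dist E x y \<le> 2 \<longleftrightarrow> x \<noteq> y \<and> ({x, y} \<in> E \<or> (\<exists>w. {x, w} \<in> E \<and> {w, y} \<in> E))" for x y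
    using graph_dist_1_2[of x y E] graph_dist_self[of E x] by (cases "x = y") auto
  then show ?thesis unfolding b1_def by simp
qed

context
  fixes V :: "'a set" and E :: "'a set set"
  assumes G: "simple_graph V E" and E: "E \<noteq> {}"
begin

private abbreviation "S1 \<equiv> {int (vertex_degree E x) + int (vertex_degree E y) - 1 | x y.
     x \<in> V \<and> y \<in> V \<and> x \<noteq> y \<and> ({x, y} \<in> E \<or> (\<exists>w. {x, w} \<in> E \<and> {w, y} \<in> E))}"
private abbreviation "S3 \<equiv> {max
     (int (vertex_degree E x) + int (vertex_degree E y) - 1
        - int (card (neighbourhood E x \<inter> neighbourhood E y)))
     (int (vertex_degree E x) + int (vertex_degree E y) - 3) | x y. {x, y} \<in> E}"

lemma S_finite: "finite S1" "finite S3" and S_nonempty: "S1 \<noteq> {}" "S3 \<noteq> {}"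
proof -
  have fVV: "finite (V \<times> V)" using simple_graphD(1)[OF G] by simp
  show "finite S1"
    by (rule finite_subset[OF _ finite_imageI[OF fVV, of "\<lambda>(x, y). int (vertex_degree E x) + int (vertex_degree E y) - 1"]]) auto
  show "finite S3"
    by (rule finite_subset[OF _ finite_imageI[OF fVV, of "\<lambda>(x, y). max (int (vertex_degree E x) + int (vertex_degree E y) - 1
        - int (card (neighbourhood E x \<inter> neighbourhood E y))) (int (vertex_degree E x) + int (vertex_degree E y) - 3)"]])
      (use simple_graphD(3)[OF G] in auto)
  obtain e where "e \<in> E" using E by blast
  then obtain x y where "{x, y} \<in> E" using G unfolding simple_graph_def by (metis card_2_iff)
  then show "S1 \<noteq> {}" "S3 \<noteq> {}" using simple_graphD(3)[OF G] by blast+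
qed

lemma B'_le:
  shows B'_le_b1: "x \<in> V \<Longrightarrow> y \<in> V \<Longrightarrow> x \<noteq> y \<Longrightarrow> {x, y} \<in> E \<or> (\<exists>w. {x, w} \<in> E \<and> {w, y} \<in> E) \<Longrightarrow>
      B' V E \<le> int (vertex_degree E x) + int (vertex_degree E y) - 1"
    and B'_le_b3: "{x, y} \<in> E \<Longrightarrow> B' V E \<le> max
     (int (vertex_degree E x) + int (vertex_degree E y) - 1
        - int (card (neighbourhood E x \<inter> neighbourhood E y)))
     (int (vertex_degree E x) + int (vertex_degree E y) - 3)"
proof -
  show "B' V E \<le> int (vertex_degree E x) + int (vertex_degree E y) - 1"
    if "x \<in> V" "y \<in> V" "x \<noteq> y" "{x, y} \<in> E \<or> (\<exists>w. {x, w} \<in> E \<and> {w, y} \<in> E)"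
  proof -
    have "b1 V E \<le> int (vertex_degree E x) + int (vertex_degree E y) - 1"
      unfolding b1_altdef by (rule Min_le[OF S_finite(1)]) (use that in blast)
    then show ?thesis by (simp add: B'_def)
  qed
  show "B' V E \<le> max (int (vertex_degree E x) + int (vertex_degree E y) - 1
        - int (card (neighbourhood E x \<inter> neighbourhood E y)))
     (int (vertex_degree E x) + int (vertex_degree E y) - 3)" if "{x, y} \<in> E"
  proof -
    have "b3 E \<le> max (int (vertex_degree E x) + int (vertex_degree E y) - 1
        - int (card (neighbourhood E x \<inter> neighbourhood E y)))
     (int (vertex_degree E x) + int (vertex_degree E y) - 3)"
      unfolding b3_def by (rule Min_le[OF S_finite(2)]) (use that in blast)
    then show ?thesis unfolding B'_def by linarith
  qed
qed

text \<open>Both minima are attained. A minimising pair of \<open>b1\<close> is adjacent or has a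
  common neighbour, and for \<open>b3\<close> the first entry of the maximum is already an upper
  bound.\<close>

lemma bondage_le_B': "int (bondage_number V E) \<le> B' V E"
proof -
  have "b1 V E \<in> S1" unfolding b1_altdef by (rule Min_in[OF S_finite(1) S_nonempty(1)])
  then obtain x y where xy: "b1 V E = int (vertex_degree E x) + int (vertex_degree E y) - 1"
    "x \<noteq> y" "{x, y} \<in> E \<or> (\<exists>w. {x, w} \<in> E \<and> {w, y} \<in> E)" by blast
  have "int (bondage_number V E) \<le> b1 V E"
    using xy(3)
  proof
    assume "{x, y} \<in> E"
    from bondage_le_adjacent[OF G this] show ?thesis unfolding xy(1) by linarith
  next
    assume "\<exists>w. {x, w} \<in> E \<and> {w, y} \<in> E"
    then show ?thesis unfolding xy(1) using bondage_le_common_neighbour[OF G _ _ xy(2)] by blast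
  qed
  moreover have "b3 E \<in> S3" unfolding b3_def by (rule Min_in[OF S_finite(2) S_nonempty(2)])
  then obtain a b where ab: "b3 E = max (int (vertex_degree E a) + int (vertex_degree E b) - 1
        - int (card (neighbourhood E a \<inter> neighbourhood E b)))
     (int (vertex_degree E a) + int (vertex_degree E b) - 3)" "{a, b} \<in> E" by blast
  have "int (bondage_number V E) \<le> b3 E" unfolding ab(1) using bondage_le_adjacent[OF G ab(2)] by simp
  ultimately show ?thesis by (simp add: B'_def)
qed

end

text \<open>The size of \<open>I\<close> links it to the hypothesis of the theorem; the discharging
  uses maximality under inclusion, which holds because a vertex without neighbour in
  \<open>I\<close> could be added.\<close>

lemma maximum_independent_set:
  assumes "finite A" and loopless: "\<And>x. {x} \<notin> E"
  obtains I where "I \<subseteq> A" "\<And>x y. x \<in> I \<Longrightarrow> y \<in> I \<Longrightarrow> {x, y} \<notin> E"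
    "card I = independence_number A (induced_edges A E)"
    "\<And>v. v \<in> A \<Longrightarrow> v \<notin> I \<Longrightarrow> \<exists>u\<in>I. {u, v} \<in> E"
proof -
  let ?X = "{I. independent_set A (induced_edges A E) I}"
  have ind: "I \<in> ?X \<longleftrightarrow> I \<subseteq> A \<and> (\<forall>x\<in>I. \<forall>y\<in>I. {x, y} \<notin> E)" for I
    by (auto simp: independent_set_def induced_edges_def)
  have "?X \<subseteq> Pow A" by (auto simp: independent_set_def)
  then have fX: "finite (card ` ?X)" using assms(1) finite_subset by blast
  have "{} \<in> ?X" unfolding ind by simp
  then have "Max (card ` ?X) \<in> card ` ?X" using Max_in[OF fX] by blast
  then obtain I where I: "I \<in> ?X" "card I = independence_number A (induced_edges A E)"
    unfolding independence_number_def by force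
  have "\<exists>u\<in>I. {u, v} \<in> E" if v: "v \<in> A" "v \<notin> I" for v
  proof (rule ccontr)
    assume no: "\<not> (\<exists>u\<in>I. {u, v} \<in> E)"
    then have "{v, u} \<notin> E" "{u, v} \<notin> E" if "u \<in> I" for u using that by (auto simp: insert_commute)
    then have "insert v I \<in> ?X" using I(1) v loopless[of v] unfolding ind by simp
    then have "card (insert v I) \<le> card I" unfolding I(2) independence_number_def by (intro Max_ge[OF fX] imageI)
    moreover have "finite I" using I(1) assms(1) finite_subset unfolding ind by blast
    ultimately show False using v by simp
  qed
  then show ?thesis using that[of I] I unfolding ind by blast
qed

theorem theorem1:
  fixes V :: "'a set" and E :: "'a set set" and M :: "'b topology"
    and p :: "'a \<Rightarrow> 'b" and g :: "'a set \<Rightarrow> real \<Rightarrow> 'b"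
    and chi :: int and s :: nat
  assumes "simple_graph V E" and "connected_graph V E"
    and "(\<exists>h. sphere_with_handles h M \<and> chi = 2 - 2 * int h) \<or>
         (\<exists>q\<ge>1. sphere_with_crosscaps q M \<and> chi = 2 - int q)"
    and "two_cell_embedding M V E p g"
    and "s \<ge> 4" and "verts_of_degree V E s \<noteq> {}"
    and "- 14 * chi <
           (int s - 4) * int (independence_number (verts_of_degree V E s)
                                (induced_edges (verts_of_degree V E s) E))
           + 2 * (int s - 5) * int (card V)
           + 4 * int (card (verts_of_degree_le V E 2))
           + 2 * (\<Sum>j = 3..s - 1. (5 - int j) * int (card (verts_of_degree V E j)))"
  shows "int (bondage_number V E) \<le> B' V E \<and> B' V E \<le> 2 * int s - 2"
proof -
  let ?A = "verts_of_degree V E s"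
  obtain v where v: "v \<in> V" "vertex_degree E v = s" using assms(6) by (auto simp: verts_of_degree_def)
  have "neighbourhood E v \<noteq> {}" using v(2) \<open>s \<ge> 4\<close> by (auto simp: vertex_degree_def)
  then have E: "E \<noteq> {}" by (auto simp: neighbourhood_def)
  have finA: "finite ?A" using simple_graphD(1)[OF assms(1)] by (simp add: verts_of_degree_def)
  have loopless: "{x} \<notin> E" for x using simple_graphD(3)[OF assms(1), of x x] by auto
  obtain I where I: "I \<subseteq> ?A" "\<And>x y. x \<in> I \<Longrightarrow> y \<in> I \<Longrightarrow> {x, y} \<notin> E"
    "card I = independence_number ?A (induced_edges ?A E)"
    "\<And>v. v \<in> ?A \<Longrightarrow> v \<notin> I \<Longrightarrow> \<exists>u\<in>I. {u, v} \<in> E"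
    using maximum_independent_set[OF finA loopless] by blast
  obtain \<Phi> :: "'b set set" and l r where fs: "finite \<Phi>" "\<And>e. e \<in> E \<Longrightarrow> l e \<in> \<Phi> \<and> r e \<in> \<Phi>"
    "\<And>F v. F \<in> \<Phi> \<Longrightarrow> v \<in> V \<Longrightarrow> even (card {e\<in>E. v \<in> e \<and> (l e = F) \<noteq> (r e = F)})"
    "\<And>\<Psi> e. \<Psi> \<subseteq> \<Phi> \<Longrightarrow> \<Psi> \<noteq> {} \<Longrightarrow> (\<And>e. e \<in> E \<Longrightarrow> (l e \<in> \<Psi>) = (r e \<in> \<Psi>)) \<Longrightarrow> e \<in> E \<Longrightarrow> l e \<in> \<Psi> \<and> r e \<in> \<Psi>"
    "int (card E) + chi \<le> int (card V) + int (card \<Phi>)"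
  proof (rule embedding_faces_structure[OF assms(1,2) E assms(3,4)], goal_cases)
    case 1
    show ?case by (rule that[OF 1(2-)])
  qed
  have "B' V E \<le> 2 * int s - 2"
  proof (rule ccontr)
    assume "\<not> B' V E \<le> 2 * int s - 2"
    then have B: "2 * int s - 1 \<le> B' V E" by simp
    interpret face_structure V E \<Phi> l r chi s I
    proof
      show "simple_graph V E" "connected_graph V E" "s \<ge> 4" "finite \<Phi>" by fact+
      show "\<exists>v\<in>V. vertex_degree E v = s" using v by blast
      show "I \<subseteq> {v\<in>V. vertex_degree E v = s}" using I(1) by (simp add: verts_of_degree_def)
      show "int (card E) + chi \<le> int (card V) + int (card \<Phi>)" by fact
      show "2 * s \<le> vertex_degree E x + vertex_degree E y"
        if "x \<in> V" "y \<in> V" "x \<noteq> y" "{x, y} \<in> E \<or> (\<exists>w. {x, w} \<in> E \<and> {w, y} \<in> E)" for x y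
        using B'_le_b1[OF assms(1) E that] B by linarith
      show "2 * s + 2 \<le> vertex_degree E x + vertex_degree E y \<or>
          2 * s + card (neighbourhood E x \<inter> neighbourhood E y) \<le> vertex_degree E x + vertex_degree E y"
        if "{x, y} \<in> E" for x y
        using B'_le_b3[OF assms(1) E that] B by linarith
      show "\<exists>u\<in>I. {u, v} \<in> E" if "v \<in> V" "vertex_degree E v = s" "v \<notin> I" for v
        using I(4) that by (simp add: verts_of_degree_def)
    qed (fact fs I)+
    have "chi \<le> 2" using assms(3) by auto
    \<comment> \<open>As \<open>card I\<close> is the independence number, \<open>rhs\<close> is the
      right side of the assumed strict inequality, which this bound contradicts.\<close>
    then have "rhs \<le> - 14 * chi" by (rule discharging_bound)
    then show False using assms(7) unfolding rhs_def I(3) by linarith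
  qed
  then show ?thesis using bondage_le_B'[OF assms(1) E] by blast
qed

end
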